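(* Let $\sigma\leq 1$. All smooth solitary waves of the system below (for $\vec u=(u,\eta)$) are stable in $X=H^1(\mathbb{R})\times L^2(\mathbb{R})$ in the orbital sense defined below.
   Context: Consider, for a constant $A>0$ and a real parameter $\sigma$, the system $u_t-u_{txx}-Au_x+3uu_x-\sigma(2u_xu_{xx}+uu_{xxx})+(1+\eta)\eta_x=0$, $\eta_t+((1+\eta)u)_x=0$, with $u,\eta\to0$ as $|x|\to\infty$ (here $\eta=\rho-1$). Let $X=H^1(\mathbb{R})\times L^2(\mathbb{R})$. With $p(x)=\frac12 e^{-|x|}$, a function $\vec u=(u,\eta)\in C([0,T);X)$ is a solution on $[0,T)$ if it satisfies $u_t+\sigma uu_x+\partial_x p\ast\big(-Au+\frac{3-\sigma}{2}u^2+\frac{\sigma}{2}u_x^2+\frac12(1+\eta)^2\big)=0$, $\eta_t+((1+\eta)u)_x=0$ in the distribution sense and the functionals $E(\vec u)=\frac12\int(u^2+u_x^2+\eta^2)\,dx$ and $F(\vec u)=\frac12\int(u^3+\sigma uu_x^2+2u\eta+u\eta^2-Au^2)\,dx$ are conserved. A solitary wave is a nontrivial traveling-wave solution $\vec\varphi_c(t,x)=(\varphi_c(x-ct),\eta_c(x-ct))\in H^1(\mathbb{R})\times H^1(\mathbb{R})$, $c\in\mathbb{R}$, with $\varphi_c,\eta_c$ vanishing at infinity; smooth solitary waves exist only for $c>A_1$ or $c<A_2$, where $A_{1,2}=\frac{-A\pm\sqrt{A^2+4}}{2}$. For $\epsilon>0$ let $U_\epsilon=\{\vec u\in X:\ \inf_{s\in\mathbb{R}}\|\vec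 u-\vec\varphi_c(\cdot-s)\|_X<\epsilon\}$. The solitary wave $\vec\varphi_c$ is called stable in $X$ if for every $\epsilon>0$ there is $\delta>0$ such that for any $\vec u_0\in U_\delta$, if $\vec u\in C([0,T);X)$, $0<T\leq\infty$, is a solution with $\vec u(0)=\vec u_0$, then $\vec u(t)\in U_\epsilon$ for all $t\in[0,T)$. *)

theory Defs
  imports "HOL-Analysis.Analysis" "HOL-Library.Extended_Real"
begin

definition smooth1 :: "(real \<Rightarrow> real) \<Rightarrow> bool" where
  "smooth1 f \<longleftrightarrow> (\<exists>D :: nat \<Rightarrow> real \<Rightarrow> real. D 0 = f \<and>
      (\<forall>n x. (D n has_real_derivative D (Suc n) x) (at x)))"

definition test1 :: "(real \<Rightarrow> real) \<Rightarrow> bool" where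
  "test1 \<phi> \<longleftrightarrow> smooth1 \<phi> \<and> compact (closure {x. \<phi> x \<noteq> 0})"

definition test2 :: "ereal \<Rightarrow> (real \<Rightarrow> real \<Rightarrow> real) \<Rightarrow> bool" where
  "test2 T \<phi> \<longleftrightarrow>
     (\<exists>D :: nat \<Rightarrow> nat \<Rightarrow> real \<Rightarrow> real \<Rightarrow> real. D 0 0 = \<phi> \<and>
        (\<forall>i j t x. ((\<lambda>s. D i j s x) has_real_derivative D (Suc i) j t x) (at t) \<and>
                   ((\<lambda>y. D i j t y) has_real_derivative D i (Suc j) t x) (at x)) \<and>
        (\<forall>i j. continuous_on UNIV (\<lambda>(t, x). D i j t x))) \<and>
     compact (closure {(t, x). \<phi> t x \<noteq> 0}) \<and>
     closure {(t, x). \<phi> t x \<noteq> 0} \<subseteq> {(t, x). 0 < t \<and> ereal t < T}"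

definition dt :: "(real \<Rightarrow> real \<Rightarrow> real) \<Rightarrow> real \<Rightarrow> real \<Rightarrow> real" where
  "dt \<phi> t x = deriv (\<lambda>s. \<phi> s x) t"
definition dx :: "(real \<Rightarrow> real \<Rightarrow> real) \<Rightarrow> real \<Rightarrow> real \<Rightarrow> real" where
  "dx \<phi> t x = deriv (\<lambda>y. \<phi> t y) x"

definition L2 :: "(real \<Rightarrow> real) \<Rightarrow> bool" where
  "L2 f \<longleftrightarrow> f \<in> borel_measurable lborel \<and> integrable lborel (\<lambda>x. (f x)\<^sup>2)"

definition has_weak_deriv :: "(real \<Rightarrow> real) \<Rightarrow> (real \<Rightarrow> real) \<Rightarrow> bool" where
  "has_weak_deriv f g \<longleftrightarrow>
     (\<forall>\<phi>. test1 \<phi> \<longrightarrow> (LINT x|lborel. f x * deriv \<phi> x) = - (LINT x|lborel. g x * \<phi> x))"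

definition H1 :: "(real \<Rightarrow> real) \<Rightarrow> bool" where
  "H1 f \<longleftrightarrow> L2 f \<and> (\<exists>g. L2 g \<and> has_weak_deriv f g)"

text \<open>A chosen weak derivative (unique up to null sets) of an H1 function.\<close>
definition wd :: "(real \<Rightarrow> real) \<Rightarrow> real \<Rightarrow> real" where
  "wd f = (SOME g. L2 g \<and> has_weak_deriv f g)"

definition inX :: "(real \<Rightarrow> real) \<times> (real \<Rightarrow> real) \<Rightarrow> bool" where
  "inX w \<longleftrightarrow> H1 (fst w) \<and> L2 (snd w)"

definition normX :: "(real \<Rightarrow> real) \<times> (real \<Rightarrow> real) \<Rightarrow> real" where
  "normX w = sqrt (LINT x|lborel. (fst w x)\<^sup>2 + (wd (fst w) x)\<^sup>2 + (snd w x)\<^sup>2)"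

definition distX :: "(real \<Rightarrow> real) \<times> (real \<Rightarrow> real) \<Rightarrow> (real \<Rightarrow> real) \<times> (real \<Rightarrow> real) \<Rightarrow> real" where
  "distX v w = normX (\<lambda>x. fst v x - fst w x, \<lambda>x. snd v x - snd w x)"

definition pker :: "real \<Rightarrow> real" where
  "pker x = exp (- \<bar>x\<bar>) / 2"

definition conv :: "(real \<Rightarrow> real) \<Rightarrow> (real \<Rightarrow> real) \<Rightarrow> real \<Rightarrow> real" where
  "conv f g x = (LINT y|lborel. f (x - y) * g y)"

definition Gterm :: "real \<Rightarrow> real \<Rightarrow> (real \<Rightarrow> real) \<Rightarrow> (real \<Rightarrow> real) \<Rightarrow> real \<Rightarrow> real" where
  "Gterm A \<sigma> u \<eta> x = - A * u x + (3 - \<sigma>) / 2 * (u x)\<^sup>2 + \<sigma> / 2 * (wd u x)\<^sup>2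
                       + (1 + \<eta> x)\<^sup>2 / 2"

definition Efun :: "(real \<Rightarrow> real) \<Rightarrow> (real \<Rightarrow> real) \<Rightarrow> real" where
  "Efun u \<eta> = (LINT x|lborel. (u x)\<^sup>2 + (wd u x)\<^sup>2 + (\<eta> x)\<^sup>2) / 2"

definition Ffun :: "real \<Rightarrow> real \<Rightarrow> (real \<Rightarrow> real) \<Rightarrow> (real \<Rightarrow> real) \<Rightarrow> real" where
  "Ffun A \<sigma> u \<eta> = (LINT x|lborel. (u x)^3 + \<sigma> * u x * (wd u x)\<^sup>2 + 2 * u x * \<eta> x
                       + u x * (\<eta> x)\<^sup>2 - A * (u x)\<^sup>2) / 2"

definition time_dom :: "ereal \<Rightarrow> real set" where
  "time_dom T = {t. 0 \<le> t \<and> ereal t < T}"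

text \<open>(u, eta) in C([0,T); X) is a solution on [0,T): continuity into X, the two
  equations in the sense of distributions on (0,T) x R (weak form, obtained by moving
  all derivatives onto the test function), and conservation of E and F.\<close>
definition is_solution ::
  "real \<Rightarrow> real \<Rightarrow> ereal \<Rightarrow> (real \<Rightarrow> real \<Rightarrow> real) \<Rightarrow> (real \<Rightarrow> real \<Rightarrow> real) \<Rightarrow> bool" where
  "is_solution A \<sigma> T u \<eta> \<longleftrightarrow>
     (\<forall>t \<in> time_dom T. inX (u t, \<eta> t)) \<and>
     (\<forall>t0 \<in> time_dom T.
        ((\<lambda>t. distX (u t, \<eta> t) (u t0, \<eta> t0)) \<longlongrightarrow> 0) (at t0 within time_dom T)) \<and>
     (\<forall>\<phi>. test2 T \<phi> \<longrightarrow>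
        (LINT t|lborel. LINT x|lborel.
            u t x * dt \<phi> t x + \<sigma> / 2 * (u t x)\<^sup>2 * dx \<phi> t x
            + conv pker (Gterm A \<sigma> (u t) (\<eta> t)) x * dx \<phi> t x) = 0) \<and>
     (\<forall>\<phi>. test2 T \<phi> \<longrightarrow>
        (LINT t|lborel. LINT x|lborel.
            \<eta> t x * dt \<phi> t x + (1 + \<eta> t x) * u t x * dx \<phi> t x) = 0) \<and>
     (\<forall>t \<in> time_dom T. Efun (u t) (\<eta> t) = Efun (u 0) (\<eta> 0)) \<and>
     (\<forall>t \<in> time_dom T. Ffun A \<sigma> (u t) (\<eta> t) = Ffun A \<sigma> (u 0) (\<eta> 0))"

definition smooth_solitary_wave ::
  "real \<Rightarrow> real \<Rightarrow> real \<Rightarrow> (real \<Rightarrow> real) \<Rightarrow> (real \<Rightarrow> real) \<Rightarrow> bool" where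
  "smooth_solitary_wave A \<sigma> c \<phi> \<eta>c \<longleftrightarrow>
     smooth1 \<phi> \<and> smooth1 \<eta>c \<and> H1 \<phi> \<and> H1 \<eta>c \<and>
     (\<phi> \<longlongrightarrow> 0) at_infinity \<and> (\<eta>c \<longlongrightarrow> 0) at_infinity \<and>
     \<not> (\<phi> = (\<lambda>x. 0) \<and> \<eta>c = (\<lambda>x. 0)) \<and>
     is_solution A \<sigma> \<infinity> (\<lambda>t x. \<phi> (x - c * t)) (\<lambda>t x. \<eta>c (x - c * t))"

definition tube :: "(real \<Rightarrow> real) \<Rightarrow> (real \<Rightarrow> real) \<Rightarrow> real
                    \<Rightarrow> ((real \<Rightarrow> real) \<times> (real \<Rightarrow> real)) set" where
  "tube \<phi> \<eta>c \<epsilon> = {w. inX w \<and>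
      (INF s. distX w (\<lambda>x. \<phi> (x - s), \<lambda>x. \<eta>c (x - s))) < \<epsilon>}"

definition orbitally_stable ::
  "real \<Rightarrow> real \<Rightarrow> (real \<Rightarrow> real) \<Rightarrow> (real \<Rightarrow> real) \<Rightarrow> bool" where
  "orbitally_stable A \<sigma> \<phi> \<eta>c \<longleftrightarrow>
     (\<forall>\<epsilon>>0. \<exists>\<delta>>0. \<forall>u0 \<eta>0 T u \<eta>.
        (u0, \<eta>0) \<in> tube \<phi> \<eta>c \<delta> \<longrightarrow> 0 < T \<longrightarrow> is_solution A \<sigma> T u \<eta> \<longrightarrow>
        u 0 = u0 \<longrightarrow> \<eta> 0 = \<eta>0 \<longrightarrow>
        (\<forall>t \<in> time_dom T. (u t, \<eta> t) \<in> tube \<phi> \<eta>c \<epsilon>))"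

end

theory Submission
  imports Defs
begin

text \<open>Put \<open>r = A\<^sub>1\<close>, so that \<open>A = 1 / r - r\<close>, and let the wave have speed \<open>c > 0\<close>.  Completing the square
  in \<open>\<eta>\<close> turns \<open>2 (C E - F)\<close> into
  \<open>\<integral> (C - \<sigma> u) u\<^sub>x\<^sup>2 + W\<^sub>C(u) + (C - u) (\<eta> - u / (C - u))\<^sup>2\<close> with
  \<open>W\<^sub>C(s) = s\<^sup>2 (C - s - r) (C - s + 1 / r) / (C - s)\<close>.  A Modica-Mortola argument bounds this from below by
  \<open>4 \<integral>\<^sub>0\<^sup>M sqrt ((C - \<sigma> s) W\<^sub>C(s)) ds\<close> when \<open>u\<close> has maximum \<open>M = C - r\<close>, with equality for the solitary wave of
  speed \<open>C\<close>.  For \<open>\<sigma> \<le> 1\<close> this bound is strictly convex in \<open>C\<close>, and its derivative at \<open>c\<close> is twice the energy of the wave.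
  Hence \<open>E\<close> and \<open>F\<close> near their values at the wave force \<open>M\<close> to be near \<open>c - r\<close>.  Then \<open>\<bar>u\<^sub>x\<bar>\<close> and \<open>\<eta>\<close> are
  close in \<open>L\<^sup>2\<close> to the functions of \<open>u\<close> that characterise the wave, and comparing how fast \<open>u\<close> and the
  wave descend from their maxima bounds \<open>u\<close> from below by the wave, up to a small error.  Together with the value of
  the energy this gives closeness in \<open>X\<close>.  Continuity in time turns the static estimate into
  orbital stability; no linearised operator is involved.\<close>

section \<open>Primitives of locally integrable functions\<close>

text \<open>Elements of the energy space have only weak derivatives, so all calculus is done with
  pairs of a continuous function and a locally integrable function whose integrals are its
  increments. The obstacle is the top of the wave. That \<open>\<bar>u\<^sub>x\<bar>\<close> is
  close in \<open>L\<^sup>2\<close> to a function of \<open>u\<close> is a perturbed first-order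
  equation whose right side has a square-root zero at the maximal height. Uniqueness fails there:
  \<open>u\<close> may linger at its maximum before it descends, and no two-sided comparison with
  the wave is available. What survives is that \<open>u\<close> cannot descend faster than the wave,
  hence the one-sided bound. It is enough, because in the expansion of the squared distance between
  \<open>u\<close> and \<open>\<phi>\<close> the cross term is at most a product with the positive
  part of \<open>\<phi> - u\<close>. A plateau at the top is excluded by the norms alone: it would
  raise them, and the conserved energy fixes them.\<close>

definition is_primitive :: "(real \<Rightarrow> real) \<Rightarrow> (real \<Rightarrow> real) \<Rightarrow> bool" where
  "is_primitive u v \<longleftrightarrow> v \<in> borel_measurable borel \<and>
     (\<forall>a b. a \<le> b \<longrightarrow> set_integrable lborel {a..b} v \<and> (LINT x:{a..b}|lborel. v x) = u b - u a)"

lemma is_primitiveD: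
  assumes "is_primitive u v"
  shows "v \<in> borel_measurable borel" "set_integrable lborel {a..b} v"
    "a \<le> b \<Longrightarrow> (LINT x:{a..b}|lborel. v x) = u b - u a"
  using assms unfolding is_primitive_def
  by (auto, metis atLeastatMost_empty linorder_not_less set_integrable_empty order_less_imp_le)

lemma is_primitive_continuous:
  assumes "is_primitive u v"
  shows "continuous_on UNIV u"
proof (rule continuous_at_imp_continuous_on, rule ballI)
  fix x :: real
  let ?a = "x - 1" and ?b = "x + 1"
  have si: "set_integrable lborel {?a..?b} v" by (rule is_primitiveD[OF assms])
  have "v integrable_on {?a..?b}" using set_borel_integral_eq_integral(1)[OF si] .
  then have c: "continuous_on {?a..?b} (\<lambda>y. integral {?a..y} v)"
    by (rule indefinite_integral_continuous_1)
  have eq: "u y = u ?a + integral {?a..y} v" if "y \<in> {?a..?b}" for y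
    using set_borel_integral_eq_integral(2)[OF is_primitiveD(2)[OF assms, of ?a y]]
      is_primitiveD(3)[OF assms, of ?a y] that by simp
  have "continuous_on {?a..?b} u"
    by (subst continuous_on_cong[OF refl eq]) (auto intro!: continuous_intros c)
  then have "continuous_on {?a<..<?b} u" by (rule continuous_on_subset) auto
  then show "isCont u x" by (rule continuous_on_interior) simp
qed

lemma is_primitive_deriv:
  assumes "\<And>x. (u has_real_derivative v x) (at x)" "continuous_on UNIV v"
  shows "is_primitive u v"
  unfolding is_primitive_def
proof (intro conjI allI impI)
  show "v \<in> borel_measurable borel" using assms(2) by (rule borel_measurable_continuous_onI)
  fix a b :: real assume "a \<le> b"
  have c: "continuous_on {a..b} v" using assms(2) by (rule continuous_on_subset) auto
  show "set_integrable lborel {a..b} v" using borel_integrable_atLeastAtMost'[OF c] .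
  show "(LINT x:{a..b}|lborel. v x) = u b - u a"
    unfolding set_lebesgue_integral_def
    by (rule integral_FTC_atLeastAtMost[OF \<open>a \<le> b\<close> _ c])
      (use assms(1) in \<open>auto simp: has_real_derivative_iff_has_vector_derivative[symmetric] intro: DERIV_subset\<close>)
qed

lemma is_primitive_add:
  assumes "is_primitive u v" "is_primitive u' v'"
  shows "is_primitive (\<lambda>x. u x + u' x) (\<lambda>x. v x + v' x)"
  using assms unfolding is_primitive_def by (auto simp: set_integral_add)

lemma is_primitive_cmult:
  assumes "is_primitive u v"
  shows "is_primitive (\<lambda>x. k * u x) (\<lambda>x. k * v x)"
  using assms unfolding is_primitive_def by (auto simp flip: right_diff_distrib)

lemma is_primitive_diff:
  assumes "is_primitive u v" "is_primitive u' v'"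
  shows "is_primitive (\<lambda>x. u x - u' x) (\<lambda>x. v x - v' x)"
  using is_primitive_add[OF assms(1) is_primitive_cmult[OF assms(2), of "-1"]] by simp

lemma is_primitive_const_add:
  assumes "is_primitive u v"
  shows "is_primitive (\<lambda>x. k + u x) v"
  using assms unfolding is_primitive_def by auto

lemma set_integrable_cont_mult:
  fixes f v :: "real \<Rightarrow> real"
  assumes "continuous_on {a..b} f" "set_integrable lborel {a..b} v" "v \<in> borel_measurable borel"
  shows "set_integrable lborel {a..b} (\<lambda>x. f x * v x)"
proof -
  have "compact (f ` {a..b})" by (rule compact_continuous_image[OF assms(1)]) simp
  then obtain B where B: "\<And>x. x \<in> {a..b} \<Longrightarrow> \<bar>f x\<bar> \<le> B"
    using compact_imp_bounded bounded_iff by (metis imageI real_norm_def)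
  have m: "(\<lambda>x. indicator {a..b} x *\<^sub>R f x) \<in> borel_measurable borel"
    by (rule borel_measurable_continuous_on_indicator[OF _ assms(1)]) simp
  have m2: "(\<lambda>x. indicator {a..b} x *\<^sub>R (f x * v x)) \<in> borel_measurable borel"
  proof -
    have "(\<lambda>x. indicator {a..b} x *\<^sub>R (f x * v x)) = (\<lambda>x. (indicator {a..b} x *\<^sub>R f x) * v x)"
      by (auto simp: indicator_def)
    then show ?thesis using m assms(3) by simp
  qed
  show ?thesis
    by (rule set_integrable_bound[OF set_integrable_mult_right[where a=B, OF assms(2)]])
      (use m2 B in \<open>auto simp: set_borel_measurable_def abs_mult intro!: AE_I2 mult_right_mono\<close>,
       smt (verit) B atLeastAtMost_iff)
qed

lemma set_integral_combine_Icc: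
  fixes v :: "real \<Rightarrow> real"
  assumes "a \<le> b" "b \<le> c" "set_integrable lborel {a..c} v"
  shows "(LINT x:{a..c}|lborel. v x) = (LINT x:{a..b}|lborel. v x) + (LINT x:{b..c}|lborel. v x)"
proof -
  have 1: "set_integrable lborel {a..b} v" "set_integrable lborel {b..c} v"
    using assms by (auto intro: set_integrable_subset)
  have "integral {a..b} v + integral {b..c} v = integral {a..c} v"
    by (rule Henstock_Kurzweil_Integration.integral_combine) (use assms set_borel_integral_eq_integral(1)[OF assms(3)] in auto)
  then show ?thesis
    using set_borel_integral_eq_integral(2)[OF 1(1)] set_borel_integral_eq_integral(2)[OF 1(2)]
      set_borel_integral_eq_integral(2)[OF assms(3)] by simp
qed

lemma set_integral_abs_le:
  fixes f :: "real \<Rightarrow> real"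
  assumes "set_integrable lborel A f"
  shows "\<bar>LINT x:A|lborel. f x\<bar> \<le> (LINT x:A|lborel. \<bar>f x\<bar>)"
  using set_integral_norm_bound[OF assms] by simp

text \<open>On a short interval the mean value theorem gives \<open>\<Psi> (u q) - \<Psi> (u p) = \<psi> (u \<xi>) (u q - u p)\<close>,
  and replacing \<open>u \<xi>\<close> by \<open>u x\<close> under the integral costs an arbitrarily small multiple of the
  integral of \<open>\<bar>v\<bar>\<close>; Bolzano's principle adds up the errors.\<close>
lemma is_primitive_chain:
  assumes P: "is_primitive u v" and D: "\<And>s. (\<Psi> has_real_derivative \<psi> s) (at s)"
    and c: "continuous_on UNIV \<psi>"
  shows "is_primitive (\<lambda>x. \<Psi> (u x)) (\<lambda>x. \<psi> (u x) * v x)"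
proof -
  have cu: "continuous_on UNIV u" by (rule is_primitive_continuous[OF P])
  have cpu: "continuous_on S (\<lambda>x. \<psi> (u x))" for S
    by (rule continuous_on_compose2[OF c continuous_on_subset[OF cu]]) auto
  have mv: "v \<in> borel_measurable borel" by (rule is_primitiveD[OF P])
  have si: "set_integrable lborel {a..b} (\<lambda>x. \<psi> (u x) * v x)" for a b
    by (rule set_integrable_cont_mult[OF cpu is_primitiveD(2)[OF P] mv])
  have sv: "set_integrable lborel {a..b} v" for a b by (rule is_primitiveD[OF P])
  have sav: "set_integrable lborel {a..b} (\<lambda>x. \<bar>v x\<bar>)" for a b by (rule set_integrable_abs[OF sv])
  let ?R = "\<lambda>p q. \<Psi> (u q) - \<Psi> (u p) - (LINT x:{p..q}|lborel. \<psi> (u x) * v x)"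
  have main: "\<bar>?R a b\<bar> \<le> e * (LINT x:{a..b}|lborel. \<bar>v x\<bar>)" if "a \<le> b" "e > 0" for a b e
    using \<open>a \<le> b\<close>
  proof (induction rule: Bolzano)
    case (trans p q s)
    have "?R p s = ?R p q + ?R q s"
      using set_integral_combine_Icc[OF trans(3,4) si] by simp
    moreover have "(LINT x:{p..s}|lborel. \<bar>v x\<bar>) = (LINT x:{p..q}|lborel. \<bar>v x\<bar>) + (LINT x:{q..s}|lborel. \<bar>v x\<bar>)"
      by (rule set_integral_combine_Icc[OF trans(3,4) sav])
    ultimately show ?case using trans(1,2) by (simp add: distrib_left)
  next
    case (local x)
    have "isCont (\<lambda>x. \<psi> (u x)) x" using cpu[of UNIV] continuous_on_eq_continuous_at by blast
    then obtain d where d: "d > 0" "\<And>y. \<bar>y - x\<bar> < d \<Longrightarrow> \<bar>\<psi> (u y) - \<psi> (u x)\<bar> < e / 2"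
      using \<open>e > 0\<close> unfolding continuous_at_eps_delta dist_real_def by (meson half_gt_zero)
    have "\<bar>?R p q\<bar> \<le> e * (LINT x:{p..q}|lborel. \<bar>v x\<bar>)" if h: "p \<le> x" "x \<le> q" "q - p < d" for p q
    proof -
      have pq: "p \<le> q" using h by simp
      obtain s where s: "s \<in> closed_segment (u p) (u q)" "\<Psi> (u q) - \<Psi> (u p) = \<psi> s * (u q - u p)"
      proof (cases "u p = u q")
        case True then show ?thesis using that[of "u p"] by simp
      next
        case False
        then consider "u p < u q" | "u q < u p" by linarith
        then show ?thesis
        proof cases
          case 1
          from MVT2[OF 1, of \<Psi> \<psi>] D obtain z where "u p < z" "z < u q" "\<Psi> (u q) - \<Psi> (u p) = (u q - u p) * \<psi> z" by auto
          then show ?thesis using that[of z] by (auto simp: closed_segment_eq_real_ivl mult.commute)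
        next
          case 2
          from MVT2[OF 2, of \<Psi> \<psi>] D obtain z where "u q < z" "z < u p" "\<Psi> (u p) - \<Psi> (u q) = (u p - u q) * \<psi> z" by auto
          then show ?thesis using that[of z] by (auto simp: closed_segment_eq_real_ivl algebra_simps)
        qed
      qed
      have cupq: "continuous_on {p..q} u" using cu continuous_on_subset by blast
      obtain \<xi> where xi: "\<xi> \<in> {p..q}" "u \<xi> = s"
        using s(1) IVT'[of u p s q, OF _ _ pq cupq] IVT2'[of u q s p, OF _ _ pq cupq]
        by (auto simp: closed_segment_eq_real_ivl split: if_splits)
      have "u q - u p = (LINT x:{p..q}|lborel. v x)" using is_primitiveD(3)[OF P pq] by simp
      then have "?R p q = (LINT x:{p..q}|lborel. \<psi> (u \<xi>) * v x) - (LINT x:{p..q}|lborel. \<psi> (u x) * v x)"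
        using s(2) xi(2) by simp
      also have "\<dots> = (LINT x:{p..q}|lborel. \<psi> (u \<xi>) * v x - \<psi> (u x) * v x)"
        by (subst set_integral_diff(2)) (use sv si in auto)
      finally have "\<bar>?R p q\<bar> \<le> (LINT x:{p..q}|lborel. \<bar>\<psi> (u \<xi>) * v x - \<psi> (u x) * v x\<bar>)"
        using set_integral_abs_le[of "{p..q}" "\<lambda>x. \<psi> (u \<xi>) * v x - \<psi> (u x) * v x"] sv si by (simp add: set_integral_diff)
      also have "\<dots> \<le> (LINT y:{p..q}|lborel. e * \<bar>v y\<bar>)"
      proof (rule set_integral_mono)
        show "set_integrable lborel {p..q} (\<lambda>x. \<bar>\<psi> (u \<xi>) * v x - \<psi> (u x) * v x\<bar>)"
          by (intro set_integrable_abs set_integral_diff) (use sv si in auto)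
        show "set_integrable lborel {p..q} (\<lambda>y. e * \<bar>v y\<bar>)" using sav by auto
        fix y assume "y \<in> {p..q}"
        then have "\<bar>\<psi> (u \<xi>) - \<psi> (u y)\<bar> \<le> e"
          using d(2)[of \<xi>] d(2)[of y] xi h by (simp only: atLeastAtMost_iff) argo
        then show "\<bar>\<psi> (u \<xi>) * v y - \<psi> (u y) * v y\<bar> \<le> e * \<bar>v y\<bar>"
          by (metis abs_mult abs_ge_zero left_diff_distrib mult_right_mono)
      qed
      finally show ?thesis by simp
    qed
    then show ?case using d(1) by blast
  qed
  show ?thesis unfolding is_primitive_def
  proof (intro conjI allI impI)
    show "(\<lambda>x. \<psi> (u x) * v x) \<in> borel_measurable borel"
      using mv borel_measurable_continuous_onI[OF cpu] by simp
    fix a b :: real assume ab: "a \<le> b"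
    show "set_integrable lborel {a..b} (\<lambda>x. \<psi> (u x) * v x)" by (rule si)
    have "\<bar>?R a b\<bar> \<le> 0"
    proof (rule field_le_epsilon)
      fix e :: real assume "e > 0"
      let ?V = "LINT x:{a..b}|lborel. \<bar>v x\<bar>"
      have V: "?V \<ge> 0" unfolding set_lebesgue_integral_def by (rule integral_nonneg_AE) auto
      have "\<bar>?R a b\<bar> \<le> e / (?V + 1) * ?V" by (rule main[OF ab]) (use V \<open>e > 0\<close> in auto)
      also have "\<dots> \<le> e" using V \<open>e > 0\<close> by (simp add: field_simps)
      finally show "\<bar>?R a b\<bar> \<le> 0 + e" by simp
    qed
    then show "(LINT x:{a..b}|lborel. \<psi> (u x) * v x) = \<Psi> (u b) - \<Psi> (u a)" by simp
  qed
qed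

text \<open>Polarisation: a product is a combination of squares, and for squares the chain rule
  suffices.\<close>

lemma is_primitive_mult:
  assumes "is_primitive u v" "is_primitive u' v'"
  shows "is_primitive (\<lambda>x. u x * u' x) (\<lambda>x. v x * u' x + u x * v' x)"
proof -
  have sq: "is_primitive (\<lambda>x. (w x)\<^sup>2) (\<lambda>x. (2 * w x) * z x)" if "is_primitive w z" for w z
    by (rule is_primitive_chain[OF that, of "\<lambda>s. s^2" "\<lambda>s. 2 * s"])
      (auto intro!: derivative_eq_intros continuous_intros)
  have "is_primitive (\<lambda>x. 1/2 * ((u x + u' x)\<^sup>2 - ((u x)\<^sup>2 + (u' x)\<^sup>2)))
     (\<lambda>x. 1/2 * ((2 * (u x + u' x)) * (v x + v' x) - ((2 * u x) * v x + (2 * u' x) * v' x)))"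
    by (intro is_primitive_cmult is_primitive_diff is_primitive_add sq assms)
  then show ?thesis by (simp add: algebra_simps power2_eq_square)
qed

section \<open>Translation invariance and limits of primitives at infinity\<close>

lemma integral_shift:
  fixes f :: "real \<Rightarrow> real"
  shows "(LINT x|lborel. f (x - s)) = (LINT x|lborel. f x)"
  using lborel_integral_real_affine[of 1 f "-s"] by simp

lemma integrable_shift_iff:
  fixes f :: "real \<Rightarrow> real"
  shows "integrable lborel (\<lambda>x. f (x - s)) \<longleftrightarrow> integrable lborel f"
  using lborel_integrable_real_affine_iff[of 1 f "-s"] by simp

lemma AE_shift:
  fixes P :: "real \<Rightarrow> bool"
  assumes "AE x in lborel. P x"
  shows "AE x in lborel. P (x - s)"
proof -
  have "(+) (- s) = (\<lambda>x. x - s)" by auto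
  then have "AE x in distr lborel borel (\<lambda>x. x - s). P x"
    using assms lborel_distr_plus[of "-s"] by metis
  then show ?thesis by (rule AE_distrD[rotated]) simp
qed

lemma is_primitive_shift:
  assumes "is_primitive u v"
  shows "is_primitive (\<lambda>x. u (x - s)) (\<lambda>x. v (x - s))"
  unfolding is_primitive_def
proof (intro conjI allI impI)
  show "(\<lambda>x. v (x - s)) \<in> borel_measurable borel"
    using is_primitiveD(1)[OF assms] by measurable
  fix a b :: real assume ab: "a \<le> b"
  have e: "(\<lambda>x. indicator {a..b} x *\<^sub>R v (x - s)) = (\<lambda>x. (\<lambda>y. indicator {a-s..b-s} y *\<^sub>R v y) (x - s))"
    by (auto simp: indicator_def)
  show "set_integrable lborel {a..b} (\<lambda>x. v (x - s))"
    unfolding set_integrable_def e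
    by (subst integrable_shift_iff) (use is_primitiveD(2)[OF assms, of "a-s" "b-s"] in \<open>simp add: set_integrable_def\<close>)
  show "(LINT x:{a..b}|lborel. v (x - s)) = u (b - s) - u (a - s)"
    unfolding set_lebesgue_integral_def e
    by (subst integral_shift) (use is_primitiveD(3)[OF assms, of "a-s" "b-s"] ab in \<open>simp add: set_lebesgue_integral_def\<close>)
qed

lemma is_primitive_limits:
  assumes P: "is_primitive u v" and i: "integrable lborel v"
  shows "(u \<longlongrightarrow> u a + (LINT x:{a..}|lborel. v x)) at_top"
    "(u \<longlongrightarrow> u a - (LINT x:{..a}|lborel. v x)) at_bot"
proof -
  have si: "set_integrable lborel S v" if "S \<in> sets lborel" for S
    using i that integrable_mult_indicator set_integrable_def by blast
  have "((\<lambda>b. LINT x:{a..b}|lborel. v x) \<longlongrightarrow> (LINT x:{a..}|lborel. v x)) at_top"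
    by (rule tendsto_set_lebesgue_integral_at_top) (auto intro: si)
  then have "((\<lambda>b. u a + (LINT x:{a..b}|lborel. v x)) \<longlongrightarrow> u a + (LINT x:{a..}|lborel. v x)) at_top"
    by (intro tendsto_intros)
  then show "(u \<longlongrightarrow> u a + (LINT x:{a..}|lborel. v x)) at_top"
    by (rule Lim_transform_eventually)
      (use is_primitiveD(3)[OF P, of a] in \<open>auto intro!: eventually_at_top_linorderI[of a]\<close>)
  have "((\<lambda>b. LINT x:{b..a}|lborel. v x) \<longlongrightarrow> (LINT x:{..a}|lborel. v x)) at_bot"
    by (rule tendsto_set_lebesgue_integral_at_bot) (auto intro: si)
  then have "((\<lambda>b. u a - (LINT x:{b..a}|lborel. v x)) \<longlongrightarrow> u a - (LINT x:{..a}|lborel. v x)) at_bot"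
    by (intro tendsto_intros)
  then show "(u \<longlongrightarrow> u a - (LINT x:{..a}|lborel. v x)) at_bot"
    by (rule Lim_transform_eventually)
      (use is_primitiveD(3)[OF P, of _ a] in \<open>auto intro!: eventually_at_bot_linorderI[of a]\<close>)
qed

text \<open>The signed integral is the form used at a maximum \<open>a\<close>: the ascent before
  \<open>a\<close> and the descent after it each contribute the height \<open>u a\<close>.\<close>

lemma is_primitive_half_integrals:
  assumes P: "is_primitive u v" and i: "integrable lborel v"
    and l: "(u \<longlongrightarrow> 0) at_top" "(u \<longlongrightarrow> 0) at_bot"
  shows "(LINT x:{a..}|lborel. v x) = - u a" "(LINT x:{..a}|lborel. v x) = u a"
    "(LINT x|lborel. sgn (x - a) * v x) = - 2 * u a" "(LINT x|lborel. v x) = 0"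
proof -
  show 1: "(LINT x:{a..}|lborel. v x) = - u a"
    using tendsto_unique[OF _ is_primitive_limits(1)[OF P i, of a] l(1)] by simp
  show 2: "(LINT x:{..a}|lborel. v x) = u a"
    using tendsto_unique[OF _ is_primitive_limits(2)[OF P i, of a] l(2)] by simp
  have si: "set_integrable lborel S v" if "S \<in> sets lborel" for S
    using i that integrable_mult_indicator set_integrable_def by blast
  \<comment> \<open>The point \<open>a\<close> lies in both half lines, so the decompositions below
    hold only off a null set.\<close>
  have ne: "AE x in lborel. x \<noteq> a" by (rule AE_lborel_singleton)
  have mv[measurable]: "v \<in> borel_measurable borel" by (rule is_primitiveD[OF P])
  have "(LINT x|lborel. sgn (x - a) * v x) = (LINT x|lborel. indicator {a..} x *\<^sub>R v x - indicator {..a} x *\<^sub>R v x)"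
  proof (rule integral_cong_AE)
    show "AE x in lborel. sgn (x - a) * v x = indicator {a..} x *\<^sub>R v x - indicator {..a} x *\<^sub>R v x"
      using ne by (rule AE_mp) (auto simp: indicator_def sgn_if intro!: AE_I2)
  qed (auto simp: borel_measurable_sgn)
  also have "\<dots> = (LINT x:{a..}|lborel. v x) - (LINT x:{..a}|lborel. v x)"
    using si[of "{a..}"] si[of "{..a}"] unfolding set_lebesgue_integral_def set_integrable_def by simp
  finally show "(LINT x|lborel. sgn (x - a) * v x) = - 2 * u a" using 1 2 by simp
  have "(LINT x|lborel. v x) = (LINT x|lborel. indicator {a..} x *\<^sub>R v x + indicator {..a} x *\<^sub>R v x)"
  proof (rule integral_cong_AE)
    show "AE x in lborel. v x = indicator {a..} x *\<^sub>R v x + indicator {..a} x *\<^sub>R v x"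
      using ne by (rule AE_mp) (auto simp: indicator_def sgn_if intro!: AE_I2)
  qed auto
  also have "\<dots> = (LINT x:{a..}|lborel. v x) + (LINT x:{..a}|lborel. v x)"
    using si[of "{a..}"] si[of "{..a}"] unfolding set_lebesgue_integral_def set_integrable_def by simp
  finally show "(LINT x|lborel. v x) = 0" using 1 2 by simp
qed

section \<open>Test functions and weak derivatives\<close>

text \<open>Coinduction for smoothness: in a family that contains a derivative of each member, every
  member is smooth, and no formula for the n-th derivative is needed.\<close>

lemma smooth1I:
  assumes "f \<in> S" "\<And>h. h \<in> S \<Longrightarrow> \<exists>h'\<in>S. \<forall>x. (h has_real_derivative h' x) (at x)"
  shows "smooth1 f"
proof -
  obtain d where d: "\<And>h. h \<in> S \<Longrightarrow> d h \<in> S" "\<And>h x. h \<in> S \<Longrightarrow> (h has_real_derivative d h x) (at x)"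
    using assms(2) by metis
  have S: "(d ^^ n) f \<in> S" for n by (induction n) (auto simp: assms(1) d(1))
  show ?thesis unfolding smooth1_def
    by (rule exI[of _ "\<lambda>n. (d ^^ n) f"]) (use d(2)[OF S] in auto)
qed

lemma smooth1_deriv:
  assumes "smooth1 f"
  shows "\<And>x. (f has_real_derivative deriv f x) (at x)" "smooth1 (deriv f)"
    "continuous_on UNIV f"
proof -
  obtain D where D: "D 0 = f" "\<And>n x. (D n has_real_derivative D (Suc n) x) (at x)"
    using assms unfolding smooth1_def by blast
  have e: "deriv f = D 1" using D(2)[of 0] D(1) by (auto intro!: ext DERIV_imp_deriv)
  show "\<And>x. (f has_real_derivative deriv f x) (at x)" using D(2)[of 0] D(1) e by simp
  show "smooth1 (deriv f)" unfolding smooth1_def e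
    by (rule exI[of _ "\<lambda>n. D (Suc n)"]) (use D(2) in auto)
  show "continuous_on UNIV f"
    using D(2)[of 0] D(1) by (auto intro!: DERIV_continuous_on simp: has_field_derivative_at_within)
qed

lemma smooth1_antideriv:
  assumes "smooth1 g" "\<And>x. (f has_real_derivative g x) (at x)"
  shows "smooth1 f"
proof -
  obtain D where D: "D 0 = g" "\<And>n x. (D n has_real_derivative D (Suc n) x) (at x)"
    using assms unfolding smooth1_def by blast
  show ?thesis unfolding smooth1_def
    by (rule exI[of _ "\<lambda>n. case n of 0 \<Rightarrow> f | Suc k \<Rightarrow> D k"]) (use D assms(2) in \<open>auto split: nat.split\<close>)
qed

lemma smooth1_add:
  assumes "smooth1 f" "smooth1 g" shows "smooth1 (\<lambda>x. f x + g x)"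
proof (rule smooth1I[of _ "{\<lambda>x. p x + q x | p q. smooth1 p \<and> smooth1 q}"])
  show "(\<lambda>x. f x + g x) \<in> {\<lambda>x. p x + q x | p q. smooth1 p \<and> smooth1 q}" using assms by auto
  fix h assume "h \<in> {\<lambda>x. p x + q x | p q. smooth1 p \<and> smooth1 q}"
  then obtain p q where h: "h = (\<lambda>x. p x + q x)" "smooth1 p" "smooth1 q" by auto
  show "\<exists>h'\<in>{\<lambda>x. p x + q x | p q. smooth1 p \<and> smooth1 q}. \<forall>x. (h has_real_derivative h' x) (at x)"
  proof (intro bexI[of _ "\<lambda>x. deriv p x + deriv q x"] allI)
    show "(h has_real_derivative deriv p x + deriv q x) (at x)" for x
      unfolding h(1) by (rule DERIV_add[OF smooth1_deriv(1)[OF h(2)] smooth1_deriv(1)[OF h(3)]])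
    show "(\<lambda>x. deriv p x + deriv q x) \<in> {\<lambda>x. p x + q x | p q. smooth1 p \<and> smooth1 q}"
      using smooth1_deriv(2)[OF h(2)] smooth1_deriv(2)[OF h(3)] by blast
  qed
qed

lemma smooth1_cmult:
  assumes "smooth1 f" shows "smooth1 (\<lambda>x. k * f x)"
proof (rule smooth1I[of _ "{\<lambda>x. k * p x | p. smooth1 p}"])
  show "(\<lambda>x. k * f x) \<in> {\<lambda>x. k * p x | p. smooth1 p}" using assms by auto
  fix h assume "h \<in> {\<lambda>x. k * p x | p. smooth1 p}"
  then obtain p where h: "h = (\<lambda>x. k * p x)" "smooth1 p" by auto
  show "\<exists>h'\<in>{\<lambda>x. k * p x | p. smooth1 p}. \<forall>x. (h has_real_derivative h' x) (at x)"
  proof (intro bexI[of _ "\<lambda>x. k * deriv p x"] allI)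
    show "(h has_real_derivative k * deriv p x) (at x)" for x
      unfolding h(1) by (rule DERIV_cmult[OF smooth1_deriv(1)[OF h(2)]])
    show "(\<lambda>x. k * deriv p x) \<in> {\<lambda>x. k * p x | p. smooth1 p}"
      using smooth1_deriv(2)[OF h(2)] by blast
  qed
qed

lemma smooth1_affine:
  assumes "smooth1 f" shows "smooth1 (\<lambda>x. f (k * x + l))"
proof (rule smooth1I[of _ "{\<lambda>x. m * p (k * x + l) | m p. smooth1 p}"])
  show "(\<lambda>x. f (k * x + l)) \<in> {\<lambda>x. m * p (k * x + l) | m p. smooth1 p}"
    using assms by (auto intro!: exI[of _ 1] exI[of _ f])
  fix h assume "h \<in> {\<lambda>x. m * p (k * x + l) | m p. smooth1 p}"
  then obtain m p where h: "h = (\<lambda>x. m * p (k * x + l))" "smooth1 p" by auto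
  have "(h has_real_derivative (m * k) * deriv p (k * x + l)) (at x)" for x
    unfolding h(1)
    by (auto intro!: derivative_eq_intros DERIV_chain'[where g=p, OF _ smooth1_deriv(1)[OF h(2)]])
  then show "\<exists>h'\<in>{\<lambda>x. m * p (k * x + l) | m p. smooth1 p}. \<forall>x. (h has_real_derivative h' x) (at x)"
    using smooth1_deriv(2)[OF h(2)] by (intro bexI[of _ "\<lambda>x. (m * k) * deriv p (k * x + l)"]) auto
qed

text \<open>The product rule turns one product into a sum of two, so sums must be included to obtain
  a family closed under differentiation.\<close>

inductive_set sums_of_products :: "(real \<Rightarrow> real) set" where
  base: "smooth1 f \<Longrightarrow> smooth1 g \<Longrightarrow> (\<lambda>x. f x * g x) \<in> sums_of_products"
| plus: "p \<in> sums_of_products \<Longrightarrow> q \<in> sums_of_products \<Longrightarrow> (\<lambda>x. p x + q x) \<in> sums_of_products"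

lemma smooth1_mult:
  assumes "smooth1 f" "smooth1 g" shows "smooth1 (\<lambda>x. f x * g x)"
proof (rule smooth1I[of _ sums_of_products])
  show "(\<lambda>x. f x * g x) \<in> sums_of_products" using assms by (rule base)
  fix h assume "h \<in> sums_of_products"
  then show "\<exists>h'\<in>sums_of_products. \<forall>x. (h has_real_derivative h' x) (at x)"
  proof induction
    case (base f g)
    have "((\<lambda>x. f x * g x) has_real_derivative deriv f x * g x + f x * deriv g x) (at x)" for x
      by (auto intro!: derivative_eq_intros smooth1_deriv(1) base)
    then show ?case
      using base by (intro bexI[of _ "\<lambda>x. deriv f x * g x + f x * deriv g x"])
        (auto intro!: sums_of_products.intros smooth1_deriv(2))
  next
    case (plus p q)
    then obtain p' q' where "p' \<in> sums_of_products" "\<And>x. (p has_real_derivative p' x) (at x)"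
      "q' \<in> sums_of_products" "\<And>x. (q has_real_derivative q' x) (at x)" by blast
    then show ?case
      by (intro bexI[of _ "\<lambda>x. p' x + q' x"] allI DERIV_add sums_of_products.plus)
  qed
qed

section \<open>Smooth cut-off functions\<close>

definition flat_exp :: "real poly \<Rightarrow> real \<Rightarrow> real" where
  "flat_exp P x = (if x \<le> 0 then 0 else poly P (inverse x) * exp (- inverse x))"

lemma poly_exp_tendsto_0: "((\<lambda>y. poly P y * exp (- y)) \<longlongrightarrow> (0::real)) at_top"
proof (induction P)
  case 0 then show ?case by simp
next
  case (pCons a P)
  have *: "((\<lambda>y. y ^ k * exp (- y)) \<longlongrightarrow> (0::real)) at_top" for k :: nat
    using tendsto_power_div_exp_0[of k] by (simp add: exp_minus divide_inverse)
  have "((\<lambda>y. poly P y * y * exp (- y)) \<longlongrightarrow> (0::real)) at_top" for P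
  proof -
    have "((\<lambda>y. \<Sum>i\<le>degree P. coeff P i * (y ^ (Suc i) * exp (- y))) \<longlongrightarrow> (\<Sum>i\<le>degree P. coeff P i * 0)) at_top"
      by (intro tendsto_intros *)
    moreover have "(\<Sum>i\<le>degree P. coeff P i * (y ^ (Suc i) * exp (- y))) = poly P y * y * exp (- y)" for y
      by (simp add: poly_altdef sum_distrib_right sum_distrib_left algebra_simps)
    ultimately show ?thesis by simp
  qed
  moreover have "((\<lambda>y. a * (y ^ 0 * exp (- y))) \<longlongrightarrow> a * 0) at_top" by (intro tendsto_intros *)
  ultimately have "((\<lambda>y. a * (y ^ 0 * exp (- y)) + poly P y * y * exp (- y)) \<longlongrightarrow> a * 0 + 0) at_top"
    by (intro tendsto_add)
  then show ?case by (simp add: algebra_simps)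
qed

text \<open>With \<open>y = 1 / x\<close> the derivative of \<open>P(y) exp (-y)\<close> is
  \<open>y^2 (P - P')(y) exp (-y)\<close>. Thus the polynomial multiples of
  \<open>exp (-1 / x)\<close> are closed under differentiation, and at 0 their decay makes the
  derivative vanish.\<close>

lemma flat_exp_deriv:
  "(flat_exp P has_real_derivative flat_exp ([:0,0,1:] * (P - pderiv P)) x) (at x)"
proof -
  consider "x < 0" | "x = 0" | "x > 0" by linarith
  then show ?thesis
  proof cases
    case 1
    have "((\<lambda>x. 0) has_real_derivative 0) (at x)" by simp
    then have "(flat_exp P has_real_derivative 0) (at x)"
      by (rule DERIV_cong_ev[THEN iffD1, OF refl _ refl, rotated])
        (use 1 in \<open>auto simp: flat_exp_def intro!: eventually_mono[OF eventually_nhds_in_open[of "{..<0}"]]\<close>)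
    then show ?thesis using 1 by (simp add: flat_exp_def)
  next
    case 3
    have "((\<lambda>x. poly P (inverse x) * exp (- inverse x)) has_real_derivative
        poly ([:0,0,1:] * (P - pderiv P)) (inverse x) * exp (- inverse x)) (at x)"
    proof -
      have i: "(inverse has_real_derivative - (inverse x)\<^sup>2) (at x)"
        using DERIV_inverse[of x] 3 by (simp add: power2_eq_square)
      have e: "((\<lambda>x. exp (- inverse x)) has_real_derivative exp (- inverse x) * (inverse x)\<^sup>2) (at x)"
        using DERIV_chain2[OF DERIV_exp DERIV_minus[OF i]] by simp
      show ?thesis
        using DERIV_mult[OF DERIV_chain2[OF poly_DERIV[of P] i] e]
        by (rule DERIV_cong) (simp add: algebra_simps power2_eq_square)
    qed
    then have "(flat_exp P has_real_derivative poly ([:0,0,1:] * (P - pderiv P)) (inverse x) * exp (- inverse x)) (at x)"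
      by (rule DERIV_cong_ev[THEN iffD1, OF refl _ refl, rotated])
        (use 3 in \<open>auto simp: flat_exp_def intro!: eventually_mono[OF eventually_nhds_in_open[of "{0<..}"]]\<close>)
    then show ?thesis using 3 by (simp add: flat_exp_def)
  next
    case 2
    have "((\<lambda>h. flat_exp P h / h) \<longlongrightarrow> 0) (at 0)"
    proof (rule filterlim_split_at)
      show "((\<lambda>h. flat_exp P h / h) \<longlongrightarrow> 0) (at_left 0)"
        by (rule Lim_transform_eventually[OF tendsto_const[of 0]])
          (auto simp: flat_exp_def eventually_at_filter)
      \<comment> \<open>Division by \<open>h\<close> multiplies the polynomial by its variable, so
        the difference quotient at 0 has the form already treated.\<close>
      have "((\<lambda>h. poly (P * [:0,1:]) (inverse h) * exp (- inverse h)) \<longlongrightarrow> 0) (at_right (0::real))"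
        by (rule filterlim_compose[OF poly_exp_tendsto_0 filterlim_inverse_at_top_right])
      then show "((\<lambda>h. flat_exp P h / h) \<longlongrightarrow> 0) (at_right 0)"
        by (rule Lim_transform_eventually)
          (auto simp: flat_exp_def eventually_at_filter divide_inverse)
    qed
    then show ?thesis using 2 by (simp add: DERIV_def flat_exp_def)
  qed
qed

lemma smooth1_flat_exp: "smooth1 (flat_exp P)"
  by (rule smooth1I[of _ "range flat_exp"]) (auto intro: flat_exp_deriv)

definition bump :: "real \<Rightarrow> real" where
  "bump x = flat_exp 1 x * flat_exp 1 (1 - x)"

lemma smooth1_bump: "smooth1 bump"
  unfolding bump_def[abs_def]
  using smooth1_mult[OF smooth1_flat_exp[of 1] smooth1_affine[OF smooth1_flat_exp[of 1], of "-1" 1]] by simp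

lemma bump_nonneg: "bump x \<ge> 0" and bump_pos_iff: "bump x > 0 \<longleftrightarrow> 0 < x \<and> x < 1"
  and bump_zero: "x \<le> 0 \<or> 1 \<le> x \<Longrightarrow> bump x = 0"
  by (auto simp: bump_def flat_exp_def)

lemma ex_antideriv:
  fixes f :: "real \<Rightarrow> real"
  assumes "continuous_on UNIV f"
  obtains F where "\<And>x. (F has_real_derivative f x) (at x)"
proof -
  \<comment> \<open>An integral over an interval with reversed endpoints is 0, so this difference is
    the signed integral from 0 to \<open>x\<close>.\<close>
  define F where "F x = integral {0..x} f - integral {x..0} f" for x
  have "(F has_real_derivative f x) (at x)" for x
  proof -
    define a where "a = - \<bar>x\<bar> - 1"
    define b where "b = \<bar>x\<bar> + 1"
    have x: "a < x" "x < b" "a < 0" "0 < b" by (auto simp: a_def b_def)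
    have c: "continuous_on {a..b} f" using assms continuous_on_subset by blast
    have ii: "f integrable_on {p..q}" for p q
      by (rule integrable_continuous_interval) (use assms continuous_on_subset in blast)
    have e: "F y = integral {a..y} f - integral {a..0} f" if "y \<in> {a<..<b}" for y
      using Henstock_Kurzweil_Integration.integral_combine[of a 0 y f]
        Henstock_Kurzweil_Integration.integral_combine[of a y 0 f] that x ii
      unfolding F_def by (cases "y \<le> 0"; cases "y = 0") auto
    have "((\<lambda>y. integral {a..y} f) has_real_derivative f x) (at x within {a..b})"
      using integral_has_real_derivative[OF c, of x] x by auto
    moreover have "at x within {a..b} = at x" using x by (intro at_within_Icc_at)
    ultimately have "((\<lambda>y. integral {a..y} f) has_real_derivative f x) (at x)" by simp
    from DERIV_diff[OF this DERIV_const]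
    have "((\<lambda>y. integral {a..y} f - integral {a..0} f) has_real_derivative f x) (at x)" by simp
    then show ?thesis
      by (rule DERIV_cong_ev[THEN iffD1, OF refl _ refl, rotated])
        (use e x in \<open>auto intro!: eventually_mono[OF eventually_nhds_in_open[of "{a<..<b}"]]\<close>)
  qed
  then show ?thesis using that by blast
qed

text \<open>The step is the antiderivative of the bump, shifted and normalised by the total
  increment.\<close>

lemma smooth_step:
  obtains \<theta> where "smooth1 \<theta>" "\<And>x. x \<le> 0 \<Longrightarrow> \<theta> x = 0" "\<And>x. 1 \<le> x \<Longrightarrow> \<theta> x = (1::real)"
    "\<And>x. 0 \<le> \<theta> x" "\<And>x. \<theta> x \<le> 1"
proof -
  obtain F where F: "\<And>x. (F has_real_derivative bump x) (at x)"
    using ex_antideriv[OF smooth1_deriv(3)[OF smooth1_bump]] by blast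
  have mono: "F x \<le> F y" if "x \<le> y" for x y
    by (rule DERIV_nonneg_imp_nondecreasing[OF that]) (use F bump_nonneg in blast)
  have mv: "\<exists>z. x < z \<and> z < y \<and> F y - F x = (y - x) * bump z" if "x < y" for x y
    using MVT2[OF that, of F bump] F by blast
  have c1: "F x = F 0" if "x \<le> 0" for x
  proof (cases "x = 0")
    case False
    then have "x < 0" using that by simp
    then obtain z where "z < 0" "F 0 - F x = (0 - x) * bump z" using mv[of x 0] by blast
    then show ?thesis using bump_zero[of z] by simp
  qed simp
  have c2: "F x = F 1" if "x \<ge> 1" for x
  proof (cases "x = 1")
    case False
    then have "1 < x" using that by simp
    then obtain z where "1 < z" "F x - F 1 = (x - 1) * bump z" using mv[of 1 x] by blast
    then show ?thesis using bump_zero[of z] by simp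
  qed simp
  obtain z where "0 < z" "z < 1" "F 1 - F 0 = (1 - 0) * bump z" using mv[of 0 1] by auto
  then have lt: "F 0 < F 1" using bump_pos_iff[of z] by simp
  define \<theta> where "\<theta> x = (1 / (F 1 - F 0)) * (F x + (- F 0))" for x
  have c: "smooth1 (\<lambda>x::real. k)" for k :: real
    unfolding smooth1_def by (rule exI[of _ "\<lambda>n x. if n = 0 then k else 0"]) auto
  have "smooth1 \<theta>" unfolding \<theta>_def[abs_def]
    by (intro smooth1_cmult smooth1_add c smooth1_antideriv[OF smooth1_bump F])
  moreover have "\<theta> x = 0" if "x \<le> 0" for x using c1[OF that] by (simp add: \<theta>_def)
  moreover have "\<theta> x = 1" if "1 \<le> x" for x using c2[OF that] lt by (simp add: \<theta>_def)
  moreover have "0 \<le> \<theta> x" for x using mono[of 0 x] c1[of x] lt by (cases "x \<le> 0") (auto simp: \<theta>_def)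
  moreover have "\<theta> x \<le> 1" for x using mono[of x 1] c2[of x] lt by (cases "x \<le> 1") (auto simp: \<theta>_def field_simps)
  ultimately show ?thesis using that by blast
qed

lemma test1I:
  assumes "smooth1 f" "\<And>x. x < a \<or> b < x \<Longrightarrow> f x = 0"
  shows "test1 f"
proof -
  have "closure {x. f x \<noteq> 0} \<subseteq> {a..b}"
    by (rule closure_minimal) (use assms(2) in \<open>force simp: not_less[symmetric]\<close>, simp)
  then show ?thesis unfolding test1_def using assms(1) compact_Int_closed[of "{a..b}" "closure {x. f x \<noteq> 0}"]
    by (auto simp: Int_absorb1)
qed

lemma test1_support:
  assumes "test1 f"
  obtains a b where "a < b" "\<And>x. x < a \<or> b < x \<Longrightarrow> f x = 0" "smooth1 f"
proof -
  have "bounded {x. f x \<noteq> 0}"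
    using assms unfolding test1_def by (meson bounded_closure_image bounded_subset closure_subset compact_imp_bounded)
  then obtain K where K: "\<And>x. f x \<noteq> 0 \<Longrightarrow> \<bar>x\<bar> \<le> K" unfolding bounded_iff by auto
  show ?thesis
  proof (rule that[of "-\<bar>K\<bar>-1" "\<bar>K\<bar>+1"])
    fix x assume "x < -\<bar>K\<bar>-1 \<or> \<bar>K\<bar>+1 < x"
    then have "\<not> \<bar>x\<bar> \<le> K" by linarith
    then show "f x = 0" using K by blast
  qed (use assms in \<open>auto simp: test1_def\<close>)
qed

lemma test1_deriv:
  assumes "test1 f" shows "test1 (deriv f)"
proof -
  obtain a b where ab: "a < b" "\<And>x. x < a \<or> b < x \<Longrightarrow> f x = 0" "smooth1 f" using test1_support[OF assms] by blast
  have "deriv f x = 0" if "x < a \<or> b < x" for x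
  proof -
    have "((\<lambda>x. 0) has_real_derivative 0) (at x)" by simp
    then have "(f has_real_derivative 0) (at x)"
      by (rule DERIV_cong_ev[THEN iffD1, OF refl _ refl, rotated])
        (use that ab in \<open>auto intro!: eventually_mono[OF eventually_nhds_in_open[of "{..<a} \<union> {b<..}"]]\<close>)
    then show ?thesis by (rule DERIV_imp_deriv)
  qed
  then show ?thesis using test1I[OF smooth1_deriv(2)[OF ab(3)]] by blast
qed

text \<open>A difference of steeper and steeper steps.\<close>
lemma indicator_approx:
  assumes "a < (b::real)"
  obtains \<zeta> :: "nat \<Rightarrow> real \<Rightarrow> real" where "\<And>n. test1 (\<zeta> n)"
    "\<And>n x. \<bar>\<zeta> n x\<bar> \<le> indicator {a..b+1} x" "\<And>x. (\<lambda>n. \<zeta> n x) \<longlonglongrightarrow> indicator {a<..b} x"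
proof -
  obtain \<theta> where \<theta>: "smooth1 \<theta>" "\<And>x. x \<le> 0 \<Longrightarrow> \<theta> x = 0" "\<And>x. 1 \<le> x \<Longrightarrow> \<theta> x = (1::real)"
    "\<And>x. 0 \<le> \<theta> x" "\<And>x. \<theta> x \<le> 1" using smooth_step by blast
  \<comment> \<open>The first step climbs on \<open>[a, a + 1 / (n + 1)]\<close>: it is 0 at
    \<open>a\<close> for every \<open>n\<close> and eventually 1 at each later point. This is why
    the limit is the indicator of a half-open interval.\<close>
  define \<zeta> where "\<zeta> n x = \<theta> (real (Suc n) * x + (- real (Suc n) * a)) + (-1) * \<theta> (real (Suc n) * x + (- real (Suc n) * b))" for n x
  have big: "\<theta> (real (Suc n) * x + (- real (Suc n) * c)) = 1" if "x \<ge> c + 1" for n x c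
  proof (rule \<theta>(3))
    have "1 * 1 \<le> real (Suc n) * (x - c)" by (rule mult_mono) (use that in auto)
    then show "1 \<le> real (Suc n) * x + (- real (Suc n) * c)" by (simp add: algebra_simps)
  qed
  have small: "\<theta> (real (Suc n) * x + (- real (Suc n) * c)) = 0" if "x \<le> c" for n x c
  proof (rule \<theta>(2))
    have "real (Suc n) * x \<le> real (Suc n) * c" using that by (intro mult_left_mono) auto
    then show "real (Suc n) * x + (- real (Suc n) * c) \<le> 0" by (simp add: algebra_simps)
  qed
  have out: "\<zeta> n x = 0" if "x < a \<or> b + 1 < x" for n x
  proof -
    from that show ?thesis
    proof
      assume "x < a" then show ?thesis unfolding \<zeta>_def by (subst (1 2) small) (use assms in auto)
    next
      assume "b + 1 < x" then show ?thesis unfolding \<zeta>_def by (subst (1 2) big) (use assms in auto)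
    qed
  qed
  have "smooth1 (\<zeta> n)" for n
    unfolding \<zeta>_def[abs_def] by (intro smooth1_add smooth1_cmult smooth1_affine \<theta>(1))
  then have t: "test1 (\<zeta> n)" for n
    by (rule test1I[of _ a "b+1"]) (rule out)
  have b: "\<bar>\<zeta> n x\<bar> \<le> indicator {a..b+1} x" for n x
  proof (cases "x \<in> {a..b+1}")
    case True
    have "\<bar>p + (-1) * q\<bar> \<le> 1" if "0 \<le> p" "p \<le> 1" "0 \<le> q" "q \<le> 1" for p q :: real using that by linarith
    from this[OF \<theta>(4) \<theta>(5) \<theta>(4) \<theta>(5)] have "\<bar>\<zeta> n x\<bar> \<le> 1" unfolding \<zeta>_def .
    then show ?thesis using True by simp
  next
    case False then show ?thesis using out[of x n] by auto
  qed
  have l1: "(\<lambda>n. \<theta> (real (Suc n) * x + (- real (Suc n) * c))) \<longlonglongrightarrow> indicator {c<..} x" for x c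
  proof (cases "x \<le> c")
    case True then show ?thesis using small[OF True] by simp
  next
    case False
    obtain N where N: "real N * (x - c) > 1" using reals_Archimedean3[of "x - c"] False by auto
    have "\<theta> (real (Suc n) * x + (- real (Suc n) * c)) = 1" if "n \<ge> N" for n
    proof (rule \<theta>(3))
      have "real N * (x - c) \<le> real (Suc n) * (x - c)" using that False by (intro mult_right_mono) auto
      then show "1 \<le> real (Suc n) * x + (- real (Suc n) * c)" using N by (simp add: algebra_simps)
    qed
    then show ?thesis using False
      by (intro tendsto_eventually eventually_sequentiallyI[of N]) auto
  qed
  have "(\<lambda>n. \<zeta> n x) \<longlonglongrightarrow> indicator {a<..b} x" for x
  proof -
    have "(\<lambda>n. \<zeta> n x) \<longlonglongrightarrow> indicator {a<..} x + (-1) * indicator {b<..} x"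
      unfolding \<zeta>_def by (intro tendsto_intros l1)
    moreover have "indicator {a<..} x + (-1) * indicator {b<..} x = (indicator {a<..b} x :: real)"
      using assms by (auto simp: indicator_def)
    ultimately show ?thesis by simp
  qed
  then show ?thesis using that t b by blast
qed

section \<open>Functions determined by their integrals against test functions\<close>

lemma AE_zero_from_intervals:
  fixes g :: "real \<Rightarrow> real"
  assumes si: "\<And>a b. set_integrable lborel {a..b} g"
    and z: "\<And>a b. a < b \<Longrightarrow> (LINT x:{a<..b}|lborel. g x) = 0"
  shows "AE x in lborel. g x = 0"
proof -
  \<comment> \<open>Truncation makes the function integrable. The Borel sets over which the
    truncated function integrates to 0 form a Dynkin class containing the half-open intervals, which
    are stable under intersection.\<close>
  have "AE x in lborel. indicator {-real n<..real n} x *\<^sub>R g x = 0" for n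
  proof (rule sigma_finite_measure.density_zero[OF lborel.sigma_finite_measure_axioms])
    let ?f = "\<lambda>x. indicator {-real n<..real n} x *\<^sub>R g x"
    have "set_integrable lborel {-real n<..real n} g"
      by (rule set_integrable_subset[OF si[of "-real n" "real n"]]) auto
    then show int: "integrable lborel ?f" by (simp add: set_integrable_def)
    have sf: "set_integrable lborel A ?f" if "A \<in> sets borel" for A
      using integrable_mult_indicator[OF _ int, of A] that by (simp add: set_integrable_def)
    fix A :: "real set" assume "A \<in> sets lborel"
    then have "A \<in> sigma_sets UNIV (range (\<lambda>(a, b). {a <.. b::real}))"
      using borel_sigma_sets_Ioc by (metis sets_lborel sets_measure_of subset_UNIV Pow_UNIV)
    note A = this
    have "Int_stable (range (\<lambda>(a, b). {a <.. b::real}))"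
    proof (rule Int_stableI)
      fix p q assume "p \<in> range (\<lambda>(a, b). {a <.. b::real})" "q \<in> range (\<lambda>(a, b). {a <.. b::real})"
      then obtain a b c d where "p = {a<..b}" "q = {c<..d}" by auto
      then have "p \<inter> q = (case (max a c, min b d) of (a, b) \<Rightarrow> {a <.. b})" by auto
      then show "p \<inter> q \<in> range (\<lambda>(a, b). {a <.. b::real})" by blast
    qed
    moreover have "range (\<lambda>(a, b). {a <.. b::real}) \<subseteq> Pow UNIV" by simp
    from calculation this A show "(LINT x:A|lborel. ?f x) = 0"
    proof (induction rule: sigma_sets_induct_disjoint)
      case (basic A)
      then obtain a b where A: "A = {a<..b}" by auto
      have "(LINT x:A|lborel. ?f x) = (LINT x:{max a (-real n)<..min b (real n)}|lborel. g x)"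
        unfolding set_lebesgue_integral_def A
        by (rule Bochner_Integration.integral_cong) (auto simp: indicator_def)
      also have "\<dots> = 0"
        using z[of "max a (-real n)" "min b (real n)"] by (cases "max a (-real n) < min b (real n)") (auto simp: set_lebesgue_integral_def)
      finally show ?case .
    next
      case empty show ?case by (simp add: set_lebesgue_integral_def)
    next
      case (compl A)
      have A: "A \<in> sets borel" using compl(1) borel_sigma_sets_Ioc by (metis sets_measure_of subset_UNIV Pow_UNIV)
      have "(LINT x:UNIV - A|lborel. ?f x) = (LINT x|lborel. ?f x - indicator A x *\<^sub>R ?f x)"
        unfolding set_lebesgue_integral_def
        by (rule Bochner_Integration.integral_cong) (auto simp: indicator_def)
      also have "\<dots> = (LINT x|lborel. ?f x) - (LINT x:A|lborel. ?f x)"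
        using sf[OF A] int unfolding set_lebesgue_integral_def set_integrable_def by simp
      also have "(LINT x|lborel. ?f x) = 0"
        using z[of "-real n" "real n"] by (cases "n = 0") (auto simp: set_lebesgue_integral_def)
      finally show ?case using compl(2) by simp
    next
      case (union A)
      have A: "A i \<in> sets borel" for i using union(2) borel_sigma_sets_Ioc by (metis sets_measure_of subset_UNIV Pow_UNIV range_subsetD)
      have U: "(\<Union>i. A i) \<in> sets borel" using A by (intro sets.countable_UN) auto
      have "(LINT x:(\<Union>i. A i)|lborel. ?f x) = (\<Sum>i. (LINT x:A i|lborel. ?f x))"
      proof (rule lebesgue_integral_countable_add)
        show "A i \<inter> A j = {}" if "i \<noteq> j" for i j
          using union(1) that unfolding disjoint_family_on_def by simp
      qed (use A sf[OF U] in auto)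
      then show ?case using union(3) by simp
    qed
  qed
  then have "AE x in lborel. \<forall>n. indicator {-real n<..real n} x *\<^sub>R g x = 0"
    unfolding AE_all_countable by (rule allI)
  then show ?thesis
  proof (rule AE_mp, intro AE_I2 impI)
    fix x assume h: "\<forall>n. indicator {-real n<..real n} x *\<^sub>R g x = 0"
    obtain n where "real n > \<bar>x\<bar>" using reals_Archimedean2 by blast
    then show "g x = 0" using spec[OF h, of n] by (simp add: abs_less_iff)
  qed
qed

lemma test_approx_integral:
  fixes g :: "real \<Rightarrow> real"
  assumes si: "\<And>a b. set_integrable lborel {a..b} g" and mg[measurable]: "g \<in> borel_measurable borel"
    and t: "\<And>n. test1 (\<zeta> n)"
    and b: "\<And>n x. \<bar>\<zeta> n x\<bar> \<le> indicator {a..b+1} x" and l: "\<And>x. (\<lambda>n. \<zeta> n x) \<longlonglongrightarrow> indicator {a<..b} x"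
  shows "(\<lambda>n. LINT x|lborel. g x * \<zeta> n x) \<longlonglongrightarrow> (LINT x:{a<..b}|lborel. g x)"
    "\<And>n. integrable lborel (\<lambda>x. g x * \<zeta> n x)"
proof -
  have m[measurable]: "\<zeta> n \<in> borel_measurable borel" for n
    using t[of n] by (auto simp: test1_def intro!: borel_measurable_continuous_onI smooth1_deriv(3))
  have w: "integrable lborel (\<lambda>x. \<bar>indicator {a..b+1} x *\<^sub>R g x\<bar>)"
    using si[of a "b+1"] unfolding set_integrable_def by (rule integrable_abs)
  have d: "norm (g x * \<zeta> n x) \<le> \<bar>indicator {a..b+1} x *\<^sub>R g x\<bar>" for n x
    using mult_left_mono[OF b[of n x], of "\<bar>g x\<bar>"] by (simp add: abs_mult mult.commute)
  show "integrable lborel (\<lambda>x. g x * \<zeta> n x)" for n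
    by (rule Bochner_Integration.integrable_bound[OF w]) (use d in auto)
  show "(\<lambda>n. LINT x|lborel. g x * \<zeta> n x) \<longlonglongrightarrow> (LINT x:{a<..b}|lborel. g x)"
    unfolding set_lebesgue_integral_def
  proof (rule integral_dominated_convergence[OF _ _ w])
    show "AE x in lborel. (\<lambda>n. g x * \<zeta> n x) \<longlonglongrightarrow> indicator {a<..b} x *\<^sub>R g x"
      by (intro AE_I2) (use l in \<open>auto intro!: tendsto_eq_intros\<close>)
  qed (use d in auto)
qed

text \<open>Fundamental lemma of the calculus of variations: test functions converge boundedly to
  indicators of half-open intervals.\<close>

lemma weak_zero:
  fixes g :: "real \<Rightarrow> real"
  assumes si: "\<And>a b. set_integrable lborel {a..b} g" and mg: "g \<in> borel_measurable borel"
    and z: "\<And>\<phi>. test1 \<phi> \<Longrightarrow> (LINT x|lborel. g x * \<phi> x) = 0"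
  shows "AE x in lborel. g x = 0"
proof (rule AE_zero_from_intervals[OF si])
  fix a b :: real assume "a < b"
  obtain \<zeta> where c: "\<And>n. test1 (\<zeta> n)"
    "\<And>n x. \<bar>\<zeta> n x\<bar> \<le> indicator {a..b+1} x" "\<And>x. (\<lambda>n. \<zeta> n x) \<longlonglongrightarrow> indicator {a<..b} x"
    using indicator_approx[OF \<open>a < b\<close>] by blast
  have "(\<lambda>n. 0) \<longlonglongrightarrow> (LINT x:{a<..b}|lborel. g x)"
    using test_approx_integral(1)[of g, OF si mg c] z[OF c(1)] by simp
  then show "(LINT x:{a<..b}|lborel. g x) = 0" by (simp add: LIMSEQ_const_iff)
qed

text \<open>Zero mean gives the antiderivative the same constant value on both sides of the support;
  subtracting it leaves compact support.\<close>

lemma test1_integral_antideriv: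
  assumes "test1 f" "(LINT x|lborel. f x) = 0"
  obtains F where "test1 F" "deriv F = f"
proof -
  obtain a b where ab: "a < b" "\<And>x. x < a \<or> b < x \<Longrightarrow> f x = 0" "smooth1 f" using test1_support[OF assms(1)] by blast
  obtain G where G: "\<And>x. (G has_real_derivative f x) (at x)"
    using ex_antideriv[OF smooth1_deriv(3)[OF ab(3)]] by blast
  have P: "is_primitive G f" by (rule is_primitive_deriv[OF G smooth1_deriv(3)[OF ab(3)]])
  have const: "G x = G y" if "x < y" "\<And>z. x < z \<Longrightarrow> z < y \<Longrightarrow> f z = 0" for x y
  proof -
    have "\<exists>z. x < z \<and> z < y \<and> G y - G x = (y - x) * f z" by (rule MVT2[OF that(1)]) (rule G)
    then obtain z where "x < z" "z < y" "G y - G x = (y - x) * f z" by blast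
    then show ?thesis using that(2)[of z] by simp
  qed
  have cl: "G x = G (a - 1)" if "x < a" for x
  proof -
    consider "x < a - 1" | "x = a - 1" | "a - 1 < x" by linarith
    then show ?thesis
    proof cases
      case 1 show ?thesis by (rule const[OF 1]) (use ab(2) that in auto)
    next
      case 3 show ?thesis by (rule const[OF 3, symmetric]) (use ab(2) that in auto)
    qed simp
  qed
  have "(LINT x:{a-1..b+1}|lborel. f x) = (LINT x|lborel. f x)"
    unfolding set_lebesgue_integral_def
    by (rule Bochner_Integration.integral_cong[OF refl]) (use ab(2) in \<open>force simp: indicator_def\<close>)
  then have gb: "G (b+1) = G (a-1)" using is_primitiveD(3)[OF P, of "a-1" "b+1"] ab(1) assms(2) by simp
  have cr: "G x = G (b + 1)" if "b < x" for x
  proof -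
    consider "x < b + 1" | "x = b + 1" | "b + 1 < x" by linarith
    then show ?thesis
    proof cases
      case 1 show ?thesis by (rule const[OF 1]) (use ab(2) that in auto)
    next
      case 3 show ?thesis by (rule const[OF 3, symmetric]) (use ab(2) that in auto)
    qed simp
  qed
  define F where "F x = G x - G (a-1)" for x
  have F: "(F has_real_derivative f x) (at x)" for x
    unfolding F_def by (auto intro!: derivative_eq_intros G)
  show ?thesis
  proof (rule that[of F])
    have "F x = 0" if "x < a \<or> b < x" for x
      using that
    proof
      assume "x < a" from cl[OF this] show ?thesis by (simp add: F_def)
    next
      assume "b < x" from cr[OF this] gb show ?thesis by (simp add: F_def)
    qed
    then show "test1 F" by (rule test1I[of _ a b, OF smooth1_antideriv[OF ab(3) F]])
    show "deriv F = f" using DERIV_imp_deriv[OF F] by blast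
  qed
qed

lemma test1_add: "test1 f \<Longrightarrow> test1 g \<Longrightarrow> test1 (\<lambda>x. f x + g x)"
proof -
  assume f: "test1 f" and g: "test1 g"
  obtain a b where ab: "a < b" "\<And>x. x < a \<or> b < x \<Longrightarrow> f x = 0" "smooth1 f" using test1_support[OF f] by blast
  obtain a' b' where ab': "a' < b'" "\<And>x. x < a' \<or> b' < x \<Longrightarrow> g x = 0" "smooth1 g" using test1_support[OF g] by blast
  show ?thesis
    by (rule test1I[of _ "min a a'" "max b b'", OF smooth1_add[OF ab(3) ab'(3)]]) (use ab(2) ab'(2) in auto)
qed

lemma test1_cmult: "test1 f \<Longrightarrow> test1 (\<lambda>x. k * f x)"
proof -
  assume f: "test1 f"
  obtain a b where ab: "a < b" "\<And>x. x < a \<or> b < x \<Longrightarrow> f x = 0" "smooth1 f" using test1_support[OF f] by blast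
  show ?thesis
    by (rule test1I[of _ a b, OF smooth1_cmult[OF ab(3)]]) (use ab(2) in auto)
qed

text \<open>Lemma of du Bois-Reymond. Test functions of zero mean are derivatives of test functions,
  and two approximate indicators can be combined to zero mean; the constant is the mean of
  \<open>w\<close> over the unit interval.\<close>

lemma weak_const:
  fixes w :: "real \<Rightarrow> real"
  assumes si: "\<And>a b. set_integrable lborel {a..b} w" and mw: "w \<in> borel_measurable borel"
    and z: "\<And>\<phi>. test1 \<phi> \<Longrightarrow> (LINT x|lborel. w x * deriv \<phi> x) = 0"
  shows "\<exists>K. AE x in lborel. w x = K"
proof -
  define K where "K = (LINT x:{0<..1}|lborel. w x)"
  have si1: "set_integrable lborel {a..b} (\<lambda>x. 1 :: real)" for a b :: real
    using is_primitiveD(2)[OF is_primitive_deriv[of "\<lambda>x. x" "\<lambda>x. 1"]] by auto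
  have siIoc: "set_integrable lborel {a<..b} w" "set_integrable lborel {a<..b} (\<lambda>x. 1::real)" for a b
    by (rule set_integrable_subset[OF si[of a b]] set_integrable_subset[OF si1[of a b]]; auto)+
  obtain \<kappa> where k: "\<And>n. test1 (\<kappa> n)"
    "\<And>n x. \<bar>\<kappa> n x\<bar> \<le> indicator {0..1+1} x" "\<And>x. (\<lambda>n. \<kappa> n x) \<longlonglongrightarrow> indicator {0<..1::real} x"
    using indicator_approx[of 0 1] by auto
  have len: "(LINT x:{a<..b}|lborel. 1) = b - a" if "a < b" for a b :: real
    using that by (simp add: set_lebesgue_integral_def)
  have "AE x in lborel. w x - K = 0"
  proof (rule AE_zero_from_intervals)
    show "set_integrable lborel {a..b} (\<lambda>x. w x - K)" for a b
      using si set_integrable_mult_right[of K lborel, OF si1] by (intro set_integral_diff) auto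
    fix a b :: real assume ab: "a < b"
    obtain \<zeta> where c: "\<And>n. test1 (\<zeta> n)"
      "\<And>n x. \<bar>\<zeta> n x\<bar> \<le> indicator {a..b+1} x" "\<And>x. (\<lambda>n. \<zeta> n x) \<longlonglongrightarrow> indicator {a<..b} x"
      using indicator_approx[OF \<open>a < b\<close>] by blast
    note k' = test_approx_integral[of _ \<kappa> 0 1, OF _ _ k] and c' = test_approx_integral[of _ \<zeta> a b, OF _ _ c]
    have k1: "(\<lambda>n. LINT x|lborel. \<kappa> n x) \<longlonglongrightarrow> 1" "\<And>n. integrable lborel (\<kappa> n)"
      using k'[of "\<lambda>x. 1"] si1 len[of 0 1] by simp_all
    have c1: "(\<lambda>n. LINT x|lborel. \<zeta> n x) \<longlonglongrightarrow> b - a" "\<And>n. integrable lborel (\<zeta> n)"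
      using c'[of "\<lambda>x. 1"] si1 len[of a b] ab by simp_all
    have kw: "(\<lambda>n. LINT x|lborel. w x * \<kappa> n x) \<longlonglongrightarrow> K" "\<And>n. integrable lborel (\<lambda>x. w x * \<kappa> n x)"
      using k'[of w] si mw by (simp_all add: K_def)
    have cw: "(\<lambda>n. LINT x|lborel. w x * \<zeta> n x) \<longlonglongrightarrow> (LINT x:{a<..b}|lborel. w x)" "\<And>n. integrable lborel (\<lambda>x. w x * \<zeta> n x)"
      using c'[of w] si mw by simp_all
    have id: "(LINT x|lborel. \<kappa> n x) * (LINT x|lborel. w x * \<zeta> n x) - (LINT x|lborel. \<zeta> n x) * (LINT x|lborel. w x * \<kappa> n x) = 0" for n
    proof -
      \<comment> \<open>Each approximate indicator is weighted by the integral of the other, which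
        gives zero mean without a division.\<close>
      define f where "f x = (LINT x|lborel. \<kappa> n x) * \<zeta> n x + (- (LINT x|lborel. \<zeta> n x)) * \<kappa> n x" for x
      have "test1 f" unfolding f_def[abs_def] by (intro test1_add test1_cmult k c)
      moreover have "(LINT x|lborel. f x) = 0" unfolding f_def using k1(2)[of n] c1(2)[of n] by simp
      ultimately obtain F where F: "test1 F" "deriv F = f" by (rule test1_integral_antideriv)
      have "(LINT x|lborel. w x * f x) = 0" using z[OF F(1)] F(2) by simp
      moreover have "(LINT x|lborel. w x * f x) = (LINT x|lborel. (LINT x|lborel. \<kappa> n x) * (w x * \<zeta> n x) - (LINT x|lborel. \<zeta> n x) * (w x * \<kappa> n x))"
        unfolding f_def by (simp add: algebra_simps)
      ultimately show ?thesis using kw(2)[of n] cw(2)[of n] by simp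
    qed
    have "(\<lambda>n. (LINT x|lborel. \<kappa> n x) * (LINT x|lborel. w x * \<zeta> n x) - (LINT x|lborel. \<zeta> n x) * (LINT x|lborel. w x * \<kappa> n x))
      \<longlonglongrightarrow> 1 * (LINT x:{a<..b}|lborel. w x) - (b - a) * K"
      by (intro tendsto_intros k1 c1 kw cw)
    then have "(LINT x:{a<..b}|lborel. w x) - (b - a) * K = 0" using id by (simp add: LIMSEQ_const_iff)
    moreover have "(LINT x:{a<..b}|lborel. w x - K) = (LINT x:{a<..b}|lborel. w x) - (LINT x:{a<..b}|lborel. K * 1)"
      using siIoc set_integrable_mult_right[of K lborel, OF siIoc(2)] by (subst set_integral_diff(2)[symmetric]) auto
    moreover have "(LINT x:{a<..b}|lborel. K * 1) = K * (b - a)"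
      unfolding len[OF ab, symmetric] by (rule set_integral_mult_right)
    ultimately show "(LINT x:{a<..b}|lborel. w x - K) = 0" by (simp add: mult.commute)
  qed
  then show ?thesis by (intro exI[of _ K]) auto
qed

section \<open>Functions in the first Sobolev space\<close>

lemma L2D:
  assumes "L2 f"
  shows "f \<in> borel_measurable borel" "integrable lborel (\<lambda>x. (f x)\<^sup>2)"
  using assms by (auto simp: L2_def)

lemma L2_mult_integrable:
  assumes "L2 f" "L2 g" shows "integrable lborel (\<lambda>x. f x * g x)"
proof -
  note [measurable] = L2D(1)[OF assms(1)] L2D(1)[OF assms(2)]
  have "integrable lborel (\<lambda>x. (f x)\<^sup>2 + (g x)\<^sup>2)" using L2D(2)[OF assms(1)] L2D(2)[OF assms(2)] by simp
  then show ?thesis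
  proof (rule Bochner_Integration.integrable_bound)
    have "\<bar>a * b\<bar> \<le> a\<^sup>2 + b\<^sup>2" for a b :: real
    proof -
      have "0 \<le> a\<^sup>2 + b\<^sup>2 - 2 * (\<bar>a\<bar> * \<bar>b\<bar>)"
        using zero_le_power2[of "\<bar>a\<bar> - \<bar>b\<bar>"] by (simp add: power2_diff)
      moreover have "0 \<le> \<bar>a\<bar> * \<bar>b\<bar>" by simp
      ultimately show ?thesis unfolding abs_mult by linarith
    qed
    then show "AE x in lborel. norm (f x * g x) \<le> norm ((f x)\<^sup>2 + (g x)\<^sup>2)" by (auto intro!: AE_I2)
  qed simp
qed

lemma L2_add: assumes "L2 f" "L2 g" shows "L2 (\<lambda>x. f x + g x)"
proof -
  have "integrable lborel (\<lambda>x. (f x)\<^sup>2 + 2 * (f x * g x) + (g x)\<^sup>2)"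
    using L2D(2)[OF assms(1)] L2D(2)[OF assms(2)] L2_mult_integrable[OF assms] by simp
  then show ?thesis using L2D(1)[OF assms(1)] L2D(1)[OF assms(2)]
    by (simp add: L2_def power2_sum algebra_simps)
qed

lemma L2_cmult: "L2 f \<Longrightarrow> L2 (\<lambda>x. k * f x)"
  by (auto simp: L2_def power_mult_distrib)

lemma L2_diff: assumes "L2 f" "L2 g" shows "L2 (\<lambda>x. f x - g x)"
  using L2_add[OF assms(1) L2_cmult[OF assms(2), of "-1"]] by simp

lemma L2_shift: "L2 f \<Longrightarrow> L2 (\<lambda>x. f (x - s))"
  using integrable_shift_iff[of "\<lambda>x. (f x)\<^sup>2" s] by (auto simp: L2_def)

lemma L2_cong_AE: "L2 f \<Longrightarrow> AE x in lborel. f x = g x \<Longrightarrow> g \<in> borel_measurable borel \<Longrightarrow> L2 g"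
proof -
  assume a: "L2 f" "AE x in lborel. f x = g x" "g \<in> borel_measurable borel"
  have "integrable lborel (\<lambda>x. (g x)\<^sup>2) \<longleftrightarrow> integrable lborel (\<lambda>x. (f x)\<^sup>2)"
    by (rule Bochner_Integration.integrable_cong_AE) (use a in \<open>auto simp: L2_def\<close>)
  then show "L2 g" using a by (auto simp: L2_def)
qed

lemma L2_bound:
  assumes "L2 g" "f \<in> borel_measurable borel" "\<And>x. \<bar>f x\<bar> \<le> K * \<bar>g x\<bar>"
  shows "L2 f"
proof -
  have "integrable lborel (\<lambda>x. K\<^sup>2 * (g x)\<^sup>2)" using L2D(2)[OF assms(1)] by simp
  then have "integrable lborel (\<lambda>x. (f x)\<^sup>2)"
  proof (rule Bochner_Integration.integrable_bound)
    have "(f x)\<^sup>2 \<le> K\<^sup>2 * (g x)\<^sup>2" for x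
      using power_mono[OF assms(3)[of x], of 2] by (simp add: power_mult_distrib)
    then show "AE x in lborel. norm ((f x)\<^sup>2) \<le> norm (K\<^sup>2 * (g x)\<^sup>2)" by (auto intro!: AE_I2)
  qed (use assms(2) in simp)
  then show ?thesis using assms(2) by (simp add: L2_def)
qed

lemma L2_loc: assumes "L2 g" shows "set_integrable lborel {a..b} g"
proof -
  note [measurable] = L2D(1)[OF assms]
  have "set_integrable lborel {a..b} (\<lambda>x. 1 :: real)"
    using is_primitiveD(2)[OF is_primitive_deriv[of "\<lambda>x. x" "\<lambda>x. 1"]] by auto
  moreover have "set_integrable lborel {a..b} (\<lambda>x. (g x)\<^sup>2)"
    using integrable_mult_indicator[of "{a..b}" lborel "\<lambda>x. (g x)\<^sup>2"] L2D(2)[OF assms] unfolding set_integrable_def by simp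
  ultimately have "set_integrable lborel {a..b} (\<lambda>x. 1 + (g x)\<^sup>2)" by (rule set_integral_add(1))
  then show ?thesis
  proof (rule set_integrable_bound)
    have "\<bar>y\<bar> \<le> 1 + y\<^sup>2" for y :: real
      using zero_le_power2[of "\<bar>y\<bar> - 1"] zero_le_power2[of y] by (simp add: power2_diff)
    then show "AE x\<in>{a..b} in lborel. norm (g x) \<le> norm (1 + (g x)\<^sup>2)" by (auto intro!: AE_I2)
  qed (simp add: set_borel_measurable_def)
qed

section \<open>Weak derivatives and continuous representatives\<close>

lemma AE_eq_cong_continuous:
  fixes f g :: "real \<Rightarrow> real"
  assumes "AE x in lborel. f x = g x" "continuous_on UNIV f" "continuous_on UNIV g"
  shows "f = g"
proof (rule ext, rule ccontr)
  fix x assume ne: "f x \<noteq> g x"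
  have "isCont (\<lambda>y. f y - g y) x"
    using assms(2,3) continuous_on_eq_continuous_at by (intro continuous_intros) blast+
  then obtain d where d: "d > 0" "\<And>y. \<bar>y - x\<bar> < d \<Longrightarrow> \<bar>(f y - g y) - (f x - g x)\<bar> < \<bar>f x - g x\<bar>"
    using ne unfolding continuous_at_eps_delta dist_real_def by (metis right_minus_eq zero_less_abs_iff)
  have "f y \<noteq> g y" if "y \<in> {x<..<x+d}" for y
  proof -
    have "\<bar>(f y - g y) - (f x - g x)\<bar> < \<bar>f x - g x\<bar>" by (rule d(2)) (use that in auto)
    then show ?thesis by auto
  qed
  then have "{x<..<x+d} \<inter> {y. f y = g y} = {}" by auto
  then have "AE y in lborel. y \<notin> {x<..<x+d}"
    using assms(1) by (elim AE_mp) (intro AE_I2 impI, blast)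
  then have "{x<..<x+d} \<in> null_sets lborel" by (subst AE_iff_null_sets) auto
  then have "emeasure lborel {x<..<x+d} = 0" by auto
  then show False using d(1) by simp
qed

lemma test1_primitive:
  assumes "test1 f"
  shows "is_primitive f (deriv f)" "continuous_on UNIV f" "continuous_on UNIV (deriv f)"
proof -
  have s: "smooth1 f" using assms by (simp add: test1_def)
  show "continuous_on UNIV f" "continuous_on UNIV (deriv f)"
    by (rule smooth1_deriv(3) smooth1_deriv(2) s)+
  then show "is_primitive f (deriv f)" by (intro is_primitive_deriv smooth1_deriv(1) s)
qed

lemma test_mult_integrable:
  fixes v :: "real \<Rightarrow> real"
  assumes "test1 f" "v \<in> borel_measurable borel" "\<And>a b. set_integrable lborel {a..b} v"
  shows "integrable lborel (\<lambda>x. v x * f x)"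
proof -
  obtain a b where ab: "a < b" "\<And>x. x < a \<or> b < x \<Longrightarrow> f x = 0" using test1_support[OF assms(1)] by metis
  have "set_integrable lborel {a..b} (\<lambda>x. f x * v x)"
    by (rule set_integrable_cont_mult[OF continuous_on_subset[OF test1_primitive(2)[OF assms(1)]] assms(3,2)]) simp
  moreover have "(\<lambda>x. indicator {a..b} x *\<^sub>R (f x * v x)) = (\<lambda>x. v x * f x)"
  proof
    fix x show "indicator {a..b} x *\<^sub>R (f x * v x) = v x * f x"
      using ab(2)[of x] by (cases "x < a \<or> b < x") (auto simp: indicator_def)
  qed
  ultimately show ?thesis unfolding set_integrable_def by metis
qed

lemma continuous_loc_integrable:
  assumes "continuous_on UNIV (f :: real \<Rightarrow> real)"
  shows "set_integrable lborel {a..b} f" "f \<in> borel_measurable borel"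
  using borel_integrable_atLeastAtMost'[OF continuous_on_subset[OF assms subset_UNIV]]
    borel_measurable_continuous_onI[OF assms] by auto

lemma is_primitive_weak_deriv:
  assumes P: "is_primitive u v" shows "has_weak_deriv u v"
  unfolding has_weak_deriv_def
proof (intro allI impI)
  fix f assume f: "test1 f"
  obtain a b where ab: "a < b" "\<And>x. x < a \<or> b < x \<Longrightarrow> f x = 0" using test1_support[OF f] by metis
  have i1: "integrable lborel (\<lambda>x. v x * f x)"
    by (rule test_mult_integrable[OF f is_primitiveD(1,2)[OF P]])
  have i2: "integrable lborel (\<lambda>x. u x * deriv f x)"
    by (rule test_mult_integrable[OF test1_deriv[OF f]])
      (use continuous_loc_integrable[OF is_primitive_continuous[OF P]] in auto)
  have Q: "is_primitive (\<lambda>x. u x * f x) (\<lambda>x. v x * f x + u x * deriv f x)"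
    by (rule is_primitive_mult[OF P test1_primitive(1)[OF f]])
  have "eventually (\<lambda>x. u x * f x = 0) at_top" "eventually (\<lambda>x. u x * f x = 0) at_bot"
    using ab(2) by (auto intro!: eventually_at_top_linorderI[of "b+1"] eventually_at_bot_linorderI[of "a-1"])
  then have "((\<lambda>x. u x * f x) \<longlongrightarrow> 0) at_top" "((\<lambda>x. u x * f x) \<longlongrightarrow> 0) at_bot"
    by (auto intro: tendsto_eventually)
  then have "(LINT x|lborel. v x * f x + u x * deriv f x) = 0"
    by (intro is_primitive_half_integrals(4)[OF Q]) (use i1 i2 in auto)
  then show "(LINT x|lborel. u x * deriv f x) = - (LINT x|lborel. v x * f x)"
    using i1 i2 by simp
qed

text \<open>\<open>wd\<close> is an arbitrary choice of weak derivative; this determines it up to a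
  null set, even after the function itself has been changed on a null set.\<close>

lemma weak_deriv_unique:
  assumes "has_weak_deriv f g" "has_weak_deriv f' h" "AE x in lborel. f x = f' x"
    "f \<in> borel_measurable borel" "f' \<in> borel_measurable borel"
    "g \<in> borel_measurable borel" "\<And>a b. set_integrable lborel {a..b} g"
    "h \<in> borel_measurable borel" "\<And>a b. set_integrable lborel {a..b} h"
  shows "AE x in lborel. g x = h x"
proof -
  have "AE x in lborel. g x - h x = 0"
  proof (rule weak_zero)
    fix \<phi> assume t: "test1 \<phi>"
    have [measurable]: "deriv \<phi> \<in> borel_measurable borel" using continuous_loc_integrable(2)[OF test1_primitive(3)[OF t]] .
    have i: "integrable lborel (\<lambda>x. g x * \<phi> x)" "integrable lborel (\<lambda>x. h x * \<phi> x)"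
      by (rule test_mult_integrable[OF t]; use assms in auto)+
    have "(LINT x|lborel. f x * deriv \<phi> x) = (LINT x|lborel. f' x * deriv \<phi> x)"
      by (rule integral_cong_AE) (use assms in auto)
    then have "(LINT x|lborel. g x * \<phi> x) = (LINT x|lborel. h x * \<phi> x)"
      using assms(1,2) t unfolding has_weak_deriv_def by simp
    then show "(LINT x|lborel. (g x - h x) * \<phi> x) = 0"
      using i by (simp add: left_diff_distrib)
  qed (use assms in \<open>auto intro: set_integral_diff\<close>)
  then show ?thesis by simp
qed

lemma H1D:
  assumes "H1 f"
  shows "L2 f" "L2 (wd f)" "has_weak_deriv f (wd f)"
proof -
  have "\<exists>g. L2 g \<and> has_weak_deriv f g" using assms by (simp add: H1_def)
  then have "L2 (wd f) \<and> has_weak_deriv f (wd f)" unfolding wd_def by (rule someI_ex)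
  then show "L2 f" "L2 (wd f)" "has_weak_deriv f (wd f)" using assms by (auto simp: H1_def)
qed

lemma has_weak_deriv_cong_AE:
  assumes "has_weak_deriv f v" "AE x in lborel. f x = f' x" "f \<in> borel_measurable borel" "f' \<in> borel_measurable borel"
  shows "has_weak_deriv f' v"
  unfolding has_weak_deriv_def
proof (intro allI impI)
  fix \<phi> assume t: "test1 \<phi>"
  have [measurable]: "deriv \<phi> \<in> borel_measurable borel" using continuous_loc_integrable(2)[OF test1_primitive(3)[OF t]] .
  have "(LINT x|lborel. f' x * deriv \<phi> x) = (LINT x|lborel. f x * deriv \<phi> x)"
    by (rule integral_cong_AE) (use assms in auto)
  then show "(LINT x|lborel. f' x * deriv \<phi> x) = - (LINT x|lborel. v x * \<phi> x)"
    using assms(1) t unfolding has_weak_deriv_def by simp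
qed

lemma primitive_H1:
  assumes "is_primitive u v" "L2 v" "L2 f" "AE x in lborel. u x = f x"
  shows "H1 f" "AE x in lborel. wd f x = v x"
proof -
  have mu: "u \<in> borel_measurable borel" by (rule continuous_loc_integrable(2)[OF is_primitive_continuous[OF assms(1)]])
  have wu: "has_weak_deriv f v"
    by (rule has_weak_deriv_cong_AE[OF is_primitive_weak_deriv[OF assms(1)] assms(4) mu L2D(1)[OF assms(3)]])
  then show H: "H1 f" using assms by (auto simp: H1_def)
  show "AE x in lborel. wd f x = v x"
    by (rule weak_deriv_unique[OF H1D(3)[OF H] wu])
      (use L2D L2_loc H1D(2)[OF H] assms in auto)
qed

lemma primitive_exists:
  fixes v :: "real \<Rightarrow> real"
  assumes mv: "v \<in> borel_measurable borel" and si: "\<And>a b. set_integrable lborel {a..b} v"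
  obtains u where "is_primitive u v"
proof -
  define u where "u x = (LINT y:{0..x}|lborel. v y) - (LINT y:{x..0}|lborel. v y)" for x
  have z: "(LINT y:{x..x}|lborel. v y) = 0" for x
    using set_integral_combine_Icc[of x x x v, OF _ _ si] by simp
  have e: "(LINT y:{x..0}|lborel. v y) = 0" if "x > 0" for x
    using that by (simp add: set_lebesgue_integral_def)
  have e': "(LINT y:{0..x}|lborel. v y) = 0" if "x < 0" for x
    using that by (simp add: set_lebesgue_integral_def)
  have "is_primitive u v"
    unfolding is_primitive_def
  proof (intro conjI allI impI mv si)
    fix a b :: real assume ab: "a \<le> b"
    have u1: "u x = (LINT y:{0..x}|lborel. v y)" if "0 \<le> x" for x
      using that e[of x] z[of 0] unfolding u_def by (cases "x = 0") auto
    have u2: "u x = - (LINT y:{x..0}|lborel. v y)" if "x \<le> 0" for x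
      using that e'[of x] z[of 0] unfolding u_def by (cases "x = 0") auto
    consider "0 \<le> a" | "a \<le> 0" "0 \<le> b" | "b \<le> 0" by linarith
    then show "(LINT x:{a..b}|lborel. v x) = u b - u a"
    proof cases
      case 1
      then show ?thesis using set_integral_combine_Icc[OF 1 ab si] u1 ab by simp
    next
      case 2
      then show ?thesis using set_integral_combine_Icc[OF 2 si] u1 u2 by simp
    next
      case 3
      then show ?thesis using set_integral_combine_Icc[OF ab 3 si] u2 ab by simp
    qed
  qed
  then show ?thesis using that by blast
qed

text \<open>An antiderivative of the weak derivative differs from \<open>f\<close> by a function
  with zero weak derivative, that is by a constant, which is added to it.\<close>

lemma H1_primitive:
  assumes "H1 f"
  obtains u where "is_primitive u (wd f)" "AE x in lborel. u x = f x"
proof -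
  note H = H1D[OF assms]
  obtain u where u: "is_primitive u (wd f)" using primitive_exists[OF L2D(1)[OF H(2)] L2_loc[OF H(2)]] by blast
  note cu = continuous_loc_integrable[OF is_primitive_continuous[OF u]]
  have "\<exists>K. AE x in lborel. f x - u x = K"
  proof (rule weak_const)
    show "set_integrable lborel {a..b} (\<lambda>x. f x - u x)" for a b
      by (intro set_integral_diff L2_loc H cu)
    show "(\<lambda>x. f x - u x) \<in> borel_measurable borel" using L2D(1)[OF H(1)] cu(2) by simp
    fix \<phi> assume t: "test1 \<phi>"
    have "integrable lborel (\<lambda>x. f x * deriv \<phi> x)" "integrable lborel (\<lambda>x. u x * deriv \<phi> x)"
      by (rule test_mult_integrable[OF test1_deriv[OF t]]; use L2D(1)[OF H(1)] cu L2_loc[OF H(1)] in auto)+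
    then show "(LINT x|lborel. (f x - u x) * deriv \<phi> x) = 0"
      using H(3) is_primitive_weak_deriv[OF u] t unfolding has_weak_deriv_def
      by (simp add: left_diff_distrib)
  qed
  then obtain K where K: "AE x in lborel. f x - u x = K" by blast
  show ?thesis
    by (rule that[OF is_primitive_const_add[OF u, of K]]) (use K in auto)
qed

lemma integrable_limit_zero:
  fixes h :: "real \<Rightarrow> real"
  assumes i: "integrable lborel h" and nn: "\<And>x. h x \<ge> 0" and l: "(h \<longlongrightarrow> L) at_top"
  shows "L = 0"
proof (rule ccontr)
  assume "L \<noteq> 0"
  moreover have "L \<ge> 0" by (rule tendsto_lowerbound[OF l]) (auto simp: nn)
  ultimately have L: "L > 0" by simp
  then have "eventually (\<lambda>x. h x > L / 2) at_top" by (intro order_tendstoD(1)[OF l]) simp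
  then obtain N where N: "\<And>x. x \<ge> N \<Longrightarrow> h x > L / 2" unfolding eventually_at_top_linorder by blast
  \<comment> \<open>With this endpoint the integral of \<open>L / 2\<close> over
    \<open>{N..b}\<close> equals the whole integral of \<open>h\<close> plus 1.\<close>
  define b where "b = N + 2 * ((LINT x|lborel. h x) + 1) / L"
  have pos: "(LINT x|lborel. h x) \<ge> 0" by (rule integral_nonneg_AE) (simp add: nn)
  have Nb: "N \<le> b" unfolding b_def using L pos by (simp add: field_simps)
  have "(b - N) * (L / 2) = (LINT x:{N..b}|lborel. L / 2)"
    using Nb by (simp add: set_lebesgue_integral_def)
  also have "\<dots> \<le> (LINT x|lborel. h x)"
    unfolding set_lebesgue_integral_def
  proof (rule integral_mono[OF _ i])
    show "integrable lborel (\<lambda>x. indicator {N..b} x *\<^sub>R (L / 2))"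
      using continuous_loc_integrable(1)[of "\<lambda>x. L/2" N b] unfolding set_integrable_def by simp
    show "indicator {N..b} x *\<^sub>R (L / 2) \<le> h x" for x
      using N[of x] nn[of x] by (auto simp: indicator_def)
  qed
  finally show False using L by (simp add: b_def field_simps)
qed

lemma sq_tendsto_zero:
  assumes "((\<lambda>x. (f x)\<^sup>2) \<longlongrightarrow> (0::real)) F" shows "(f \<longlongrightarrow> 0) F"
proof -
  have "((\<lambda>x. sqrt ((f x)\<^sup>2)) \<longlongrightarrow> sqrt 0) F" by (intro tendsto_intros assms)
  then show ?thesis by (simp add: tendsto_rabs_zero_iff)
qed

text \<open>\<open>u^2\<close> is a primitive of the integrable function \<open>2 u v\<close>, so it
  has limits, and these are 0 because \<open>u^2\<close> is integrable. The signed integral of its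
  derivative gives the uniform bound with constant 1, which later turns closeness in the energy
  space into uniform closeness.\<close>

lemma primitive_L2_vanish:
  assumes P: "is_primitive u v" and u: "L2 u" and v: "L2 v"
  shows "(u \<longlongrightarrow> 0) at_top" "(u \<longlongrightarrow> 0) at_bot"
    "(u x)\<^sup>2 \<le> (LINT y|lborel. (u y)\<^sup>2 + (v y)\<^sup>2)"
proof -
  have Q: "is_primitive (\<lambda>x. u x * u x) (\<lambda>x. v x * u x + u x * v x)" by (rule is_primitive_mult[OF P P])
  have i: "integrable lborel (\<lambda>x. v x * u x + u x * v x)" using L2_mult_integrable[OF u v] by (simp add: mult.commute)
  have iu: "integrable lborel (\<lambda>x. u x * u x)" using L2_mult_integrable[OF u u] .
  have l1: "u 0 * u 0 + (LINT x:{0..}|lborel. v x * u x + u x * v x) = 0"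
    by (rule integrable_limit_zero[OF iu _ is_primitive_limits(1)[OF Q i]]) simp
  have "integrable lborel (\<lambda>x. u (-x) * u (-x))"
    using lborel_integrable_real_affine[of "\<lambda>x. u x * u x" "-1" 0] iu by simp
  moreover have "((\<lambda>x. u (-x) * u (-x)) \<longlongrightarrow> u 0 * u 0 - (LINT x:{..0}|lborel. v x * u x + u x * v x)) at_top"
    using is_primitive_limits(2)[OF Q i, of 0] by (simp add: filterlim_at_bot_mirror)
  ultimately have l2: "u 0 * u 0 - (LINT x:{..0}|lborel. v x * u x + u x * v x) = 0"
    by (intro integrable_limit_zero[of "\<lambda>x. u (-x) * u (-x)"]) auto
  have t1: "((\<lambda>x. u x * u x) \<longlongrightarrow> 0) at_top" using is_primitive_limits(1)[OF Q i, of 0] l1 by simp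
  have t2: "((\<lambda>x. u x * u x) \<longlongrightarrow> 0) at_bot" using is_primitive_limits(2)[OF Q i, of 0] l2 by simp
  show "(u \<longlongrightarrow> 0) at_top" "(u \<longlongrightarrow> 0) at_bot"
    using sq_tendsto_zero[of u] t1 t2 by (auto simp: power2_eq_square)
  have [measurable]: "u \<in> borel_measurable borel" "v \<in> borel_measurable borel" using u v by (auto simp: L2_def)
  have "2 * (u x * u x) = - (LINT y|lborel. sgn (y - x) * (v y * u y + u y * v y))"
    using is_primitive_half_integrals(3)[OF Q i t1 t2, of x] by simp
  also have "\<dots> \<le> (LINT y|lborel. \<bar>sgn (y - x) * (v y * u y + u y * v y)\<bar>)"
    using integral_abs_bound[of lborel "\<lambda>y. sgn (y - x) * (v y * u y + u y * v y)"] by linarith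
  also have "\<dots> \<le> (LINT y|lborel. (u y)\<^sup>2 + (v y)\<^sup>2)"
  proof (rule integral_mono_AE)
    show "integrable lborel (\<lambda>y. \<bar>sgn (y - x) * (v y * u y + u y * v y)\<bar>)"
      by (rule integrable_abs, rule Bochner_Integration.integrable_bound[OF i])
        (auto simp: abs_mult sgn_if borel_measurable_sgn)
    show "integrable lborel (\<lambda>y. (u y)\<^sup>2 + (v y)\<^sup>2)" using u v by (simp add: L2_def)
    have *: "\<bar>s * (b * a + a * b)\<bar> \<le> a\<^sup>2 + b\<^sup>2" if "\<bar>s\<bar> \<le> 1" for s a b :: real
    proof -
      have "\<bar>s * (b * a + a * b)\<bar> \<le> 1 * \<bar>b * a + a * b\<bar>"
        unfolding abs_mult[of s] using that by (intro mult_right_mono) auto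
      also have "\<dots> \<le> a\<^sup>2 + b\<^sup>2"
        using zero_le_power2[of "a - b"] zero_le_power2[of "a + b"] by (simp add: power2_eq_square algebra_simps abs_le_iff)
      finally show ?thesis .
    qed
    show "AE y in lborel. \<bar>sgn (y - x) * (v y * u y + u y * v y)\<bar> \<le> (u y)\<^sup>2 + (v y)\<^sup>2"
      by (intro AE_I2 *) (simp add: abs_sgn_eq)
  qed
  finally show "(u x)\<^sup>2 \<le> (LINT y|lborel. (u y)\<^sup>2 + (v y)\<^sup>2)"
    using zero_le_square[of "u x"] unfolding power2_eq_square by linarith
qed

lemma H1_diff:
  assumes "H1 f" "H1 g"
  shows "H1 (\<lambda>x. f x - g x)" "AE x in lborel. wd (\<lambda>x. f x - g x) x = wd f x - wd g x"
proof -
  obtain u where u: "is_primitive u (wd f)" "AE x in lborel. u x = f x" using H1_primitive[OF assms(1)] .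
  obtain w where w: "is_primitive w (wd g)" "AE x in lborel. w x = g x" using H1_primitive[OF assms(2)] .
  have "L2 (\<lambda>x. wd f x - wd g x)" "L2 (\<lambda>x. f x - g x)" by (intro L2_diff H1D assms)+
  moreover have "AE x in lborel. u x - w x = f x - g x" using u(2) w(2) by auto
  ultimately show "H1 (\<lambda>x. f x - g x)" "AE x in lborel. wd (\<lambda>x. f x - g x) x = wd f x - wd g x"
    using primitive_H1[OF is_primitive_diff[OF u(1) w(1)]] by auto
qed

lemma H1_shift:
  assumes "H1 f"
  shows "H1 (\<lambda>x. f (x - s))" "AE x in lborel. wd (\<lambda>x. f (x - s)) x = wd f (x - s)"
proof -
  obtain u where u: "is_primitive u (wd f)" "AE x in lborel. u x = f x" using H1_primitive[OF assms(1)] .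
  have "L2 (\<lambda>x. wd f (x - s))" "L2 (\<lambda>x. f (x - s))" by (intro L2_shift H1D assms)+
  moreover have "AE x in lborel. u (x - s) = f (x - s)" using AE_shift[OF u(2)] .
  ultimately show "H1 (\<lambda>x. f (x - s))" "AE x in lborel. wd (\<lambda>x. f (x - s)) x = wd f (x - s)"
    using primitive_H1[OF is_primitive_shift[OF u(1), of s]] by auto
qed

lemma H1_smooth:
  assumes H: "H1 f" and s: "smooth1 f"
  shows "AE x in lborel. wd f x = deriv f x" "L2 (deriv f)" "is_primitive f (deriv f)"
proof -
  show P: "is_primitive f (deriv f)"
    by (intro is_primitive_deriv smooth1_deriv(1)[OF s] smooth1_deriv(3)[OF smooth1_deriv(2)[OF s]])
  show ae: "AE x in lborel. wd f x = deriv f x"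
    by (rule weak_deriv_unique[OF H1D(3)[OF H] is_primitive_weak_deriv[OF P]])
      (use L2D(1) L2_loc H1D[OF H] is_primitiveD[OF P] in auto)
  show "L2 (deriv f)" by (rule L2_cong_AE[OF H1D(2)[OF H] ae is_primitiveD(1)[OF P]])
qed

section \<open>The equations of a travelling profile\<close>

text \<open>Mixed derivatives of \<open>f t * g (x - c * t)\<close>: a time derivative either raises
  the order \<open>p\<close> on \<open>f\<close>, or raises the order \<open>q\<close> on
  \<open>g\<close> with a factor \<open>- c\<close>. They are the witnesses that
  \<open>test2\<close> asks for.\<close>

fun wave_partial :: "real \<Rightarrow> (real \<Rightarrow> real) \<Rightarrow> (real \<Rightarrow> real) \<Rightarrow> nat \<Rightarrow> nat \<Rightarrow> nat \<Rightarrow> real \<Rightarrow> real \<Rightarrow> real" where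
  "wave_partial c f g 0 p q t x = (deriv ^^ p) f t * (deriv ^^ q) g (x - c * t)"
| "wave_partial c f g (Suc i) p q t x = wave_partial c f g i (Suc p) q t x - c * wave_partial c f g i p (Suc q) t x"

lemma smooth1_funpow_deriv: "smooth1 f \<Longrightarrow> smooth1 ((deriv ^^ n) f)"
  by (induction n) (auto intro: smooth1_deriv(2))

lemma wave_test2:
  assumes f: "test1 f" "\<And>t. t < 1 \<or> L < t \<Longrightarrow> f t = 0" and g: "test1 g"
  shows "test2 \<infinity> (\<lambda>t x. f t * g (x - c * t))"
proof -
  have sf: "smooth1 f" and sg: "smooth1 g" using f(1) g by (auto simp: test1_def)
  let ?f = "\<lambda>p. (deriv ^^ p) f" and ?g = "\<lambda>p. (deriv ^^ p) g"
  have df: "(?f p has_real_derivative ?f (Suc p) x) (at x)" for p x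
    using smooth1_deriv(1)[OF smooth1_funpow_deriv[OF sf]] by simp
  have dg: "(?g p has_real_derivative ?g (Suc p) x) (at x)" for p x
    using smooth1_deriv(1)[OF smooth1_funpow_deriv[OF sg]] by simp
  have cf: "continuous_on UNIV (?f p)" and cg: "continuous_on UNIV (?g p)" for p
    by (rule smooth1_deriv(3) smooth1_funpow_deriv sf sg)+
  let ?D = "\<lambda>i j. wave_partial c f g i 0 j"
  have dx: "((\<lambda>y. wave_partial c f g i p q t y) has_real_derivative wave_partial c f g i p (Suc q) t x) (at x)" for i p q t x
  proof (induction i arbitrary: p q)
    case 0
    have "((\<lambda>y. ?g q (y - c * t)) has_real_derivative ?g (Suc q) (x - c * t) * 1) (at x)"
      by (rule DERIV_chain2[OF dg]) (auto intro!: derivative_eq_intros)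
    from DERIV_cmult[OF this, of "?f p t"] show ?case by simp
  next
    case (Suc i)
    show ?case using DERIV_diff[OF Suc DERIV_cmult[OF Suc]] by simp
  qed
  have dt: "((\<lambda>s. wave_partial c f g i p q s x) has_real_derivative wave_partial c f g (Suc i) p q t x) (at t)" for i p q t x
  proof (induction i arbitrary: p q)
    case 0
    have "((\<lambda>s. ?g q (x - c * s)) has_real_derivative ?g (Suc q) (x - c * t) * (- c)) (at t)"
      by (rule DERIV_chain2[OF dg]) (auto intro!: derivative_eq_intros)
    from DERIV_mult[OF df this] show ?case by (simp add: algebra_simps)
  next
    case (Suc i)
    show ?case using DERIV_diff[OF Suc DERIV_cmult[OF Suc]] by simp
  qed
  have cc: "continuous_on UNIV (\<lambda>(t, x). wave_partial c f g i p q t x)" for i p q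
  proof (induction i arbitrary: p q)
    case 0
    have "continuous_on UNIV (\<lambda>z. ?f p (fst z) * ?g q (snd z - c * fst z))"
      by (intro continuous_on_mult continuous_on_compose2[OF cf] continuous_on_compose2[OF cg] continuous_intros) auto
    then show ?case by (simp add: case_prod_beta)
  next
    case (Suc i)
    have "continuous_on UNIV (\<lambda>z. (\<lambda>(t, x). wave_partial c f g i (Suc p) q t x) z - c * (\<lambda>(t, x). wave_partial c f g i p (Suc q) t x) z)"
      by (intro continuous_intros Suc)
    then show ?case by (simp add: case_prod_beta)
  qed
  obtain a b where ab: "a < b" "\<And>x. x < a \<or> b < x \<Longrightarrow> g x = 0" using test1_support[OF g] by metis
  \<comment> \<open>The support lies in a rectangle sheared along the direction of travel; times in
    \<open>{1..L}\<close> keep it away from \<open>t = 0\<close>.\<close>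
  let ?K = "(\<lambda>(t, y). (t, y + c * t)) ` ({1..L} \<times> {a..b})"
  have K: "compact ?K"
    by (intro compact_continuous_image compact_Times) (auto simp: case_prod_beta intro!: continuous_intros)
  have sub: "{(t, x). f t * g (x - c * t) \<noteq> 0} \<subseteq> ?K"
  proof clarify
    fix t x assume "f t * g (x - c * t) \<noteq> 0"
    then have "\<not> (t < 1 \<or> L < t)" "\<not> (x - c * t < a \<or> b < x - c * t)" using f(2) ab(2) by (metis mult_eq_0_iff)+
    then show "(t, x) \<in> ?K" by (intro image_eqI[of _ _ "(t, x - c * t)"]) auto
  qed
  then have cs: "closure {(t, x). f t * g (x - c * t) \<noteq> 0} \<subseteq> ?K"
    by (rule closure_minimal[OF _ compact_imp_closed[OF K]])
  have "?K \<subseteq> {(t, x). 0 < t \<and> ereal t < \<infinity>}" by auto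
  then show ?thesis
    unfolding test2_def
    using cs compact_Int_closed[OF K closed_closure, of "{(t, x). f t * g (x - c * t) \<noteq> 0}"] dx dt cc
    by (intro conjI exI[of _ ?D]) (auto simp: Int_absorb1 fun_eq_iff simp del: wave_partial.simps(2))
qed

text \<open>Tested with \<open>f t * g (x - c * t)\<close>, the equation separates: the term with
  \<open>deriv f\<close> integrates to 0 in time, and what remains says that \<open>V - c U\<close>
  is orthogonal to every \<open>deriv g\<close>.\<close>

lemma wave_profile_weak:
  fixes U V :: "real \<Rightarrow> real"
  assumes cU: "continuous_on UNIV U" and cV: "continuous_on UNIV V"
    and h: "\<And>\<psi>. test2 \<infinity> \<psi> \<Longrightarrow>
      (LINT t|lborel. LINT x|lborel. U (x - c * t) * dt \<psi> t x + V (x - c * t) * dx \<psi> t x) = 0"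
  shows "\<exists>K. \<forall>x. V x - c * U x = K"
proof -
  \<comment> \<open>A cut-off in time with nonzero integral is needed, so that the time factor can
    be divided out at the end.\<close>
  obtain \<zeta> where z: "\<And>n. test1 (\<zeta> n)"
    "\<And>n x. \<bar>\<zeta> n x\<bar> \<le> indicator {1..2+1} x" "\<And>x. (\<lambda>n. \<zeta> n x) \<longlonglongrightarrow> indicator {1<..2::real} x"
    using indicator_approx[of 1 2] by auto
  have "(\<lambda>n. LINT x|lborel. 1 * \<zeta> n x) \<longlonglongrightarrow> (LINT x:{1<..2::real}|lborel. 1)"
    by (rule test_approx_integral(1)[OF _ _ z]) (auto intro!: continuous_loc_integrable)
  then have "(\<lambda>n. LINT x|lborel. \<zeta> n x) \<longlonglongrightarrow> 1" by (simp add: set_lebesgue_integral_def)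
  then have "eventually (\<lambda>n. (LINT x|lborel. \<zeta> n x) > 0) sequentially" by (rule order_tendstoD) simp
  then obtain n where n: "(LINT x|lborel. \<zeta> n x) > 0" by (auto simp: eventually_sequentially)
  define f where "f = \<zeta> n"
  have f: "test1 f" "(LINT x|lborel. f x) > 0" using z(1) n by (auto simp: f_def)
  have f0: "f t = 0" if "t < 1 \<or> 3 < t" for t using z(2)[of n t] that by (auto simp: f_def indicator_def)
  have sf: "smooth1 f" using f(1) by (simp add: test1_def)
  have int_test: "integrable lborel p" if "test1 p" for p
    using test_mult_integrable[OF that, of "\<lambda>x. 1"] continuous_loc_integrable[of "\<lambda>x. 1"] by simp
  have f'0: "(LINT t|lborel. deriv f t) = 0"
  proof (rule is_primitive_half_integrals(4)[OF test1_primitive(1)[OF f(1)] int_test[OF test1_deriv[OF f(1)]]])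
    show "(f \<longlongrightarrow> 0) at_top" using f0 by (intro tendsto_eventually eventually_at_top_linorderI[of 4]) auto
    show "(f \<longlongrightarrow> 0) at_bot" using f0 by (intro tendsto_eventually eventually_at_bot_linorderI[of 0]) auto
  qed
  note lU = continuous_loc_integrable[OF cU] and lV = continuous_loc_integrable[OF cV]
  have "\<exists>K. AE x in lborel. V x - c * U x = K"
  proof (rule weak_const)
    show "set_integrable lborel {a..b} (\<lambda>x. V x - c * U x)" for a b
      by (rule continuous_loc_integrable) (intro continuous_intros cU cV)
    show "(\<lambda>x. V x - c * U x) \<in> borel_measurable borel"
      by (rule continuous_loc_integrable) (intro continuous_intros cU cV)
    fix g assume g: "test1 g"
    have sg: "smooth1 g" using g by (simp add: test1_def)
    let ?\<psi> = "\<lambda>t x. f t * g (x - c * t)"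
    have dx: "dx ?\<psi> t x = f t * deriv g (x - c * t)" for t x
    proof -
      have "((\<lambda>y. g (y - c * t)) has_real_derivative deriv g (x - c * t) * 1) (at x)"
        by (rule DERIV_chain2[OF smooth1_deriv(1)[OF sg]]) (auto intro!: derivative_eq_intros)
      from DERIV_cmult[OF this, of "f t"] show ?thesis unfolding dx_def by (intro DERIV_imp_deriv) simp
    qed
    have dt: "dt ?\<psi> t x = deriv f t * g (x - c * t) - c * f t * deriv g (x - c * t)" for t x
    proof -
      have "((\<lambda>s. g (x - c * s)) has_real_derivative deriv g (x - c * t) * (-c)) (at t)"
        by (rule DERIV_chain2[OF smooth1_deriv(1)[OF sg]]) (auto intro!: derivative_eq_intros)
      from DERIV_mult[OF smooth1_deriv(1)[OF sf] this] show ?thesis unfolding dt_def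
        by (intro DERIV_imp_deriv) (simp add: algebra_simps)
    qed
    note iUg = test_mult_integrable[OF g lU(2,1)]
    note iUg' = test_mult_integrable[OF test1_deriv[OF g] lU(2,1)]
    note iVg' = test_mult_integrable[OF test1_deriv[OF g] lV(2,1)]
    define I1 where "I1 = (LINT y|lborel. U y * g y)"
    define I2 where "I2 = (LINT y|lborel. V y * deriv g y) - c * (LINT y|lborel. U y * deriv g y)"
    have inner: "(LINT x|lborel. U (x - c * t) * dt ?\<psi> t x + V (x - c * t) * dx ?\<psi> t x) = deriv f t * I1 + f t * I2" for t
    proof -
      have "(LINT x|lborel. U (x - c * t) * dt ?\<psi> t x + V (x - c * t) * dx ?\<psi> t x) =
        (LINT x|lborel. (\<lambda>y. deriv f t * (U y * g y) - c * f t * (U y * deriv g y) + f t * (V y * deriv g y)) (x - c * t))"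
        unfolding dx dt by (rule Bochner_Integration.integral_cong) (auto simp: algebra_simps)
      also have "\<dots> = (LINT y|lborel. deriv f t * (U y * g y) - c * f t * (U y * deriv g y) + f t * (V y * deriv g y))"
        by (rule integral_shift)
      also have "\<dots> = deriv f t * (LINT y|lborel. U y * g y) - c * f t * (LINT y|lborel. U y * deriv g y) + f t * (LINT y|lborel. V y * deriv g y)"
        using iUg iUg' iVg' by simp
      also have "\<dots> = deriv f t * I1 + f t * I2"
        by (simp add: I1_def I2_def algebra_simps)
      finally show ?thesis .
    qed
    have "(LINT t|lborel. deriv f t * I1 + f t * I2) = 0"
    proof -
      have "test2 \<infinity> ?\<psi>" by (rule wave_test2[OF f(1) f0 g])
      from h[OF this] show ?thesis unfolding inner .
    qed
    then have "I2 = 0" using f'0 f(2) int_test[OF f(1)] int_test[OF test1_deriv[OF f(1)]] by simp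
    then show "(LINT x|lborel. (V x - c * U x) * deriv g x) = 0"
      using iUg' iVg' by (simp add: I2_def left_diff_distrib mult.assoc)
  qed
  then obtain K where K: "AE x in lborel. V x - c * U x = K" by blast
  have "(\<lambda>x. V x - c * U x) = (\<lambda>x. K)"
    by (rule AE_eq_cong_continuous[OF K]) (intro continuous_intros cU cV)+
  then show ?thesis by metis
qed

section \<open>Convolution with \<open>pker\<close> as the inverse of
  \<open>1 - d^2/dx^2\<close>\<close>

lemma is_primitive_imp_deriv:
  assumes P: "is_primitive u v" and c: "continuous_on UNIV v"
  shows "(u has_real_derivative v x) (at x)"
proof -
  obtain F where F: "\<And>x. (F has_real_derivative v x) (at x)" using ex_antideriv[OF c] by blast
  have PF: "is_primitive F v" by (rule is_primitive_deriv[OF F c])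
  have "u y = F y + (u 0 - F 0)" for y
    using is_primitiveD(3)[OF P, of 0 y] is_primitiveD(3)[OF PF, of 0 y]
      is_primitiveD(3)[OF P, of y 0] is_primitiveD(3)[OF PF, of y 0] by (cases "0 \<le> y") auto
  then have e: "u = (\<lambda>y. F y + (u 0 - F 0))" by blast
  have "((\<lambda>y. F y + (u 0 - F 0)) has_real_derivative v x + 0) (at x)"
    by (rule DERIV_add[OF F DERIV_const])
  then show ?thesis by (subst e) simp
qed

lemma set_integral_Icc_diff:
  fixes h :: "real \<Rightarrow> real"
  assumes ab: "a \<le> b" and i: "set_integrable lborel {..b} h"
  shows "set_integrable lborel {a..b} h" "(LINT y:{a..b}|lborel. h y) = (LINT y:{..b}|lborel. h y) - (LINT y:{..a}|lborel. h y)"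
proof -
  show 1: "set_integrable lborel {a..b} h" by (rule set_integrable_subset[OF i]) auto
  have 2: "set_integrable lborel {..a} h" by (rule set_integrable_subset[OF i]) (use ab in auto)
  have "{..b} = {..a} \<union> {a..b}" using ab by auto
  moreover have "(LINT y:({..a} \<union> {a..b})|lborel. h y) = (LINT y:{..a}|lborel. h y) + (LINT y:{a..b}|lborel. h y)"
  proof (rule set_integral_Un_AE[OF _ _ _ 2 1])
    show "AE x in lborel. \<not> (x \<in> {..a} \<and> x \<in> {a..b})"
      using AE_lborel_singleton[of a] by (rule AE_mp) (auto intro!: AE_I2)
  qed auto
  ultimately show "(LINT y:{a..b}|lborel. h y) = (LINT y:{..b}|lborel. h y) - (LINT y:{..a}|lborel. h y)" by simp
qed

lemma set_integral_reflect:
  fixes h :: "real \<Rightarrow> real"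
  shows "(LINT y:{x..}|lborel. h y) = (LINT y:{..-x}|lborel. h (-y))"
proof -
  have e: "(indicator {x..} (-y) :: real) = indicator {..-x} y" for y by (auto simp: indicator_def)
  show ?thesis
    using lborel_integral_real_affine[of "-1" "\<lambda>y. indicator {x..} y *\<^sub>R h y" 0]
    unfolding set_lebesgue_integral_def by (simp add: e)
qed

text \<open>Splitting the kernel \<open>exp (-\<bar>x - y\<bar>)\<close> at \<open>y = x\<close> makes the convolution differentiable twice
  without differentiating under the integral sign.\<close>
lemma conv_pker_deriv:
  assumes G: "continuous_on UNIV G" and i: "\<And>x. integrable lborel (\<lambda>y. exp (-\<bar>x - y\<bar>) * G y)"
  obtains S1 where "\<And>x. (conv pker G has_real_derivative S1 x) (at x)"
    "\<And>x. (S1 has_real_derivative conv pker G x - G x) (at x)"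
proof -
  have [measurable]: "G \<in> borel_measurable borel" by (rule continuous_loc_integrable[OF G])
  have half: "set_integrable lborel {..x} (\<lambda>y. exp y * H y)"
    if "integrable lborel (\<lambda>y. exp (-\<bar>x - y\<bar>) * H y)" for x and H :: "real \<Rightarrow> real"
  proof -
    have "integrable lborel (\<lambda>y. exp x * (indicator {..x} y *\<^sub>R (exp (-\<bar>x - y\<bar>) * H y)))"
      by (rule integrable_mult_right, rule integrable_mult_indicator[OF _ that]) simp
    also have "(\<lambda>y. exp x * (indicator {..x} y *\<^sub>R (exp (-\<bar>x - y\<bar>) * H y))) = (\<lambda>y. indicator {..x} y *\<^sub>R (exp y * H y))"
      by (auto simp: indicator_def fun_eq_iff exp_add[symmetric] simp flip: mult.assoc)
    finally show ?thesis unfolding set_integrable_def .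
  qed
  have half_deriv: "((\<lambda>x. LINT y:{..x}|lborel. exp y * H y) has_real_derivative exp x * H x) (at x)"
    if "continuous_on UNIV H" "\<And>x. integrable lborel (\<lambda>y. exp (-\<bar>x - y\<bar>) * H y)" for H x
  proof (rule is_primitive_imp_deriv)
    have c: "continuous_on UNIV (\<lambda>x. exp x * H x)" by (intro continuous_intros that)
    then show "continuous_on UNIV (\<lambda>x. exp x * H x)" .
    show "is_primitive (\<lambda>x. LINT y:{..x}|lborel. exp y * H y) (\<lambda>x. exp x * H x)"
      unfolding is_primitive_def using set_integral_Icc_diff[OF _ half[OF that(2)]] continuous_loc_integrable[OF c] by auto
  qed
  \<comment> \<open>\<open>?Q\<close> is \<open>?P\<close> for the reflected function, so both
    halves of the convolution use the same differentiation.\<close>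
  let ?P = "\<lambda>x. LINT y:{..x}|lborel. exp y * G y"
  let ?Q = "\<lambda>x. LINT y:{..x}|lborel. exp y * G (- y)"
  have i': "integrable lborel (\<lambda>y. exp (-\<bar>x - y\<bar>) * G (- y))" for x
    using lborel_integrable_real_affine[OF i[of "-x"], of "-1" 0] by (simp add: abs_minus_commute algebra_simps)
  have dP: "(?P has_real_derivative exp x * G x) (at x)" for x by (rule half_deriv[OF G i])
  have "continuous_on UNIV (\<lambda>y. G (- y))" by (intro continuous_on_compose2[OF G] continuous_intros) auto
  then have dQ: "(?Q has_real_derivative exp x * G (- x)) (at x)" for x by (rule half_deriv[OF _ i'])
  have dQ': "((\<lambda>x. ?Q (- x)) has_real_derivative - (exp (- x) * G x)) (at x)" for x
  proof -
    have "((\<lambda>x. ?Q (- x)) has_real_derivative (exp (- x) * G (- (- x))) * (- 1)) (at x)"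
      by (rule DERIV_chain2[OF dQ]) (auto intro!: derivative_eq_intros)
    then show ?thesis by simp
  qed
  have S: "conv pker G x = exp (- x) * ?P x / 2 + exp x * ?Q (- x) / 2" for x
  proof -
    have Q: "?Q (- x) = (LINT y:{x..}|lborel. exp (- y) * G y)"
      using set_integral_reflect[of x "\<lambda>y. exp (- y) * G y"] by simp
    have "conv pker G x = (LINT y|lborel. 1/2 * (exp (-\<bar>x - y\<bar>) * G y))"
      unfolding conv_def pker_def by (rule Bochner_Integration.integral_cong) auto
    also have "\<dots> = 1/2 * (LINT y|lborel. exp (-\<bar>x - y\<bar>) * G y)" by simp
    also have "(LINT y|lborel. exp (-\<bar>x - y\<bar>) * G y) = (LINT y:{..x} \<union> {x..}|lborel. exp (-\<bar>x - y\<bar>) * G y)"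
      by (auto simp: set_lebesgue_integral_def indicator_def intro!: Bochner_Integration.integral_cong)
    also have "\<dots> = (LINT y:{..x}|lborel. exp (-\<bar>x - y\<bar>) * G y) + (LINT y:{x..}|lborel. exp (-\<bar>x - y\<bar>) * G y)"
    proof (rule set_integral_Un_AE)
      show "AE y in lborel. \<not> (y \<in> {..x} \<and> y \<in> {x..})"
        using AE_lborel_singleton[of x] by (rule AE_mp) (auto intro!: AE_I2)
    qed (use integrable_mult_indicator[OF _ i] in \<open>auto simp: set_integrable_def\<close>)
    also have "(LINT y:{..x}|lborel. exp (-\<bar>x - y\<bar>) * G y) = (LINT y:{..x}|lborel. exp (-x) * (exp y * G y))"
      by (rule set_lebesgue_integral_cong) (auto simp: exp_add[symmetric] simp flip: mult.assoc)
    also have "(LINT y:{x..}|lborel. exp (-\<bar>x - y\<bar>) * G y) = (LINT y:{x..}|lborel. exp x * (exp (-y) * G y))"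
      by (rule set_lebesgue_integral_cong) (auto simp: exp_add[symmetric] simp flip: mult.assoc)
    finally show ?thesis by (simp add: Q)
  qed
  let ?S1 = "\<lambda>x. exp x * ?Q (- x) / 2 - exp (- x) * ?P x / 2"
  have em: "((\<lambda>x. exp (- x)) has_real_derivative - exp (- x)) (at x)" for x :: real
    by (auto intro!: derivative_eq_intros)
  have dA: "((\<lambda>x. exp (- x) * ?P x / 2) has_real_derivative (G x - exp (- x) * ?P x) / 2) (at x)" for x
    by (rule DERIV_cong[OF DERIV_cdivide[OF DERIV_mult[OF em dP]]])
      (simp add: algebra_simps exp_minus_inverse exp_minus)
  have dB: "((\<lambda>x. exp x * ?Q (- x) / 2) has_real_derivative (exp x * ?Q (- x) - G x) / 2) (at x)" for x
    by (rule DERIV_cong[OF DERIV_cdivide[OF DERIV_mult[OF DERIV_exp dQ']]])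
      (simp add: algebra_simps exp_minus_inverse exp_minus)
  have e: "conv pker G = (\<lambda>x. exp (- x) * ?P x / 2 + exp x * ?Q (- x) / 2)" using S by blast
  show ?thesis
  proof (rule that[of ?S1])
    show "(conv pker G has_real_derivative ?S1 x) (at x)" for x
      unfolding e using DERIV_add[OF dA dB] by (rule DERIV_cong) (simp add: field_simps)
    show "(?S1 has_real_derivative conv pker G x - G x) (at x)" for x
      unfolding S using DERIV_diff[OF dB dA] by (rule DERIV_cong) (simp add: field_simps)
  qed
qed

lemma integrable_exp_abs: "integrable lborel (\<lambda>y::real. exp (-\<bar>x - y\<bar>))"
proof -
  have "(\<lambda>x::real. exp (-1 * x)) absolutely_integrable_on {0..}"
    by (intro nonnegative_absolutely_integrable_1 integrable_on_exp_minus_to_infinity) auto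
  then have "integrable lborel (\<lambda>y::real. indicator {0..} y *\<^sub>R exp (- y))"
    unfolding set_integrable_def by (subst (asm) integrable_completion) auto
  note 1 = this
  have 2: "integrable lborel (\<lambda>y::real. indicator {0..} (- y) *\<^sub>R exp y)"
    using lborel_integrable_real_affine[OF 1, of "-1" 0] by simp
  have "integrable lborel (\<lambda>y::real. indicator {0..} y *\<^sub>R exp (- y) + indicator {0..} (- y) *\<^sub>R exp y)"
    using 1 2 by simp
  then have "integrable lborel (\<lambda>y::real. exp (-\<bar>y\<bar>))"
    by (rule Bochner_Integration.integrable_bound) (auto simp: indicator_def intro!: AE_I2)
  then show ?thesis using integrable_shift_iff[of "\<lambda>y. exp (-\<bar>y\<bar>)" x] by (simp add: abs_minus_commute)
qed

lemma bounded_of_vanish: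
  fixes f :: "real \<Rightarrow> real"
  assumes "continuous_on UNIV f" "(f \<longlongrightarrow> 0) at_infinity"
  obtains B where "B > 0" "\<And>x. \<bar>f x\<bar> \<le> B"
proof -
  have "eventually (\<lambda>x. \<bar>f x\<bar> < 1) at_infinity"
    using tendstoD[OF assms(2), of 1] by (simp add: dist_real_def)
  then obtain R where R: "\<And>x. R \<le> \<bar>x\<bar> \<Longrightarrow> \<bar>f x\<bar> < 1" unfolding eventually_at_infinity by auto
  have "compact (f ` {-R..R})" by (rule compact_continuous_image) (use assms(1) continuous_on_subset in auto)
  then obtain B where B: "\<And>x. x \<in> {-R..R} \<Longrightarrow> \<bar>f x\<bar> \<le> B"
    using compact_imp_bounded bounded_iff by (metis imageI real_norm_def)
  have "\<bar>f x\<bar> \<le> max 1 B" for x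
  proof (cases "R \<le> \<bar>x\<bar>")
    case False
    then have "x \<in> {-R..R}" by auto
    from B[OF this] show ?thesis by simp
  qed (use R[of x] in simp)
  then show ?thesis by (intro that[of "max 1 B"]) auto
qed

text \<open>The weak equation makes
  \<open>\<sigma> / 2 * \<phi>^2 + conv pker G - c * \<phi>\<close> constant. Since the convolution
  \<open>S\<close> satisfies \<open>S'' = S - G\<close>, differentiating this relation twice
  eliminates it. The value of \<open>K\<close> is found later from the decay of the profile.\<close>

lemma solitary_wave_equations:
  assumes w: "smooth_solitary_wave A \<sigma> c \<phi> \<eta>"
  obtains K where
    "\<And>x. c * \<phi> x - c * deriv (deriv \<phi>) x + \<sigma> * (\<phi> x * deriv (deriv \<phi>) x + (deriv \<phi> x)\<^sup>2 / 2)
       - 3 / 2 * (\<phi> x)\<^sup>2 + A * \<phi> x - (1 + \<eta> x)\<^sup>2 / 2 + K = 0"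
    "\<And>x. (1 + \<eta> x) * \<phi> x = c * \<eta> x"
proof -
  note w' = w[unfolded smooth_solitary_wave_def]
  have s: "smooth1 \<phi>" "smooth1 \<eta>" "H1 \<phi>" "H1 \<eta>" "(\<phi> \<longlongrightarrow> 0) at_infinity" "(\<eta> \<longlongrightarrow> 0) at_infinity" using w' by auto
  have sol: "is_solution A \<sigma> \<infinity> (\<lambda>t x. \<phi> (x - c * t)) (\<lambda>t x. \<eta> (x - c * t))" using w' by blast
  note c\<phi> = smooth1_deriv(3)[OF s(1)] and c\<eta> = smooth1_deriv(3)[OF s(2)]
    and c\<phi>' = smooth1_deriv(3)[OF smooth1_deriv(2)[OF s(1)]]
  note d\<phi> = smooth1_deriv(1)[OF s(1)] and d\<phi>' = smooth1_deriv(1)[OF smooth1_deriv(2)[OF s(1)]]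
  note H = H1_smooth[OF s(3,1)]
  define G where "G y = - A * \<phi> y + (3 - \<sigma>) / 2 * (\<phi> y)\<^sup>2 + \<sigma> / 2 * (deriv \<phi> y)\<^sup>2 + (1 + \<eta> y)\<^sup>2 / 2" for y
  have cG: "continuous_on UNIV G" unfolding G_def by (intro continuous_intros c\<phi> c\<eta> c\<phi>') auto
  have [measurable]: "\<phi> \<in> borel_measurable borel" "\<eta> \<in> borel_measurable borel" "deriv \<phi> \<in> borel_measurable borel" "G \<in> borel_measurable borel"
    using continuous_loc_integrable(2) c\<phi> c\<eta> c\<phi>' cG by auto
  obtain B where B: "B > 0" "\<And>x. \<bar>\<phi> x\<bar> \<le> B" using bounded_of_vanish[OF c\<phi> s(5)] by blast
  obtain C where C: "C > 0" "\<And>x. \<bar>\<eta> x\<bar> \<le> C" using bounded_of_vanish[OF c\<eta> s(6)] by blast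
  have iG: "integrable lborel (\<lambda>y. exp (-\<bar>x - y\<bar>) * G y)" for x
  proof -
    define M where "M = \<bar>A\<bar> * B + \<bar>3 - \<sigma>\<bar> / 2 * B\<^sup>2 + (1 + C)\<^sup>2 / 2"
    have "integrable lborel (\<lambda>y. M * exp (-\<bar>x - y\<bar>) + \<bar>\<sigma>\<bar> / 2 * (deriv \<phi> y)\<^sup>2)"
      using integrable_exp_abs[of x] L2D(2)[OF H(2)] by simp
    then show ?thesis
    proof (rule Bochner_Integration.integrable_bound)
      have "\<bar>exp (-\<bar>x - y\<bar>) * G y\<bar> \<le> M * exp (-\<bar>x - y\<bar>) + \<bar>\<sigma>\<bar> / 2 * (deriv \<phi> y)\<^sup>2" for y
      proof -
        have a: "\<bar>\<phi> y\<bar>\<^sup>2 \<le> B\<^sup>2" "\<bar>1 + \<eta> y\<bar>\<^sup>2 \<le> (1 + C)\<^sup>2"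
          by (rule power_mono; use B(2)[of y] C(1) C(2)[of y] in linarith)+
        have "\<bar>G y\<bar> \<le> \<bar>- A * \<phi> y\<bar> + \<bar>(3 - \<sigma>) / 2 * (\<phi> y)\<^sup>2\<bar> + \<bar>\<sigma> / 2 * (deriv \<phi> y)\<^sup>2\<bar> + \<bar>(1 + \<eta> y)\<^sup>2 / 2\<bar>"
          unfolding G_def by linarith
        also have "\<dots> = \<bar>A\<bar> * \<bar>\<phi> y\<bar> + \<bar>3 - \<sigma>\<bar> / 2 * (\<bar>\<phi> y\<bar>)\<^sup>2 + \<bar>\<sigma>\<bar> / 2 * (deriv \<phi> y)\<^sup>2 + \<bar>1 + \<eta> y\<bar>\<^sup>2 / 2"
          by (simp add: abs_mult)
        also have "\<dots> \<le> M + \<bar>\<sigma>\<bar> / 2 * (deriv \<phi> y)\<^sup>2"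
          using a mult_left_mono[OF B(2)[of y], of "\<bar>A\<bar>"] mult_left_mono[OF a(1), of "\<bar>3 - \<sigma>\<bar> / 2"]
          unfolding M_def by simp
        finally have g: "\<bar>G y\<bar> \<le> M + \<bar>\<sigma>\<bar> / 2 * (deriv \<phi> y)\<^sup>2" .
        have "\<bar>exp (-\<bar>x - y\<bar>) * G y\<bar> = exp (-\<bar>x - y\<bar>) * \<bar>G y\<bar>" by (simp add: abs_mult)
        also have "\<dots> \<le> exp (-\<bar>x - y\<bar>) * (M + \<bar>\<sigma>\<bar> / 2 * (deriv \<phi> y)\<^sup>2)" by (intro mult_left_mono g) simp
        also have "\<dots> = M * exp (-\<bar>x - y\<bar>) + exp (-\<bar>x - y\<bar>) * (\<bar>\<sigma>\<bar> / 2 * (deriv \<phi> y)\<^sup>2)" by (simp add: algebra_simps)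
        also have "\<dots> \<le> M * exp (-\<bar>x - y\<bar>) + 1 * (\<bar>\<sigma>\<bar> / 2 * (deriv \<phi> y)\<^sup>2)"
          by (intro add_left_mono mult_right_mono) auto
        finally show ?thesis by simp
      qed
      then show "AE y in lborel. norm (exp (-\<bar>x - y\<bar>) * G y) \<le> norm (M * exp (-\<bar>x - y\<bar>) + \<bar>\<sigma>\<bar> / 2 * (deriv \<phi> y)\<^sup>2)"
        by (intro AE_I2) (smt (verit) real_norm_def)
    qed simp
  qed
  obtain S1 where S1: "\<And>x. (conv pker G has_real_derivative S1 x) (at x)"
    "\<And>x. (S1 has_real_derivative conv pker G x - G x) (at x)"
    using conv_pker_deriv[OF cG iG] by blast
  have cS: "continuous_on UNIV (conv pker G)"
    by (rule DERIV_continuous_on, rule has_field_derivative_at_within, rule S1(1))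
  \<comment> \<open>A solution applies \<open>wd\<close> to every translate separately. It agrees
    with the translated classical derivative only almost everywhere, which the convolution does not
    notice.\<close>
  have convs: "conv pker (Gterm A \<sigma> (\<lambda>x. \<phi> (x - a)) (\<lambda>x. \<eta> (x - a))) x = conv pker G (x - a)" for a x
  proof -
    have ae: "AE y in lborel. wd (\<lambda>x. \<phi> (x - a)) y = deriv \<phi> (y - a)"
      using H1_shift(2)[OF s(3), of a] AE_shift[OF H(1), of a] by auto
    have [measurable]: "wd (\<lambda>x. \<phi> (x - a)) \<in> borel_measurable borel" using H1D(2)[OF H1_shift(1)[OF s(3)]] by (simp add: L2_def)
    have "conv pker (Gterm A \<sigma> (\<lambda>x. \<phi> (x - a)) (\<lambda>x. \<eta> (x - a))) x = (LINT y|lborel. pker (x - y) * G (y - a))"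
      unfolding conv_def
    proof (rule integral_cong_AE)
      show "AE y in lborel. pker (x - y) * Gterm A \<sigma> (\<lambda>x. \<phi> (x - a)) (\<lambda>x. \<eta> (x - a)) y = pker (x - y) * G (y - a)"
        using ae by (rule AE_mp) (auto intro!: AE_I2 simp: Gterm_def G_def)
    qed (auto simp: Gterm_def[abs_def] pker_def)
    also have "\<dots> = (LINT y|lborel. (\<lambda>y. pker (x - a - y) * G y) (y - a))" by (simp add: algebra_simps)
    also have "\<dots> = (LINT y|lborel. pker (x - a - y) * G y)" by (rule integral_shift)
    finally show ?thesis by (simp add: conv_def)
  qed
  note sol' = sol[unfolded is_solution_def]
  have "\<exists>K. \<forall>x. (\<sigma> / 2 * (\<phi> x)\<^sup>2 + conv pker G x) - c * \<phi> x = K"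
  proof (rule wave_profile_weak[OF c\<phi>])
    show "continuous_on UNIV (\<lambda>x. \<sigma> / 2 * (\<phi> x)\<^sup>2 + conv pker G x)" by (intro continuous_intros c\<phi> cS)
    fix \<psi> assume "test2 \<infinity> \<psi>"
    then show "(LINT t|lborel. LINT x|lborel. \<phi> (x - c * t) * dt \<psi> t x +
       (\<sigma> / 2 * (\<phi> (x - c * t))\<^sup>2 + conv pker G (x - c * t)) * dx \<psi> t x) = 0"
      using sol' unfolding convs by (simp add: distrib_right add.assoc)
  qed
  then obtain K where K: "\<And>x. \<sigma> / 2 * (\<phi> x)\<^sup>2 + conv pker G x - c * \<phi> x = K" by blast
  have "\<exists>K. \<forall>x. (1 + \<eta> x) * \<phi> x - c * \<eta> x = K"
  proof (rule wave_profile_weak[OF c\<eta>])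
    show "continuous_on UNIV (\<lambda>x. (1 + \<eta> x) * \<phi> x)" by (intro continuous_intros c\<phi> c\<eta>)
    fix \<psi> assume "test2 \<infinity> \<psi>"
    then show "(LINT t|lborel. LINT x|lborel. \<eta> (x - c * t) * dt \<psi> t x +
       ((1 + \<eta> (x - c * t)) * \<phi> (x - c * t)) * dx \<psi> t x) = 0"
      using sol' by simp
  qed
  then obtain K2 where K2: "\<And>x. (1 + \<eta> x) * \<phi> x - c * \<eta> x = K2" by blast
  have "((\<lambda>x. (1 + \<eta> x) * \<phi> x - c * \<eta> x) \<longlongrightarrow> (1 + 0) * 0 - c * 0) at_top"
    by (intro tendsto_intros) (use s tendsto_mono[OF at_top_le_at_infinity] in auto)
  then have "K2 = 0" unfolding K2 by (simp add: tendsto_const_iff)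
  have S: "conv pker G = (\<lambda>x. K + c * \<phi> x - \<sigma> / 2 * (\<phi> x)\<^sup>2)" using K by (auto simp: fun_eq_iff algebra_simps)
  have "((\<lambda>x. K + c * \<phi> x - \<sigma> / 2 * (\<phi> x)\<^sup>2) has_real_derivative c * deriv \<phi> x - \<sigma> * (\<phi> x * deriv \<phi> x)) (at x)" for x
    by (auto intro!: derivative_eq_intros d\<phi>)
  then have S1e: "S1 = (\<lambda>x. c * deriv \<phi> x - \<sigma> * (\<phi> x * deriv \<phi> x))"
    using DERIV_unique[OF S1(1)[unfolded S]] by blast
  have "((\<lambda>x. c * deriv \<phi> x - \<sigma> * (\<phi> x * deriv \<phi> x)) has_real_derivative
     c * deriv (deriv \<phi>) x - \<sigma> * (\<phi> x * deriv (deriv \<phi>) x + deriv \<phi> x * deriv \<phi> x)) (at x)" for x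
    by (auto intro!: derivative_eq_intros d\<phi> d\<phi>')
  then have "c * deriv (deriv \<phi>) x - \<sigma> * (\<phi> x * deriv (deriv \<phi>) x + deriv \<phi> x * deriv \<phi> x) = conv pker G x - G x" for x
    by (rule DERIV_unique[OF _ S1(2)[unfolded S1e]])
  then have "c * deriv (deriv \<phi>) x - \<sigma> * (\<phi> x * deriv (deriv \<phi>) x + deriv \<phi> x * deriv \<phi> x) = (K + c * \<phi> x - \<sigma> / 2 * (\<phi> x)\<^sup>2) - G x" for x
    unfolding S .
  note e = this
  show ?thesis
  proof (rule that)
    show "(1 + \<eta> x) * \<phi> x = c * \<eta> x" for x using K2[of x] \<open>K2 = 0\<close> by simp
    show "c * \<phi> x - c * deriv (deriv \<phi>) x + \<sigma> * (\<phi> x * deriv (deriv \<phi>) x + (deriv \<phi> x)\<^sup>2 / 2)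
       - 3 / 2 * (\<phi> x)\<^sup>2 + A * \<phi> x - (1 + \<eta> x)\<^sup>2 / 2 + K = 0" for x
      using e[of x] unfolding G_def power2_eq_square by (simp add: field_simps)
  qed
qed

section \<open>The shape of the profile\<close>

text \<open>By the mean value theorem on \<open>[n, n + 1]\<close> the derivative is small at points
  tending to infinity. The hypothesis concerns the square because a first integral determines the
  derivative only up to sign.\<close>

lemma deriv_limit_zero:
  assumes d: "\<And>x. (f has_real_derivative f' x) (at x)" and l: "(f \<longlongrightarrow> a) at_top"
    and l': "((\<lambda>x. (f' x)\<^sup>2) \<longlongrightarrow> (b::real)) at_top"
  shows "b = 0"
proof -
  have "\<exists>z. real n < z \<and> z < real n + 1 \<and> f (real n + 1) - f (real n) = ((real n + 1) - real n) * f' z" for n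
    by (rule MVT2) (use d in auto)
  then obtain z where z: "\<And>n. real n < z n" "\<And>n. f (real n + 1) - f (real n) = f' (z n)" by (metis add_diff_cancel_left' mult_1)
  have lim: "filterlim (\<lambda>n. real n) at_top sequentially" by (rule filterlim_real_sequentially)
  have lim1: "filterlim (\<lambda>n. real n + 1) at_top sequentially"
    by (rule filterlim_at_top_mono[OF lim]) auto
  have limz: "filterlim z at_top sequentially"
    by (rule filterlim_at_top_mono[OF lim]) (use z(1) in \<open>auto intro!: always_eventually less_imp_le\<close>)
  have "(\<lambda>n. f (real n + 1) - f (real n)) \<longlonglongrightarrow> a - a"
    by (intro tendsto_diff filterlim_compose[OF l lim] filterlim_compose[OF l lim1])
  then have 1: "(\<lambda>n. (f' (z n))\<^sup>2) \<longlonglongrightarrow> (a - a)\<^sup>2" unfolding z(2) by (rule tendsto_power)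
  have 2: "(\<lambda>n. (f' (z n))\<^sup>2) \<longlonglongrightarrow> b" by (rule filterlim_compose[OF l' limz])
  from LIMSEQ_unique[OF 1 2] show ?thesis by simp
qed

lemma vanishing_attains_max:
  fixes f :: "real \<Rightarrow> real"
  assumes c: "continuous_on UNIV f" and l: "(f \<longlongrightarrow> 0) at_infinity" and y: "f y > 0"
  obtains x0 where "\<And>x. f x \<le> f x0"
proof -
  have "eventually (\<lambda>x. f x < f y) at_infinity" using order_tendstoD(2)[OF l y] .
  then obtain R where R: "\<And>x. R \<le> \<bar>x\<bar> \<Longrightarrow> f x < f y" unfolding eventually_at_infinity by auto
  define b where "b = \<bar>R\<bar> + \<bar>y\<bar>"
  obtain x0 where x0: "x0 \<in> {-b..b}" "\<And>x. x \<in> {-b..b} \<Longrightarrow> f x \<le> f x0"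
  proof -
    have "{-b..b} \<noteq> {}" by (simp add: b_def)
    then have "\<exists>x\<in>{-b..b}. \<forall>y\<in>{-b..b}. f y \<le> f x"
      by (intro continuous_attains_sup continuous_on_subset[OF c]) auto
    then show thesis using that by blast
  qed
  have "y \<in> {-b..b}" by (auto simp: b_def)
  have "f x \<le> f x0" for x
  proof (cases "x \<in> {-b..b}")
    case False
    then have "R \<le> \<bar>x\<bar>" by (auto simp: b_def)
    from R[OF this] x0(2)[OF \<open>y \<in> {-b..b}\<close>] show ?thesis by simp
  qed (rule x0(2))
  then show ?thesis using that by blast
qed

lemma ivt_exists:
  fixes f :: "real \<Rightarrow> real"
  assumes "continuous_on UNIV f" "f a \<le> v" "v \<le> f b"
  shows "\<exists>x. min a b \<le> x \<and> x \<le> max a b \<and> f x = v"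
proof (cases "a \<le> b")
  case True
  have "\<exists>x\<ge>a. x \<le> b \<and> f x = v"
    by (rule IVT') (use assms True continuous_on_subset in auto)
  then show ?thesis using True by auto
next
  case False
  have "\<exists>x\<ge>b. x \<le> a \<and> f x = v"
    by (rule IVT2') (use assms False continuous_on_subset in auto)
  then show ?thesis using False by auto
qed

text \<open>Where \<open>1 + \<eta>\<close> is nonzero, \<open>\<phi>\<close> vanishes on a
  neighbourhood and the equation forces \<open>(1 + \<eta>)^2 = 2 K\<close>, which is 1 by the
  behaviour at infinity. Continuity then keeps \<open>1 + \<eta>\<close> at the value 1.\<close>

lemma zero_speed_trivial:
  fixes \<phi> \<eta> :: "real \<Rightarrow> real"
  assumes d: "\<And>x. (\<phi> has_real_derivative \<phi>1 x) (at x)" and c: "continuous_on UNIV \<eta>"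
    and l: "(\<phi> \<longlongrightarrow> 0) at_infinity" "(\<eta> \<longlongrightarrow> 0) at_infinity"
    and ode: "\<And>x. \<sigma> * (\<phi> x * \<phi>2 x + (\<phi>1 x)\<^sup>2 / 2) - 3 / 2 * (\<phi> x)\<^sup>2 + A * \<phi> x - (1 + \<eta> x)\<^sup>2 / 2 + K = 0"
    and h: "\<And>x. (1 + \<eta> x) * \<phi> x = 0"
  shows "\<phi> x = 0 \<and> \<eta> x = 0"
proof -
  have k: "(1 + \<eta> x)\<^sup>2 = 2 * K" if "1 + \<eta> x \<noteq> 0" for x
  proof -
    have "isCont (\<lambda>x. 1 + \<eta> x) x" using c continuous_on_eq_continuous_at by (intro continuous_intros) blast
    then have "eventually (\<lambda>y. 1 + \<eta> y \<noteq> 0) (at x)" using that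
      by (metis isCont_def tendsto_imp_eventually_ne)
    then have ev: "eventually (\<lambda>y. 1 + \<eta> y \<noteq> 0) (nhds x)" using that by (simp add: eventually_nhds_conv_at)
    have "((\<lambda>x. 0) has_real_derivative 0) (at x)" by simp
    then have "(\<phi> has_real_derivative 0) (at x)"
      by (rule DERIV_cong_ev[THEN iffD1, OF refl _ refl, rotated])
        (use ev h in \<open>auto elim!: eventually_mono simp: mult_eq_0_iff\<close>)
    then have "\<phi>1 x = 0" using DERIV_unique[OF d] by blast
    moreover have "\<phi> x = 0" using h[of x] that by simp
    ultimately show ?thesis using ode[of x] by simp
  qed
  have ev: "eventually (\<lambda>x. \<bar>\<eta> x\<bar> < e) at_infinity" if "e > 0" for e
    using tendstoD[OF l(2) that] by (simp add: dist_real_def)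
  obtain R where R: "\<And>x. R \<le> \<bar>x\<bar> \<Longrightarrow> \<bar>\<eta> x\<bar> < 1/2" using ev[of "1/2"] unfolding eventually_at_infinity by auto
  have "eventually (\<lambda>x. (1 + \<eta> x)\<^sup>2 = 2 * K) at_infinity"
    using ev[OF zero_less_one] by (rule eventually_mono) (rule k, linarith)
  then have k1: "((\<lambda>x. (1 + \<eta> x)\<^sup>2) \<longlongrightarrow> 2 * K) at_infinity" by (rule tendsto_eventually)
  have k2: "((\<lambda>x. (1 + \<eta> x)\<^sup>2) \<longlongrightarrow> (1 + 0)\<^sup>2) at_infinity" by (intro tendsto_intros l)
  from tendsto_unique[OF trivial_limit_at_infinity k1 k2] have K: "2 * K = 1" by simp
  have cc: "continuous_on UNIV (\<lambda>x. 1 + \<eta> x)" by (intro continuous_intros c)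
  \<comment> \<open>Far out \<open>1 + \<eta>\<close> exceeds 1/2, so dropping to 1/4 or below would
    mean attaining 1/4 exactly, where the identity would read \<open>(1/4)^2 = 1\<close>.\<close>
  have "1 + \<eta> x > 1/4"
  proof (rule ccontr)
    assume "\<not> 1 + \<eta> x > 1/4"
    then obtain y where y: "1 + \<eta> y = 1/4"
    proof -
      have "\<bar>\<eta> \<bar>R\<bar>\<bar> < 1/2" by (rule R) simp
      then have "1/4 \<le> 1 + \<eta> \<bar>R\<bar>" by linarith
      moreover have "1 + \<eta> x \<le> 1/4" using \<open>\<not> 1 + \<eta> x > 1/4\<close> by linarith
      ultimately show thesis using ivt_exists[OF cc, of x "1/4" "\<bar>R\<bar>"] that by blast
    qed
    have "(1/4)\<^sup>2 = 2 * K" using k[of y] unfolding y by simp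
    then show False using K by (simp add: power2_eq_square)
  qed
  then show ?thesis using k[of x] K h[of x] by (auto simp: power2_eq_1_iff)
qed

lemma profile_first_integral:
  fixes \<phi> \<phi>1 \<phi>2 \<eta> :: "real \<Rightarrow> real"
  assumes c0: "c > 0" and r0: "r > 0" and A: "A = 1 / r - r"
    and d: "\<And>x. (\<phi> has_real_derivative \<phi>1 x) (at x)" and d1: "\<And>x. (\<phi>1 has_real_derivative \<phi>2 x) (at x)"
    and l: "(\<phi> \<longlongrightarrow> 0) at_infinity"
    and ode: "\<And>x. c * \<phi> x - c * \<phi>2 x + \<sigma> * (\<phi> x * \<phi>2 x + (\<phi>1 x)\<^sup>2 / 2)
       - 3 / 2 * (\<phi> x)\<^sup>2 + A * \<phi> x - (1 + \<eta> x)\<^sup>2 / 2 + K = 0"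
    and h: "\<And>x. (1 + \<eta> x) * \<phi> x = c * \<eta> x"
  shows "\<phi> x < c" "\<eta> x = \<phi> x / (c - \<phi> x)"
    "(c - \<sigma> * \<phi> x) * (c - \<phi> x) * (\<phi>1 x)\<^sup>2 = (\<phi> x)\<^sup>2 * (c - \<phi> x - r) * (c - \<phi> x + 1 / r)"
    "(c - \<sigma> * \<phi> x) * \<phi>2 x = (c + A) * \<phi> x - 3 / 2 * (\<phi> x)\<^sup>2 + \<sigma> / 2 * (\<phi>1 x)\<^sup>2 - (c / (c - \<phi> x))\<^sup>2 / 2 + 1 / 2"
proof -
  have c\<phi>: "continuous_on UNIV \<phi>" by (rule DERIV_continuous_on, rule has_field_derivative_at_within, rule d)
  have lt: "(\<phi> \<longlongrightarrow> 0) at_top" by (rule tendsto_mono[OF at_top_le_at_infinity l])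
  \<comment> \<open>At height \<open>c\<close> the mass relation would give \<open>c = 0\<close>; so
    \<open>\<phi>\<close> stays on the side of \<open>c\<close> on which it tends to 0.\<close>
  have ne: "\<phi> x \<noteq> c" for x
  proof
    assume "\<phi> x = c"
    then have "(1 + \<eta> x) * c = c * \<eta> x" using h[of x] by simp
    then show False using c0 by (simp add: algebra_simps)
  qed
  have lt_c: "\<phi> x < c" for x
  proof (rule ccontr)
    assume n: "\<not> \<phi> x < c"
    have "eventually (\<lambda>y. \<phi> y < c) at_top" by (rule order_tendstoD(2)[OF lt c0])
    then obtain y where "\<phi> y < c" by (auto simp: eventually_at_top_linorder)
    then show False using ivt_exists[OF c\<phi>, of y c x] n ne by auto
  qed
  show "\<phi> x < c" by (rule lt_c)
  have \<eta>: "\<eta> x = \<phi> x / (c - \<phi> x)" for x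
    using h[of x] lt_c[of x] by (simp add: field_simps)
  show "\<eta> x = \<phi> x / (c - \<phi> x)" by (rule \<eta>)
  have \<eta>1: "1 + \<eta> x = c / (c - \<phi> x)" for x
    unfolding \<eta> using lt_c[of x] by (simp add: field_simps)
  have ode2: "(c - \<sigma> * \<phi> x) * \<phi>2 x = (c + A) * \<phi> x - 3 / 2 * (\<phi> x)\<^sup>2 + \<sigma> / 2 * (\<phi>1 x)\<^sup>2 - (c / (c - \<phi> x))\<^sup>2 / 2 + K" for x
    using ode[of x] unfolding \<eta>1 by (simp add: algebra_simps)
  \<comment> \<open>The derivative of \<open>N\<close> is \<open>2 * \<phi>1\<close> times the
    profile equation.\<close>
  define N where "N x = (c - \<sigma> * \<phi> x) * (\<phi>1 x)\<^sup>2 - (c + A) * (\<phi> x)\<^sup>2 + (\<phi> x)^3 + c\<^sup>2 / (c - \<phi> x) - 2 * K * \<phi> x" for x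
  have dN: "(N has_real_derivative 0) (at x)" for x
  proof -
    have "(N has_real_derivative (- (\<sigma> * \<phi>1 x) * (\<phi>1 x)\<^sup>2 + 2 * \<phi>1 x * ((c - \<sigma> * \<phi> x) * \<phi>2 x) - (c + A) * (2 * \<phi> x * \<phi>1 x)
        + 3 * (\<phi> x)\<^sup>2 * \<phi>1 x + (c / (c - \<phi> x))\<^sup>2 * \<phi>1 x - 2 * K * \<phi>1 x)) (at x)"
      unfolding N_def
      by (auto intro!: derivative_eq_intros d d1 simp: lt_c[of x, THEN less_imp_neq] power2_eq_square)
        (use lt_c[of x] in \<open>auto simp: algebra_simps power2_eq_square\<close>)
    moreover obtain q where q: "(c / (c - \<phi> x))\<^sup>2 = q" by blast
    ultimately show ?thesis unfolding ode2 q by (simp add: algebra_simps power2_eq_square power3_eq_cube)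
  qed
  have Nc: "N x = N 0" for x using DERIV_isconst_all[of N x 0] dN by blast
  have F: "(\<phi>1 x)\<^sup>2 = (N 0 + (c + A) * (\<phi> x)\<^sup>2 - (\<phi> x)^3 - c\<^sup>2 / (c - \<phi> x) + 2 * K * \<phi> x) / (c - \<sigma> * \<phi> x)"
    if "c - \<sigma> * \<phi> x \<noteq> 0" for x
    using Nc[of x] that unfolding N_def by (simp add: field_simps)
  have evp: "eventually (\<lambda>x. c - \<sigma> * \<phi> x \<noteq> 0) at_top"
  proof -
    have "((\<lambda>x. c - \<sigma> * \<phi> x) \<longlongrightarrow> c - \<sigma> * 0) at_top" by (intro tendsto_intros lt)
    then show ?thesis using c0 by (intro tendsto_imp_eventually_ne) auto
  qed
  have "((\<lambda>x. (N 0 + (c + A) * (\<phi> x)\<^sup>2 - (\<phi> x)^3 - c\<^sup>2 / (c - \<phi> x) + 2 * K * \<phi> x) / (c - \<sigma> * \<phi> x))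
    \<longlongrightarrow> (N 0 + (c + A) * 0\<^sup>2 - 0^3 - c\<^sup>2 / (c - 0) + 2 * K * 0) / (c - \<sigma> * 0)) at_top"
    by (intro tendsto_intros lt) (use c0 in auto)
  moreover have "eventually (\<lambda>x. (N 0 + (c + A) * (\<phi> x)\<^sup>2 - (\<phi> x)^3 - c\<^sup>2 / (c - \<phi> x) + 2 * K * \<phi> x) / (c - \<sigma> * \<phi> x) = (\<phi>1 x)\<^sup>2) at_top"
    using evp by (rule eventually_mono) (simp add: F)
  ultimately have "((\<lambda>x. (\<phi>1 x)\<^sup>2) \<longlongrightarrow> (N 0 + (c + A) * 0\<^sup>2 - 0^3 - c\<^sup>2 / (c - 0) + 2 * K * 0) / (c - \<sigma> * 0)) at_top"
    by (rule Lim_transform_eventually)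
  then have l1: "((\<lambda>x. (\<phi>1 x)\<^sup>2) \<longlongrightarrow> (N 0 - c) / c) at_top"
    by (simp add: power2_eq_square)
  \<comment> \<open>Decay fixes both constants: \<open>\<phi>1^2\<close> has a limit, which must be
    0, so \<open>N = c\<close>; then \<open>\<phi>2\<close> has a limit, which must be 0 as well, so
    \<open>K = 1/2\<close>.\<close>
  have N0: "N 0 = c" using deriv_limit_zero[OF d lt l1] c0 by simp
  then have l1': "(\<phi>1 \<longlongrightarrow> 0) at_top" using l1 by (simp add: sq_tendsto_zero)
  have "((\<lambda>x. ((c + A) * \<phi> x - 3 / 2 * (\<phi> x)\<^sup>2 + \<sigma> / 2 * (\<phi>1 x)\<^sup>2 - (c / (c - \<phi> x))\<^sup>2 / 2 + K) / (c - \<sigma> * \<phi> x))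
    \<longlongrightarrow> ((c + A) * 0 - 3 / 2 * 0\<^sup>2 + \<sigma> / 2 * 0\<^sup>2 - (c / (c - 0))\<^sup>2 / 2 + K) / (c - \<sigma> * 0)) at_top"
    by (intro tendsto_intros lt l1') (use c0 in auto)
  moreover have "eventually (\<lambda>x. ((c + A) * \<phi> x - 3 / 2 * (\<phi> x)\<^sup>2 + \<sigma> / 2 * (\<phi>1 x)\<^sup>2 - (c / (c - \<phi> x))\<^sup>2 / 2 + K) / (c - \<sigma> * \<phi> x) = \<phi>2 x) at_top"
    using evp by (rule eventually_mono) (simp only: ode2[symmetric] nonzero_mult_div_cancel_left not_False_eq_True)
  ultimately have "(\<phi>2 \<longlongrightarrow> ((c + A) * 0 - 3 / 2 * 0\<^sup>2 + \<sigma> / 2 * 0\<^sup>2 - (c / (c - 0))\<^sup>2 / 2 + K) / (c - \<sigma> * 0)) at_top"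
    by (rule Lim_transform_eventually)
  then have "(\<phi>2 \<longlongrightarrow> (K - 1/2) / c) at_top" using c0 by simp
  then have "((\<lambda>x. (\<phi>2 x)\<^sup>2) \<longlongrightarrow> ((K - 1/2) / c)\<^sup>2) at_top" by (rule tendsto_power)
  from deriv_limit_zero[OF d1 l1' this] have K: "K = 1/2" using c0 by simp
  show "(c - \<sigma> * \<phi> x) * \<phi>2 x = (c + A) * \<phi> x - 3 / 2 * (\<phi> x)\<^sup>2 + \<sigma> / 2 * (\<phi>1 x)\<^sup>2 - (c / (c - \<phi> x))\<^sup>2 / 2 + 1 / 2"
    using ode2[of x] K by simp
  have "(c - \<sigma> * \<phi> x) * (\<phi>1 x)\<^sup>2 = c + (c + A) * (\<phi> x)\<^sup>2 - (\<phi> x)^3 - c\<^sup>2 / (c - \<phi> x) + \<phi> x"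
    using Nc[of x] N0 K unfolding N_def by simp
  then have "(c - \<phi> x) * ((c - \<sigma> * \<phi> x) * (\<phi>1 x)\<^sup>2) = (c - \<phi> x) * (c + (c + A) * (\<phi> x)\<^sup>2 - (\<phi> x)^3 + \<phi> x) - c\<^sup>2"
    using lt_c[of x] by (simp add: field_simps)
  also have "\<dots> = (\<phi> x)\<^sup>2 * ((c - \<phi> x)\<^sup>2 + A * (c - \<phi> x) - 1)"
    by (simp add: algebra_simps power2_eq_square power3_eq_cube)
  \<comment> \<open>The numbers \<open>r\<close> and \<open>- 1 / r\<close> are the roots of
    \<open>y^2 + A y - 1\<close>; this is the purpose of writing
    \<open>A = 1 / r - r\<close>.\<close>
  also have "(c - \<phi> x)\<^sup>2 + A * (c - \<phi> x) - 1 = (c - \<phi> x - r) * (c - \<phi> x + 1 / r)"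
    unfolding A using r0 by (simp add: field_simps power2_eq_square)
  finally show "(c - \<sigma> * \<phi> x) * (c - \<phi> x) * (\<phi>1 x)\<^sup>2 = (\<phi> x)\<^sup>2 * (c - \<phi> x - r) * (c - \<phi> x + 1 / r)"
    by (simp add: mult_ac)
qed

text \<open>The hypotheses are the first integral and the profile equation.  A critical point at a nonzero
  value is only possible at height \<open>c - r\<close>, which forces the shape of the wave.\<close>
lemma profile_shape:
  fixes \<phi> \<phi>1 \<phi>2 :: "real \<Rightarrow> real"
  assumes c0: "c > 0" and r0: "r > 0" and A: "A = 1 / r - r" and sg: "\<sigma> \<le> 1"
    and d: "\<And>x. (\<phi> has_real_derivative \<phi>1 x) (at x)" and d1: "\<And>x. (\<phi>1 has_real_derivative \<phi>2 x) (at x)"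
    and l: "(\<phi> \<longlongrightarrow> 0) at_infinity" and lt_c: "\<And>x. \<phi> x < c"
    and fi: "\<And>x. (c - \<sigma> * \<phi> x) * (c - \<phi> x) * (\<phi>1 x)\<^sup>2 = (\<phi> x)\<^sup>2 * (c - \<phi> x - r) * (c - \<phi> x + 1 / r)"
    and ode: "\<And>x. (c - \<sigma> * \<phi> x) * \<phi>2 x = (c + A) * \<phi> x - 3 / 2 * (\<phi> x)\<^sup>2 + \<sigma> / 2 * (\<phi>1 x)\<^sup>2 - (c / (c - \<phi> x))\<^sup>2 / 2 + 1 / 2"
    and nz: "\<phi> y0 \<noteq> 0"
  obtains x0 where "c > r" "\<And>x. 0 < \<phi> x" "\<And>x. \<phi> x \<le> c - r" "\<phi> x0 = c - r"
    "\<And>x. x < x0 \<Longrightarrow> \<phi>1 x > 0" "\<And>x. x0 < x \<Longrightarrow> \<phi>1 x < 0"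
proof -
  have c\<phi>: "continuous_on UNIV \<phi>" by (rule DERIV_continuous_on, rule has_field_derivative_at_within, rule d)
  have c\<phi>1: "continuous_on UNIV \<phi>1" by (rule DERIV_continuous_on, rule has_field_derivative_at_within, rule d1)
  have crit: "\<phi> x = c - r" if "\<phi>1 x = 0" "\<phi> x \<noteq> 0" for x
  proof -
    have "c - \<phi> x + 1 / r > 0" using lt_c[of x] r0 by (simp add: add_pos_pos)
    then show ?thesis using fi[of x] that by auto
  qed
  have nonneg: "\<phi> x \<ge> 0" for x
  proof (rule ccontr)
    assume neg: "\<not> \<phi> x \<ge> 0"
    have "((\<lambda>x. - \<phi> x) \<longlongrightarrow> - 0) at_infinity" by (intro tendsto_intros l)
    then obtain z where z: "\<And>y. - \<phi> y \<le> - \<phi> z"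
      using vanishing_attains_max[of "\<lambda>x. - \<phi> x" x] c\<phi> neg by (auto intro: continuous_intros)
    have zneg: "\<phi> z < 0" using z[of x] neg by simp
    have "\<phi>1 z = 0" by (rule DERIV_local_min[OF d, of 1]) (use z in auto)
    then have q: "\<phi> z = c - r" using crit zneg by simp
    \<comment> \<open>A negative level above the minimum and so close to 0 that
      \<open>c - \<sigma> * v > 0\<close> even for very negative \<open>\<sigma>\<close>. At this
      level the first integral would equate a nonnegative number with a negative one.\<close>
    define v where "v = - min (- \<phi> z / 2) (c / (2 * (\<bar>\<sigma>\<bar> + 1)))"
    have v: "v < 0" "\<phi> z < v" using zneg c0 by (auto simp: v_def min_less_iff_disj)
    have "\<bar>\<sigma> * v\<bar> \<le> \<bar>\<sigma>\<bar> * (c / (2 * (\<bar>\<sigma>\<bar> + 1)))"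
      unfolding abs_mult by (rule mult_left_mono) (use zneg c0 in \<open>auto simp: v_def\<close>)
    also have "\<dots> < c"
    proof -
      have "\<bar>\<sigma>\<bar> * c < c * (2 * (\<bar>\<sigma>\<bar> + 1))" using c0 by (simp add: algebra_simps) (simp add: add_nonneg_pos)
      then show ?thesis by (simp add: pos_divide_less_eq add_nonneg_pos)
    qed
    finally have pos: "c - \<sigma> * v > 0" by linarith
    have lt: "(\<phi> \<longlongrightarrow> 0) at_top" by (rule tendsto_mono[OF at_top_le_at_infinity l])
    have "eventually (\<lambda>y. v < \<phi> y) at_top" by (rule order_tendstoD(1)[OF lt v(1)])
    then obtain y where "v < \<phi> y" by (auto simp: eventually_at_top_linorder)
    then obtain w where w: "\<phi> w = v" using ivt_exists[OF c\<phi>, of z v y] v by auto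
    have "(c - \<sigma> * v) * (c - v) * (\<phi>1 w)\<^sup>2 \<ge> 0" using pos lt_c[of w] w by (intro mult_nonneg_nonneg) auto
    moreover have "v\<^sup>2 * (c - v - r) * (c - v + 1 / r) < 0"
      using v q lt_c[of w] w r0 by (intro mult_neg_pos mult_pos_neg) (auto simp: add_pos_pos)
    ultimately show False using fi[of w] w by simp
  qed
  obtain x0 where x0: "\<And>x. \<phi> x \<le> \<phi> x0"
    using vanishing_attains_max[OF c\<phi> l, of y0] nonneg[of y0] nz by force
  have p0: "\<phi> x0 > 0" using x0[of y0] nonneg[of y0] nz by simp
  have "\<phi>1 x0 = 0" by (rule DERIV_local_max[OF d, of 1]) (use x0 in auto)
  then have m: "\<phi> x0 = c - r" using crit p0 by simp
  have cr: "c > r" using m p0 by simp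
  have le: "\<phi> x \<le> c - r" for x using x0[of x] m by simp
  have cs: "c - \<sigma> * \<phi> x \<ge> r" for x
    using mult_right_mono[OF sg nonneg[of x]] le[of x] by simp
  \<comment> \<open>The constant in \<open>\<bar>\<phi>1\<bar> \<le> C * \<phi>\<close>, read off
    from the first integral with both coefficients at least \<open>r\<close>. Then
    \<open>\<phi> exp (C x)\<close> is nondecreasing and \<open>\<phi> exp (- C x)\<close>
    nonincreasing, so a zero of \<open>\<phi>\<close> would propagate to the maximum.\<close>
  define C where "C = sqrt (c * (c + 1 / r)) / r"
  have C0: "C \<ge> 0" using c0 r0 by (simp add: C_def)
  have bd: "\<bar>\<phi>1 x\<bar> \<le> C * \<phi> x" for x
  proof -
    have "r * r * (\<phi>1 x)\<^sup>2 \<le> (c - \<sigma> * \<phi> x) * (c - \<phi> x) * (\<phi>1 x)\<^sup>2"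
      using cs[of x] le[of x] r0 by (intro mult_right_mono mult_mono) auto
    also have "\<dots> = (\<phi> x)\<^sup>2 * ((c - \<phi> x - r) * (c - \<phi> x + 1 / r))" by (simp add: fi)
    also have "\<dots> \<le> (\<phi> x)\<^sup>2 * (c * (c + 1 / r))"
      using le[of x] nonneg[of x] r0 c0 by (intro mult_left_mono mult_mono) (auto simp: add_nonneg_nonneg)
    finally have "(r * \<phi>1 x)\<^sup>2 \<le> (\<phi> x)\<^sup>2 * (c * (c + 1 / r))" by (simp add: power2_eq_square mult_ac)
    also have "\<dots> = (r * (C * \<phi> x))\<^sup>2"
      using c0 r0 unfolding C_def by (simp add: power_mult_distrib power_divide real_sqrt_pow2 add_nonneg_nonneg)
    finally have "\<bar>r * \<phi>1 x\<bar> \<le> \<bar>r * (C * \<phi> x)\<bar>" by (simp only: abs_le_square_iff)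
    then have "r * \<bar>\<phi>1 x\<bar> \<le> r * (C * \<phi> x)" using r0 C0 nonneg[of x] by (simp add: abs_mult)
    then show ?thesis using r0 by simp
  qed
  have dp: "((\<lambda>x. \<phi> x * exp (k * x)) has_real_derivative (\<phi>1 x + k * \<phi> x) * exp (k * x)) (at x)" for k x
    by (auto intro!: derivative_eq_intros d simp: algebra_simps)
  have pos: "0 < \<phi> x" for x
  proof (rule ccontr)
    assume "\<not> 0 < \<phi> x"
    then have z: "\<phi> x = 0" using nonneg[of x] by simp
    have "\<phi> x0 \<le> 0"
    proof (cases "x0 \<le> x")
      case True
      have "\<phi> x0 * exp (C * x0) \<le> \<phi> x * exp (C * x)"
      proof (rule DERIV_nonneg_imp_nondecreasing[OF True])
        fix y have "0 \<le> (\<phi>1 y + C * \<phi> y) * exp (C * y)" using bd[of y] by (simp add: abs_le_iff)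
        then show "\<exists>z. ((\<lambda>x. \<phi> x * exp (C * x)) has_real_derivative z) (at y) \<and> 0 \<le> z" using dp[of C y] by blast
      qed
      then show ?thesis using z by (simp add: mult_le_0_iff)
    next
      case False
      then have "x \<le> x0" by simp
      have "\<phi> x0 * exp (-C * x0) \<le> \<phi> x * exp (-C * x)"
      proof (rule DERIV_nonpos_imp_nonincreasing[OF \<open>x \<le> x0\<close>])
        fix y have "(\<phi>1 y + (-C) * \<phi> y) * exp (-C * y) \<le> 0" using bd[of y] by (simp add: abs_le_iff mult_le_0_iff)
        then show "\<exists>z. ((\<lambda>x. \<phi> x * exp (-C * x)) has_real_derivative z) (at y) \<and> z \<le> 0" using dp[of "-C" y] by blast
      qed
      then show ?thesis using z by (simp add: mult_le_0_iff)
    qed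
    then show False using p0 by simp
  qed
  have crit': "\<phi> x = c - r" if "\<phi>1 x = 0" for x using crit[OF that] pos[of x] by simp
  \<comment> \<open>At height \<open>c - r\<close> the profile equation determines the sign of
    \<open>\<phi>2\<close>, so each such point is a strict local maximum.\<close>
  have top: "\<phi>1 x = 0 \<and> \<phi>2 x < 0" if "\<phi> x = c - r" for x
  proof
    show z: "\<phi>1 x = 0" by (rule DERIV_local_max[OF d, of 1]) (use that le in auto)
    define m where "m = c - r"
    have c: "c = m + r" "m > 0" using cr by (auto simp: m_def)
    have "(c - \<sigma> * m) * \<phi>2 x = (c + A) * m - 3 / 2 * m\<^sup>2 - (c / r)\<^sup>2 / 2 + 1 / 2"
      using ode[of x] that z by (simp add: m_def)
    also have "\<dots> = - (m\<^sup>2 * (1 + 1 / r\<^sup>2) / 2)"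
      unfolding c(1) A using r0 by (simp add: field_simps power2_eq_square)
    also have "\<dots> < 0" using c(2) r0 by (simp add: add_pos_pos)
    finally have "(c - \<sigma> * m) * \<phi>2 x < 0" .
    moreover have "c - \<sigma> * m > 0" using cs[of x] r0 that by (simp add: m_def)
    ultimately show "\<phi>2 x < 0" by (simp add: mult_less_0_iff)
  qed
  \<comment> \<open>Between two points of maximal height there would be an interior minimum below
    that height, hence a critical point at a wrong level.\<close>
  have uniq: False if h: "x1 < x2" "\<phi> x1 = c - r" "\<phi> x2 = c - r" for x1 x2
  proof -
    obtain e where e: "e > 0" "\<And>k. 0 < k \<Longrightarrow> k < e \<Longrightarrow> \<phi>1 (x1 + k) < \<phi>1 x1"
      using DERIV_neg_dec_right[OF d1 conjunct2[OF top[OF h(2)]]] by blast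
    define k where "k = min (e / 2) ((x2 - x1) / 2)"
    have k: "0 < k" "k < e" "x1 + k < x2" using e(1) h(1) by (auto simp: k_def min_def field_simps)
    obtain z where z: "x1 < z" "z < x1 + k" "\<phi> (x1 + k) - \<phi> x1 = ((x1 + k) - x1) * \<phi>1 z"
      using MVT2[of x1 "x1 + k" \<phi> \<phi>1] d k(1) by auto
    have "\<phi>1 z < 0" using e(2)[of "z - x1"] z k top[OF h(2)] by auto
    then have lt: "\<phi> (x1 + k) < c - r" using z(3) k(1) h(2) mult_pos_neg[of k "\<phi>1 z"] by simp
    obtain w where w: "w \<in> {x1..x2}" "\<And>y. y \<in> {x1..x2} \<Longrightarrow> \<phi> w \<le> \<phi> y"
    proof -
      have "{x1..x2} \<noteq> {}" using h(1) by simp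
      then have "\<exists>x\<in>{x1..x2}. \<forall>y\<in>{x1..x2}. \<phi> x \<le> \<phi> y"
        by (intro continuous_attains_inf continuous_on_subset[OF c\<phi>]) auto
      then show thesis using that by blast
    qed
    have wlt: "\<phi> w < c - r" using w(2)[of "x1 + k"] k lt by auto
    then have "w \<noteq> x1" "w \<noteq> x2" using h by auto
    then have win: "x1 < w" "w < x2" using w(1) by auto
    have "\<phi>1 w = 0"
      by (rule DERIV_local_min[OF d, of "min (w - x1) (x2 - w)"]) (use win w(2) in \<open>auto simp: abs_less_iff\<close>)
    then show False using crit' wlt by simp
  qed
  have n1: "\<phi>1 x \<noteq> 0" if "x \<noteq> x0" for x
    using crit'[of x] uniq[of x x0] uniq[of x0 x] m that by (metis linorder_neqE_linordered_idom)
  have lt: "\<phi> x < c - r" if "x \<noteq> x0" for x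
    using top[of x] n1[OF that] le[of x] by force
  have right: "\<phi>1 x < 0" if "x0 < x" for x
  proof (rule ccontr)
    assume n: "\<not> \<phi>1 x < 0"
    obtain z where z: "x0 < z" "z < x" "\<phi> x - \<phi> x0 = (x - x0) * \<phi>1 z"
      using MVT2[OF \<open>x0 < x\<close>, of \<phi> \<phi>1] d by blast
    have "(x - x0) * \<phi>1 z < 0" using z(3) lt[of x] m that by simp
    then have "\<phi>1 z < 0" using that by (simp add: mult_less_0_iff)
    then obtain y where "min z x \<le> y" "\<phi>1 y = 0" using ivt_exists[OF c\<phi>1, of z 0 x] n by auto
    then show False using n1[of y] z by auto
  qed
  have left: "\<phi>1 x > 0" if "x < x0" for x
  proof (rule ccontr)
    assume n: "\<not> \<phi>1 x > 0"
    obtain z where z: "x < z" "z < x0" "\<phi> x0 - \<phi> x = (x0 - x) * \<phi>1 z"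
      using MVT2[OF \<open>x < x0\<close>, of \<phi> \<phi>1] d by blast
    have "(x0 - x) * \<phi>1 z > 0" using z(3) lt[of x] m that by simp
    then have "\<phi>1 z > 0" using that by (simp add: zero_less_mult_iff)
    then obtain y where "y \<le> max x z" "\<phi>1 y = 0" using ivt_exists[OF c\<phi>1, of x 0 z] n by auto
    then show False using n1[of y] z by auto
  qed
  show ?thesis using that[OF cr pos le m left right] .
qed

section \<open>The action of a wave as a function of its speed\<close>

text \<open>\<open>psi\<close> is \<open>sqrt ((C - \<sigma> s) W(s))\<close> for the potential \<open>W\<close>, with \<open>s\<close> clipped to \<open>[0, C - r]\<close>.  In \<open>action\<close> the
  substitution \<open>y = C - s\<close> makes the weight \<open>wt r y\<close> independent of the speed \<open>C\<close>; \<open>action_slope\<close> is the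
  derivative of its integrand in \<open>C\<close>.\<close>
definition wt :: "real \<Rightarrow> real \<Rightarrow> real" where
  "wt r y = sqrt ((y - r) * (y + 1 / r) / y)"

definition clamp0 :: "real \<Rightarrow> real \<Rightarrow> real" where
  "clamp0 m s = min (max s 0) m"

definition potential :: "real \<Rightarrow> real \<Rightarrow> real \<Rightarrow> real" where
  "potential r C s = s\<^sup>2 * ((C - s - r) * (C - s + 1 / r) / (C - s))"

definition psi :: "real \<Rightarrow> real \<Rightarrow> real \<Rightarrow> real \<Rightarrow> real" where
  "psi \<sigma> r C s = clamp0 (C - r) s * sqrt (C - \<sigma> * clamp0 (C - r) s) * wt r (C - clamp0 (C - r) s)"

definition action :: "real \<Rightarrow> real \<Rightarrow> real \<Rightarrow> real" where
  "action \<sigma> r C = integral {r..C} (\<lambda>y. (C - y) * sqrt (C - \<sigma> * (C - y)) * wt r y)"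

definition action_slope :: "real \<Rightarrow> real \<Rightarrow> real \<Rightarrow> real \<Rightarrow> real" where
  "action_slope \<sigma> r C y = (sqrt (C - \<sigma> * (C - y)) + (1 - \<sigma>) * (C - y) / (2 * sqrt (C - \<sigma> * (C - y)))) * wt r y"

lemma clamp0_range: "0 \<le> m \<Longrightarrow> 0 \<le> clamp0 m s \<and> clamp0 m s \<le> m"
  and clamp0_id: "0 \<le> s \<Longrightarrow> s \<le> m \<Longrightarrow> clamp0 m s = s"
  and clamp0_neg: "0 \<le> m \<Longrightarrow> s \<le> 0 \<Longrightarrow> clamp0 m s = 0"
  and clamp0_big: "0 \<le> m \<Longrightarrow> m \<le> s \<Longrightarrow> clamp0 m s = m"
  and clamp0_abs: "0 \<le> m \<Longrightarrow> \<bar>clamp0 m s\<bar> \<le> \<bar>s\<bar>"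
  by (auto simp: clamp0_def min_def max_def)

lemma clamp0_continuous: "continuous_on S (clamp0 m)"
  unfolding clamp0_def[abs_def] by (intro continuous_intros)

lemma wt_continuous: "r > 0 \<Longrightarrow> continuous_on {r..} (wt r)"
  unfolding wt_def[abs_def] by (intro continuous_intros) auto

lemma wt_nonneg: "r > 0 \<Longrightarrow> r \<le> y \<Longrightarrow> 0 \<le> wt r y"
  unfolding wt_def by (intro real_sqrt_ge_zero divide_nonneg_nonneg mult_nonneg_nonneg) (auto simp: add_nonneg_nonneg)

lemma wt_r [simp]: "wt r r = 0" by (simp add: wt_def)

text \<open>This is how \<open>\<sigma> \<le> 1\<close> keeps the coefficient of
  \<open>u\<^sub>x\<^sup>2\<close> positive between 0 and the top of the wave.\<close>

lemma speed_lower: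
  fixes \<sigma> s C r :: real
  assumes "\<sigma> \<le> 1" "0 \<le> s" "s \<le> C - r" shows "r \<le> C - \<sigma> * s"
  using mult_right_mono[OF assms(1,2)] assms(3) by simp

lemma psi_continuous:
  assumes "\<sigma> \<le> 1" "r > 0" "r \<le> C"
  shows "continuous_on UNIV (psi \<sigma> r C)"
proof -
  have m: "0 \<le> C - r" using assms by simp
  show ?thesis unfolding psi_def[abs_def]
    by (intro continuous_intros clamp0_continuous continuous_on_compose2[OF wt_continuous[OF assms(2)]])
      (use clamp0_range[OF m] in \<open>auto simp: algebra_simps\<close>)
qed

lemma psi_sq:
  assumes "\<sigma> \<le> 1" "r > 0" "0 \<le> s" "s \<le> C - r"
  shows "(psi \<sigma> r C s)\<^sup>2 = (C - \<sigma> * s) * potential r C s"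
proof -
  have "0 \<le> C - \<sigma> * s" using speed_lower[OF assms(1,3,4)] assms(2) by simp
  moreover have "0 \<le> (C - s - r) * (C - s + 1 / r) / (C - s)"
    using assms by (intro divide_nonneg_nonneg mult_nonneg_nonneg) (auto simp: add_nonneg_nonneg)
  ultimately show ?thesis
    using clamp0_id[OF assms(3,4)] by (simp add: psi_def wt_def potential_def power_mult_distrib real_sqrt_pow2)
qed

lemma psi_zero: "r \<le> C \<Longrightarrow> s \<le> 0 \<or> C - r \<le> s \<Longrightarrow> psi \<sigma> r C s = 0"
  using clamp0_neg[of "C - r" s] clamp0_big[of "C - r" s] by (auto simp: psi_def)

lemma psi_nonneg:
  assumes "\<sigma> \<le> 1" "r > 0" "r \<le> C"
  shows "0 \<le> psi \<sigma> r C s"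
proof -
  have m: "0 \<le> C - r" using assms by simp
  note q = clamp0_range[OF m, of s]
  have "r \<le> C - \<sigma> * clamp0 (C - r) s" by (rule speed_lower[OF assms(1)]) (use q in auto)
  then show ?thesis unfolding psi_def using q assms by (intro mult_nonneg_nonneg wt_nonneg real_sqrt_ge_zero) auto
qed

lemma continuous_bounded_on_Icc:
  fixes f :: "real \<Rightarrow> real"
  assumes "continuous_on {a..b} f"
  obtains B where "B > 0" "\<And>x. a \<le> x \<Longrightarrow> x \<le> b \<Longrightarrow> \<bar>f x\<bar> \<le> B"
proof -
  have "compact (f ` {a..b})" by (rule compact_continuous_image[OF assms]) simp
  then obtain B where B: "\<And>x. x \<in> {a..b} \<Longrightarrow> \<bar>f x\<bar> \<le> B"
    using compact_imp_bounded bounded_iff by (metis imageI real_norm_def)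
  show ?thesis by (rule that[of "\<bar>B\<bar> + 1"]) (use B in force)+
qed

text \<open>A linear bound puts \<open>psi\<close> of an \<open>L2\<close> function into
  \<open>L2\<close>, so that its product with the derivative is integrable.\<close>

lemma psi_bound:
  assumes "\<sigma> \<le> 1" "r > 0" "r \<le> C"
  obtains B where "B > 0" "\<And>s. \<bar>psi \<sigma> r C s\<bar> \<le> B * \<bar>s\<bar>"
proof -
  have m: "0 \<le> C - r" using assms by simp
  have "continuous_on {0..C - r} (\<lambda>q. sqrt (C - \<sigma> * q) * wt r (C - q))"
    by (intro continuous_intros continuous_on_compose2[OF wt_continuous[OF assms(2)]]) auto
  then obtain B where B: "B > 0" "\<And>x. 0 \<le> x \<Longrightarrow> x \<le> C - r \<Longrightarrow> \<bar>sqrt (C - \<sigma> * x) * wt r (C - x)\<bar> \<le> B"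
    using continuous_bounded_on_Icc by blast
  have "\<bar>psi \<sigma> r C s\<bar> \<le> B * \<bar>s\<bar>" for s
  proof -
    have "\<bar>psi \<sigma> r C s\<bar> = \<bar>clamp0 (C - r) s\<bar> * \<bar>sqrt (C - \<sigma> * clamp0 (C - r) s) * wt r (C - clamp0 (C - r) s)\<bar>"
      by (simp add: psi_def abs_mult mult.assoc)
    also have "\<dots> \<le> \<bar>s\<bar> * B"
      using clamp0_range[OF m, of s] by (intro mult_mono clamp0_abs[OF m] B(2)) auto
    finally show ?thesis by (simp add: mult.commute)
  qed
  then show ?thesis using that B(1) by blast
qed

lemma psi_antideriv:
  assumes "\<sigma> \<le> 1" "r > 0" "r \<le> C"
  obtains \<Psi> where "\<And>s. (\<Psi> has_real_derivative psi \<sigma> r C s) (at s)" "\<Psi> 0 = 0" "\<Psi> (C - r) = action \<sigma> r C"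
proof -
  obtain F where F: "\<And>s. (F has_real_derivative psi \<sigma> r C s) (at s)"
    using ex_antideriv[OF psi_continuous[OF assms]] by blast
  have G: "((\<lambda>y. - F (C - y)) has_real_derivative psi \<sigma> r C (C - y)) (at y)" for y
  proof -
    have "((\<lambda>y. F (C - y)) has_real_derivative psi \<sigma> r C (C - y) * (- 1)) (at y)"
      by (rule DERIV_chain2[OF F]) (auto intro!: derivative_eq_intros)
    from DERIV_minus[OF this] show ?thesis by simp
  qed
  have "((\<lambda>y. psi \<sigma> r C (C - y)) has_integral (- F (C - C) - - F (C - r))) {r..C}"
    by (rule fundamental_theorem_of_calculus[OF assms(3)])
      (use G in \<open>auto simp: has_real_derivative_iff_has_vector_derivative[symmetric] intro: has_field_derivative_at_within\<close>)
  then have "integral {r..C} (\<lambda>y. psi \<sigma> r C (C - y)) = F (C - r) - F 0" by (simp add: integral_unique)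
  moreover have "integral {r..C} (\<lambda>y. psi \<sigma> r C (C - y)) = action \<sigma> r C"
    unfolding action_def by (rule integral_cong) (simp add: psi_def clamp0_id)
  ultimately show ?thesis
    by (intro that[of "\<lambda>s. F s - F 0"]) (auto intro!: derivative_eq_intros F)
qed

text \<open>With \<open>p\<^sup>2 = a z + y\<close> and \<open>q\<^sup>2 = a z' + y\<close>, the gap times \<open>2 a p\<close> is
  \<open>(q - p)\<^sup>2 (p (2 q + p) + y)\<close>; this is where \<open>a = 1 - \<sigma> \<ge> 0\<close> enters.\<close>
lemma speed_convex:
  fixes a y z z' :: real
  assumes a: "a \<ge> 0" and y: "y > 0" and z: "z \<ge> 0" "z' \<ge> 0"
  shows "z * sqrt (a * z + y) + (z' - z) * (sqrt (a * z + y) + a * z / (2 * sqrt (a * z + y))) \<le> z' * sqrt (a * z' + y)"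
proof -
  define p where "p = sqrt (a * z + y)"
  define q where "q = sqrt (a * z' + y)"
  have pos: "a * z + y > 0" "a * z' + y > 0" using assms by (auto intro: add_nonneg_pos)
  have p: "p > 0" "p\<^sup>2 = a * z + y" and q: "q > 0" "q\<^sup>2 = a * z' + y" using pos by (auto simp: p_def q_def)
  have "z * p + (z' - z) * (p + a * z / (2 * p)) \<le> z' * q"
  proof (cases "a = 0")
    case True
    then have "p = q" by (simp add: p_def q_def)
    then show ?thesis using True by (simp add: algebra_simps)
  next
    case False
    then have a0: "a > 0" using a by simp
    have zz: "z = (p\<^sup>2 - y) / a" "z' = (q\<^sup>2 - y) / a" using p q a0 by (auto simp: field_simps)
    have fac: "2 * a * p * (z' * q - (z * p + (z' - z) * (p + a * z / (2 * p)))) = (q - p)\<^sup>2 * (p * (2 * q + p) + y)"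
      unfolding zz using a0 p(1) by (simp add: field_simps power2_eq_square)
    have "(q - p)\<^sup>2 * (p * (2 * q + p) + y) \<ge> 0" using p q y by (intro mult_nonneg_nonneg add_nonneg_nonneg) auto
    then have ge: "0 \<le> 2 * a * p * (z' * q - (z * p + (z' - z) * (p + a * z / (2 * p))))" unfolding fac .
    have "0 \<le> z' * q - (z * p + (z' - z) * (p + a * z / (2 * p)))"
    proof -
      have "0 < 2 * a * p" using a0 p(1) by simp
      then show ?thesis using ge by (simp add: zero_le_mult_iff)
    qed
    then show ?thesis by simp
  qed
  then show ?thesis by (simp add: p_def q_def)
qed

lemma integral_linear_lower:
  fixes f :: "real \<Rightarrow> real"
  assumes ab: "a \<le> b" and f: "continuous_on {a..b} f" and le: "\<And>y. a \<le> y \<Longrightarrow> y \<le> b \<Longrightarrow> k * \<bar>C - y\<bar> \<le> f y" and C: "C = a \<or> C = b"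
  shows "k * (b - a)\<^sup>2 / 2 \<le> integral {a..b} f"
proof -
  have "((\<lambda>y. k * \<bar>C - y\<bar>) has_integral k * (b - a)\<^sup>2 / 2) {a..b}"
  proof (rule disjE[OF C])
    assume "C = b"
    have "((\<lambda>y. k * (b - y)) has_integral (- k * (b - b)\<^sup>2 / 2 - - k * (b - a)\<^sup>2 / 2)) {a..b}"
      by (rule fundamental_theorem_of_calculus[OF ab])
        (auto simp: has_real_derivative_iff_has_vector_derivative[symmetric] field_simps intro!: derivative_eq_intros)
    then show ?thesis using \<open>C = b\<close> by (simp) (rule has_integral_eq[rotated], assumption, auto)
  next
    assume "C = a"
    have "((\<lambda>y. k * (y - a)) has_integral (k * (b - a)\<^sup>2 / 2 - k * (a - a)\<^sup>2 / 2)) {a..b}"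
      by (rule fundamental_theorem_of_calculus[OF ab])
        (auto simp: has_real_derivative_iff_has_vector_derivative[symmetric] intro!: derivative_eq_intros)
    then show ?thesis using \<open>C = a\<close> by (simp) (rule has_integral_eq[rotated], assumption, auto)
  qed
  then show ?thesis
    by (rule has_integral_le[OF _ integrable_integral[OF integrable_continuous_interval[OF f]]]) (use le in auto)
qed

text \<open>Besides the convexity of the integrand, the quadratic gain comes from the part of the \<open>y\<close>-range between \<open>c\<close> and \<open>C\<close>.\<close>
lemma action_gap:
  assumes sg: "\<sigma> \<le> 1" and r: "r > 0" and cr: "r < c"
  obtains \<kappa> where "\<kappa> > 0" "\<And>C. \<bar>C - c\<bar> \<le> (c - r) / 2 \<Longrightarrow>
    action \<sigma> r c + (C - c) * integral {r..c} (action_slope \<sigma> r c) + \<kappa> * (C - c)\<^sup>2 \<le> action \<sigma> r C"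
proof -
  define J where "J C y = (C - y) * sqrt (C - \<sigma> * (C - y)) * wt r y" for C y
  \<comment> \<open>The midpoint of \<open>r\<close> and \<open>c\<close>. Speeds within
    \<open>(c - r) / 2\<close> of \<open>c\<close> stay above it, so the strip between
    \<open>c\<close> and \<open>C\<close> avoids the zero of \<open>wt\<close> at
    \<open>r\<close>.\<close>
  define b where "b = (c + r) / 2"
  have b: "r < b" "b < c" using cr by (auto simp: b_def)
  have wt_lower: "sqrt (b - r) \<le> sqrt y * wt r y" if "b \<le> y" for y
  proof -
    have "sqrt y * wt r y = sqrt ((y - r) * (y + 1 / r))"
      using that b r by (simp add: wt_def real_sqrt_mult[symmetric])
    moreover have "b - r \<le> (y - r) * (y + 1 / r)" if "1 \<le> y + 1 / r"
      using mult_mono[of "b - r" "y - r" 1 "y + 1/r"] that \<open>b \<le> y\<close> b by simp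
    moreover have "1 \<le> y + 1 / r"
    proof (cases "r \<le> 1")
      case True
      then have "1 \<le> 1 / r" using r by simp
      then show ?thesis using that b r by linarith
    next
      case False
      have "0 < 1 / r" using r by simp
      then show ?thesis using that b False by linarith
    qed
    ultimately show ?thesis by simp
  qed
  define k where "k = sqrt (b - r)"
  have k: "k > 0" using b by (simp add: k_def)
  have e: "C - \<sigma> * (C - y) = (1 - \<sigma>) * (C - y) + y" for C y by (simp add: algebra_simps)
  have sq: "sqrt y \<le> sqrt (C - \<sigma> * (C - y))" if "y \<le> C" for C y
    unfolding e using that sg by (intro real_sqrt_le_mono) simp
  have cJ: "continuous_on {p..q} (J C)" if "r \<le> p" for C p q
    unfolding J_def by (intro continuous_intros continuous_on_subset[OF wt_continuous[OF r]]) (use that in auto)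
  have cS: "continuous_on {p..q} (action_slope \<sigma> r c)" if "r \<le> p" "q \<le> c" for p q
  proof -
    have "c - \<sigma> * (c - y) > 0" if "p \<le> y" "y \<le> q" for y
      using sq[of y c] that \<open>r \<le> p\<close> \<open>q \<le> c\<close> r by (metis dual_order.trans leD leI order.strict_trans2 real_sqrt_gt_0_iff real_sqrt_le_iff)
    then show ?thesis unfolding action_slope_def[abs_def]
      by (intro continuous_intros continuous_on_subset[OF wt_continuous[OF r]]) (use that in \<open>fastforce\<close>)+
  qed
  note ii = integrable_continuous_interval
  have cvx: "J c y + (C - c) * action_slope \<sigma> r c y \<le> J C y" if "r \<le> y" "y \<le> c" "y \<le> C" for C y
  proof -
    have "(c - y) * sqrt (c - \<sigma> * (c - y)) + (C - c) * (sqrt (c - \<sigma> * (c - y)) + (1 - \<sigma>) * (c - y) / (2 * sqrt (c - \<sigma> * (c - y))))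
      \<le> (C - y) * sqrt (C - \<sigma> * (C - y))"
      using speed_convex[of "1 - \<sigma>" y "c - y" "C - y"] sg r that unfolding e by simp
    from mult_right_mono[OF this wt_nonneg[OF r that(1)]] show ?thesis
      by (simp add: J_def action_slope_def algebra_simps)
  qed
  show ?thesis
  proof (rule that[of "k / 2"])
    show "k / 2 > 0" using k by simp
    fix C assume C: "\<bar>C - c\<bar> \<le> (c - r) / 2"
    then have "c - C \<le> (c - r) / 2" by linarith
    then have bC: "b \<le> C" by (simp add: b_def field_simps)
    show "action \<sigma> r c + (C - c) * integral {r..c} (action_slope \<sigma> r c) + k / 2 * (C - c)\<^sup>2 \<le> action \<sigma> r C"
    proof (cases "c \<le> C")
      case True
      have "action \<sigma> r c + (C - c) * integral {r..c} (action_slope \<sigma> r c) = integral {r..c} (\<lambda>y. J c y + (C - c) * action_slope \<sigma> r c y)"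
        unfolding action_def J_def[symmetric]
        by (subst Henstock_Kurzweil_Integration.integral_add) (auto intro!: ii continuous_intros cJ cS)
      also have "\<dots> \<le> integral {r..c} (J C)"
        by (rule integral_le) (use cvx True in \<open>auto intro!: ii continuous_intros cJ cS\<close>)
      finally have 1: "action \<sigma> r c + (C - c) * integral {r..c} (action_slope \<sigma> r c) \<le> integral {r..c} (J C)" .
      \<comment> \<open>For \<open>C > c\<close> the gain is the part of the action over the new
        strip, where the integrand is at least \<open>k * (C - y)\<close>.\<close>
      have "k * (C - c)\<^sup>2 / 2 \<le> integral {c..C} (J C)"
      proof (rule integral_linear_lower[OF True cJ])
        fix y assume y: "c \<le> y" "y \<le> C"
        have "k * \<bar>C - y\<bar> \<le> (sqrt y * wt r y) * (C - y)"
          using wt_lower[of y] y b by (auto simp: k_def intro!: mult_right_mono)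
        also have "\<dots> \<le> J C y" unfolding J_def
          using mult_right_mono[OF mult_left_mono[OF sq[OF y(2)], of "C - y"] wt_nonneg[OF r, of y]] y cr by (simp add: mult_ac)
        finally show "k * \<bar>C - y\<bar> \<le> J C y" .
      qed (use cr in auto)
      moreover have "action \<sigma> r C = integral {r..c} (J C) + integral {c..C} (J C)"
        unfolding action_def J_def[symmetric]
        by (rule Henstock_Kurzweil_Integration.integral_combine[symmetric]) (use True cr ii[OF cJ] in auto)
      ultimately show ?thesis using 1 by simp
    next
      case False
      then have Cc: "C \<le> c" by simp
      \<comment> \<open>For \<open>C < c\<close> the action at \<open>C\<close> omits the strip from
        \<open>C\<close> to \<open>c\<close>, and the tangent integrand \<open>?T\<close> is at most
        \<open>- k * (y - C)\<close> there; its absence is the gain.\<close>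
      let ?T = "\<lambda>y. J c y + (C - c) * action_slope \<sigma> r c y"
      have iT: "?T integrable_on {p..q}" if "r \<le> p" "q \<le> c" for p q
        using that by (auto intro!: ii continuous_intros cJ cS)
      have "action \<sigma> r c + (C - c) * integral {r..c} (action_slope \<sigma> r c) = integral {r..c} ?T"
        unfolding action_def J_def[symmetric]
        by (subst Henstock_Kurzweil_Integration.integral_add) (auto intro!: ii continuous_intros cJ cS)
      also have "\<dots> = integral {r..C} ?T + integral {C..c} ?T"
        by (rule Henstock_Kurzweil_Integration.integral_combine[symmetric]) (use Cc bC b iT[of r c] in auto)
      finally have 1: "action \<sigma> r c + (C - c) * integral {r..c} (action_slope \<sigma> r c) = integral {r..C} ?T + integral {C..c} ?T" .
      have 2: "integral {r..C} ?T \<le> action \<sigma> r C"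
        unfolding action_def J_def[symmetric]
        by (rule integral_le) (use cvx Cc iT in \<open>auto intro!: ii cJ\<close>)
      have 3: "k * (c - C)\<^sup>2 / 2 \<le> integral {C..c} (\<lambda>y. - ?T y)"
      proof (rule integral_linear_lower[OF Cc])
        show "continuous_on {C..c} (\<lambda>y. - ?T y)" using bC b by (intro continuous_intros cJ cS) auto
        fix y assume y: "C \<le> y" "y \<le> c"
        have ry: "r \<le> y" using y bC b by simp
        let ?s = "sqrt (c - \<sigma> * (c - y))"
        have s0: "0 < ?s" using sq[OF y(2)] ry r by (smt (verit) real_sqrt_gt_0_iff)
        have f': "sqrt y \<le> ?s + (1 - \<sigma>) * (c - y) / (2 * ?s)"
          using sq[OF y(2)] sg y s0 by (smt (verit) divide_nonneg_pos mult_nonneg_nonneg)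
        have "(c - y) * ?s + (C - c) * (?s + (1 - \<sigma>) * (c - y) / (2 * ?s)) \<le> (c - y) * (?s + (1 - \<sigma>) * (c - y) / (2 * ?s)) + (C - c) * (?s + (1 - \<sigma>) * (c - y) / (2 * ?s))"
          using sg y s0 by (intro add_right_mono mult_left_mono) auto
        also have "\<dots> = - ((y - C) * (?s + (1 - \<sigma>) * (c - y) / (2 * ?s)))"
        proof -
          have "(c - y) * D + (C - c) * D = - ((y - C) * D)" for D by (simp add: algebra_simps)
          then show ?thesis .
        qed
        also have "\<dots> \<le> - ((y - C) * sqrt y)" using mult_left_mono[OF f', of "y - C"] y by simp
        finally have "((c - y) * ?s + (C - c) * (?s + (1 - \<sigma>) * (c - y) / (2 * ?s))) * wt r y \<le> - ((y - C) * sqrt y) * wt r y"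
          by (rule mult_right_mono) (rule wt_nonneg[OF r ry])
        then have "(sqrt y * wt r y) * (y - C) \<le> - ?T y" by (simp add: J_def action_slope_def algebra_simps)
        moreover have "k * \<bar>C - y\<bar> \<le> (sqrt y * wt r y) * (y - C)"
          using wt_lower[of y] y bC by (auto simp: k_def intro!: mult_right_mono)
        ultimately show "k * \<bar>C - y\<bar> \<le> - ?T y" by simp
      qed simp
      have "integral {C..c} (\<lambda>y. - ?T y) = - integral {C..c} ?T" by (rule integral_neg)
      then show ?thesis using 1 2 3 by (simp add: power2_commute[of c C])
    qed
  qed
qed

section \<open>Energy, momentum and height\<close>

text \<open>A point of the energy space given by the continuous representative \<open>u\<close> and
  its derivative \<open>v\<close>; carrying \<open>v\<close> along avoids the choice made by
  \<open>wd\<close>.\<close>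

definition state :: "(real \<Rightarrow> real) \<Rightarrow> (real \<Rightarrow> real) \<Rightarrow> (real \<Rightarrow> real) \<Rightarrow> bool" where
  "state u v \<eta> \<longleftrightarrow> is_primitive u v \<and> L2 u \<and> L2 v \<and> L2 \<eta>"

text \<open>\<open>energy\<close> and \<open>moment\<close> are \<open>2 E\<close> and \<open>2 F\<close>.\<close>
definition energy :: "(real \<Rightarrow> real) \<Rightarrow> (real \<Rightarrow> real) \<Rightarrow> (real \<Rightarrow> real) \<Rightarrow> real" where
  "energy u v \<eta> = (LINT x|lborel. (u x)\<^sup>2 + (v x)\<^sup>2 + (\<eta> x)\<^sup>2)"

definition moment :: "real \<Rightarrow> real \<Rightarrow> (real \<Rightarrow> real) \<Rightarrow> (real \<Rightarrow> real) \<Rightarrow> (real \<Rightarrow> real) \<Rightarrow> real" where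
  "moment A \<sigma> u v \<eta> = (LINT x|lborel. (u x)^3 + \<sigma> * u x * (v x)\<^sup>2 + 2 * u x * \<eta> x + u x * (\<eta> x)\<^sup>2 - A * (u x)\<^sup>2)"

lemma L2_cauchy_schwarz:
  assumes f: "L2 f" and g: "L2 g"
  shows "\<bar>LINT x|lborel. f x * g x\<bar> \<le> sqrt (LINT x|lborel. (f x)\<^sup>2) * sqrt (LINT x|lborel. (g x)\<^sup>2)"
proof -
  let ?a = "LINT x|lborel. (f x)\<^sup>2" and ?b = "LINT x|lborel. (g x)\<^sup>2" and ?p = "LINT x|lborel. f x * g x"
  note i = L2D(2)[OF f] L2D(2)[OF g] L2_mult_integrable[OF f g]
  have a: "?a \<ge> 0" and b: "?b \<ge> 0" by (auto intro!: integral_nonneg_AE)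
  have q: "0 \<le> s\<^sup>2 * ?a + 2 * s * t * ?p + t\<^sup>2 * ?b" for s t
  proof -
    have "0 \<le> (LINT x|lborel. (s * f x + t * g x)\<^sup>2)" by (rule integral_nonneg_AE) auto
    also have "\<dots> = (LINT x|lborel. s\<^sup>2 * (f x)\<^sup>2 + 2 * s * t * (f x * g x) + t\<^sup>2 * (g x)\<^sup>2)"
      by (rule Bochner_Integration.integral_cong) (auto simp: power2_eq_square algebra_simps)
    also have "\<dots> = s\<^sup>2 * ?a + 2 * s * t * ?p + t\<^sup>2 * ?b" using i by simp
    finally show ?thesis .
  qed
  have "?p\<^sup>2 \<le> ?a * ?b"
  proof (cases "?b = 0")
    case True
    have "?p = 0"
    proof (rule ccontr)
      assume "?p \<noteq> 0"
      have "2 * (- (?a + 1) / (2 * ?p)) * ?p = - (?a + 1)" using \<open>?p \<noteq> 0\<close> by simp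
      moreover have "0 \<le> 1\<^sup>2 * ?a + 2 * 1 * (- (?a + 1) / (2 * ?p)) * ?p + (- (?a + 1) / (2 * ?p))\<^sup>2 * ?b" by (rule q)
      ultimately show False unfolding True by simp
    qed
    then show ?thesis using a b by simp
  next
    case False
    have "0 \<le> ?b\<^sup>2 * ?a + 2 * ?b * (- ?p) * ?p + (- ?p)\<^sup>2 * ?b" by (rule q)
    then have "0 \<le> ?b * (?a * ?b - ?p\<^sup>2)" by (simp add: algebra_simps power2_eq_square)
    then show ?thesis using False b by (simp add: zero_le_mult_iff)
  qed
  then have "sqrt (?p\<^sup>2) \<le> sqrt (?a * ?b)" by (rule real_sqrt_le_mono)
  then show ?thesis by (simp add: real_sqrt_mult)
qed

lemma integrable_bounded_mult:
  fixes f u :: "real \<Rightarrow> real"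
  assumes "integrable lborel f" "u \<in> borel_measurable borel" "\<And>x. \<bar>u x\<bar> \<le> N"
  shows "integrable lborel (\<lambda>x. u x * f x)"
proof -
  have [measurable]: "f \<in> borel_measurable borel" "u \<in> borel_measurable borel" using assms(1,2) by auto
  have "integrable lborel (\<lambda>x. N * \<bar>f x\<bar>)" using assms(1) by simp
  then show ?thesis
  proof (rule Bochner_Integration.integrable_bound)
    show "AE x in lborel. norm (u x * f x) \<le> norm (N * \<bar>f x\<bar>)"
    proof (rule AE_I2)
      fix x have "\<bar>u x\<bar> * \<bar>f x\<bar> \<le> \<bar>N\<bar> * \<bar>f x\<bar>" using assms(3)[of x] by (intro mult_right_mono) auto
      then show "norm (u x * f x) \<le> norm (N * \<bar>f x\<bar>)" by (simp add: abs_mult)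
    qed
  qed simp
qed

lemma stateD:
  assumes "state u v \<eta>"
  shows "is_primitive u v" "L2 u" "L2 v" "L2 \<eta>" "continuous_on UNIV u"
    "(u \<longlongrightarrow> 0) at_top" "(u \<longlongrightarrow> 0) at_bot"
    "integrable lborel (\<lambda>x. (u x)\<^sup>2 + (v x)\<^sup>2 + (\<eta> x)\<^sup>2)"
    "integrable lborel (\<lambda>x. (u x)^3 + \<sigma> * u x * (v x)\<^sup>2 + 2 * u x * \<eta> x + u x * (\<eta> x)\<^sup>2 - A * (u x)\<^sup>2)"
    "0 \<le> energy u v \<eta>" "(u x)\<^sup>2 \<le> energy u v \<eta>"
    "(LINT x|lborel. (u x)\<^sup>2) \<le> energy u v \<eta>" "(LINT x|lborel. (v x)\<^sup>2) \<le> energy u v \<eta>"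
    "(LINT x|lborel. (\<eta> x)\<^sup>2) \<le> energy u v \<eta>"
proof -
  show s: "is_primitive u v" "L2 u" "L2 v" "L2 \<eta>" using assms by (auto simp: state_def)
  show "continuous_on UNIV u" by (rule is_primitive_continuous[OF s(1)])
  show "(u \<longlongrightarrow> 0) at_top" "(u \<longlongrightarrow> 0) at_bot" by (rule primitive_L2_vanish[OF s(1-3)])+
  show i: "integrable lborel (\<lambda>x. (u x)\<^sup>2 + (v x)\<^sup>2 + (\<eta> x)\<^sup>2)" using s by (simp add: L2_def)
  show "0 \<le> energy u v \<eta>" unfolding energy_def by (rule integral_nonneg_AE) auto
  have mono: "(LINT x|lborel. h x) \<le> energy u v \<eta>" if "integrable lborel h" "\<And>x. h x \<le> (u x)\<^sup>2 + (v x)\<^sup>2 + (\<eta> x)\<^sup>2" for h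
    unfolding energy_def by (rule integral_mono[OF that(1) i that(2)])
  have ub: "(u x)\<^sup>2 \<le> energy u v \<eta>" for x
    using primitive_L2_vanish(3)[OF s(1-3), of x] mono[of "\<lambda>x. (u x)\<^sup>2 + (v x)\<^sup>2"] s by (auto simp: L2_def)
  then show "(u x)\<^sup>2 \<le> energy u v \<eta>" .
  show "(LINT x|lborel. (u x)\<^sup>2) \<le> energy u v \<eta>" "(LINT x|lborel. (v x)\<^sup>2) \<le> energy u v \<eta>"
    "(LINT x|lborel. (\<eta> x)\<^sup>2) \<le> energy u v \<eta>" by (rule mono; use s in \<open>auto simp: L2_def\<close>)+
  have N: "\<bar>u x\<bar> \<le> sqrt (energy u v \<eta>)" for x using real_sqrt_le_mono[OF ub[of x]] by simp
  have mu: "u \<in> borel_measurable borel" using s(2) by (simp add: L2_def)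
  note b = integrable_bounded_mult[OF _ mu N]
  have "integrable lborel (\<lambda>x. u x * (u x)\<^sup>2 + \<sigma> * (u x * (v x)\<^sup>2) + 2 * (u x * \<eta> x) + u x * (\<eta> x)\<^sup>2 - A * (u x)\<^sup>2)"
    using b[OF L2D(2)[OF s(2)]] b[OF L2D(2)[OF s(3)]] b[OF L2D(2)[OF s(4)]] L2_mult_integrable[OF s(2,4)] L2D(2)[OF s(2)] by simp
  then show "integrable lborel (\<lambda>x. (u x)^3 + \<sigma> * u x * (v x)\<^sup>2 + 2 * u x * \<eta> x + u x * (\<eta> x)\<^sup>2 - A * (u x)\<^sup>2)"
    by (simp add: power2_eq_square power3_eq_cube mult.assoc)
qed

text \<open>The terms in \<open>h\<close> are \<open>(C - u) h^2 - 2 u h\<close>, and completing the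
  square costs \<open>u^2 / (C - u)\<close>. With \<open>y = C - u\<close> the rest is
  \<open>u^2 (y + A - 1 / y)\<close>, which factors into the potential by the form of
  \<open>A\<close>.\<close>

lemma density_identity:
  fixes u v h :: real
  assumes "C - u > 0" "A = 1 / r - r" "r > 0"
  shows "C * (u\<^sup>2 + v\<^sup>2 + h\<^sup>2) - (u^3 + \<sigma> * u * v\<^sup>2 + 2 * u * h + u * h\<^sup>2 - A * u\<^sup>2)
    = (C - \<sigma> * u) * v\<^sup>2 + potential r C u + (C - u) * (h - u / (C - u))\<^sup>2"
proof -
  define y where "y = C - u"
  have y: "y > 0" "C = y + u" using assms(1) by (auto simp: y_def)
  have "potential r C u = u\<^sup>2 * ((y - r) * (y + 1 / r) / y)" by (simp add: potential_def y_def)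
  also have "\<dots> = u\<^sup>2 * (y + A - 1 / y)" unfolding assms(2) using y(1) assms(3) by (simp add: field_simps power2_eq_square)
  finally have p: "potential r C u = u\<^sup>2 * (y + A - 1 / y)" .
  have "(C - u) * (h - u / (C - u))\<^sup>2 = y * h\<^sup>2 - 2 * u * h + u\<^sup>2 / y"
    using y by (simp add: field_simps power2_eq_square)
  then show ?thesis unfolding p unfolding y(2) using y(1)
    by (simp add: algebra_simps power2_eq_square power3_eq_cube)
qed

text \<open>After multiplication by \<open>\<alpha>\<close> the difference of the two sides is
  \<open>(\<alpha> v + s p)^2 + (\<alpha> \<beta> - s^2 p^2)\<close>. The factor \<open>s\<close>
  stands for a sign, which is 0 at the maximum itself.\<close>

lemma am_gm_signed:
  fixes \<alpha> \<beta> p s v :: real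
  assumes "\<alpha> \<ge> 0" "\<beta> \<ge> 0" "p\<^sup>2 \<le> \<alpha> * \<beta>" "\<bar>s\<bar> \<le> 1"
  shows "- 2 * (s * (p * v)) \<le> \<alpha> * v\<^sup>2 + \<beta>"
proof (cases "\<alpha> = 0")
  case True
  then show ?thesis using assms by simp
next
  case False
  have "s\<^sup>2 \<le> 1" using assms(4) by (simp add: abs_square_le_1)
  then have "s\<^sup>2 * p\<^sup>2 \<le> 1 * p\<^sup>2" by (intro mult_right_mono) auto
  then have "0 \<le> (\<alpha> * v + s * p)\<^sup>2 + (\<alpha> * \<beta> - s\<^sup>2 * p\<^sup>2)" using assms(3) by simp
  also have "\<dots> = \<alpha> * (\<alpha> * v\<^sup>2 + \<beta> + 2 * (s * (p * v)))" by (simp add: algebra_simps power2_eq_square)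
  finally show ?thesis using False assms(1) by (simp add: zero_le_mult_iff)
qed

text \<open>The speed \<open>C\<close> is the one whose solitary wave has the same height as \<open>u\<close>.\<close>
lemma action_lower_bound:
  assumes sg: "\<sigma> \<le> 1" and r: "r > 0" and A: "A = 1 / r - r" and S: "state u v \<eta>"
    and mx: "\<And>x. u x \<le> u z" and C: "C = u z + r" and uz: "u z \<ge> 0" and sp: "\<And>x. 0 \<le> C - \<sigma> * u x"
  shows "4 * action \<sigma> r C \<le> C * energy u v \<eta> - moment A \<sigma> u v \<eta>"
proof -
  note D = stateD[OF S]
  have rC: "r \<le> C" using C uz by simp
  obtain \<Psi> where \<Psi>: "\<And>s. (\<Psi> has_real_derivative psi \<sigma> r C s) (at s)" "\<Psi> 0 = 0" "\<Psi> (C - r) = action \<sigma> r C"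
    using psi_antideriv[OF sg r rC] by blast
  obtain B where B: "B > 0" "\<And>s. \<bar>psi \<sigma> r C s\<bar> \<le> B * \<bar>s\<bar>" using psi_bound[OF sg r rC] by blast
  have P: "is_primitive (\<lambda>x. \<Psi> (u x)) (\<lambda>x. psi \<sigma> r C (u x) * v x)"
    by (rule is_primitive_chain[OF D(1) \<Psi>(1) psi_continuous[OF sg r rC]])
  have cp: "continuous_on UNIV (\<lambda>x. psi \<sigma> r C (u x))"
    by (rule continuous_on_compose2[OF psi_continuous[OF sg r rC] D(5)]) auto
  have i: "integrable lborel (\<lambda>x. psi \<sigma> r C (u x) * v x)"
    by (rule L2_mult_integrable[OF L2_bound[OF D(2) continuous_loc_integrable(2)[OF cp] B(2)] D(3)])
  have "isCont \<Psi> 0" using \<Psi>(1) DERIV_isCont by blast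
  then have t: "((\<lambda>x. \<Psi> (u x)) \<longlongrightarrow> \<Psi> 0) F" if "(u \<longlongrightarrow> 0) F" for F
    using isCont_tendsto_compose that by blast
  have eq: "(LINT x|lborel. sgn (x - z) * (psi \<sigma> r C (u x) * v x)) = - 2 * \<Psi> (u z)"
    by (rule is_primitive_half_integrals(3)[OF P i]) (use t[OF D(6)] t[OF D(7)] \<Psi>(2) in auto)
  have isg: "integrable lborel (\<lambda>x. sgn (x - z) * (psi \<sigma> r C (u x) * v x))"
    by (rule integrable_bounded_mult[OF i, where N=1]) (auto simp: abs_sgn_eq borel_measurable_sgn)
  have pt: "- 2 * (sgn (x - z) * (psi \<sigma> r C (u x) * v x)) \<le> C * ((u x)\<^sup>2 + (v x)\<^sup>2 + (\<eta> x)\<^sup>2)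
     - ((u x)^3 + \<sigma> * u x * (v x)\<^sup>2 + 2 * u x * \<eta> x + u x * (\<eta> x)\<^sup>2 - A * (u x)\<^sup>2)" for x
  proof -
    have cu: "C - u x \<ge> r" using mx[of x] C by simp
    have pot: "0 \<le> potential r C (u x)" unfolding potential_def
      using cu r by (intro mult_nonneg_nonneg divide_nonneg_nonneg) (auto simp: add_nonneg_nonneg)
    \<comment> \<open>Where \<open>u\<close> is negative the clipped \<open>psi\<close> is 0 and the
      potential is nonnegative, so undershoots do not spoil the bound.\<close>
    have sq: "(psi \<sigma> r C (u x))\<^sup>2 \<le> (C - \<sigma> * u x) * potential r C (u x)"
    proof (cases "0 \<le> u x")
      case True
      then show ?thesis using psi_sq[OF sg r True, of C] cu by simp
    next
      case False
      then show ?thesis using psi_zero[OF rC, of "u x" \<sigma>] sp[of x] pot by simp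
    qed
    have "- 2 * (sgn (x - z) * (psi \<sigma> r C (u x) * v x)) \<le> (C - \<sigma> * u x) * (v x)\<^sup>2 + potential r C (u x)"
      by (rule am_gm_signed[OF sp pot sq]) (simp add: abs_sgn_eq)
    also have "\<dots> \<le> (C - \<sigma> * u x) * (v x)\<^sup>2 + potential r C (u x) + (C - u x) * (\<eta> x - u x / (C - u x))\<^sup>2"
      using cu r by simp
    finally show ?thesis using density_identity[of C "u x" A r] cu r A by simp
  qed
  have "- 2 * (LINT x|lborel. sgn (x - z) * (psi \<sigma> r C (u x) * v x)) = (LINT x|lborel. - 2 * (sgn (x - z) * (psi \<sigma> r C (u x) * v x)))"
    by simp
  also have "\<dots> \<le> (LINT x|lborel. C * ((u x)\<^sup>2 + (v x)\<^sup>2 + (\<eta> x)\<^sup>2)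
     - ((u x)^3 + \<sigma> * u x * (v x)\<^sup>2 + 2 * u x * \<eta> x + u x * (\<eta> x)\<^sup>2 - A * (u x)\<^sup>2))"
    by (rule integral_mono[OF _ _ pt]) (use isg D(8) D(9)[of \<sigma> A] in \<open>auto intro!: Bochner_Integration.integrable_diff\<close>)
  also have "\<dots> = C * energy u v \<eta> - moment A \<sigma> u v \<eta>"
    unfolding energy_def moment_def using D(8) D(9)[of \<sigma> A] by (subst Bochner_Integration.integral_diff) auto
  finally show ?thesis using eq \<Psi>(3) C by simp
qed

lemma integral_split_at:
  fixes f :: "real \<Rightarrow> real"
  assumes i: "integrable lborel f"
  shows "(LINT x|lborel. f x) = (LINT x:{a..}|lborel. f x) + (LINT x:{..a}|lborel. f x)"
proof -
  have si: "set_integrable lborel S f" if "S \<in> sets lborel" for S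
    using i that integrable_mult_indicator set_integrable_def by blast
  have [measurable]: "f \<in> borel_measurable borel" using i by auto
  have ne: "AE x in lborel. x \<noteq> a" by (rule AE_lborel_singleton)
  have "(LINT x|lborel. f x) = (LINT x|lborel. indicator {a..} x *\<^sub>R f x + indicator {..a} x *\<^sub>R f x)"
  proof (rule integral_cong_AE)
    show "AE x in lborel. f x = indicator {a..} x *\<^sub>R f x + indicator {..a} x *\<^sub>R f x"
      using ne by (rule AE_mp) (auto simp: indicator_def intro!: AE_I2)
  qed auto
  then show ?thesis
    using si[of "{a..}"] si[of "{..a}"] unfolding set_lebesgue_integral_def set_integrable_def by simp
qed

text \<open>What is retained of a solitary wave of positive speed. \<open>A\<close> enters through
  \<open>r\<close> and may have either sign, so waves of negative speed are covered after a change
  of sign of \<open>\<phi>\<close>.\<close>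

locale wave_profile =
  fixes \<sigma> c r A x0 :: real and \<phi> \<phi>1 \<phi>2 :: "real \<Rightarrow> real"
  assumes sg: "\<sigma> \<le> 1" and r0: "0 < r" and cr: "r < c" and A: "A = 1 / r - r"
    and d: "\<And>x. (\<phi> has_real_derivative \<phi>1 x) (at x)" and d1: "\<And>x. (\<phi>1 has_real_derivative \<phi>2 x) (at x)"
    and c2: "continuous_on UNIV \<phi>2" and L\<phi>: "L2 \<phi>" and L\<phi>1: "L2 \<phi>1"
    and pos: "\<And>x. 0 < \<phi> x" and le: "\<And>x. \<phi> x \<le> c - r" and top: "\<phi> x0 = c - r"
    and left: "\<And>x. x < x0 \<Longrightarrow> \<phi>1 x > 0" and right: "\<And>x. x0 < x \<Longrightarrow> \<phi>1 x < 0"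
    and fi: "\<And>x. (c - \<sigma> * \<phi> x) * (c - \<phi> x) * (\<phi>1 x)\<^sup>2 = (\<phi> x)\<^sup>2 * (c - \<phi> x - r) * (c - \<phi> x + 1 / r)"
    and ode: "\<And>x. (c - \<sigma> * \<phi> x) * \<phi>2 x = (c + A) * \<phi> x - 3 / 2 * (\<phi> x)\<^sup>2 + \<sigma> / 2 * (\<phi>1 x)\<^sup>2 - (c / (c - \<phi> x))\<^sup>2 / 2 + 1 / 2"
begin

section \<open>The wave as the equality case of the lower bound\<close>

definition \<eta>\<phi> where "\<eta>\<phi> x = \<phi> x / (c - \<phi> x)"

lemma cont: "continuous_on UNIV \<phi>" "continuous_on UNIV \<phi>1"
  by (rule DERIV_continuous_on, rule has_field_derivative_at_within, rule d d1)+

lemma speed: "r \<le> c - \<sigma> * \<phi> x" "r \<le> c - \<phi> x"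
  using speed_lower[OF sg less_imp_le[OF pos] le] le[of x] by auto

lemma crit: "\<phi>1 x0 = 0"
  by (rule DERIV_local_max[OF d, of 1]) (use le top in auto)

lemma abs_slope: "\<bar>\<phi>1 x\<bar> = - (sgn (x - x0) * \<phi>1 x)"
  using left[of x] right[of x] crit by (cases "x < x0"; cases "x = x0") auto

lemma potential_\<phi>: "potential r c (\<phi> x) = (c - \<sigma> * \<phi> x) * (\<phi>1 x)\<^sup>2"
proof -
  have y: "c - \<phi> x \<noteq> 0" using speed(2)[of x] r0 by linarith
  have "(c - \<sigma> * \<phi> x) * (\<phi>1 x)\<^sup>2 * (c - \<phi> x) = (\<phi> x)\<^sup>2 * ((c - \<phi> x - r) * (c - \<phi> x + 1 / r))"
    using fi[of x] by (simp only: mult_ac)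
  then have "(c - \<sigma> * \<phi> x) * (\<phi>1 x)\<^sup>2 = (\<phi> x)\<^sup>2 * ((c - \<phi> x - r) * (c - \<phi> x + 1 / r)) / (c - \<phi> x)"
    by (simp only: nonzero_eq_divide_eq[OF y])
  then show ?thesis by (simp add: potential_def)
qed

lemma wt_eq: "\<phi> x * wt r (c - \<phi> x) = sqrt (c - \<sigma> * \<phi> x) * \<bar>\<phi>1 x\<bar>"
proof -
  have "sqrt ((\<phi> x)\<^sup>2 * ((c - \<phi> x - r) * (c - \<phi> x + 1 / r) / (c - \<phi> x))) = sqrt ((c - \<sigma> * \<phi> x) * (\<phi>1 x)\<^sup>2)"
    using potential_\<phi>[of x] by (simp only: potential_def)
  then show ?thesis
    unfolding real_sqrt_mult[of "(\<phi> x)\<^sup>2"] real_sqrt_mult[of "c - \<sigma> * \<phi> x"] real_sqrt_abs wt_def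
    using pos[of x] by (simp only: abs_of_pos)
qed

lemma psi_\<phi>: "psi \<sigma> r c (\<phi> x) = (c - \<sigma> * \<phi> x) * \<bar>\<phi>1 x\<bar>"
proof -
  have "psi \<sigma> r c (\<phi> x) = sqrt (c - \<sigma> * \<phi> x) * (\<phi> x * wt r (c - \<phi> x))"
    using clamp0_id[OF less_imp_le[OF pos] le] by (simp add: psi_def)
  then show ?thesis unfolding wt_eq using speed[of x] r0 by (simp add: mult.assoc[symmetric])
qed

lemma prim: "is_primitive \<phi> \<phi>1" "is_primitive \<phi>1 \<phi>2"
  by (rule is_primitive_deriv[OF d cont(2)], rule is_primitive_deriv[OF d1 c2])

lemma \<eta>\<phi>_bounds: "0 < \<eta>\<phi> x" "\<eta>\<phi> x \<le> \<phi> x / r"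
  unfolding \<eta>\<phi>_def using pos[of x] speed[of x] r0 by (auto intro!: divide_left_mono mult_pos_pos)

lemma \<eta>\<phi>_cont: "continuous_on UNIV \<eta>\<phi>"
proof -
  have "c - \<phi> x \<noteq> 0" for x using speed(2)[of x] r0 by linarith
  then show ?thesis unfolding \<eta>\<phi>_def[abs_def] by (intro continuous_intros cont) auto
qed

lemma state_\<phi>: "state \<phi> \<phi>1 \<eta>\<phi>"
proof -
  have "\<bar>\<eta>\<phi> x\<bar> \<le> (1 / r) * \<bar>\<phi> x\<bar>" for x using \<eta>\<phi>_bounds[of x] pos[of x] by simp
  then have "L2 \<eta>\<phi>" by (rule L2_bound[OF L\<phi> continuous_loc_integrable(2)[OF \<eta>\<phi>_cont]])
  then show ?thesis unfolding state_def using prim L\<phi> L\<phi>1 by auto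
qed

lemma slope_bound: obtains B where "B > 0" "\<And>x. \<bar>\<phi>1 x\<bar> \<le> B * \<phi> x"
proof -
  obtain B where B: "B > 0" "\<And>s. \<bar>psi \<sigma> r c s\<bar> \<le> B * \<bar>s\<bar>" using psi_bound[OF sg r0 less_imp_le[OF cr]] by blast
  have "\<bar>\<phi>1 x\<bar> \<le> (B / r) * \<phi> x" for x
  proof -
    have "r * \<bar>\<phi>1 x\<bar> \<le> (c - \<sigma> * \<phi> x) * \<bar>\<phi>1 x\<bar>" using speed[of x] by (intro mult_right_mono) auto
    also have "\<dots> \<le> \<bar>psi \<sigma> r c (\<phi> x)\<bar>" unfolding psi_\<phi> by simp
    also have "\<dots> \<le> B * \<phi> x" using B(2)[of "\<phi> x"] pos[of x] by simp
    finally show ?thesis using r0 by (simp add: field_simps)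
  qed
  then show ?thesis using that[of "B / r"] B(1) r0 by simp
qed

text \<open>Every term of the profile equation is bounded by a multiple of \<open>\<phi>\<close>;
  the constant 1/2 cancels against \<open>(c / (c - \<phi>))^2 / 2\<close> at
  \<open>\<phi> = 0\<close>. The result allows an integration by parts onto \<open>\<phi>1\<close>
  when the derivatives are compared.\<close>

lemma L\<phi>2: "L2 \<phi>2"
proof -
  obtain B where B: "B > 0" "\<And>x. \<bar>\<phi>1 x\<bar> \<le> B * \<phi> x" using slope_bound by blast
  define N where "N = (\<bar>c + A\<bar> + 3 / 2 * c + \<bar>\<sigma>\<bar> / 2 * (B\<^sup>2 * c) + c / r\<^sup>2) / r"
  have "\<bar>\<phi>2 x\<bar> \<le> N * \<bar>\<phi> x\<bar>" for x
  proof -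
    have y: "r \<le> c - \<phi> x" and p: "0 < \<phi> x" "\<phi> x \<le> c" using speed[of x] pos[of x] le[of x] r0 by auto
    have sq: "(\<phi> x)\<^sup>2 \<le> c * \<phi> x" using p unfolding power2_eq_square by (intro mult_right_mono) auto
    have sq1: "(\<phi>1 x)\<^sup>2 \<le> B\<^sup>2 * (c * \<phi> x)"
    proof -
      have "(\<phi>1 x)\<^sup>2 \<le> (B * \<phi> x)\<^sup>2" using B(2)[of x] B(1) p by (simp add: abs_le_square_iff[symmetric])
      also have "\<dots> \<le> B\<^sup>2 * (c * \<phi> x)" unfolding power_mult_distrib by (intro mult_left_mono sq) simp
      finally show ?thesis .
    qed
    have q: "\<bar>(c / (c - \<phi> x))\<^sup>2 / 2 - 1 / 2\<bar> \<le> c / r\<^sup>2 * \<phi> x"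
    proof -
      have "(c / (c - \<phi> x))\<^sup>2 / 2 - 1 / 2 = (2 * c * \<phi> x - (\<phi> x)\<^sup>2) / (2 * (c - \<phi> x)\<^sup>2)"
      proof -
        have "2 * c * \<phi> x - (\<phi> x)\<^sup>2 = c\<^sup>2 - (c - \<phi> x)\<^sup>2" by (simp add: power2_eq_square algebra_simps)
        then show ?thesis using y r0 by (simp add: power_divide diff_divide_distrib)
      qed
      moreover have "0 \<le> (2 * c * \<phi> x - (\<phi> x)\<^sup>2) / (2 * (c - \<phi> x)\<^sup>2)"
      proof -
        have "(\<phi> x)\<^sup>2 \<le> 2 * c * \<phi> x" using sq mult_pos_pos[of c "\<phi> x"] p cr r0 by linarith
        then show ?thesis by (intro divide_nonneg_nonneg) auto
      qed
      moreover have "(2 * c * \<phi> x - (\<phi> x)\<^sup>2) / (2 * (c - \<phi> x)\<^sup>2) \<le> (2 * c * \<phi> x) / (2 * r\<^sup>2)"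
        using y r0 p by (intro frac_le mult_left_mono power_mono) auto
      ultimately show ?thesis by simp
    qed
    have "r * \<bar>\<phi>2 x\<bar> \<le> \<bar>(c - \<sigma> * \<phi> x) * \<phi>2 x\<bar>"
      unfolding abs_mult using speed[of x] by (intro mult_right_mono) auto
    also have "\<dots> \<le> \<bar>(c + A) * \<phi> x\<bar> + \<bar>3 / 2 * (\<phi> x)\<^sup>2\<bar> + \<bar>\<sigma> / 2 * (\<phi>1 x)\<^sup>2\<bar> + \<bar>(c / (c - \<phi> x))\<^sup>2 / 2 - 1 / 2\<bar>"
      unfolding ode by linarith
    also have "\<dots> \<le> \<bar>c + A\<bar> * \<phi> x + 3 / 2 * (c * \<phi> x) + \<bar>\<sigma>\<bar> / 2 * (B\<^sup>2 * (c * \<phi> x)) + c / r\<^sup>2 * \<phi> x"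
      using sq mult_left_mono[OF sq1, of "\<bar>\<sigma>\<bar> / 2"] q p by (simp add: abs_mult)
    also have "\<dots> = r * (N * \<bar>\<phi> x\<bar>)" unfolding N_def using r0 p by (simp add: algebra_simps add_divide_distrib)
    finally show ?thesis using r0 by simp
  qed
  then show ?thesis by (rule L2_bound[OF L\<phi> continuous_loc_integrable(2)[OF c2]])
qed

lemma \<phi>_limits: "(\<phi> \<longlongrightarrow> 0) at_top" "(\<phi> \<longlongrightarrow> 0) at_bot" "(\<phi>1 \<longlongrightarrow> 0) at_top" "(\<phi>1 \<longlongrightarrow> 0) at_bot"
  by (rule primitive_L2_vanish[OF prim(1) L\<phi> L\<phi>1] primitive_L2_vanish[OF prim(2) L\<phi>1 L\<phi>2])+

lemma chain_\<phi>_integral: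
  assumes \<Psi>: "\<And>s. (\<Psi> has_real_derivative \<psi> s) (at s)" "\<Psi> 0 = 0" and c: "continuous_on UNIV \<psi>"
    and B: "\<And>s. \<bar>\<psi> s\<bar> \<le> B * \<bar>s\<bar>"
  shows "(LINT x|lborel. \<psi> (\<phi> x) * \<bar>\<phi>1 x\<bar>) = 2 * \<Psi> (c - r)"
proof -
  have P: "is_primitive (\<lambda>x. \<Psi> (\<phi> x)) (\<lambda>x. \<psi> (\<phi> x) * \<phi>1 x)"
    by (rule is_primitive_chain[OF prim(1) \<Psi>(1) c])
  have cp: "continuous_on UNIV (\<lambda>x. \<psi> (\<phi> x))" by (rule continuous_on_compose2[OF c cont(1)]) auto
  have i: "integrable lborel (\<lambda>x. \<psi> (\<phi> x) * \<phi>1 x)"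
    by (rule L2_mult_integrable[OF L2_bound[OF L\<phi> continuous_loc_integrable(2)[OF cp] B] L\<phi>1])
  have "isCont \<Psi> 0" using \<Psi>(1) DERIV_isCont by blast
  then have t: "((\<lambda>x. \<Psi> (\<phi> x)) \<longlongrightarrow> 0) F" if "(\<phi> \<longlongrightarrow> 0) F" for F
    using isCont_tendsto_compose[OF _ that] \<Psi>(2) by fastforce
  have "(LINT x|lborel. sgn (x - x0) * (\<psi> (\<phi> x) * \<phi>1 x)) = - 2 * \<Psi> (\<phi> x0)"
    by (rule is_primitive_half_integrals(3)[OF P i t[OF \<phi>_limits(1)] t[OF \<phi>_limits(2)]])
  moreover have "(LINT x|lborel. \<psi> (\<phi> x) * \<bar>\<phi>1 x\<bar>) = (LINT x|lborel. - (sgn (x - x0) * (\<psi> (\<phi> x) * \<phi>1 x)))"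
    by (rule Bochner_Integration.integral_cong) (auto simp: abs_slope)
  ultimately show ?thesis using top by simp
qed

text \<open>On the wave the completed square vanishes and the two terms of the arithmetic-geometric
  inequality coincide, so the lower bound by the action is attained.\<close>

lemma action_\<phi>: "c * energy \<phi> \<phi>1 \<eta>\<phi> - moment A \<sigma> \<phi> \<phi>1 \<eta>\<phi> = 4 * action \<sigma> r c"
proof -
  note rc = less_imp_le[OF cr]
  note D = stateD[OF state_\<phi>]
  obtain \<Psi> where \<Psi>: "\<And>s. (\<Psi> has_real_derivative psi \<sigma> r c s) (at s)" "\<Psi> 0 = 0" "\<Psi> (c - r) = action \<sigma> r c"
    using psi_antideriv[OF sg r0 rc] by blast
  obtain B where B: "B > 0" "\<And>s. \<bar>psi \<sigma> r c s\<bar> \<le> B * \<bar>s\<bar>" using psi_bound[OF sg r0 rc] by blast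
  have *: "c * ((\<phi> x)\<^sup>2 + (\<phi>1 x)\<^sup>2 + (\<eta>\<phi> x)\<^sup>2)
     - ((\<phi> x)^3 + \<sigma> * \<phi> x * (\<phi>1 x)\<^sup>2 + 2 * \<phi> x * \<eta>\<phi> x + \<phi> x * (\<eta>\<phi> x)\<^sup>2 - A * (\<phi> x)\<^sup>2) = 2 * (psi \<sigma> r c (\<phi> x) * \<bar>\<phi>1 x\<bar>)" for x
  proof -
    have y: "c - \<phi> x > 0" using speed[of x] r0 by simp
    show ?thesis
      using density_identity[OF y A r0, of "\<phi>1 x" "\<eta>\<phi> x" \<sigma>] by (simp add: potential_\<phi>) (simp add: \<eta>\<phi>_def psi_\<phi> power2_eq_square abs_mult_self)
  qed
  have "c * energy \<phi> \<phi>1 \<eta>\<phi> - moment A \<sigma> \<phi> \<phi>1 \<eta>\<phi> = (LINT x|lborel. 2 * (psi \<sigma> r c (\<phi> x) * \<bar>\<phi>1 x\<bar>))"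
    unfolding energy_def moment_def *[symmetric] using D(8) D(9)[of \<sigma> A] by (subst Bochner_Integration.integral_diff) auto
  also have "\<dots> = 4 * action \<sigma> r c"
    using chain_\<phi>_integral[OF \<Psi>(1,2) psi_continuous[OF sg r0 rc] B(2)] \<Psi>(3) by simp
  finally show ?thesis .
qed

text \<open>The energy of the wave is the derivative of the action in the speed.  The substitution
  \<open>y = c - \<phi> x\<close> shows this only up to the total derivative \<open>((c - \<sigma> \<phi>) \<phi>')'\<close>.\<close>
lemma half_energy_density:
  "((\<phi> x)\<^sup>2 + (\<phi>1 x)\<^sup>2 + (\<eta>\<phi> x)\<^sup>2) / 2 =
    action_slope \<sigma> r c (c - \<phi> x) * \<bar>\<phi>1 x\<bar> - ((c - \<sigma> * \<phi> x) * \<phi>2 x - \<sigma> * (\<phi>1 x)\<^sup>2)"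
proof -
  define h where "h = \<eta>\<phi> x"
  define s where "s = sqrt (c - \<sigma> * \<phi> x)"
  define y where "y = c - \<phi> x"
  have y: "y > 0" "\<phi> x = c - y" using speed[of x] r0 by (auto simp: y_def)
  have s: "s > 0" "s\<^sup>2 = c - \<sigma> * \<phi> x" using speed[of x] r0 by (auto simp: s_def)
  have p: "\<phi> x > 0" by (rule pos)
  have wt': "wt r (c - \<phi> x) = s * \<bar>\<phi>1 x\<bar> / \<phi> x" using wt_eq[of x] p by (simp add: s_def field_simps)
  have "action_slope \<sigma> r c (c - \<phi> x) * \<bar>\<phi>1 x\<bar> = (s + (1 - \<sigma>) * \<phi> x / (2 * s)) * (s * \<bar>\<phi>1 x\<bar> / \<phi> x) * \<bar>\<phi>1 x\<bar>"
    unfolding action_slope_def wt' by (simp add: s_def)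
  also have "\<dots> = (s\<^sup>2 / \<phi> x + (1 - \<sigma>) / 2) * (\<bar>\<phi>1 x\<bar> * \<bar>\<phi>1 x\<bar>)"
    using s p by (simp add: field_simps power2_eq_square)
  also have "\<dots> = (c - \<sigma> * \<phi> x) * (\<phi>1 x)\<^sup>2 / \<phi> x + (1 - \<sigma>) / 2 * (\<phi>1 x)\<^sup>2"
    by (simp add: s(2) power2_eq_square[of "\<phi>1 x"] distrib_right)
  also have "(c - \<sigma> * \<phi> x) * (\<phi>1 x)\<^sup>2 / \<phi> x = \<phi> x * ((y - r) * (y + 1 / r) / y)"
    unfolding potential_\<phi>[symmetric] potential_def y_def[symmetric] using p by (simp add: power2_eq_square)
  also have "(y - r) * (y + 1 / r) / y = y + A - 1 / y"
    unfolding A using y(1) r0 by (simp add: field_simps power2_eq_square)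
  also have "\<phi> x * (y + A - 1 / y) = \<phi> x * (c + A) - (\<phi> x)\<^sup>2 - h"
    unfolding h_def \<eta>\<phi>_def y_def by (simp add: algebra_simps power2_eq_square)
  finally have 1: "action_slope \<sigma> r c (c - \<phi> x) * \<bar>\<phi>1 x\<bar> = \<phi> x * (c + A) - (\<phi> x)\<^sup>2 - h + (1 - \<sigma>) / 2 * (\<phi>1 x)\<^sup>2" .
  have 2: "c / (c - \<phi> x) = 1 + h" unfolding h_def \<eta>\<phi>_def using y by (simp add: field_simps)
  show ?thesis unfolding 1 ode 2 h_def[symmetric] by (simp add: field_simps power2_eq_square)
qed

text \<open>On either side of \<open>x0\<close> half the energy density is an exact derivative, of
  plus or minus \<open>H (c - \<phi>)\<close> minus
  \<open>(c - \<sigma> * \<phi>) * \<phi>1\<close>. The last term vanishes at \<open>x0\<close> and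
  at infinity, so each half line contributes \<open>H c - H r\<close>.\<close>

lemma energy_\<phi>: "energy \<phi> \<phi>1 \<eta>\<phi> = 4 * integral {r..c} (action_slope \<sigma> r c)"
proof -
  note rc = less_imp_le[OF cr]
  have m: "0 \<le> c - r" using rc by simp
  \<comment> \<open>Clipping extends the integrand continuously to the whole line, which gives a
    global antiderivative \<open>H\<close>.\<close>
  define z where "z y = clamp0 (c - r) (c - y)" for y
  define h where "h y = (sqrt (c - \<sigma> * z y) + (1 - \<sigma>) * z y / (2 * sqrt (c - \<sigma> * z y))) * wt r (c - z y)" for y
  have ch: "continuous_on UNIV h"
  proof -
    have zr: "0 \<le> z y" "z y \<le> c - r" for y using clamp0_range[OF m, of "c - y"] by (auto simp: z_def)
    have cz: "continuous_on UNIV z"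
      unfolding z_def[abs_def] by (rule continuous_on_compose2[OF clamp0_continuous]) (auto intro: continuous_intros)
    have ne: "2 * sqrt (c - \<sigma> * z y) \<noteq> 0" for y using speed_lower[OF sg zr, of y] r0 by simp
    have "continuous_on UNIV (\<lambda>y. wt r (c - z y))"
      by (rule continuous_on_compose2[OF wt_continuous[OF r0]]) (use zr(2) in \<open>auto intro!: continuous_intros cz simp: algebra_simps\<close>)
    then show ?thesis unfolding h_def[abs_def]
      by (intro continuous_on_mult continuous_on_add continuous_on_divide continuous_intros cz) (use ne in auto)
  qed
  obtain H where H: "\<And>y. (H has_real_derivative h y) (at y)" using ex_antideriv[OF ch] by blast
  have cH: "continuous_on UNIV H" by (rule DERIV_continuous_on, rule has_field_derivative_at_within, rule H)
  have "(h has_integral (H c - H r)) {r..c}"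
    by (rule fundamental_theorem_of_calculus[OF rc])
      (use H in \<open>auto simp: has_real_derivative_iff_has_vector_derivative[symmetric] intro: has_field_derivative_at_within\<close>)
  moreover have "integral {r..c} h = integral {r..c} (action_slope \<sigma> r c)"
    by (rule integral_cong) (simp add: h_def z_def clamp0_id action_slope_def)
  ultimately have I: "integral {r..c} (action_slope \<sigma> r c) = H c - H r" by (simp add: integral_unique)
  have h\<phi>: "h (c - \<phi> x) = action_slope \<sigma> r c (c - \<phi> x)" for x
    using clamp0_id[OF less_imp_le[OF pos] le] by (simp add: h_def z_def action_slope_def)
  define e where "e x = ((\<phi> x)\<^sup>2 + (\<phi>1 x)\<^sup>2 + (\<eta>\<phi> x)\<^sup>2) / 2" for x
  have ie: "integrable lborel e" unfolding e_def using stateD(8)[OF state_\<phi>] by simp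
  have si: "set_integrable lborel S e" if "S \<in> sets lborel" for S
    using ie that integrable_mult_indicator set_integrable_def by blast
  define T where "T s x = s * H (c - \<phi> x) - (c - \<sigma> * \<phi> x) * \<phi>1 x" for s x
  define t where "t s x = s * (h (c - \<phi> x) * (- \<phi>1 x)) - ((c - \<sigma> * \<phi> x) * \<phi>2 x - \<sigma> * (\<phi>1 x)\<^sup>2)" for s x
  have dT: "(T s has_real_derivative t s x) (at x)" for s x
  proof -
    have "((\<lambda>x. H (c - \<phi> x)) has_real_derivative h (c - \<phi> x) * (- \<phi>1 x)) (at x)"
      by (rule DERIV_chain2[OF H]) (auto intro!: derivative_eq_intros d)
    note 1 = DERIV_cmult[OF this, of s]
    have 2: "((\<lambda>x. (c - \<sigma> * \<phi> x) * \<phi>1 x) has_real_derivative ((c - \<sigma> * \<phi> x) * \<phi>2 x - \<sigma> * (\<phi>1 x)\<^sup>2)) (at x)"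
      by (auto intro!: derivative_eq_intros d d1 simp: power2_eq_square)
    show ?thesis unfolding T_def[abs_def] t_def by (rule DERIV_diff[OF 1 2])
  qed
  have ct: "continuous_on UNIV (t s)" for s
    unfolding t_def[abs_def] by (intro continuous_intros continuous_on_compose2[OF ch] cont c2) auto
  have PT: "is_primitive (T s) (t s)" for s by (rule is_primitive_deriv[OF dT ct])
  have tr: "t 1 x = e x" if "x0 \<le> x" for x
    using half_energy_density[of x] abs_slope[of x] that crit unfolding t_def e_def h\<phi> by (cases "x = x0") auto
  have tl: "t (-1) x = e x" if "x \<le> x0" for x
    using half_energy_density[of x] abs_slope[of x] that crit unfolding t_def e_def h\<phi> by (cases "x = x0") auto
  have lim: "(T s \<longlongrightarrow> s * H c) F" if "(\<phi> \<longlongrightarrow> 0) F" "(\<phi>1 \<longlongrightarrow> 0) F" for s F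
  proof -
    have "((\<lambda>x. c - \<phi> x) \<longlongrightarrow> c - 0) F" by (intro tendsto_intros that)
    moreover have "isCont H c" using H DERIV_isCont by blast
    ultimately have "((\<lambda>x. H (c - \<phi> x)) \<longlongrightarrow> H c) F" using isCont_tendsto_compose by fastforce
    then have "(T s \<longlongrightarrow> s * H c - (c - \<sigma> * 0) * 0) F"
      unfolding T_def[abs_def] by (intro tendsto_intros that)
    then show ?thesis by simp
  qed
  have T0: "T s x0 = s * H r" for s using crit top by (simp add: T_def)
  have "((\<lambda>b. LINT x:{x0..b}|lborel. e x) \<longlongrightarrow> (LINT x:{x0..}|lborel. e x)) at_top"
    by (rule tendsto_set_lebesgue_integral_at_top) (auto intro: si)
  moreover have "eventually (\<lambda>b. (LINT x:{x0..b}|lborel. e x) = T 1 b - T 1 x0) at_top"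
  proof (rule eventually_at_top_linorderI)
    fix b assume "x0 \<le> b"
    then show "(LINT x:{x0..b}|lborel. e x) = T 1 b - T 1 x0"
      using is_primitiveD(3)[OF PT, of x0 b 1] by (subst set_lebesgue_integral_cong[where g="t 1"]) (auto simp: tr)
  qed
  ultimately have "((\<lambda>b. T 1 b - T 1 x0) \<longlongrightarrow> (LINT x:{x0..}|lborel. e x)) at_top" by (rule Lim_transform_eventually)
  moreover have "((\<lambda>b. T 1 b - T 1 x0) \<longlongrightarrow> 1 * H c - T 1 x0) at_top" by (intro tendsto_intros lim \<phi>_limits)
  ultimately have right_half: "(LINT x:{x0..}|lborel. e x) = H c - H r"
    using tendsto_unique[OF trivial_limit_at_top_linorder] T0 by fastforce
  have "((\<lambda>b. LINT x:{b..x0}|lborel. e x) \<longlongrightarrow> (LINT x:{..x0}|lborel. e x)) at_bot"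
    by (rule tendsto_set_lebesgue_integral_at_bot) (auto intro: si)
  moreover have "eventually (\<lambda>b. (LINT x:{b..x0}|lborel. e x) = T (-1) x0 - T (-1) b) at_bot"
  proof (rule eventually_at_bot_linorderI)
    fix b assume "b \<le> x0"
    then show "(LINT x:{b..x0}|lborel. e x) = T (-1) x0 - T (-1) b"
      using is_primitiveD(3)[OF PT, of b x0 "-1"] by (subst set_lebesgue_integral_cong[where g="t (-1)"]) (auto simp: tl)
  qed
  ultimately have "((\<lambda>b. T (-1) x0 - T (-1) b) \<longlongrightarrow> (LINT x:{..x0}|lborel. e x)) at_bot" by (rule Lim_transform_eventually)
  moreover have "((\<lambda>b. T (-1) x0 - T (-1) b) \<longlongrightarrow> T (-1) x0 - (-1) * H c) at_bot" by (intro tendsto_intros lim \<phi>_limits)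
  ultimately have left_half: "(LINT x:{..x0}|lborel. e x) = H c - H r"
    using tendsto_unique[OF trivial_limit_at_bot_linorder] T0 by fastforce
  have "energy \<phi> \<phi>1 \<eta>\<phi> = 2 * (LINT x|lborel. e x)" unfolding energy_def e_def by simp
  also have "\<dots> = 4 * (H c - H r)" using integral_split_at[OF ie, of x0] right_half left_half by simp
  finally show ?thesis using I by simp
qed

text \<open>By \<open>action_\<phi>\<close> and \<open>energy_\<phi>\<close>, the tangent of
  \<open>4 * action\<close> at \<open>c\<close> takes at \<open>C\<close> the value
  \<open>C * energy - moment\<close> of the wave. Subtracting it from the lower bound for
  \<open>u\<close> at the matched speed \<open>C = u x0 + r\<close> leaves only differences of
  conserved quantities and the quadratic convexity gap.\<close>

lemma height_estimate:
  obtains \<kappa> where "\<kappa> > 0"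
    "\<And>u v \<eta>. state u v \<eta> \<Longrightarrow> (\<And>x. u x \<le> u x0) \<Longrightarrow> (\<And>x. 0 \<le> u x0 + r - \<sigma> * u x) \<Longrightarrow>
      \<bar>u x0 - (c - r)\<bar> \<le> (c - r) / 2 \<Longrightarrow>
      \<kappa> * (u x0 - (c - r))\<^sup>2 \<le> (u x0 + r) * (energy u v \<eta> - energy \<phi> \<phi>1 \<eta>\<phi>) - (moment A \<sigma> u v \<eta> - moment A \<sigma> \<phi> \<phi>1 \<eta>\<phi>)"
proof -
  obtain \<kappa> where k: "\<kappa> > 0" "\<And>C. \<bar>C - c\<bar> \<le> (c - r) / 2 \<Longrightarrow>
    action \<sigma> r c + (C - c) * integral {r..c} (action_slope \<sigma> r c) + \<kappa> * (C - c)\<^sup>2 \<le> action \<sigma> r C"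
    using action_gap[OF sg r0 cr] by blast
  show ?thesis
  proof (rule that[of "4 * \<kappa>"])
    show "4 * \<kappa> > 0" using k by simp
    fix u v \<eta> assume S: "state u v \<eta>" and mx: "\<And>x. u x \<le> u x0" and sp: "\<And>x. 0 \<le> u x0 + r - \<sigma> * u x"
      and near: "\<bar>u x0 - (c - r)\<bar> \<le> (c - r) / 2"
    define C where "C = u x0 + r"
    have Cc: "C - c = u x0 - (c - r)" by (simp add: C_def)
    have "(c - r) - u x0 \<le> (c - r) / 2" using near by linarith
    then have "u x0 \<ge> 0" using cr by (simp add: field_simps)
    then have h1: "4 * action \<sigma> r C \<le> C * energy u v \<eta> - moment A \<sigma> u v \<eta>"
      by (intro action_lower_bound[OF sg r0 A S mx C_def]) (use sp in \<open>auto simp: C_def\<close>)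
    have h2: "action \<sigma> r c + (C - c) * integral {r..c} (action_slope \<sigma> r c) + \<kappa> * (C - c)\<^sup>2 \<le> action \<sigma> r C"
      by (rule k(2)) (use near in \<open>simp only: Cc\<close>)
    have "4 * (action \<sigma> r c + (C - c) * integral {r..c} (action_slope \<sigma> r c) + \<kappa> * (C - c)\<^sup>2) \<le> C * energy u v \<eta> - moment A \<sigma> u v \<eta>"
      by (rule order_trans[OF mult_left_mono[OF h2] h1]) simp
    moreover have "4 * (action \<sigma> r c + (C - c) * integral {r..c} (action_slope \<sigma> r c) + \<kappa> * (C - c)\<^sup>2) =
       C * energy \<phi> \<phi>1 \<eta>\<phi> - moment A \<sigma> \<phi> \<phi>1 \<eta>\<phi> + 4 * \<kappa> * (C - c)\<^sup>2"
      using action_\<phi> energy_\<phi> by (simp add: algebra_simps)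
    ultimately show "4 * \<kappa> * (u x0 - (c - r))\<^sup>2 \<le> (u x0 + r) * (energy u v \<eta> - energy \<phi> \<phi>1 \<eta>\<phi>) - (moment A \<sigma> u v \<eta> - moment A \<sigma> \<phi> \<phi>1 \<eta>\<phi>)"
      unfolding Cc C_def[symmetric] by (simp add: algebra_simps)
  qed
qed

end

section \<open>Convergence to the profile\<close>

lemma is_primitive_reflect:
  assumes "is_primitive u v"
  shows "is_primitive (\<lambda>t. u (- t)) (\<lambda>t. - v (- t))"
  unfolding is_primitive_def
proof (intro conjI allI impI)
  show "(\<lambda>t. - v (- t)) \<in> borel_measurable borel" using is_primitiveD(1)[OF assms] by measurable
  fix a b :: real assume ab: "a \<le> b"
  have e: "(indicator {-b..-a} (- t) :: real) = indicator {a..b} t" for t by (auto simp: indicator_def)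
  have i: "integrable lborel (\<lambda>t. indicator {-b..-a} t *\<^sub>R v t)"
    using is_primitiveD(2)[OF assms, of "-b" "-a"] by (simp add: set_integrable_def)
  show "set_integrable lborel {a..b} (\<lambda>t. - v (- t))"
    using lborel_integrable_real_affine[OF i, of "-1" 0] by (simp add: set_integrable_def e)
  have "(LINT t:{a..b}|lborel. - v (- t)) = - (LINT t:{-b..-a}|lborel. v t)"
    using lborel_integral_real_affine[of "-1" "\<lambda>t. indicator {-b..-a} t *\<^sub>R v t" 0]
    by (simp add: set_lebesgue_integral_def e)
  then show "(LINT t:{a..b}|lborel. - v (- t)) = u (- b) - u (- a)"
    using is_primitiveD(3)[OF assms, of "-b" "-a"] ab by simp
qed

lemma is_primitive_affine:
  assumes "is_primitive u v" "s = 1 \<or> s = -1"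
  shows "is_primitive (\<lambda>t. u (a + s * t)) (\<lambda>t. s * v (a + s * t))"
proof (rule disjE[OF assms(2)])
  assume s: "s = 1"
  show ?thesis using is_primitive_shift[OF assms(1), of "-a"] unfolding s by (simp add: add.commute)
next
  assume s: "s = -1"
  show ?thesis using is_primitive_reflect[OF is_primitive_shift[OF assms(1), of "-a"]] unfolding s by (simp add: add.commute)
qed

text \<open>The clipped weight \<open>1 / max g \<gamma>\<close> measures how long it takes to
  descend along \<open>f' = - g f\<close>.  Near the top the descent of \<open>f\<close> is degenerate (\<open>g\<close> vanishes there
  and is not Lipschitz), which costs at most the time \<open>\<beta>\<close>.\<close>
lemma travel_time_comparison:
  fixes g f f1 :: "real \<Rightarrow> real"
  assumes cg: "continuous_on UNIV g" and g0: "\<And>s. 0 \<le> g s" and gG: "\<And>s. g s \<le> G"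
    and f: "\<And>t. (f has_real_derivative f1 t) (at t)" and cf1: "continuous_on UNIV f1"
    and fg: "\<And>t. 0 \<le> t \<Longrightarrow> t \<le> x \<Longrightarrow> f1 t = - g (f t)"
    and neg: "\<And>t. 0 < t \<Longrightarrow> t \<le> x \<Longrightarrow> f1 t < 0" and b: "0 < \<beta>" "\<beta> < x"
  obtains \<gamma> where "\<gamma> > 0" "\<And>u v. is_primitive u v \<Longrightarrow>
    f x - u x \<le> (G + 1) * (\<beta> + (\<bar>u 0 - f 0\<bar> + (LINT t:{0..x}|lborel. \<bar>v t + g (u t)\<bar>)) / \<gamma>)"
proof -
  have "{\<beta>..x} \<noteq> {}" using b by simp
  then have "\<exists>t0\<in>{\<beta>..x}. \<forall>t\<in>{\<beta>..x}. - f1 t0 \<le> - f1 t"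
    by (intro continuous_attains_inf continuous_intros continuous_on_subset[OF cf1]) auto
  then obtain t0 where t0: "t0 \<in> {\<beta>..x}" "\<And>t. t \<in> {\<beta>..x} \<Longrightarrow> - f1 t0 \<le> - f1 t" by blast
  \<comment> \<open>A lower bound for the speed of descent of \<open>f\<close> after time
    \<open>\<beta>\<close>; from then on the clipping is inactive along \<open>f\<close>, and
    \<open>\<Theta> (f t) + t\<close> is constant. The cap at 1 keeps
    \<open>max (g s) \<gamma> \<le> G + 1\<close>.\<close>
  define \<gamma> where "\<gamma> = min (- f1 t0) 1"
  have \<gamma>: "\<gamma> > 0" "\<gamma> \<le> 1" using neg[of t0] t0(1) b by (auto simp: \<gamma>_def)
  have G0: "0 \<le> G" using g0[of 0] gG[of 0] by linarith
  define \<theta> where "\<theta> s = 1 / max (g s) \<gamma>" for s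
  have mx: "max (g s) \<gamma> > 0" "max (g s) \<gamma> \<ge> \<gamma>" "max (g s) \<gamma> \<le> G + 1" "max (g s) \<gamma> \<ge> g s" for s
    using \<gamma> gG[of s] G0 by (auto simp: max_def)
  have \<theta>b: "0 < \<theta> s" "\<theta> s \<le> 1 / \<gamma>" "1 / (G + 1) \<le> \<theta> s" "\<theta> s * g s \<le> 1" for s
    unfolding \<theta>_def using mx[of s] \<gamma>(1) G0 by (auto intro!: divide_left_mono simp: divide_le_eq)
  have c\<theta>: "continuous_on UNIV \<theta>" unfolding \<theta>_def[abs_def]
    by (intro continuous_intros cg) (use mx in \<open>auto simp: less_imp_neq[symmetric] dest: less_imp_neq\<close>)
  obtain \<Theta> where \<Theta>: "\<And>s. (\<Theta> has_real_derivative \<theta> s) (at s)" using ex_antideriv[OF c\<theta>] by blast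
  have mvt: "\<exists>z. \<Theta> q - \<Theta> p = (q - p) * \<theta> z" if "p < q" for p q
    using MVT2[OF that, of \<Theta> \<theta>] \<Theta> by blast
  have mono: "\<Theta> p \<le> \<Theta> q" if "p \<le> q" for p q
    by (rule DERIV_nonneg_imp_nondecreasing[OF that]) (use \<Theta> \<theta>b(1) less_imp_le in blast)
  have lip: "\<bar>\<Theta> p - \<Theta> q\<bar> \<le> \<bar>p - q\<bar> / \<gamma>" for p q
  proof -
    have *: "\<Theta> q - \<Theta> p \<le> (q - p) / \<gamma>" if "p < q" for p q
      using mvt[OF that] mult_left_mono[OF \<theta>b(2), of "q - p"] that by auto
    show ?thesis using *[of p q] *[of q p] mono[of p q] mono[of q p] by (cases p q rule: linorder_cases) auto
  qed
  have fb: "f \<beta> \<le> f 0"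
  proof (rule DERIV_nonpos_imp_nonincreasing[of 0 \<beta> f])
    show "0 \<le> \<beta>" using b by simp
    fix t assume "0 \<le> t" "t \<le> \<beta>"
    then have "f1 t \<le> 0" using fg[of t] g0[of "f t"] b by simp
    then show "\<exists>y. (f has_real_derivative y) (at t) \<and> y \<le> 0" using f by blast
  qed
  have fA: "\<Theta> (f \<beta>) - \<Theta> (f x) = x - \<beta>"
  proof -
    have D: "((\<lambda>t. \<Theta> (f t) + t) has_real_derivative \<theta> (f t) * f1 t + 1) (at t)" for t
      by (intro DERIV_add DERIV_chain2[OF \<Theta>] f DERIV_ident)
    obtain z where z: "\<beta> < z" "z < x" "(\<Theta> (f x) + x) - (\<Theta> (f \<beta>) + \<beta>) = (x - \<beta>) * (\<theta> (f z) * f1 z + 1)"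
      using MVT2[OF b(2), of "\<lambda>t. \<Theta> (f t) + t" "\<lambda>t. \<theta> (f t) * f1 t + 1"] D by blast
    have "g (f z) = - f1 z" using fg[of z] z b by simp
    moreover have "\<gamma> \<le> - f1 z" using t0(2)[of z] z by (auto simp: \<gamma>_def)
    moreover have "f1 z < 0" using neg[of z] z b by simp
    ultimately have "\<theta> (f z) * f1 z = -1" by (simp add: \<theta>_def max_def)
    then show ?thesis using z(3) by simp
  qed
  show ?thesis
  proof (rule that[OF \<gamma>(1)])
    fix u v assume P: "is_primitive u v"
    note cu = is_primitive_continuous[OF P]
    have cgu: "continuous_on S (\<lambda>t. g (u t))" for S by (rule continuous_on_compose2[OF cg continuous_on_subset[OF cu]]) auto
    let ?I = "LINT t:{0..x}|lborel. \<bar>v t + g (u t)\<bar>"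
    have sI: "set_integrable lborel {0..x} (\<lambda>t. \<bar>v t + g (u t)\<bar>)"
      by (intro set_integrable_abs set_integral_add is_primitiveD(2)[OF P] continuous_loc_integrable(1)[OF cgu])
    have I0: "0 \<le> ?I" unfolding set_lebesgue_integral_def by (rule integral_nonneg_AE) auto
    have Q: "is_primitive (\<lambda>t. \<Theta> (u t)) (\<lambda>t. \<theta> (u t) * v t)" by (rule is_primitive_chain[OF P \<Theta> c\<theta>])
    \<comment> \<open>In the time measured by \<open>\<Theta>\<close>, \<open>u\<close> descends at
      most at unit rate, apart from an error weighted by \<open>1 / \<gamma>\<close>.\<close>
    have "\<Theta> (u 0) - \<Theta> (u x) = - (LINT t:{0..x}|lborel. \<theta> (u t) * v t)" using is_primitiveD(3)[OF Q, of 0 x] b by simp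
    also have "\<dots> = (LINT t:{0..x}|lborel. - (\<theta> (u t) * v t))"
      by (rule set_integral_uminus[symmetric]) (rule is_primitiveD(2)[OF Q])
    also have "\<dots> \<le> (LINT t:{0..x}|lborel. 1 + (1 / \<gamma>) * \<bar>v t + g (u t)\<bar>)"
    proof (rule set_integral_mono)
      show "set_integrable lborel {0..x} (\<lambda>t. - (\<theta> (u t) * v t))"
        using set_integrable_mult_right[of "-1" lborel "{0..x}", OF is_primitiveD(2)[OF Q]] by simp
      show "set_integrable lborel {0..x} (\<lambda>t. 1 + (1 / \<gamma>) * \<bar>v t + g (u t)\<bar>)"
        by (intro set_integral_add set_integrable_mult_right sI) (simp add: continuous_loc_integrable)
      fix t
      have "- (\<theta> (u t) * v t) = \<theta> (u t) * g (u t) + \<theta> (u t) * (- (v t + g (u t)))" by (simp add: algebra_simps)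
      also have "\<dots> \<le> 1 + (1 / \<gamma>) * \<bar>v t + g (u t)\<bar>"
      proof (rule add_mono)
        show "\<theta> (u t) * g (u t) \<le> 1" by (rule \<theta>b)
        have "\<theta> (u t) * (- (v t + g (u t))) \<le> \<theta> (u t) * \<bar>v t + g (u t)\<bar>"
          using \<theta>b(1)[of "u t"] by (intro mult_left_mono) auto
        also have "\<dots> \<le> (1 / \<gamma>) * \<bar>v t + g (u t)\<bar>" by (rule mult_right_mono[OF \<theta>b(2)]) simp
        finally show "\<theta> (u t) * (- (v t + g (u t))) \<le> (1 / \<gamma>) * \<bar>v t + g (u t)\<bar>" .
      qed
      finally show "- (\<theta> (u t) * v t) \<le> 1 + (1 / \<gamma>) * \<bar>v t + g (u t)\<bar>" .
    qed
    also have "\<dots> = (LINT t:{0..x}|lborel. 1) + (LINT t:{0..x}|lborel. (1 / \<gamma>) * \<bar>v t + g (u t)\<bar>)"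
      by (intro set_integral_add set_integrable_mult_right sI) (simp add: continuous_loc_integrable)
    also have "\<dots> = x + ?I / \<gamma>" using b by (simp add: set_lebesgue_integral_def)
    finally have uA: "\<Theta> (u 0) - \<Theta> (u x) \<le> x + ?I / \<gamma>" .
    have "\<Theta> (f 0) - \<Theta> (u 0) \<le> \<bar>u 0 - f 0\<bar> / \<gamma>" using lip[of "f 0" "u 0"] by (simp add: abs_minus_commute abs_le_iff)
    then have main: "\<Theta> (f x) - \<Theta> (u x) \<le> \<beta> + (\<bar>u 0 - f 0\<bar> + ?I) / \<gamma>"
      using uA fA mono[OF fb] by (simp add: add_divide_distrib)
    have R0: "0 \<le> \<beta> + (\<bar>u 0 - f 0\<bar> + ?I) / \<gamma>" using b I0 \<gamma> by (auto intro!: add_nonneg_nonneg divide_nonneg_nonneg)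
    \<comment> \<open>The bound \<open>\<theta> \<ge> 1 / (G + 1)\<close> converts the lag in time
      back into a difference of heights.\<close>
    show "f x - u x \<le> (G + 1) * (\<beta> + (\<bar>u 0 - f 0\<bar> + ?I) / \<gamma>)"
    proof (cases "u x < f x")
      case True
      then obtain z where z: "\<Theta> (f x) - \<Theta> (u x) = (f x - u x) * \<theta> z" using mvt by blast
      have "(f x - u x) / (G + 1) \<le> (f x - u x) * \<theta> z" using mult_left_mono[OF \<theta>b(3)[of z], of "f x - u x"] True by simp
      then have "(f x - u x) / (G + 1) \<le> \<beta> + (\<bar>u 0 - f 0\<bar> + ?I) / \<gamma>" using main z by linarith
      then show ?thesis using G0 by (simp add: divide_le_eq mult.commute)
    next
      case False
      then show ?thesis using R0 G0 by (smt (verit) mult_nonneg_nonneg)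
    qed
  qed
qed

lemma L2_continuous_bound:
  assumes "continuous_on UNIV f" "L2 u" "\<And>x. \<bar>f x\<bar> \<le> K * \<bar>u x\<bar>" shows "L2 f"
  by (rule L2_bound[OF assms(2) continuous_loc_integrable(2)[OF assms(1)] assms(3)])

context wave_profile
begin

text \<open>The wave satisfies \<open>\<bar>\<phi>1\<bar> = slope \<phi>\<close> and has second
  component \<open>ratio \<phi>\<close>. Through the clipping in \<open>psi\<close>,
  \<open>slope\<close> is 0 below 0 and above the top of the wave.\<close>

definition slope where "slope s = psi \<sigma> r c s / (c - \<sigma> * clamp0 (c - r) s)"

definition ratio where "ratio s = s / (c - s)"

lemma clamp_speed: "r \<le> c - \<sigma> * clamp0 (c - r) s"
  using speed_lower[OF sg, of "clamp0 (c - r) s" c r] clamp0_range[of "c - r" s] cr by simp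

lemma slope_continuous: "continuous_on UNIV slope"
proof -
  have "c - \<sigma> * clamp0 (c - r) s \<noteq> 0" for s using clamp_speed[of s] r0 by linarith
  then show ?thesis unfolding slope_def[abs_def]
    by (intro continuous_intros psi_continuous sg r0 less_imp_le[OF cr] clamp0_continuous) auto
qed

lemma slope_nonneg: "0 \<le> slope s"
  unfolding slope_def using psi_nonneg[OF sg r0 less_imp_le[OF cr], of s] clamp_speed[of s] r0 by simp

lemma slope_zero: "s \<le> 0 \<or> c - r \<le> s \<Longrightarrow> slope s = 0"
  unfolding slope_def using psi_zero[OF less_imp_le[OF cr], of s \<sigma>] by simp

lemma slope_psi: "(c - \<sigma> * s) * slope s = psi \<sigma> r c s"
proof (cases "s \<le> 0 \<or> c - r \<le> s")
  case True then show ?thesis using slope_zero psi_zero[OF less_imp_le[OF cr], of s \<sigma>] by simp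
next
  case False
  then have "clamp0 (c - r) s = s" by (intro clamp0_id) auto
  then show ?thesis using clamp_speed[of s] r0 by (simp add: slope_def)
qed

lemma slope_\<phi>: "slope (\<phi> x) = \<bar>\<phi>1 x\<bar>"
proof -
  have "(c - \<sigma> * \<phi> x) * slope (\<phi> x) = (c - \<sigma> * \<phi> x) * \<bar>\<phi>1 x\<bar>" unfolding slope_psi psi_\<phi> ..
  then show ?thesis using speed(1)[of x] r0 by simp
qed

lemma slope_linear_bound: obtains B where "B > 0" "\<And>s. \<bar>slope s\<bar> \<le> B * \<bar>s\<bar>" "\<And>s. slope s \<le> B"
proof -
  obtain B where B: "B > 0" "\<And>s. \<bar>psi \<sigma> r c s\<bar> \<le> B * \<bar>s\<bar>" using psi_bound[OF sg r0 less_imp_le[OF cr]] by blast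
  have 1: "\<bar>slope s\<bar> \<le> (B / r) * \<bar>s\<bar>" for s
  proof -
    have "\<bar>slope s\<bar> = \<bar>psi \<sigma> r c s\<bar> / (c - \<sigma> * clamp0 (c - r) s)"
      unfolding slope_def using clamp_speed[of s] r0 by simp
    also have "\<dots> \<le> (B * \<bar>s\<bar>) / r" using clamp_speed[of s] r0 B by (intro frac_le) auto
    finally show ?thesis by simp
  qed
  have 2: "slope s \<le> (B / r) * c" for s
  proof (cases "s \<le> 0 \<or> c - r \<le> s")
    case True then show ?thesis using slope_zero[OF True] B r0 cr by simp
  next
    case False
    then have "(B / r) * \<bar>s\<bar> \<le> (B / r) * c" using B r0 by (intro mult_left_mono) auto
    then show ?thesis using 1[of s] by linarith
  qed
  show ?thesis
  proof (rule that[of "B / r + (B / r) * c"])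
    show "B / r + (B / r) * c > 0" using B r0 cr by (simp add: add_pos_pos)
    show "\<bar>slope s\<bar> \<le> (B / r + (B / r) * c) * \<bar>s\<bar>" for s
      using 1[of s] B r0 cr by (simp add: distrib_right) (smt (verit) divide_nonneg_nonneg mult_nonneg_nonneg abs_ge_zero)
    show "slope s \<le> B / r + (B / r) * c" for s using 2[of s] B r0 by (smt (verit) divide_pos_pos)
  qed
qed

text \<open>The maximum has been translated to \<open>x0\<close>. The other conditions put the
  height into the range of the convexity gap and keep the coefficients \<open>c - u\<close> and
  \<open>c - \<sigma> * u\<close> at least \<open>r / 2\<close>.\<close>

definition admissible where
  "admissible u v \<eta> \<longleftrightarrow> state u v \<eta> \<and> (\<forall>x. u x \<le> u x0) \<and> \<bar>u x0 - (c - r)\<bar> \<le> (c - r) / 2 \<and>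
     \<bar>u x0 - (c - r)\<bar> \<le> r / 2 \<and> (\<forall>x. r / 2 \<le> c - \<sigma> * u x) \<and> (\<forall>x. 0 \<le> u x0 + r - \<sigma> * u x)"

lemma admissibleD:
  assumes "admissible u v \<eta>"
  shows "state u v \<eta>" "u x \<le> u x0" "\<bar>u x0 - (c - r)\<bar> \<le> (c - r) / 2" "\<bar>u x0 - (c - r)\<bar> \<le> r / 2"
    "r / 2 \<le> c - \<sigma> * u x" "0 \<le> u x0 + r - \<sigma> * u x" "r / 2 \<le> c - u x"
    "L2 (\<lambda>x. slope (u x))" "L2 (\<lambda>x. ratio (u x))" "continuous_on UNIV (\<lambda>x. slope (u x))"
    "continuous_on UNIV (\<lambda>x. ratio (u x))"
    "L2 (\<lambda>x. v x + sgn (x - x0) * slope (u x))" "\<bar>ratio (u x)\<bar> \<le> 2 / r * \<bar>u x\<bar>"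
proof -
  show a: "state u v \<eta>" "u x \<le> u x0" "\<bar>u x0 - (c - r)\<bar> \<le> (c - r) / 2" "\<bar>u x0 - (c - r)\<bar> \<le> r / 2"
    "r / 2 \<le> c - \<sigma> * u x" "0 \<le> u x0 + r - \<sigma> * u x" for x using assms by (auto simp: admissible_def)
  have "u x0 - (c - r) \<le> r / 2" using a(4) by linarith
  then have cu: "r / 2 \<le> c - u x" for x using a(2)[of x] by (simp add: field_simps)
  then show "r / 2 \<le> c - u x" .
  note D = stateD[OF a(1)]
  show cs: "continuous_on UNIV (\<lambda>x. slope (u x))" by (rule continuous_on_compose2[OF slope_continuous D(5)]) auto
  have "c - u x \<noteq> 0" for x using cu[of x] r0 by linarith
  then show ck: "continuous_on UNIV (\<lambda>x. ratio (u x))"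
    unfolding ratio_def by (intro continuous_intros D(5)) auto
  obtain B where B0: "B > 0" and B: "\<And>s. \<bar>slope s\<bar> \<le> B * \<bar>s\<bar>" and B1: "\<And>s. slope s \<le> B"
    using slope_linear_bound by blast
  show s: "L2 (\<lambda>x. slope (u x))" by (rule L2_continuous_bound[OF cs D(2)]) (rule B)
  have rb: "\<bar>ratio (u x)\<bar> \<le> 2 / r * \<bar>u x\<bar>" for x
  proof -
    have "\<bar>ratio (u x)\<bar> = \<bar>u x\<bar> / (c - u x)" using cu[of x] r0 by (simp add: ratio_def)
    also have "\<dots> \<le> \<bar>u x\<bar> / (r / 2)" using cu[of x] r0 by (intro divide_left_mono mult_pos_pos) auto
    finally show ?thesis by (simp add: mult.commute)
  qed
  then show "\<bar>ratio (u x)\<bar> \<le> 2 / r * \<bar>u x\<bar>" .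
  show "L2 (\<lambda>x. ratio (u x))" by (rule L2_continuous_bound[OF ck D(2)]) (rule rb)
  have "L2 (\<lambda>x. sgn (x - x0) * slope (u x))"
  proof (rule L2_bound[OF s])
    show "(\<lambda>x. sgn (x - x0) * slope (u x)) \<in> borel_measurable borel"
      using continuous_loc_integrable(2)[OF cs] by (simp add: borel_measurable_sgn)
    show "\<bar>sgn (x - x0) * slope (u x)\<bar> \<le> 1 * \<bar>slope (u x)\<bar>" for x by (simp add: abs_mult abs_sgn_eq)
  qed
  then show "L2 (\<lambda>x. v x + sgn (x - x0) * slope (u x))" by (rule L2_add[OF D(3)])
qed

lemma sgn_chain_integral:
  assumes u: "state u v \<eta>" and \<Psi>: "\<And>s. (\<Psi> has_real_derivative \<psi> s) (at s)" "\<Psi> 0 = 0" and c: "continuous_on UNIV \<psi>"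
    and B: "\<And>s. \<bar>\<psi> s\<bar> \<le> B * \<bar>s\<bar>"
  shows "(LINT x|lborel. sgn (x - x0) * (\<psi> (u x) * v x)) = - 2 * \<Psi> (u x0)"
    "integrable lborel (\<lambda>x. sgn (x - x0) * (\<psi> (u x) * v x))"
proof -
  note D = stateD[OF u]
  have P: "is_primitive (\<lambda>x. \<Psi> (u x)) (\<lambda>x. \<psi> (u x) * v x)"
    by (rule is_primitive_chain[OF D(1) \<Psi>(1) c])
  have cp: "continuous_on UNIV (\<lambda>x. \<psi> (u x))" by (rule continuous_on_compose2[OF c D(5)]) auto
  have i: "integrable lborel (\<lambda>x. \<psi> (u x) * v x)"
    by (rule L2_mult_integrable[OF L2_continuous_bound[OF cp D(2) B] D(3)])
  have "isCont \<Psi> 0" using \<Psi>(1) DERIV_isCont by blast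
  then have t: "((\<lambda>x. \<Psi> (u x)) \<longlongrightarrow> 0) F" if "(u \<longlongrightarrow> 0) F" for F
    using isCont_tendsto_compose[OF _ that] \<Psi>(2) by fastforce
  show "(LINT x|lborel. sgn (x - x0) * (\<psi> (u x) * v x)) = - 2 * \<Psi> (u x0)"
    by (rule is_primitive_half_integrals(3)[OF P i t[OF D(6)] t[OF D(7)]])
  show "integrable lborel (\<lambda>x. sgn (x - x0) * (\<psi> (u x) * v x))"
    by (rule integrable_bounded_mult[OF i, where N=1]) (auto simp: abs_sgn_eq borel_measurable_sgn)
qed

text \<open>Below 0 the potential dominates \<open>(c - r) u^2\<close>; on \<open>[0, c - r]\<close>
  it equals \<open>psi * slope\<close>; above \<open>c - r\<close> it is nonpositive, but only by a
  multiple of the excess height times \<open>u^2\<close>. That error is the price for working at the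
  fixed speed \<open>c\<close> instead of the speed matched to the height.\<close>

lemma potential_lower:
  assumes cu: "r / 2 \<le> c - u" and le: "u - (c - r) \<le> M"  and M: "0 \<le> M"
  shows "(c - r) * (min u 0)\<^sup>2 + (psi \<sigma> r c u) * slope u \<le> potential r c u + (1 + 2 / r\<^sup>2) * (M * u\<^sup>2)"
proof -
  have P: "0 \<le> (1 + 2 / r\<^sup>2) * (M * u\<^sup>2)" using M r0 by (intro mult_nonneg_nonneg add_nonneg_nonneg) auto
  consider "u < 0" | "0 \<le> u" "u \<le> c - r" | "c - r < u" by linarith
  then show ?thesis
  proof cases
    case 1
    have "(c - r) * 1 \<le> (c - u - r) * ((c - u + 1 / r) / (c - u))"
      using 1 cr r0 by (intro mult_mono) (auto simp: le_divide_eq)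
    then have "u\<^sup>2 * (c - r) \<le> u\<^sup>2 * ((c - u - r) * ((c - u + 1 / r) / (c - u)))" by (intro mult_left_mono) auto
    then have "(c - r) * (min u 0)\<^sup>2 \<le> potential r c u" using 1 by (simp add: potential_def mult.commute)
    then show ?thesis using P slope_zero[of u] 1 by simp
  next
    case 2
    have pos': "0 < c - \<sigma> * u" using speed_lower[OF sg 2] r0 by simp
    have "(c - \<sigma> * u) * (psi \<sigma> r c u * slope u) = psi \<sigma> r c u * ((c - \<sigma> * u) * slope u)" by (simp add: mult_ac)
    also have "\<dots> = (c - \<sigma> * u) * potential r c u"
      unfolding slope_psi using psi_sq[OF sg r0 2] by (simp add: power2_eq_square)
    finally have "(c - \<sigma> * u) * (psi \<sigma> r c u * slope u) = (c - \<sigma> * u) * potential r c u" .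
    then have "psi \<sigma> r c u * slope u = potential r c u" using pos' by simp
    then show ?thesis using P 2 by simp
  next
    case 3
    have y: "0 < c - u" using cu r0 by linarith
    have q: "(c - u + 1 / r) / (c - u) \<le> 1 + 2 / r\<^sup>2"
    proof -
      have "(c - u + 1 / r) / (c - u) = 1 + (1 / r) / (c - u)" using y by (simp add: add_divide_distrib)
      also have "(1 / r) / (c - u) \<le> (1 / r) / (r / 2)" using cu r0 y by (intro divide_left_mono mult_pos_pos) auto
      finally show ?thesis by (simp add: power2_eq_square)
    qed
    have "(u - (c - r)) * ((c - u + 1 / r) / (c - u)) \<le> M * (1 + 2 / r\<^sup>2)"
      by (rule mult_mono[OF le q M]) (use y r0 in \<open>auto intro!: divide_nonneg_nonneg add_nonneg_nonneg\<close>)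
    from mult_left_mono[OF this zero_le_power2[of u]]
    have "u\<^sup>2 * ((u - (c - r)) * ((c - u + 1 / r) / (c - u))) \<le> (1 + 2 / r\<^sup>2) * (M * u\<^sup>2)"
      by (simp only: mult_ac)
    moreover have "- potential r c u = u\<^sup>2 * ((u - (c - r)) * ((c - u + 1 / r) / (c - u)))"
    proof -
      define X where "X = (c - u + 1 / r) / (c - u)"
      have "potential r c u = u\<^sup>2 * ((c - u - r) * X)" by (simp add: potential_def X_def)
      then show ?thesis unfolding X_def[symmetric] by (simp add: algebra_simps)
    qed
    ultimately have "- potential r c u \<le> (1 + 2 / r\<^sup>2) * (M * u\<^sup>2)" by simp
    then show ?thesis using slope_zero[of u] 3 cr r0 by (simp add: min_def)
  qed
qed

text \<open>The squares dropped in the lower bound by the action are now kept. At speed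
  \<open>c\<close> the cross term integrates to a value of the antiderivative of \<open>psi\<close>
  at the height of \<open>u\<close>, which differs from \<open>action\<close> by a multiple of the
  error in height. Hence convergence of energy, moment and height makes \<open>u\<close> satisfy
  both relations of the wave in \<open>L2\<close> and lose its negative part.\<close>

lemma deficit_estimate:
  obtains B where "B > 0" "\<And>u v \<eta>. admissible u v \<eta> \<Longrightarrow>
     r / 2 * (LINT x|lborel. (v x + sgn (x - x0) * slope (u x))\<^sup>2) + r / 2 * (LINT x|lborel. (\<eta> x - ratio (u x))\<^sup>2)
       + (c - r) * (LINT x|lborel. (min (u x) 0)\<^sup>2)
     \<le> c * energy u v \<eta> - moment A \<sigma> u v \<eta> - 4 * action \<sigma> r c + B * (\<bar>u x0 - (c - r)\<bar> * (1 + energy u v \<eta>))"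
proof -
  note rc = less_imp_le[OF cr]
  obtain \<Psi> where \<Psi>: "\<And>s. (\<Psi> has_real_derivative psi \<sigma> r c s) (at s)" "\<Psi> 0 = 0" "\<Psi> (c - r) = action \<sigma> r c"
    using psi_antideriv[OF sg r0 rc] by blast
  obtain B where B: "B > 0" "\<And>s. \<bar>psi \<sigma> r c s\<bar> \<le> B * \<bar>s\<bar>" using psi_bound[OF sg r0 rc] by blast
  define P where "P = 1 + 2 / r\<^sup>2"
  have P: "0 \<le> P" unfolding P_def by simp
  show ?thesis
  \<comment> \<open>\<open>4 * (B * c)\<close> pays for replacing the height of \<open>u\<close> by
    \<open>c - r\<close> in the antiderivative, \<open>P\<close> for the part of \<open>u\<close>
    above \<open>c - r\<close>, and 1 makes the constant positive.\<close>
  proof (rule that[of "4 * (B * c) + P + 1"])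
    show "4 * (B * c) + P + 1 > 0" using B P cr r0 by (simp add: add_nonneg_pos)
    fix u v \<eta> assume adm: "admissible u v \<eta>"
    note a = admissibleD[OF adm]
    note D = stateD[OF a(1)]
    define M where "M = \<bar>u x0 - (c - r)\<bar>"
    have M: "0 \<le> M" by (simp add: M_def)
    let ?S = "\<lambda>x. sgn (x - x0) * (psi \<sigma> r c (u x) * v x)"
    let ?e = "\<lambda>x. c * ((u x)\<^sup>2 + (v x)\<^sup>2 + (\<eta> x)\<^sup>2) - ((u x)^3 + \<sigma> * u x * (v x)\<^sup>2 + 2 * u x * \<eta> x + u x * (\<eta> x)\<^sup>2 - A * (u x)\<^sup>2)"
    let ?L = "\<lambda>x. r / 2 * (v x + sgn (x - x0) * slope (u x))\<^sup>2 + r / 2 * (\<eta> x - ratio (u x))\<^sup>2 + (c - r) * (min (u x) 0)\<^sup>2"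
    have S: "(LINT x|lborel. ?S x) = - 2 * \<Psi> (u x0)" "integrable lborel ?S"
      by (rule sgn_chain_integral[OF a(1) \<Psi>(1,2) psi_continuous[OF sg r0 rc] B(2)])+
    have pt: "?L x \<le> ?e x + 2 * ?S x + P * (M * (u x)\<^sup>2)" for x
    proof -
      define s where "s = sgn (x - x0)"
      have s: "s\<^sup>2 \<le> 1" by (auto simp: s_def sgn_if)
      let ?y = "v x + s * slope (u x)"
      have "r / 2 * ?y\<^sup>2 \<le> (c - \<sigma> * u x) * ?y\<^sup>2" by (rule mult_right_mono[OF a(5)]) simp
      also have "\<dots> = (c - \<sigma> * u x) * (v x)\<^sup>2 + 2 * (s * (((c - \<sigma> * u x) * slope (u x)) * v x)) + s\<^sup>2 * (((c - \<sigma> * u x) * slope (u x)) * slope (u x))"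
        by (simp add: algebra_simps power2_eq_square)
      also have "\<dots> = (c - \<sigma> * u x) * (v x)\<^sup>2 + 2 * (s * (psi \<sigma> r c (u x) * v x)) + s\<^sup>2 * (psi \<sigma> r c (u x) * slope (u x))"
        unfolding slope_psi ..
      also have "\<dots> \<le> (c - \<sigma> * u x) * (v x)\<^sup>2 + 2 * (s * (psi \<sigma> r c (u x) * v x)) + 1 * (psi \<sigma> r c (u x) * slope (u x))"
        by (intro add_left_mono mult_right_mono s mult_nonneg_nonneg psi_nonneg sg r0 rc slope_nonneg)
      finally have 1: "r / 2 * ?y\<^sup>2 \<le> (c - \<sigma> * u x) * (v x)\<^sup>2 + 2 * (s * (psi \<sigma> r c (u x) * v x)) + psi \<sigma> r c (u x) * slope (u x)" by simp
      have 2: "r / 2 * (\<eta> x - ratio (u x))\<^sup>2 \<le> (c - u x) * (\<eta> x - u x / (c - u x))\<^sup>2"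
        unfolding ratio_def by (rule mult_right_mono[OF a(7)]) simp
      have 3: "(c - r) * (min (u x) 0)\<^sup>2 + (psi \<sigma> r c (u x)) * slope (u x) \<le> potential r c (u x) + P * (M * (u x)\<^sup>2)"
        unfolding P_def by (rule potential_lower[OF a(7) _ M]) (use a(2)[of x] in \<open>simp add: M_def abs_if\<close>)
      have "c - u x > 0" using a(7)[of x] r0 by linarith
      from density_identity[OF this A r0, of "v x" "\<eta> x" \<sigma>]
      show ?thesis using 1 2 3 unfolding s_def by linarith
    qed
    have iL: "integrable lborel (\<lambda>x. (v x + sgn (x - x0) * slope (u x))\<^sup>2)" "integrable lborel (\<lambda>x. (\<eta> x - ratio (u x))\<^sup>2)"
      using L2D(2)[OF a(12)] L2D(2)[OF L2_diff[OF D(4) a(9)]] by auto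
    have "L2 (\<lambda>x. min (u x) 0)"
    proof (rule L2_continuous_bound[OF _ D(2), of _ 1])
      show "continuous_on UNIV (\<lambda>x. min (u x) 0)" by (intro continuous_intros D(5))
      show "\<bar>min (u x) 0\<bar> \<le> 1 * \<bar>u x\<bar>" for x by (simp add: min_def)
    qed
    note iL = iL L2D(2)[OF this]
    have ie: "integrable lborel ?e"
      by (rule Bochner_Integration.integrable_diff[OF integrable_mult_right[OF D(8)] D(9)])
    have iR: "integrable lborel (\<lambda>x. ?e x + 2 * ?S x)" "integrable lborel (\<lambda>x. P * (M * (u x)\<^sup>2))"
      by (intro Bochner_Integration.integrable_add integrable_mult_right ie S(2) L2D(2)[OF D(2)])+
    have "(LINT x|lborel. ?L x) \<le> (LINT x|lborel. ?e x + 2 * ?S x + P * (M * (u x)\<^sup>2))"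
      by (rule integral_mono[OF _ Bochner_Integration.integrable_add[OF iR] pt]) (use iL in auto)
    also have "\<dots> = (LINT x|lborel. ?e x) + 2 * (LINT x|lborel. ?S x) + P * (M * (LINT x|lborel. (u x)\<^sup>2))"
      unfolding Bochner_Integration.integral_add[OF iR]
        Bochner_Integration.integral_add[OF ie integrable_mult_right[OF S(2)]] by simp
    also have "(LINT x|lborel. ?e x) = c * energy u v \<eta> - moment A \<sigma> u v \<eta>"
      unfolding energy_def moment_def
      by (subst Bochner_Integration.integral_diff[OF integrable_mult_right[OF D(8)] D(9)]) simp
    also have "2 * (LINT x|lborel. ?S x) = - 4 * \<Psi> (u x0)" using S(1) by simp
    finally have main: "(LINT x|lborel. ?L x) \<le> c * energy u v \<eta> - moment A \<sigma> u v \<eta> - 4 * \<Psi> (u x0) + P * (M * (LINT x|lborel. (u x)\<^sup>2))" by simp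
    have psiM: "\<Psi> (c - r) - \<Psi> (u x0) \<le> B * c * M"
    proof (cases "u x0 < c - r")
      case True
      obtain z where z: "u x0 < z" "z < c - r" "\<Psi> (c - r) - \<Psi> (u x0) = (c - r - u x0) * psi \<sigma> r c z"
        using MVT2[OF True, of \<Psi> "psi \<sigma> r c"] \<Psi>(1) by blast
      have u0: "0 \<le> u x0"
      proof -
        have "(c - r) - u x0 \<le> (c - r) / 2" using a(3) by linarith
        then show ?thesis using cr by (simp add: field_simps)
      qed
      have "psi \<sigma> r c z \<le> B * \<bar>z\<bar>" using B(2)[of z] by linarith
      also have "\<dots> \<le> B * c" using z u0 B(1) r0 by (intro mult_left_mono) auto
      finally have "(c - r - u x0) * psi \<sigma> r c z \<le> (c - r - u x0) * (B * c)" using True by (intro mult_left_mono) auto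
      then show ?thesis using z True by (simp add: M_def mult.commute)
    next
      case False
      then have "\<Psi> (c - r) \<le> \<Psi> (u x0)"
        by (intro DERIV_nonneg_imp_nondecreasing[of "c - r" "u x0" \<Psi>]) (use \<Psi>(1) psi_nonneg[OF sg r0 rc] in \<open>auto\<close>)
      moreover have "0 \<le> B * c * M" using B cr r0 M by simp
      ultimately show ?thesis by linarith
    qed
    have q: "P * (M * (LINT x|lborel. (u x)\<^sup>2)) \<le> P * (M * energy u v \<eta>)"
      by (intro mult_left_mono D(12) M P)
    have "(LINT x|lborel. ?L x) \<le> c * energy u v \<eta> - moment A \<sigma> u v \<eta> - 4 * action \<sigma> r c + (4 * (B * c) * M + P * (M * energy u v \<eta>))"
      using main psiM q \<Psi>(3) by linarith
    also have "4 * (B * c) * M + P * (M * energy u v \<eta>) \<le> (4 * (B * c) + P + 1) * (M * (1 + energy u v \<eta>))"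
    proof -
      have "(4 * (B * c) + P + 1) * (M * (1 + energy u v \<eta>)) - (4 * (B * c) * M + P * (M * energy u v \<eta>))
         = (4 * (B * c)) * (M * energy u v \<eta>) + P * M + M * (1 + energy u v \<eta>)" by (simp add: algebra_simps)
      also have "\<dots> \<ge> 0" using B cr r0 P M D(10) by (intro add_nonneg_nonneg mult_nonneg_nonneg) auto
      finally show ?thesis by simp
    qed
    also have "(LINT x|lborel. ?L x) = r / 2 * (LINT x|lborel. (v x + sgn (x - x0) * slope (u x))\<^sup>2) + r / 2 * (LINT x|lborel. (\<eta> x - ratio (u x))\<^sup>2)
       + (c - r) * (LINT x|lborel. (min (u x) 0)\<^sup>2)"
      using iL by simp
    finally show "r / 2 * (LINT x|lborel. (v x + sgn (x - x0) * slope (u x))\<^sup>2) + r / 2 * (LINT x|lborel. (\<eta> x - ratio (u x))\<^sup>2)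
       + (c - r) * (LINT x|lborel. (min (u x) 0)\<^sup>2)
     \<le> c * energy u v \<eta> - moment A \<sigma> u v \<eta> - 4 * action \<sigma> r c + (4 * (B * c) + P + 1) * (\<bar>u x0 - (c - r)\<bar> * (1 + energy u v \<eta>))"
      unfolding M_def by simp
  qed
qed

end

section \<open>Pointwise comparison and convergence in the energy space\<close>

context wave_profile
begin

lemma slope_along: "s = 1 \<or> s = -1 \<Longrightarrow> 0 \<le> t \<Longrightarrow> s * \<phi>1 (x0 + s * t) = - slope (\<phi> (x0 + s * t))"
  unfolding slope_\<phi> abs_slope using crit by (cases "t = 0") auto

text \<open>Read outwards from the top, \<open>u n\<close> obeys the equation of descent up to an
  error whose integral between \<open>x0\<close> and \<open>x\<close> is at most the root of the
  length times its \<open>L2\<close> norm. The loss \<open>\<beta>\<close> near the top is fixed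
  first; the resulting factor \<open>1 / \<gamma>\<close> is then absorbed by letting
  \<open>n\<close> grow.\<close>

lemma pointwise_lower_limit:
  fixes u v \<eta> :: "nat \<Rightarrow> real \<Rightarrow> real"
  assumes adm: "\<And>n. admissible (u n) (v n) (\<eta> n)"
    and M: "(\<lambda>n. u n x0) \<longlonglongrightarrow> c - r"
    and a: "(\<lambda>n. LINT x|lborel. (v n x + sgn (x - x0) * slope (u n x))\<^sup>2) \<longlonglongrightarrow> 0"
  shows "(\<lambda>n. max (\<phi> x - u n x) 0) \<longlonglongrightarrow> 0"
proof (cases "x = x0")
  case True
  have "(\<lambda>n. max (\<phi> x - u n x) 0) \<longlonglongrightarrow> max ((c - r) - (c - r)) 0"
    unfolding True top by (intro tendsto_intros M)
  then show ?thesis by simp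
next
  case False
  define s where "s = sgn (x - x0)"
  define L where "L = \<bar>x - x0\<bar>"
  have s: "s = 1 \<or> s = -1" using False by (auto simp: s_def sgn_if)
  have L: "L > 0" and x: "x = x0 + s * L" using False by (auto simp: L_def s_def sgn_if abs_if)
  have ss: "s * s = 1" using s by auto
  obtain G where G: "G > 0" "\<And>s. \<bar>slope s\<bar> \<le> G * \<bar>s\<bar>" "\<And>s. slope s \<le> G" using slope_linear_bound by blast
  define f where "f t = \<phi> (x0 + s * t)" for t
  define f1 where "f1 t = s * \<phi>1 (x0 + s * t)" for t
  have df: "(f has_real_derivative f1 t) (at t)" for t
  proof -
    have "((\<lambda>t. \<phi> (x0 + s * t)) has_real_derivative \<phi>1 (x0 + s * t) * s) (at t)"
      by (rule DERIV_chain2[OF d]) (auto intro!: derivative_eq_intros)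
    then show ?thesis unfolding f_def[abs_def] f1_def by (simp add: mult.commute)
  qed
  have cf1: "continuous_on UNIV f1"
    unfolding f1_def[abs_def] by (intro continuous_intros continuous_on_compose2[OF cont(2)]) auto
  have neg: "f1 t < 0" if "0 < t" for t
    using s left[of "x0 - t"] right[of "x0 + t"] that by (auto simp: f1_def)
  have fg: "f1 t = - slope (f t)" if "0 \<le> t" for t using slope_along[OF s that] by (simp add: f1_def f_def)
  define rn where "rn n y = v n y + sgn (y - x0) * slope (u n y)" for n y
  define an where "an n = (LINT y|lborel. (rn n y)\<^sup>2)" for n
  have an: "an \<longlonglongrightarrow> 0" using a by (simp add: an_def[abs_def] rn_def)
  have I: "(LINT t:{0..L}|lborel. \<bar>s * v n (x0 + s * t) + slope (u n (x0 + s * t))\<bar>) \<le> sqrt L * sqrt (an n)" for n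
  proof -
    have Lr: "L2 (rn n)" unfolding rn_def by (rule admissibleD(12)[OF adm])
    have s0: "s \<noteq> 0" using s by auto
    have [measurable]: "rn n \<in> borel_measurable borel" using Lr by (simp add: L2_def)
    note adm' = admissibleD[OF adm[of n]]
    have mv[measurable]: "v n \<in> borel_measurable borel" using stateD(3)[OF adm'(1)] by (simp add: L2_def)
    have ms[measurable]: "(\<lambda>x. slope (u n x)) \<in> borel_measurable borel" using adm'(8) by (simp add: L2_def)
    have ir: "integrable lborel (\<lambda>t. (rn n (x0 + s * t))\<^sup>2)"
      using lborel_integrable_real_affine[OF L2D(2)[OF Lr] s0, of x0] by simp
    have er: "(LINT t|lborel. (rn n (x0 + s * t))\<^sup>2) = an n"
      using lborel_integral_real_affine[OF s0, of "\<lambda>y. (rn n y)\<^sup>2" x0] s by (auto simp: an_def)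
    have L1: "L2 (\<lambda>t. \<bar>rn n (x0 + s * t)\<bar>)" using ir by (simp add: L2_def)
    have isq: "(indicator {0..L} t :: real)\<^sup>2 = indicator {0..L} t" for t by (simp add: indicator_def)
    have L2i: "L2 (indicator {0..L})" unfolding L2_def isq
      using continuous_loc_integrable(1)[of "\<lambda>_. 1" 0 L] by (simp add: set_integrable_def)
    have "(LINT t:{0..L}|lborel. \<bar>s * v n (x0 + s * t) + slope (u n (x0 + s * t))\<bar>) = (LINT t|lborel. indicator {0..L} t * \<bar>rn n (x0 + s * t)\<bar>)"
      unfolding set_lebesgue_integral_def
    proof (rule integral_cong_AE)
      have "s * v n (x0 + s * t) + slope (u n (x0 + s * t)) = s * rn n (x0 + s * t)" if "t > 0" for t
        using s that by (auto simp: rn_def)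
      then have "\<bar>s * v n (x0 + s * t) + slope (u n (x0 + s * t))\<bar> = \<bar>rn n (x0 + s * t)\<bar>" if "t > 0" for t
        using s that by (auto simp: abs_mult)
      then show "AE t in lborel. indicator {0..L} t *\<^sub>R \<bar>s * v n (x0 + s * t) + slope (u n (x0 + s * t))\<bar> = indicator {0..L} t * \<bar>rn n (x0 + s * t)\<bar>"
        using AE_lborel_singleton[of "0::real"] by (elim AE_mp) (auto intro!: AE_I2 simp: indicator_def)
      show "(\<lambda>t. indicator {0..L} t *\<^sub>R \<bar>s * v n (x0 + s * t) + slope (u n (x0 + s * t))\<bar>) \<in> borel_measurable lborel"
        using measurable_compose[OF _ ms, of "\<lambda>t. x0 + s * t" borel] by simp
    qed simp
    also have "\<dots> \<le> sqrt (LINT t|lborel. (indicator {0..L} t)\<^sup>2) * sqrt (LINT t|lborel. (\<bar>rn n (x0 + s * t)\<bar>)\<^sup>2)"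
      using L2_cauchy_schwarz[OF L2i L1] by linarith
    also have "(LINT t|lborel. (indicator {0..L} t)\<^sup>2) = L"
      unfolding isq using L by simp
    finally show ?thesis by (simp add: er)
  qed
  show ?thesis
  proof (rule LIMSEQ_I)
    fix e :: real assume e: "e > 0"
    \<comment> \<open>Half of the tolerance is spent on the time lost near the top;
      \<open>L / 2\<close> keeps \<open>\<beta>\<close> inside the segment.\<close>
    define \<beta> where "\<beta> = min (e / (2 * (G + 1))) (L / 2)"
    have b: "0 < \<beta>" "\<beta> < L" "(G + 1) * \<beta> \<le> e / 2"
    proof -
      show "0 < \<beta>" "\<beta> < L" using e G L by (auto simp: \<beta>_def min_less_iff_disj)
      have "(G + 1) * \<beta> \<le> (G + 1) * (e / (2 * (G + 1)))" using G by (intro mult_left_mono) (auto simp: \<beta>_def)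
      also have "\<dots> = e / 2" using G by (simp add: field_simps)
      finally show "(G + 1) * \<beta> \<le> e / 2" .
    qed
    obtain \<gamma> where \<gamma>: "\<gamma> > 0" "\<And>u v. is_primitive u v \<Longrightarrow>
      f L - u L \<le> (G + 1) * (\<beta> + (\<bar>u 0 - f 0\<bar> + (LINT t:{0..L}|lborel. \<bar>v t + slope (u t)\<bar>)) / \<gamma>)"
      using travel_time_comparison[OF slope_continuous slope_nonneg G(3) df cf1 fg neg b(1,2)] by blast
    have bd: "\<phi> x - u n x \<le> (G + 1) * (\<beta> + (\<bar>u n x0 - (c - r)\<bar> + sqrt L * sqrt (an n)) / \<gamma>)" for n
    proof -
      have P: "is_primitive (\<lambda>t. u n (x0 + s * t)) (\<lambda>t. s * v n (x0 + s * t))"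
        by (rule is_primitive_affine[OF stateD(1)[OF admissibleD(1)[OF adm]] s])
      have "\<phi> x - u n x \<le> (G + 1) * (\<beta> + (\<bar>u n x0 - (c - r)\<bar> + (LINT t:{0..L}|lborel. \<bar>s * v n (x0 + s * t) + slope (u n (x0 + s * t))\<bar>)) / \<gamma>)"
        using \<gamma>(2)[OF P] by (simp add: f_def x top)
      also have "\<dots> \<le> (G + 1) * (\<beta> + (\<bar>u n x0 - (c - r)\<bar> + sqrt L * sqrt (an n)) / \<gamma>)"
        using G \<gamma>(1) I[of n] by (intro mult_left_mono add_left_mono divide_right_mono) auto
      finally show ?thesis .
    qed
    have "(\<lambda>n. (G + 1) * (\<beta> + (\<bar>u n x0 - (c - r)\<bar> + sqrt L * sqrt (an n)) / \<gamma>)) \<longlonglongrightarrow> (G + 1) * (\<beta> + (\<bar>(c - r) - (c - r)\<bar> + sqrt L * sqrt 0) / \<gamma>)"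
      by (intro tendsto_intros M an) (use \<gamma> in auto)
    then have "(\<lambda>n. (G + 1) * (\<beta> + (\<bar>u n x0 - (c - r)\<bar> + sqrt L * sqrt (an n)) / \<gamma>)) \<longlonglongrightarrow> (G + 1) * \<beta>" by simp
    then have "eventually (\<lambda>n. (G + 1) * (\<beta> + (\<bar>u n x0 - (c - r)\<bar> + sqrt L * sqrt (an n)) / \<gamma>) < e) sequentially"
      by (rule order_tendstoD(2)) (use b(3) e in linarith)
    then obtain N where N: "\<And>n. n \<ge> N \<Longrightarrow> (G + 1) * (\<beta> + (\<bar>u n x0 - (c - r)\<bar> + sqrt L * sqrt (an n)) / \<gamma>) < e"
      by (auto simp: eventually_sequentially)
    show "\<exists>no. \<forall>n\<ge>no. norm (max (\<phi> x - u n x) 0 - 0) < e"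
    proof (intro exI allI impI)
      fix n assume "N \<le> n"
      then have "\<phi> x - u n x < e" using N[of n] bd[of n] by linarith
      then show "norm (max (\<phi> x - u n x) 0 - 0) < e" using e by (simp add: max_def)
    qed
  qed
qed

text \<open>In \<open>(u - \<phi>)^2 = u^2 - \<phi>^2 + 2 \<phi> (\<phi> - u)\<close> and its
  analogue for \<open>ratio\<close>, the cross terms are bounded by the positive part of
  \<open>\<phi> - u\<close>, because \<open>\<phi>\<close> and \<open>\<eta>\<phi>\<close> are
  positive and \<open>ratio\<close> is increasing. The constant comes from
  \<open>c - \<phi> \<ge> r\<close>, \<open>c - u \<ge> r / 2\<close> and
  \<open>\<eta>\<phi> \<le> \<phi> / r\<close>.\<close>

lemma convexity_gap:
  assumes cu: "r / 2 \<le> c - u"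
  shows "(u - \<phi> x)\<^sup>2 + (ratio u - \<eta>\<phi> x)\<^sup>2 \<le> (u\<^sup>2 + (ratio u)\<^sup>2) - ((\<phi> x)\<^sup>2 + (\<eta>\<phi> x)\<^sup>2) + (2 + 4 * c / r^3) * (\<phi> x * max (\<phi> x - u) 0)"
proof -
  have y: "r \<le> c - \<phi> x" and p: "0 < \<phi> x" using speed pos by auto
  have u: "0 < c - u" using cu r0 by linarith
  have d: "\<eta>\<phi> x - ratio u \<le> (2 * c / r\<^sup>2) * max (\<phi> x - u) 0"
  proof (cases "u \<le> \<phi> x")
    case True
    have "\<eta>\<phi> x - ratio u = c * (\<phi> x - u) / ((c - \<phi> x) * (c - u))"
      unfolding \<eta>\<phi>_def ratio_def using u y r0 by (simp add: field_simps)
    also have "\<dots> \<le> c * (\<phi> x - u) / (r * (r / 2))"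
      using True cu y r0 u cr by (intro divide_left_mono mult_mono mult_nonneg_nonneg mult_pos_pos) auto
    also have "\<dots> = (2 * c / r\<^sup>2) * (\<phi> x - u)" by (simp add: power2_eq_square)
    also have "\<phi> x - u = max (\<phi> x - u) 0" using True by simp
    finally show ?thesis .
  next
    case False
    have "ratio u - \<eta>\<phi> x = c * (u - \<phi> x) / ((c - \<phi> x) * (c - u))"
      unfolding \<eta>\<phi>_def ratio_def using u y r0 by (simp add: field_simps)
    also have "\<dots> \<ge> 0" using False u y r0 cr by (intro divide_nonneg_nonneg mult_nonneg_nonneg) auto
    finally show ?thesis using False by (simp add: max_def)
  qed
  have "\<eta>\<phi> x * (\<eta>\<phi> x - ratio u) \<le> \<eta>\<phi> x * ((2 * c / r\<^sup>2) * max (\<phi> x - u) 0)"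
    using \<eta>\<phi>_bounds[of x] by (intro mult_left_mono d) auto
  also have "\<dots> \<le> (\<phi> x / r) * ((2 * c / r\<^sup>2) * max (\<phi> x - u) 0)"
    using \<eta>\<phi>_bounds[of x] cr r0 by (intro mult_right_mono mult_nonneg_nonneg) auto
  also have "\<dots> = (2 * c / r^3) * (\<phi> x * max (\<phi> x - u) 0)"
    using r0 by (simp add: power2_eq_square power3_eq_cube mult_ac)
  finally have 1: "\<eta>\<phi> x * (\<eta>\<phi> x - ratio u) \<le> (2 * c / r^3) * (\<phi> x * max (\<phi> x - u) 0)" .
  have 2: "\<phi> x * (\<phi> x - u) \<le> \<phi> x * max (\<phi> x - u) 0" using p by (intro mult_left_mono) auto
  have "(u - \<phi> x)\<^sup>2 + (ratio u - \<eta>\<phi> x)\<^sup>2 = (u\<^sup>2 + (ratio u)\<^sup>2) - ((\<phi> x)\<^sup>2 + (\<eta>\<phi> x)\<^sup>2) + 2 * (\<phi> x * (\<phi> x - u)) + 2 * (\<eta>\<phi> x * (\<eta>\<phi> x - ratio u))"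
    by (simp add: power2_eq_square algebra_simps)
  also have "\<dots> \<le> (u\<^sup>2 + (ratio u)\<^sup>2) - ((\<phi> x)\<^sup>2 + (\<eta>\<phi> x)\<^sup>2) + 2 * (\<phi> x * max (\<phi> x - u) 0) + 2 * ((2 * c / r^3) * (\<phi> x * max (\<phi> x - u) 0))"
    using 1 2 by linarith
  finally show ?thesis by (simp add: algebra_simps)
qed

text \<open>The norm of \<open>v n\<close> is determined by the height and \<open>\<eta> n\<close>
  is tied to \<open>ratio (u n)\<close>, so the energy determines the limit of the norm of the pair
  \<open>(u n, ratio (u n))\<close>. Together with the one-sided pointwise limit this gives strong
  convergence.\<close>

lemma stability_sequence:
  fixes u v \<eta> :: "nat \<Rightarrow> real \<Rightarrow> real"
  assumes adm: "\<And>n. admissible (u n) (v n) (\<eta> n)"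
    and E: "(\<lambda>n. energy (u n) (v n) (\<eta> n)) \<longlonglongrightarrow> energy \<phi> \<phi>1 \<eta>\<phi>"
    and F: "(\<lambda>n. moment A \<sigma> (u n) (v n) (\<eta> n)) \<longlonglongrightarrow> moment A \<sigma> \<phi> \<phi>1 \<eta>\<phi>"
  shows "(\<lambda>n. LINT x|lborel. (u n x - \<phi> x)\<^sup>2 + (v n x - \<phi>1 x)\<^sup>2 + (\<eta> n x - \<eta>\<phi> x)\<^sup>2) \<longlonglongrightarrow> 0"
proof -
  note adm' = admissibleD[OF adm]
  note D = stateD[OF adm'(1)] and D\<phi> = stateD[OF state_\<phi>]
  define En where "En n = energy (u n) (v n) (\<eta> n)" for n
  define Fn where "Fn n = moment A \<sigma> (u n) (v n) (\<eta> n)" for n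
  define E0 where "E0 = energy \<phi> \<phi>1 \<eta>\<phi>"
  define F0 where "F0 = moment A \<sigma> \<phi> \<phi>1 \<eta>\<phi>"
  note E = E[folded En_def E0_def] and F = F[folded Fn_def F0_def]
  define m where "m = c - r"
  have M: "(\<lambda>n. u n x0) \<longlonglongrightarrow> m"
  proof -
    obtain \<kappa> where k: "\<kappa> > 0" "\<And>u v \<eta>. state u v \<eta> \<Longrightarrow> (\<And>x. u x \<le> u x0) \<Longrightarrow> (\<And>x. 0 \<le> u x0 + r - \<sigma> * u x) \<Longrightarrow>
      \<bar>u x0 - (c - r)\<bar> \<le> (c - r) / 2 \<Longrightarrow>
      \<kappa> * (u x0 - (c - r))\<^sup>2 \<le> (u x0 + r) * (energy u v \<eta> - energy \<phi> \<phi>1 \<eta>\<phi>) - (moment A \<sigma> u v \<eta> - moment A \<sigma> \<phi> \<phi>1 \<eta>\<phi>)"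
      using height_estimate by blast
    have b: "\<bar>(u n x0 - m)\<^sup>2\<bar> \<le> ((2 * c) * \<bar>En n - E0\<bar> + \<bar>Fn n - F0\<bar>) / \<kappa>" for n
    proof -
      have "\<kappa> * (u n x0 - m)\<^sup>2 \<le> (u n x0 + r) * (En n - E0) - (Fn n - F0)"
        unfolding m_def En_def Fn_def E0_def F0_def by (rule k(2)) (rule adm')+
      also have "\<dots> \<le> \<bar>u n x0 + r\<bar> * \<bar>En n - E0\<bar> + \<bar>Fn n - F0\<bar>"
        using abs_ge_self[of "(u n x0 + r) * (En n - E0)"] by (simp add: abs_mult)
      also have "\<bar>u n x0 + r\<bar> * \<bar>En n - E0\<bar> \<le> (2 * c) * \<bar>En n - E0\<bar>"
      proof (rule mult_right_mono)
        have "u n x0 - (c - r) \<le> r / 2" "(c - r) - u n x0 \<le> r / 2" using adm'(4)[of n] by linarith+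
        then show "\<bar>u n x0 + r\<bar> \<le> 2 * c" using cr r0 by (simp add: abs_le_iff field_simps)
      qed simp
      finally show ?thesis using k(1) by (simp add: le_divide_eq mult.commute)
    qed
    have "(\<lambda>n. ((2 * c) * \<bar>En n - E0\<bar> + \<bar>Fn n - F0\<bar>) / \<kappa>) \<longlonglongrightarrow> ((2 * c) * \<bar>E0 - E0\<bar> + \<bar>F0 - F0\<bar>) / \<kappa>"
      by (intro tendsto_intros E F) (use k in auto)
    then have "(\<lambda>n. ((2 * c) * \<bar>En n - E0\<bar> + \<bar>Fn n - F0\<bar>) / \<kappa>) \<longlonglongrightarrow> 0" by simp
    then have "(\<lambda>n. (u n x0 - m)\<^sup>2) \<longlonglongrightarrow> 0"
      by (rule Lim_null_comparison[rotated]) (use b in \<open>auto intro!: always_eventually\<close>)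
    then have "(\<lambda>n. u n x0 - m) \<longlonglongrightarrow> 0" by (rule sq_tendsto_zero)
    then show ?thesis by (rule LIM_zero_cancel)
  qed
  define rn where "rn n x = v n x + sgn (x - x0) * slope (u n x)" for n x
  define an where "an n = (LINT x|lborel. (rn n x)\<^sup>2)" for n
  define bn where "bn n = (LINT x|lborel. (\<eta> n x - ratio (u n x))\<^sup>2)" for n
  define wn where "wn n = (LINT x|lborel. (min (u n x) 0)\<^sup>2)" for n
  have Lr: "L2 (rn n)" for n unfolding rn_def by (rule adm')
  have Lb: "L2 (\<lambda>x. \<eta> n x - ratio (u n x))" for n by (rule L2_diff[OF D(4) adm'(9)])
  have Lw: "L2 (\<lambda>x. min (u n x) 0)" for n
  proof (rule L2_continuous_bound[OF _ D(2), of _ 1])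
    show "continuous_on UNIV (\<lambda>x. min (u n x) 0)" by (intro continuous_intros D(5))
    show "\<bar>min (u n x) 0\<bar> \<le> 1 * \<bar>u n x\<bar>" for x by (simp add: min_def)
  qed
  have nn: "0 \<le> an n" "0 \<le> bn n" "0 \<le> wn n" for n unfolding an_def bn_def wn_def by (auto intro!: integral_nonneg_AE)
  have lims: "an \<longlonglongrightarrow> 0" "bn \<longlonglongrightarrow> 0" "wn \<longlonglongrightarrow> 0"
  proof -
    obtain B where B: "B > 0" "\<And>u v \<eta>. admissible u v \<eta> \<Longrightarrow>
     r / 2 * (LINT x|lborel. (v x + sgn (x - x0) * slope (u x))\<^sup>2) + r / 2 * (LINT x|lborel. (\<eta> x - ratio (u x))\<^sup>2)
       + (c - r) * (LINT x|lborel. (min (u x) 0)\<^sup>2)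
     \<le> c * energy u v \<eta> - moment A \<sigma> u v \<eta> - 4 * action \<sigma> r c + B * (\<bar>u x0 - (c - r)\<bar> * (1 + energy u v \<eta>))"
      using deficit_estimate by blast
    define Z where "Z n = c * En n - Fn n - (c * E0 - F0) + B * (\<bar>u n x0 - m\<bar> * (1 + En n))" for n
    have le: "r / 2 * an n + r / 2 * bn n + (c - r) * wn n \<le> Z n" for n
      using B(2)[OF adm[of n]] action_\<phi> unfolding an_def bn_def wn_def rn_def Z_def En_def Fn_def E0_def F0_def m_def by linarith
    have "Z \<longlonglongrightarrow> c * E0 - F0 - (c * E0 - F0) + B * (\<bar>m - m\<bar> * (1 + E0))"
      unfolding Z_def[abs_def] by (intro tendsto_intros E F M)
    then have Z: "Z \<longlonglongrightarrow> 0" by simp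
    have null: "q \<longlonglongrightarrow> 0" if "\<And>n. 0 \<le> q n" "k > 0" "\<And>n. k * q n \<le> Z n" for q :: "nat \<Rightarrow> real" and k
    proof -
      have "(\<lambda>n. Z n / k) \<longlonglongrightarrow> 0 / k" by (intro tendsto_intros Z) (use that in auto)
      then have "(\<lambda>n. Z n / k) \<longlonglongrightarrow> 0" by simp
      then show ?thesis
        by (rule Lim_null_comparison[rotated]) (use that in \<open>auto intro!: always_eventually simp: le_divide_eq mult.commute\<close>)
    qed
    have p: "0 \<le> r / 2 * an n" "0 \<le> r / 2 * bn n" "0 \<le> (c - r) * wn n" for n
      using nn[of n] r0 cr by auto
    have "r / 2 * an n \<le> Z n" for n using le[of n] p[of n] by linarith
    then show "an \<longlonglongrightarrow> 0" by (rule null[rotated 2]) (use nn r0 cr in auto)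
    have "r / 2 * bn n \<le> Z n" for n using le[of n] p[of n] by linarith
    then show "bn \<longlonglongrightarrow> 0" by (rule null[rotated 2]) (use nn r0 cr in auto)
    have "(c - r) * wn n \<le> Z n" for n using le[of n] p[of n] by linarith
    then show "wn \<longlonglongrightarrow> 0" by (rule null[rotated 2]) (use nn r0 cr in auto)
  qed
  \<comment> \<open>The norm of \<open>v n\<close> converges before \<open>v n\<close> does:
    \<open>v n\<close> is close to \<open>- sgn (x - x0) * slope (u n)\<close>, whose integral
    against \<open>v n\<close> depends only on the height of \<open>u n\<close>.\<close>
  define Vn where "Vn n = (LINT x|lborel. (v n x)\<^sup>2)" for n
  define V where "V = (LINT x|lborel. (\<phi>1 x)\<^sup>2)"
  have V: "Vn \<longlonglongrightarrow> V"
  proof -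
    obtain \<Gamma> where \<Gamma>: "\<And>s. (\<Gamma> has_real_derivative slope s) (at s)" using ex_antideriv[OF slope_continuous] by blast
    define \<Gamma>0 where "\<Gamma>0 s = \<Gamma> s - \<Gamma> 0" for s
    have G: "(\<Gamma>0 has_real_derivative slope s) (at s)" "\<Gamma>0 0 = 0" for s
      unfolding \<Gamma>0_def by (auto intro!: derivative_eq_intros \<Gamma>)
    obtain B where B: "B > 0" "\<And>s. \<bar>slope s\<bar> \<le> B * \<bar>s\<bar>" "\<And>s. slope s \<le> B" using slope_linear_bound by blast
    have S: "(LINT x|lborel. sgn (x - x0) * (slope (u n x) * v n x)) = - 2 * \<Gamma>0 (u n x0)"
      "integrable lborel (\<lambda>x. sgn (x - x0) * (slope (u n x) * v n x))" for n
      by (rule sgn_chain_integral[OF adm'(1) G slope_continuous B(2)])+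
    have eq: "Vn n = (LINT x|lborel. rn n x * v n x) + 2 * \<Gamma>0 (u n x0)" for n
    proof -
      have "Vn n = (LINT x|lborel. rn n x * v n x - sgn (x - x0) * (slope (u n x) * v n x))"
        unfolding Vn_def rn_def by (rule Bochner_Integration.integral_cong) (auto simp: power2_eq_square algebra_simps)
      then show ?thesis
        using Bochner_Integration.integral_diff[OF L2_mult_integrable[OF Lr D(3)] S(2), of n n] S(1)[of n] by simp
    qed
    have V2: "V = 2 * \<Gamma>0 m"
    proof -
      have "V = (LINT x|lborel. slope (\<phi> x) * \<bar>\<phi>1 x\<bar>)"
        unfolding V_def slope_\<phi> by (rule Bochner_Integration.integral_cong) (auto simp: power2_eq_square)
      then show ?thesis using chain_\<phi>_integral[OF G slope_continuous B(2)] by (simp add: m_def)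
    qed
    have "(\<lambda>n. LINT x|lborel. rn n x * v n x) \<longlonglongrightarrow> 0"
    proof (rule Lim_null_comparison)
      have "\<bar>LINT x|lborel. rn n x * v n x\<bar> \<le> sqrt (an n) * sqrt (En n)" for n
        using L2_cauchy_schwarz[OF Lr D(3), of n n] mult_left_mono[OF real_sqrt_le_mono[OF D(13)[of n]], of "sqrt (an n)"] nn[of n]
        unfolding an_def[symmetric] En_def by simp
      then show "eventually (\<lambda>n. norm (LINT x|lborel. rn n x * v n x) \<le> sqrt (an n) * sqrt (En n)) sequentially" by simp
      have "(\<lambda>n. sqrt (an n) * sqrt (En n)) \<longlonglongrightarrow> sqrt 0 * sqrt E0" by (intro tendsto_intros lims E)
      then show "(\<lambda>n. sqrt (an n) * sqrt (En n)) \<longlonglongrightarrow> 0" by simp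
    qed
    moreover have "(\<lambda>n. \<Gamma>0 (u n x0)) \<longlonglongrightarrow> \<Gamma>0 m"
      by (rule isCont_tendsto_compose[OF _ M]) (use G DERIV_isCont in blast)
    ultimately have "Vn \<longlonglongrightarrow> 0 + 2 * \<Gamma>0 m" unfolding eq by (intro tendsto_intros)
    then show ?thesis using V2 by simp
  qed
  define Nn where "Nn n = (LINT x|lborel. (\<eta> n x)\<^sup>2)" for n
  define Kn where "Kn n = (LINT x|lborel. (ratio (u n x))\<^sup>2)" for n
  define Qn where "Qn n = (LINT x|lborel. (u n x)\<^sup>2)" for n
  \<comment> \<open>The difference of squares factors into a difference that tends to 0 in
    \<open>L2\<close> and a sum that stays bounded by the energy.\<close>
  have NK: "(\<lambda>n. Nn n - Kn n) \<longlonglongrightarrow> 0"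
  proof (rule Lim_null_comparison)
    define C where "C = 2 + 2 * (2 / r)\<^sup>2"
    have "\<bar>Nn n - Kn n\<bar> \<le> sqrt (bn n) * sqrt (C * En n)" for n
    proof -
      have Ls: "L2 (\<lambda>x. \<eta> n x + ratio (u n x))" by (rule L2_add[OF D(4) adm'(9)])
      have "Nn n - Kn n = (LINT x|lborel. (\<eta> n x)\<^sup>2 - (ratio (u n x))\<^sup>2)"
        unfolding Nn_def Kn_def using L2D(2)[OF D(4)[of n]] L2D(2)[OF adm'(9)[of n]] by simp
      also have "\<dots> = (LINT x|lborel. (\<eta> n x - ratio (u n x)) * (\<eta> n x + ratio (u n x)))"
        by (rule Bochner_Integration.integral_cong) (auto simp: power2_eq_square algebra_simps)
      finally have "\<bar>Nn n - Kn n\<bar> \<le> sqrt (bn n) * sqrt (LINT x|lborel. (\<eta> n x + ratio (u n x))\<^sup>2)"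
        using L2_cauchy_schwarz[OF Lb Ls] by (simp add: bn_def)
      also have "(LINT x|lborel. (\<eta> n x + ratio (u n x))\<^sup>2) \<le> C * En n"
      proof -
        have "(LINT x|lborel. (\<eta> n x + ratio (u n x))\<^sup>2) \<le> (LINT x|lborel. C * ((u n x)\<^sup>2 + (v n x)\<^sup>2 + (\<eta> n x)\<^sup>2))"
        proof (rule integral_mono[OF L2D(2)[OF Ls] integrable_mult_right[OF D(8)]])
          fix x
          have "(ratio (u n x))\<^sup>2 \<le> (2 / r)\<^sup>2 * (u n x)\<^sup>2"
            using power_mono[OF adm'(13)[of n x] abs_ge_zero, of 2] unfolding power_mult_distrib power2_abs .
          moreover have "(\<eta> n x + ratio (u n x))\<^sup>2 \<le> 2 * (\<eta> n x)\<^sup>2 + 2 * (ratio (u n x))\<^sup>2"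
            using zero_le_power2[of "\<eta> n x - ratio (u n x)"] by (simp add: power2_eq_square algebra_simps)
          ultimately have "(\<eta> n x + ratio (u n x))\<^sup>2 \<le> 2 * (\<eta> n x)\<^sup>2 + 2 * ((2 / r)\<^sup>2 * (u n x)\<^sup>2)" by linarith
          also have "\<dots> \<le> C * (\<eta> n x)\<^sup>2 + C * (u n x)\<^sup>2 + C * (v n x)\<^sup>2"
          proof -
            have "2 * (\<eta> n x)\<^sup>2 \<le> C * (\<eta> n x)\<^sup>2" "2 * (2 / r)\<^sup>2 * (u n x)\<^sup>2 \<le> C * (u n x)\<^sup>2" "0 \<le> C * (v n x)\<^sup>2"
              unfolding C_def by (intro mult_right_mono mult_nonneg_nonneg add_nonneg_nonneg; simp)+
            then show ?thesis by simp
          qed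
          finally show "(\<eta> n x + ratio (u n x))\<^sup>2 \<le> C * ((u n x)\<^sup>2 + (v n x)\<^sup>2 + (\<eta> n x)\<^sup>2)" by (simp add: algebra_simps)
        qed
        then show ?thesis by (simp add: En_def energy_def)
      qed
      finally show ?thesis using nn[of n] by (simp add: mult_left_mono)
    qed
    then show "eventually (\<lambda>n. norm (Nn n - Kn n) \<le> sqrt (bn n) * sqrt (C * En n)) sequentially" by simp
    have "(\<lambda>n. sqrt (bn n) * sqrt (C * En n)) \<longlonglongrightarrow> sqrt 0 * sqrt (C * E0)" by (intro tendsto_intros lims E)
    then show "(\<lambda>n. sqrt (bn n) * sqrt (C * En n)) \<longlonglongrightarrow> 0" by simp
  qed
  have split: "energy a b h = (LINT x|lborel. (a x)\<^sup>2) + (LINT x|lborel. (b x)\<^sup>2) + (LINT x|lborel. (h x)\<^sup>2)" if "state a b h" for a b h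
    unfolding energy_def using stateD(2-4)[OF that] by (simp add: L2_def)
  define QK where "QK = (LINT x|lborel. (\<phi> x)\<^sup>2) + (LINT x|lborel. (\<eta>\<phi> x)\<^sup>2)"
  \<comment> \<open>Subtracting the other two contributions from the energy leaves the norm of
    \<open>(u n, ratio (u n))\<close>, which therefore tends to that of the wave.\<close>
  have QKn: "(\<lambda>n. Qn n + Kn n) \<longlonglongrightarrow> QK"
  proof -
    have e1: "Qn n + Kn n = En n - Vn n - (Nn n - Kn n)" for n
      using split[OF adm'(1), of n] by (simp add: En_def Qn_def Vn_def Nn_def)
    have e2: "QK = E0 - V - 0" using split[OF state_\<phi>] by (simp add: QK_def E0_def V_def)
    show ?thesis unfolding e1 e2 by (rule tendsto_diff[OF tendsto_diff[OF E V] NK])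
  qed
  define zn where "zn n = (LINT x|lborel. \<phi> x * max (\<phi> x - u n x) 0)" for n
  have mphi[measurable]: "\<phi> \<in> borel_measurable borel" using L\<phi> by (simp add: L2_def)
  have mu[measurable]: "u n \<in> borel_measurable borel" for n using D(2)[of n] by (simp add: L2_def)
  have Lmax: "L2 (\<lambda>x. max (\<phi> x - u n x) 0)" for n
  proof (rule L2_continuous_bound[OF _ L2_diff[OF L\<phi> D(2)[of n]], of _ 1])
    show "continuous_on UNIV (\<lambda>x. max (\<phi> x - u n x) 0)" by (intro continuous_intros D(5) cont)
  qed simp
  have z: "zn \<longlonglongrightarrow> 0"
  proof (rule Lim_null_comparison)
    \<comment> \<open>For negative \<open>u n\<close> the integrand is not dominated by
      \<open>\<phi>^2\<close>, so \<open>u n\<close> is cut at 0 first; its negative part is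
      estimated by its own norm, which tends to 0.\<close>
    define yn where "yn n = (LINT x|lborel. \<phi> x * max (\<phi> x - max (u n x) 0) 0)" for n
    have iy: "integrable lborel (\<lambda>x. \<phi> x * max (\<phi> x - max (u n x) 0) 0)" for n
    proof (rule Bochner_Integration.integrable_bound[OF L2D(2)[OF L\<phi>]])
      have "\<phi> x * max (\<phi> x - max (u n x) 0) 0 \<le> \<phi> x * \<phi> x" for x using pos[of x] by (intro mult_left_mono) auto
      then show "AE x in lborel. norm (\<phi> x * max (\<phi> x - max (u n x) 0) 0) \<le> norm ((\<phi> x)\<^sup>2)"
        using pos by (intro AE_I2) (auto simp: power2_eq_square abs_mult less_imp_le)
    qed simp
    have "yn \<longlonglongrightarrow> (LINT (x::real)|lborel. (0::real))"
      unfolding yn_def[abs_def]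
    proof (rule integral_dominated_convergence[where w = "\<lambda>x. (\<phi> x)\<^sup>2"])
      show "integrable lborel (\<lambda>x. (\<phi> x)\<^sup>2)" by (rule L2D(2)[OF L\<phi>])
      have "(\<lambda>n. \<phi> x * max (\<phi> x - max (u n x) 0) 0) \<longlonglongrightarrow> 0" for x
      proof (rule Lim_null_comparison)
        have pl: "(\<lambda>n. max (\<phi> x - u n x) 0) \<longlonglongrightarrow> 0"
          by (rule pointwise_lower_limit[OF adm M[unfolded m_def]]) (use lims(1) in \<open>simp add: an_def[abs_def] rn_def\<close>)
        have "(\<lambda>n. \<phi> x * max (\<phi> x - u n x) 0) \<longlonglongrightarrow> \<phi> x * 0" by (intro tendsto_intros pl)
        then show "(\<lambda>n. \<phi> x * max (\<phi> x - u n x) 0) \<longlonglongrightarrow> 0" by simp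
        have "\<phi> x * max (\<phi> x - max (u n x) 0) 0 \<le> \<phi> x * max (\<phi> x - u n x) 0" for n using pos[of x] by (intro mult_left_mono) auto
        then show "eventually (\<lambda>n. norm (\<phi> x * max (\<phi> x - max (u n x) 0) 0) \<le> \<phi> x * max (\<phi> x - u n x) 0) sequentially"
          using pos[of x] by (auto simp: abs_mult)
      qed
      then show "AE x in lborel. (\<lambda>n. \<phi> x * max (\<phi> x - max (u n x) 0) 0) \<longlonglongrightarrow> 0" by simp
      have "\<phi> x * max (\<phi> x - max (u n x) 0) 0 \<le> \<phi> x * \<phi> x" for n x using pos[of x] by (intro mult_left_mono) auto
      then show "AE x in lborel. norm (\<phi> x * max (\<phi> x - max (u n x) 0) 0) \<le> (\<phi> x)\<^sup>2" for n
        using pos by (intro AE_I2) (auto simp: power2_eq_square abs_mult less_imp_le)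
    qed simp_all
    then have y: "yn \<longlonglongrightarrow> 0" by simp
    define q where "q = sqrt (LINT x|lborel. (\<phi> x)\<^sup>2)"
    have "zn n \<le> yn n + q * sqrt (wn n)" for n
    proof -
      have i: "integrable lborel (\<lambda>x. \<phi> x * min (u n x) 0)" by (rule L2_mult_integrable[OF L\<phi> Lw])
      have "zn n \<le> (LINT x|lborel. \<phi> x * max (\<phi> x - max (u n x) 0) 0 - \<phi> x * min (u n x) 0)"
        unfolding zn_def
      proof (rule integral_mono[OF L2_mult_integrable[OF L\<phi> Lmax] Bochner_Integration.integrable_diff[OF iy i]])
        fix x
        have "\<phi> x * max (\<phi> x - u n x) 0 \<le> \<phi> x * (max (\<phi> x - max (u n x) 0) 0 - min (u n x) 0)"
          using pos[of x] by (intro mult_left_mono) (auto simp: max_def min_def)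
        then show "\<phi> x * max (\<phi> x - u n x) 0 \<le> \<phi> x * max (\<phi> x - max (u n x) 0) 0 - \<phi> x * min (u n x) 0"
          by (simp add: right_diff_distrib)
      qed
      also have "\<dots> = yn n - (LINT x|lborel. \<phi> x * min (u n x) 0)" using iy i by (simp add: yn_def)
      also have "\<dots> \<le> yn n + q * sqrt (wn n)"
        using L2_cauchy_schwarz[OF L\<phi> Lw, of n] unfolding q_def wn_def by linarith
      finally show ?thesis .
    qed
    moreover have "0 \<le> zn n" for n unfolding zn_def using pos by (intro integral_nonneg_AE AE_I2 mult_nonneg_nonneg) (auto intro: less_imp_le)
    ultimately show "eventually (\<lambda>n. norm (zn n) \<le> yn n + q * sqrt (wn n)) sequentially" by simp
    have "(\<lambda>n. yn n + q * sqrt (wn n)) \<longlonglongrightarrow> 0 + q * sqrt 0" by (intro tendsto_intros y lims)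
    then show "(\<lambda>n. yn n + q * sqrt (wn n)) \<longlonglongrightarrow> 0" by simp
  qed
  define Xn where "Xn n = (LINT x|lborel. (u n x - \<phi> x)\<^sup>2)" for n
  define Yn where "Yn n = (LINT x|lborel. (ratio (u n x) - \<eta>\<phi> x)\<^sup>2)" for n
  have LX: "L2 (\<lambda>x. u n x - \<phi> x)" and LY: "L2 (\<lambda>x. ratio (u n x) - \<eta>\<phi> x)" for n
    by (rule L2_diff[OF D(2) L\<phi>] L2_diff[OF adm'(9) D\<phi>(4)])+
  have XY0: "0 \<le> Xn n" "0 \<le> Yn n" for n unfolding Xn_def Yn_def by (auto intro!: integral_nonneg_AE)
  have XY: "(\<lambda>n. Xn n + Yn n) \<longlonglongrightarrow> 0"
  proof (rule Lim_null_comparison)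
    define k where "k = 2 + 4 * c / r^3"
    have "Xn n + Yn n \<le> (Qn n + Kn n) - QK + k * zn n" for n
    proof -
      note i = L2D(2)[OF D(2)[of n]] L2D(2)[OF adm'(9)[of n]] L2D(2)[OF L\<phi>] L2D(2)[OF D\<phi>(4)]
        L2_mult_integrable[OF L\<phi> Lmax[of n]] L2D(2)[OF LX[of n]] L2D(2)[OF LY[of n]]
      have "Xn n + Yn n = (LINT x|lborel. (u n x - \<phi> x)\<^sup>2 + (ratio (u n x) - \<eta>\<phi> x)\<^sup>2)" using i by (simp add: Xn_def Yn_def)
      also have "\<dots> \<le> (LINT x|lborel. ((u n x)\<^sup>2 + (ratio (u n x))\<^sup>2) - ((\<phi> x)\<^sup>2 + (\<eta>\<phi> x)\<^sup>2) + k * (\<phi> x * max (\<phi> x - u n x) 0))"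
        unfolding k_def by (rule integral_mono[OF _ _ convexity_gap[OF adm'(7)]]) (use i in auto)
      also have "\<dots> = (Qn n + Kn n) - QK + k * zn n" using i by (simp add: Qn_def Kn_def QK_def zn_def)
      finally show ?thesis .
    qed
    then show "eventually (\<lambda>n. norm (Xn n + Yn n) \<le> (Qn n + Kn n) - QK + k * zn n) sequentially" using XY0 by simp
    have "(\<lambda>n. (Qn n + Kn n) - QK + k * zn n) \<longlonglongrightarrow> QK - QK + k * 0" by (intro tendsto_intros QKn z)
    then show "(\<lambda>n. (Qn n + Kn n) - QK + k * zn n) \<longlonglongrightarrow> 0" by simp
  qed
  have X: "Xn \<longlonglongrightarrow> 0" and Y: "Yn \<longlonglongrightarrow> 0"
    by (rule Lim_null_comparison[OF _ XY]; use XY0 in \<open>auto intro!: always_eventually\<close>)+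
  define Wn where "Wn n = (LINT x|lborel. (v n x - \<phi>1 x)\<^sup>2)" for n
  have LW: "L2 (\<lambda>x. v n x - \<phi>1 x)" for n by (rule L2_diff[OF D(3) L\<phi>1])
  define q2 where "q2 = sqrt (LINT x|lborel. (\<phi>2 x)\<^sup>2)"
  \<comment> \<open>Expanding the square leaves the pairing of \<open>v n - \<phi>1\<close> with
    \<open>\<phi>1\<close>; by parts it becomes a pairing of \<open>u n - \<phi>\<close>, already
    known to be small, with \<open>\<phi>2\<close>.\<close>
  have W: "Wn n \<le> \<bar>Vn n - V\<bar> + 2 * (sqrt (Xn n) * q2)" for n
  proof -
    have P: "is_primitive (\<lambda>x. (u n x - \<phi> x) * \<phi>1 x) (\<lambda>x. (v n x - \<phi>1 x) * \<phi>1 x + (u n x - \<phi> x) * \<phi>2 x)"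
      by (rule is_primitive_mult[OF is_primitive_diff[OF D(1) prim(1)] prim(2)])
    note i = L2_mult_integrable[OF LW[of n] L\<phi>1] L2_mult_integrable[OF LX[of n] L\<phi>2]
    have t: "((\<lambda>x. (u n x - \<phi> x) * \<phi>1 x) \<longlongrightarrow> (0 - 0) * 0) at_top" "((\<lambda>x. (u n x - \<phi> x) * \<phi>1 x) \<longlongrightarrow> (0 - 0) * 0) at_bot"
      by (intro tendsto_intros D(6) D(7) \<phi>_limits)+
    have "(LINT x|lborel. (v n x - \<phi>1 x) * \<phi>1 x + (u n x - \<phi> x) * \<phi>2 x) = 0"
      by (rule is_primitive_half_integrals(4)[OF P]) (use i t in auto)
    then have e: "(LINT x|lborel. (v n x - \<phi>1 x) * \<phi>1 x) = - (LINT x|lborel. (u n x - \<phi> x) * \<phi>2 x)" using i by simp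
    have "Wn n = (LINT x|lborel. (v n x)\<^sup>2 - (\<phi>1 x)\<^sup>2 - 2 * ((v n x - \<phi>1 x) * \<phi>1 x))"
      unfolding Wn_def by (rule Bochner_Integration.integral_cong) (auto simp: power2_eq_square algebra_simps)
    also have "\<dots> = Vn n - V - 2 * (LINT x|lborel. (v n x - \<phi>1 x) * \<phi>1 x)"
      using i L2D(2)[OF D(3)[of n]] L2D(2)[OF L\<phi>1] by (simp add: Vn_def V_def)
    also have "\<dots> = Vn n - V + 2 * (LINT x|lborel. (u n x - \<phi> x) * \<phi>2 x)" unfolding e by simp
    also have "\<dots> \<le> \<bar>Vn n - V\<bar> + 2 * (sqrt (Xn n) * q2)"
      using L2_cauchy_schwarz[OF LX L\<phi>2, of n] unfolding Xn_def q2_def by linarith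
    finally show ?thesis .
  qed
  have LH: "L2 (\<lambda>x. \<eta> n x - \<eta>\<phi> x)" for n by (rule L2_diff[OF D(4) D\<phi>(4)])
  have H: "(LINT x|lborel. (\<eta> n x - \<eta>\<phi> x)\<^sup>2) \<le> 2 * bn n + 2 * Yn n" for n
  proof -
    have "(LINT x|lborel. (\<eta> n x - \<eta>\<phi> x)\<^sup>2) \<le> (LINT x|lborel. 2 * (\<eta> n x - ratio (u n x))\<^sup>2 + 2 * (ratio (u n x) - \<eta>\<phi> x)\<^sup>2)"
    proof (rule integral_mono[OF L2D(2)[OF LH]])
      show "integrable lborel (\<lambda>x. 2 * (\<eta> n x - ratio (u n x))\<^sup>2 + 2 * (ratio (u n x) - \<eta>\<phi> x)\<^sup>2)"
        using L2D(2)[OF Lb[of n]] L2D(2)[OF LY[of n]] by simp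
      have "(p + q)\<^sup>2 \<le> 2 * p\<^sup>2 + 2 * q\<^sup>2" for p q :: real
        using zero_le_power2[of "p - q"] by (simp add: power2_eq_square algebra_simps)
      from this[of "\<eta> n x - ratio (u n x)" "ratio (u n x) - \<eta>\<phi> x" for x]
      show "(\<eta> n x - \<eta>\<phi> x)\<^sup>2 \<le> 2 * (\<eta> n x - ratio (u n x))\<^sup>2 + 2 * (ratio (u n x) - \<eta>\<phi> x)\<^sup>2" for x by simp
    qed
    also have "\<dots> = 2 * bn n + 2 * Yn n" using L2D(2)[OF Lb[of n]] L2D(2)[OF LY[of n]] by (simp add: bn_def Yn_def)
    finally show ?thesis .
  qed
  show ?thesis
  proof (rule Lim_null_comparison)
    have "(\<lambda>n. Xn n + (\<bar>Vn n - V\<bar> + 2 * (sqrt (Xn n) * q2)) + (2 * bn n + 2 * Yn n)) \<longlonglongrightarrow> 0 + (\<bar>V - V\<bar> + 2 * (sqrt 0 * q2)) + (2 * 0 + 2 * 0)"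
      by (intro tendsto_intros X Y V lims)
    then show "(\<lambda>n. Xn n + (\<bar>Vn n - V\<bar> + 2 * (sqrt (Xn n) * q2)) + (2 * bn n + 2 * Yn n)) \<longlonglongrightarrow> 0" by simp
    have e: "(LINT x|lborel. (u n x - \<phi> x)\<^sup>2 + (v n x - \<phi>1 x)\<^sup>2 + (\<eta> n x - \<eta>\<phi> x)\<^sup>2) = Xn n + Wn n + (LINT x|lborel. (\<eta> n x - \<eta>\<phi> x)\<^sup>2)" for n
      using L2D(2)[OF LX[of n]] L2D(2)[OF LW[of n]] L2D(2)[OF LH[of n]] by (simp add: Xn_def Wn_def)
    have "0 \<le> (LINT x|lborel. (u n x - \<phi> x)\<^sup>2 + (v n x - \<phi>1 x)\<^sup>2 + (\<eta> n x - \<eta>\<phi> x)\<^sup>2)" for n by (rule integral_nonneg_AE) auto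
    then show "eventually (\<lambda>n. norm (LINT x|lborel. (u n x - \<phi> x)\<^sup>2 + (v n x - \<phi>1 x)\<^sup>2 + (\<eta> n x - \<eta>\<phi> x)\<^sup>2)
       \<le> Xn n + (\<bar>Vn n - V\<bar> + 2 * (sqrt (Xn n) * q2)) + (2 * bn n + 2 * Yn n)) sequentially"
      using W H unfolding real_norm_def by (intro always_eventually allI) (smt (verit) e)
  qed
qed

end

section \<open>The distance of the energy space\<close>

text \<open>Minkowski's inequality through
  \<open>(y + z)^2 \<le> (1 + q / p) y^2 + (1 + p / q) z^2\<close>, with \<open>p\<close> and
  \<open>q\<close> the two norms; adding \<open>e / 2\<close> to each keeps the quotients
  meaningful.\<close>

lemma triple_triangle:
  assumes L: "L2 f1" "L2 f2" "L2 f3" "L2 g1" "L2 g2" "L2 g3"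
  shows "sqrt (LINT x|lborel. (f1 x + g1 x)\<^sup>2 + (f2 x + g2 x)\<^sup>2 + (f3 x + g3 x)\<^sup>2) \<le>
    sqrt (LINT x|lborel. (f1 x)\<^sup>2 + (f2 x)\<^sup>2 + (f3 x)\<^sup>2) + sqrt (LINT x|lborel. (g1 x)\<^sup>2 + (g2 x)\<^sup>2 + (g3 x)\<^sup>2)"
    (is "sqrt ?H \<le> sqrt ?F + sqrt ?G")
proof (rule field_le_epsilon)
  fix e :: real assume e: "e > 0"
  have F0: "0 \<le> ?F" and G0: "0 \<le> ?G" by (auto intro!: integral_nonneg_AE)
  have iF: "integrable lborel (\<lambda>x. (f1 x)\<^sup>2 + (f2 x)\<^sup>2 + (f3 x)\<^sup>2)" and iG: "integrable lborel (\<lambda>x. (g1 x)\<^sup>2 + (g2 x)\<^sup>2 + (g3 x)\<^sup>2)"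
    using L by (simp_all add: L2_def)
  have iH: "integrable lborel (\<lambda>x. (f1 x + g1 x)\<^sup>2 + (f2 x + g2 x)\<^sup>2 + (f3 x + g3 x)\<^sup>2)"
    using L2_add[OF L(1,4)] L2_add[OF L(2,5)] L2_add[OF L(3,6)] by (simp add: L2_def)
  define p where "p = sqrt ?F + e / 2"
  define q where "q = sqrt ?G + e / 2"
  have p: "p > 0" "?F \<le> p\<^sup>2" and q: "q > 0" "?G \<le> q\<^sup>2"
  proof -
    show "p > 0" "q > 0" using e F0 G0 by (auto simp: p_def q_def intro!: add_nonneg_pos)
    show "?F \<le> p\<^sup>2" using power_mono[of "sqrt ?F" p 2] F0 e by (simp add: p_def)
    show "?G \<le> q\<^sup>2" using power_mono[of "sqrt ?G" q 2] G0 e by (simp add: q_def)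
  qed
  have young: "(y + z)\<^sup>2 \<le> (1 + q / p) * y\<^sup>2 + (1 + p / q) * z\<^sup>2" for y z
  proof -
    have "(1 + q / p) * y\<^sup>2 + (1 + p / q) * z\<^sup>2 - (y + z)\<^sup>2 = (q * y - p * z)\<^sup>2 / (p * q)"
      using p q by (simp add: field_simps power2_eq_square)
    also have "\<dots> \<ge> 0" using p q by simp
    finally show ?thesis by simp
  qed
  have "?H \<le> (LINT x|lborel. (1 + q / p) * ((f1 x)\<^sup>2 + (f2 x)\<^sup>2 + (f3 x)\<^sup>2) + (1 + p / q) * ((g1 x)\<^sup>2 + (g2 x)\<^sup>2 + (g3 x)\<^sup>2))"
  proof (rule integral_mono[OF iH Bochner_Integration.integrable_add[OF integrable_mult_right[OF iF] integrable_mult_right[OF iG]]])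
    show "(f1 x + g1 x)\<^sup>2 + (f2 x + g2 x)\<^sup>2 + (f3 x + g3 x)\<^sup>2 \<le> (1 + q / p) * ((f1 x)\<^sup>2 + (f2 x)\<^sup>2 + (f3 x)\<^sup>2) + (1 + p / q) * ((g1 x)\<^sup>2 + (g2 x)\<^sup>2 + (g3 x)\<^sup>2)" for x
      using young[of "f1 x" "g1 x"] young[of "f2 x" "g2 x"] young[of "f3 x" "g3 x"] by (simp add: distrib_left)
  qed
  also have "\<dots> = (1 + q / p) * ?F + (1 + p / q) * ?G"
    unfolding Bochner_Integration.integral_add[OF integrable_mult_right[OF iF] integrable_mult_right[OF iG]] by simp
  also have "\<dots> \<le> (1 + q / p) * p\<^sup>2 + (1 + p / q) * q\<^sup>2"
    using p q by (intro add_mono mult_left_mono add_nonneg_nonneg) auto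
  also have "\<dots> = (p + q)\<^sup>2" using p q by (simp add: field_simps power2_eq_square)
  finally have "sqrt ?H \<le> p + q" using real_sqrt_le_mono[of ?H "(p + q)\<^sup>2"] p q by simp
  then show "sqrt ?H \<le> sqrt ?F + sqrt ?G + e" by (simp add: p_def q_def)
qed

lemma distX_eq:
  assumes "inX (a, h)" "inX (b, k)"
  shows "distX (a, h) (b, k) = sqrt (LINT x|lborel. (a x - b x)\<^sup>2 + (wd a x - wd b x)\<^sup>2 + (h x - k x)\<^sup>2)"
proof -
  have H: "H1 a" "H1 b" "L2 h" "L2 k" using assms by (auto simp: inX_def)
  note [measurable] = L2D(1)[OF H1D(1)[OF H(1)]] L2D(1)[OF H1D(1)[OF H(2)]] L2D(1)[OF H1D(2)[OF H(1)]] L2D(1)[OF H1D(2)[OF H(2)]]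
    L2D(1)[OF H(3)] L2D(1)[OF H(4)] L2D(1)[OF H1D(2)[OF H1_diff(1)[OF H(1,2)]]]
  have "(LINT x|lborel. (a x - b x)\<^sup>2 + (wd (\<lambda>x. a x - b x) x)\<^sup>2 + (h x - k x)\<^sup>2) = (LINT x|lborel. (a x - b x)\<^sup>2 + (wd a x - wd b x)\<^sup>2 + (h x - k x)\<^sup>2)"
  proof (rule integral_cong_AE)
    show "AE x in lborel. (a x - b x)\<^sup>2 + (wd (\<lambda>x. a x - b x) x)\<^sup>2 + (h x - k x)\<^sup>2 = (a x - b x)\<^sup>2 + (wd a x - wd b x)\<^sup>2 + (h x - k x)\<^sup>2"
      by (rule AE_mp[OF H1_diff(2)[OF H(1,2)]]) (simp add: AE_I2)
  qed auto
  then show ?thesis by (simp add: distX_def normX_def)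
qed

lemma distX_triangle:
  assumes "inX (a, h)" "inX (b, k)" "inX (f, l)"
  shows "distX (a, h) (f, l) \<le> distX (a, h) (b, k) + distX (b, k) (f, l)"
proof -
  have H: "H1 a" "H1 b" "H1 f" "L2 h" "L2 k" "L2 l" using assms by (auto simp: inX_def)
  have "sqrt (LINT x|lborel. ((a x - b x) + (b x - f x))\<^sup>2 + ((wd a x - wd b x) + (wd b x - wd f x))\<^sup>2 + ((h x - k x) + (k x - l x))\<^sup>2)
    \<le> sqrt (LINT x|lborel. (a x - b x)\<^sup>2 + (wd a x - wd b x)\<^sup>2 + (h x - k x)\<^sup>2) + sqrt (LINT x|lborel. (b x - f x)\<^sup>2 + (wd b x - wd f x)\<^sup>2 + (k x - l x)\<^sup>2)"
    by (rule triple_triangle) (intro L2_diff H1D H)+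
  then show ?thesis by (simp add: distX_eq assms)
qed

lemma distX_nonneg: "0 \<le> distX v w"
  unfolding distX_def normX_def by (intro real_sqrt_ge_zero integral_nonneg_AE) auto

section \<open>Translation invariance and continuity of energy and moment\<close>

lemma state_shift: "state u v \<eta> \<Longrightarrow> state (\<lambda>x. u (x - s)) (\<lambda>x. v (x - s)) (\<lambda>x. \<eta> (x - s))"
  unfolding state_def by (auto intro: is_primitive_shift L2_shift)

lemma energy_shift: "energy (\<lambda>x. u (x - s)) (\<lambda>x. v (x - s)) (\<lambda>x. \<eta> (x - s)) = energy u v \<eta>"
  unfolding energy_def by (rule integral_shift[of "\<lambda>x. (u x)\<^sup>2 + (v x)\<^sup>2 + (\<eta> x)\<^sup>2"])

lemma moment_shift: "moment A \<sigma> (\<lambda>x. u (x - s)) (\<lambda>x. v (x - s)) (\<lambda>x. \<eta> (x - s)) = moment A \<sigma> u v \<eta>"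
  unfolding moment_def by (rule integral_shift[of "\<lambda>x. (u x)^3 + \<sigma> * u x * (v x)\<^sup>2 + 2 * u x * \<eta> x + u x * (\<eta> x)\<^sup>2 - A * (u x)\<^sup>2"])

lemma state_diff: "state u v \<eta> \<Longrightarrow> state u' v' \<eta>' \<Longrightarrow> state (\<lambda>x. u x - u' x) (\<lambda>x. v x - v' x) (\<lambda>x. \<eta> x - \<eta>' x)"
  unfolding state_def by (auto intro: is_primitive_diff L2_diff)

text \<open>Every term of the two differences has a factor \<open>a\<close>, \<open>b\<close> or
  \<open>h\<close>. Young's inequality with weight \<open>\<delta>\<close> bounds the quadratic
  terms by multiples of \<open>G\<close>, and the cubic ones contain a further factor controlled
  uniformly, by \<open>\<delta>\<close>, \<open>K\<close> or \<open>K + 1\<close>. For a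
  perturbation of norm \<open>\<delta>\<close> the integral of \<open>G\<close> is of order
  \<open>\<delta>\<close>.\<close>

lemma density_close:
  fixes p p1 p2 a b h \<delta> K :: real
  assumes d: "0 < \<delta>" "\<delta> \<le> 1" and a: "\<bar>a\<bar> \<le> \<delta>" and K: "\<bar>p\<bar> \<le> K"
  defines "G \<equiv> \<delta> * (p\<^sup>2 + p1\<^sup>2 + p2\<^sup>2) + (a\<^sup>2 + b\<^sup>2 + h\<^sup>2) / \<delta>"
  shows "\<bar>((p + a)\<^sup>2 + (p1 + b)\<^sup>2 + (p2 + h)\<^sup>2) - (p\<^sup>2 + p1\<^sup>2 + p2\<^sup>2)\<bar> \<le> 6 * G"
    "\<bar>((p + a)^3 + \<sigma> * (p + a) * (p1 + b)\<^sup>2 + 2 * (p + a) * (p2 + h) + (p + a) * (p2 + h)\<^sup>2 - A * (p + a)\<^sup>2)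
      - (p^3 + \<sigma> * p * p1\<^sup>2 + 2 * p * p2 + p * p2\<^sup>2 - A * p\<^sup>2)\<bar> \<le> (10 * (K + 1) * (1 + \<bar>\<sigma>\<bar>) + 2 * \<bar>A\<bar> + 10) * G"
proof -
  define X where "X s = \<delta> * s\<^sup>2" for s
  define Y where "Y t = t\<^sup>2 / \<delta>" for t
  have y: "2 * \<bar>s * t\<bar> \<le> X s + Y t" for s t
  proof -
    have "0 \<le> (\<delta> * \<bar>s\<bar> - \<bar>t\<bar>)\<^sup>2 / \<delta>" using d by simp
    also have "\<dots> = X s + Y t - 2 * \<bar>s * t\<bar>" using d by (simp add: X_def Y_def power2_diff abs_mult field_simps power2_eq_square)
    finally show ?thesis by simp
  qed
  have nn: "0 \<le> X s" "0 \<le> Y s" for s using d by (auto simp: X_def Y_def)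
  have sq: "t\<^sup>2 \<le> Y t" for t using d by (simp add: Y_def le_divide_eq mult_left_le)
  have Ge: "G = X p + X p1 + X p2 + Y a + Y b + Y h" by (simp add: G_def X_def Y_def distrib_left add_divide_distrib)
  have G0: "0 \<le> G" unfolding Ge using nn[of p] nn[of p1] nn[of p2] nn[of a] nn[of b] nn[of h] by linarith
  note N = nn[of p] nn[of p1] nn[of p2] nn[of a] nn[of b] nn[of h]
  have pa: "\<bar>p * a\<bar> \<le> G" unfolding Ge using N y[of p a] by linarith
  have p1b: "\<bar>p1 * b\<bar> \<le> G" unfolding Ge using N y[of p1 b] by linarith
  have p2h: "\<bar>p2 * h\<bar> \<le> G" unfolding Ge using N y[of p2 h] by linarith
  have ph: "\<bar>p * h\<bar> \<le> G" unfolding Ge using N y[of p h] by linarith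
  have p2a: "\<bar>p2 * a\<bar> \<le> G" unfolding Ge using N y[of p2 a] by linarith
  have a2: "a\<^sup>2 \<le> G" unfolding Ge using N sq[of a] by linarith
  have b2: "b\<^sup>2 \<le> G" unfolding Ge using N sq[of b] by linarith
  have h2: "h\<^sup>2 \<le> G" unfolding Ge using N sq[of h] by linarith
  have ah: "\<bar>a * h\<bar> \<le> G"
  proof -
    have "2 * \<bar>a * h\<bar> \<le> a\<^sup>2 + h\<^sup>2" using zero_le_power2[of "\<bar>a\<bar> - \<bar>h\<bar>"] by (simp add: power2_diff abs_mult)
    then show ?thesis using a2 h2 by linarith
  qed
  have ap1: "\<bar>a * p1\<^sup>2\<bar> \<le> G" and ap2: "\<bar>a * p2\<^sup>2\<bar> \<le> G"
  proof -
    have "\<bar>a\<bar> * p1\<^sup>2 \<le> \<delta> * p1\<^sup>2" "\<bar>a\<bar> * p2\<^sup>2 \<le> \<delta> * p2\<^sup>2" using a by (intro mult_right_mono; simp)+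
    then have "\<bar>a\<bar> * p1\<^sup>2 \<le> X p1" "\<bar>a\<bar> * p2\<^sup>2 \<le> X p2" by (simp_all add: X_def)
    then show "\<bar>a * p1\<^sup>2\<bar> \<le> G" "\<bar>a * p2\<^sup>2\<bar> \<le> G" unfolding Ge using N by (simp_all add: abs_mult)
  qed
  have K0: "0 \<le> K" using K by linarith
  have u: "\<bar>p + a\<bar> \<le> K + 1" using K a d by linarith
  have mulG: "\<bar>s * t\<bar> \<le> S * (k * G)" if "\<bar>s\<bar> \<le> S" "\<bar>t\<bar> \<le> k * G" for s t S k
    unfolding abs_mult using that by (intro mult_mono) auto
  have "((p + a)\<^sup>2 + (p1 + b)\<^sup>2 + (p2 + h)\<^sup>2) - (p\<^sup>2 + p1\<^sup>2 + p2\<^sup>2) = 2 * (p * a) + 2 * (p1 * b) + 2 * (p2 * h) + a\<^sup>2 + b\<^sup>2 + h\<^sup>2"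
    by (simp add: power2_eq_square algebra_simps)
  moreover have "a\<^sup>2 + b\<^sup>2 + h\<^sup>2 \<le> 3 * G" "0 \<le> a\<^sup>2 + b\<^sup>2 + h\<^sup>2" using a2 b2 h2 by auto
  moreover have "\<bar>2 * (p * a) + 2 * (p1 * b) + 2 * (p2 * h) + (a\<^sup>2 + b\<^sup>2 + h\<^sup>2)\<bar> \<le> 6 * G"
  proof -
    have "2 * \<bar>p * a\<bar> + 2 * \<bar>p1 * b\<bar> + 2 * \<bar>p2 * h\<bar> \<le> G" unfolding Ge using y[of p a] y[of p1 b] y[of p2 h] by linarith
    then show ?thesis using \<open>a\<^sup>2 + b\<^sup>2 + h\<^sup>2 \<le> 3 * G\<close> \<open>0 \<le> a\<^sup>2 + b\<^sup>2 + h\<^sup>2\<close> G0 by linarith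
  qed
  ultimately show "\<bar>((p + a)\<^sup>2 + (p1 + b)\<^sup>2 + (p2 + h)\<^sup>2) - (p\<^sup>2 + p1\<^sup>2 + p2\<^sup>2)\<bar> \<le> 6 * G" by (simp add: add.assoc)
  have q: "\<bar>2 * (s * t) + t\<^sup>2\<bar> \<le> 3 * G" if "\<bar>s * t\<bar> \<le> G" "t\<^sup>2 \<le> G" for s t
    using that zero_le_power2[of t] by linarith
  define T1 where "T1 = p * (3 * (p * a) + 3 * a\<^sup>2)"
  define T2 where "T2 = a * a\<^sup>2"
  define T3 where "T3 = a * p1\<^sup>2 + (p + a) * (2 * (p1 * b) + b\<^sup>2)"
  define T4 where "T4 = 2 * (p2 * a) + 2 * (p * h) + 2 * (a * h)"
  define T5 where "T5 = a * p2\<^sup>2 + (p + a) * (2 * (p2 * h) + h\<^sup>2)"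
  define T6 where "T6 = 2 * (p * a) + a\<^sup>2"
  have "\<bar>3 * (p * a) + 3 * a\<^sup>2\<bar> \<le> 6 * G" using pa a2 zero_le_power2[of a] by linarith
  then have t1: "\<bar>T1\<bar> \<le> K * (6 * G)" unfolding T1_def by (rule mulG[OF K])
  have t2: "\<bar>T2\<bar> \<le> 1 * (1 * G)" unfolding T2_def by (rule mulG) (use a d a2 in auto)
  have "\<bar>(p + a) * (2 * (p1 * b) + b\<^sup>2)\<bar> \<le> (K + 1) * (3 * G)" by (rule mulG[OF u q[OF p1b b2]])
  then have t3: "\<bar>T3\<bar> \<le> G + (K + 1) * (3 * G)" unfolding T3_def using ap1 by linarith
  have t4: "\<bar>T4\<bar> \<le> 6 * G" unfolding T4_def using p2a ph ah by linarith
  have "\<bar>(p + a) * (2 * (p2 * h) + h\<^sup>2)\<bar> \<le> (K + 1) * (3 * G)" by (rule mulG[OF u q[OF p2h h2]])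
  then have t5: "\<bar>T5\<bar> \<le> G + (K + 1) * (3 * G)" unfolding T5_def using ap2 by linarith
  have t6: "\<bar>A * T6\<bar> \<le> \<bar>A\<bar> * (2 * G)"
  proof -
    have "2 * \<bar>p * a\<bar> \<le> X p + Y a" using y[of p a] by linarith
    then have "2 * \<bar>p * a\<bar> + a\<^sup>2 \<le> 2 * G" unfolding Ge distrib_left using sq[of a] N by linarith
    moreover have "\<bar>T6\<bar> \<le> 2 * \<bar>p * a\<bar> + a\<^sup>2" unfolding T6_def using zero_le_power2[of a] by linarith
    ultimately have "\<bar>T6\<bar> \<le> 2 * G" by linarith
    then show ?thesis by (rule mulG[OF order_refl])
  qed
  have t3': "\<bar>\<sigma> * T3\<bar> \<le> \<bar>\<sigma>\<bar> * (G + (K + 1) * (3 * G))" unfolding abs_mult by (intro mult_left_mono t3) simp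
  have "((p + a)^3 + \<sigma> * (p + a) * (p1 + b)\<^sup>2 + 2 * (p + a) * (p2 + h) + (p + a) * (p2 + h)\<^sup>2 - A * (p + a)\<^sup>2)
      - (p^3 + \<sigma> * p * p1\<^sup>2 + 2 * p * p2 + p * p2\<^sup>2 - A * p\<^sup>2) = T1 + T2 + \<sigma> * T3 + T4 + T5 - A * T6"
    by (simp add: T1_def T2_def T3_def T4_def T5_def T6_def power2_eq_square power3_eq_cube algebra_simps)
  also have "\<bar>\<dots>\<bar> \<le> K * (6 * G) + G + \<bar>\<sigma>\<bar> * (G + (K + 1) * (3 * G)) + 6 * G + (G + (K + 1) * (3 * G)) + \<bar>A\<bar> * (2 * G)"
  proof -
    have "\<bar>x1 + x2 + x3 + x4 + x5 - x6\<bar> \<le> b1 + b2 + b3 + b4 + b5 + b6"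
      if "\<bar>x1\<bar> \<le> b1" "\<bar>x2\<bar> \<le> b2" "\<bar>x3\<bar> \<le> b3" "\<bar>x4\<bar> \<le> b4" "\<bar>x5\<bar> \<le> b5" "\<bar>x6\<bar> \<le> b6"
      for x1 x2 x3 x4 x5 x6 b1 b2 b3 b4 b5 b6 :: real
      using that unfolding abs_le_iff by linarith
    moreover have "\<bar>T2\<bar> \<le> G" using t2 by simp
    ultimately show ?thesis using t1 t3' t4 t5 t6 by blast
  qed
  also have "\<dots> \<le> (10 * (K + 1) * (1 + \<bar>\<sigma>\<bar>) + 2 * \<bar>A\<bar> + 10) * G"
  proof -
    have "(10 * (K + 1) * (1 + \<bar>\<sigma>\<bar>) + 2 * \<bar>A\<bar> + 10) * G - (K * (6 * G) + G + \<bar>\<sigma>\<bar> * (G + (K + 1) * (3 * G)) + 6 * G + (G + (K + 1) * (3 * G)) + \<bar>A\<bar> * (2 * G))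
      = (K + 9 + \<bar>\<sigma>\<bar> * (7 * K + 6)) * G" by (simp add: algebra_simps)
    also have "\<dots> \<ge> 0" using K0 G0 by (intro mult_nonneg_nonneg add_nonneg_nonneg) auto
    finally show ?thesis by simp
  qed
  finally show "\<bar>((p + a)^3 + \<sigma> * (p + a) * (p1 + b)\<^sup>2 + 2 * (p + a) * (p2 + h) + (p + a) * (p2 + h)\<^sup>2 - A * (p + a)\<^sup>2)
      - (p^3 + \<sigma> * p * p1\<^sup>2 + 2 * p * p2 + p * p2\<^sup>2 - A * p\<^sup>2)\<bar> \<le> (10 * (K + 1) * (1 + \<bar>\<sigma>\<bar>) + 2 * \<bar>A\<bar> + 10) * G" .
qed

text \<open>A distance \<open>\<delta>\<close> in the energy space also bounds \<open>u - p\<close>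
  uniformly by \<open>\<delta>\<close>, so the estimate of the densities applies at every point and
  can be integrated.\<close>

lemma functionals_close:
  assumes S0: "state p p1 p2"
  obtains C where "C > 0" "\<And>u v \<eta> \<delta>. state u v \<eta> \<Longrightarrow> 0 < \<delta> \<Longrightarrow> \<delta> \<le> 1 \<Longrightarrow>
      (LINT x|lborel. (u x - p x)\<^sup>2 + (v x - p1 x)\<^sup>2 + (\<eta> x - p2 x)\<^sup>2) \<le> \<delta>\<^sup>2 \<Longrightarrow>
      \<bar>energy u v \<eta> - energy p p1 p2\<bar> \<le> C * \<delta> \<and> \<bar>moment A \<sigma> u v \<eta> - moment A \<sigma> p p1 p2\<bar> \<le> C * \<delta>"
proof -
  define K where "K = sqrt (energy p p1 p2)"
  define k where "k = 10 * (K + 1) * (1 + \<bar>\<sigma>\<bar>) + 2 * \<bar>A\<bar> + 10"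
  note D0 = stateD[OF S0]
  have K0: "0 \<le> K" using D0(10) by (simp add: K_def)
  have "0 \<le> 10 * (K + 1) * (1 + \<bar>\<sigma>\<bar>)" using K0 by simp
  moreover have "0 \<le> 2 * \<bar>A\<bar>" by simp
  ultimately have k: "6 \<le> k" unfolding k_def by linarith
  show ?thesis
  proof (rule that[of "k * (energy p p1 p2 + 1)"])
    show "k * (energy p p1 p2 + 1) > 0" using k D0(10) by (intro mult_pos_pos) auto
    fix u v \<eta> \<delta> assume S: "state u v \<eta>" and d: "0 < \<delta>" "\<delta> \<le> (1::real)"
      and le: "(LINT x|lborel. (u x - p x)\<^sup>2 + (v x - p1 x)\<^sup>2 + (\<eta> x - p2 x)\<^sup>2) \<le> \<delta>\<^sup>2"
    note D = stateD[OF S] and Dd = stateD[OF state_diff[OF S S0]]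
    let ?G = "\<lambda>x. \<delta> * ((p x)\<^sup>2 + (p1 x)\<^sup>2 + (p2 x)\<^sup>2) + ((u x - p x)\<^sup>2 + (v x - p1 x)\<^sup>2 + (\<eta> x - p2 x)\<^sup>2) / \<delta>"
    have iG: "integrable lborel ?G" using D0(8) Dd(8) by simp
    have G: "(LINT x|lborel. ?G x) \<le> \<delta> * (energy p p1 p2 + 1)"
    proof -
      have "(LINT x|lborel. ?G x) = \<delta> * energy p p1 p2 + (LINT x|lborel. (u x - p x)\<^sup>2 + (v x - p1 x)\<^sup>2 + (\<eta> x - p2 x)\<^sup>2) / \<delta>"
        unfolding energy_def using D0(8) Dd(8) by (subst Bochner_Integration.integral_add) auto
      also have "\<dots> \<le> \<delta> * energy p p1 p2 + \<delta>\<^sup>2 / \<delta>" using le d by (intro add_left_mono divide_right_mono) auto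
      also have "\<dots> = \<delta> * (energy p p1 p2 + 1)" using d by (simp add: power2_eq_square distrib_left)
      finally show ?thesis .
    qed
    have a: "\<bar>u x - p x\<bar> \<le> \<delta>" for x
    proof -
      have "(u x - p x)\<^sup>2 \<le> \<delta>\<^sup>2" using Dd(11)[of x] le unfolding energy_def by linarith
      then show ?thesis using d by (simp add: abs_le_square_iff[of "u x - p x" \<delta>, symmetric])
    qed
    have pK: "\<bar>p x\<bar> \<le> K" for x using real_sqrt_le_mono[OF D0(11)[of x]] by (simp add: K_def)
    have bound: "\<bar>(LINT x|lborel. f x) - (LINT x|lborel. g x)\<bar> \<le> k * (energy p p1 p2 + 1) * \<delta>"
      if "integrable lborel f" "integrable lborel g" "\<And>x. \<bar>f x - g x\<bar> \<le> k * ?G x" for f g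
    proof -
      have "\<bar>(LINT x|lborel. f x) - (LINT x|lborel. g x)\<bar> = \<bar>LINT x|lborel. f x - g x\<bar>" using that by simp
      also have "\<dots> \<le> (LINT x|lborel. \<bar>f x - g x\<bar>)" by (rule integral_abs_bound)
      also have "\<dots> \<le> (LINT x|lborel. k * ?G x)"
        by (rule integral_mono[OF _ integrable_mult_right[OF iG] that(3)]) (use that in auto)
      also have "\<dots> = k * (LINT x|lborel. ?G x)" by simp
      also have "\<dots> \<le> k * (\<delta> * (energy p p1 p2 + 1))" using k by (intro mult_left_mono G) auto
      finally show ?thesis by (simp add: mult_ac)
    qed
    have G0: "0 \<le> ?G x" for x using d by (intro add_nonneg_nonneg mult_nonneg_nonneg divide_nonneg_nonneg) auto
    show "\<bar>energy u v \<eta> - energy p p1 p2\<bar> \<le> k * (energy p p1 p2 + 1) * \<delta> \<and> \<bar>moment A \<sigma> u v \<eta> - moment A \<sigma> p p1 p2\<bar> \<le> k * (energy p p1 p2 + 1) * \<delta>"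
    proof
      show "\<bar>energy u v \<eta> - energy p p1 p2\<bar> \<le> k * (energy p p1 p2 + 1) * \<delta>"
        unfolding energy_def
      proof (rule bound[OF D(8) D0(8), unfolded energy_def])
        fix x
        have "\<bar>((u x)\<^sup>2 + (v x)\<^sup>2 + (\<eta> x)\<^sup>2) - ((p x)\<^sup>2 + (p1 x)\<^sup>2 + (p2 x)\<^sup>2)\<bar> \<le> 6 * ?G x"
          using density_close(1)[OF d a[of x] pK[of x], of "p1 x" "v x - p1 x" "p2 x" "\<eta> x - p2 x"] by simp
        also have "\<dots> \<le> k * ?G x" by (rule mult_right_mono[OF k G0])
        finally show "\<bar>((u x)\<^sup>2 + (v x)\<^sup>2 + (\<eta> x)\<^sup>2) - ((p x)\<^sup>2 + (p1 x)\<^sup>2 + (p2 x)\<^sup>2)\<bar> \<le> k * ?G x" .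
      qed
      show "\<bar>moment A \<sigma> u v \<eta> - moment A \<sigma> p p1 p2\<bar> \<le> k * (energy p p1 p2 + 1) * \<delta>"
        unfolding moment_def
      proof (rule bound[OF D(9) D0(9)])
        fix x
        show "\<bar>((u x)^3 + \<sigma> * u x * (v x)\<^sup>2 + 2 * u x * \<eta> x + u x * (\<eta> x)\<^sup>2 - A * (u x)\<^sup>2)
          - ((p x)^3 + \<sigma> * p x * (p1 x)\<^sup>2 + 2 * p x * p2 x + p x * (p2 x)\<^sup>2 - A * (p x)\<^sup>2)\<bar> \<le> k * ?G x"
          using density_close(2)[OF d a[of x] pK[of x], of \<sigma> "p1 x" "v x - p1 x" "p2 x" "\<eta> x - p2 x" A] unfolding k_def by simp
      qed
    qed
  qed
qed

section \<open>Orbital stability\<close>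

context wave_profile
begin

definition dev where
  "dev u v h s = (LINT x|lborel. (u x - \<phi> (x - s))\<^sup>2 + (v x - \<phi>1 (x - s))\<^sup>2 + (h x - \<eta>\<phi> (x - s))\<^sup>2)"

text \<open>The first two entries keep the height within the ranges demanded by
  \<open>admissible\<close>. The third bounds \<open>\<sigma> * u\<close> where \<open>u\<close> is
  negative, which matters when \<open>\<sigma>\<close> is negative.\<close>

definition radius where "radius = min (min ((c - r) / 2) (r / 2)) (r / (2 * (\<bar>\<sigma>\<bar> + 1)))"

lemma dev_shift: "dev (\<lambda>x. u (x - a)) (\<lambda>x. v (x - a)) (\<lambda>x. h (x - a)) s = dev u v h (s - a)"
  using integral_shift[of "\<lambda>x. (u x - \<phi> (x - (s - a)))\<^sup>2 + (v x - \<phi>1 (x - (s - a)))\<^sup>2 + (h x - \<eta>\<phi> (x - (s - a)))\<^sup>2" a]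
  by (simp add: dev_def)

lemma radius: "0 < radius" "radius \<le> (c - r) / 2" "radius \<le> r / 2" "\<bar>\<sigma>\<bar> * radius \<le> r / 2"
proof -
  show "0 < radius" using r0 cr by (simp add: radius_def)
  show "radius \<le> (c - r) / 2" "radius \<le> r / 2"
    unfolding radius_def by (rule min.coboundedI1[OF min.cobounded1] min.coboundedI1[OF min.cobounded2])+
  have "\<bar>\<sigma>\<bar> * radius \<le> (\<bar>\<sigma>\<bar> + 1) * (r / (2 * (\<bar>\<sigma>\<bar> + 1)))"
    using \<open>0 < radius\<close> by (intro mult_mono) (auto simp: radius_def)
  also have "\<dots> = r / 2" by (simp add: field_simps)
  finally show "\<bar>\<sigma>\<bar> * radius \<le> r / 2" .
qed

text \<open>Uniform closeness to a translate of the wave makes \<open>u\<close> positive somewhere,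
  so its maximum is attained. Moving the maximum to \<open>x0\<close> is the rule that selects the
  position of the comparison wave.\<close>

lemma near_admissible:
  assumes S: "state u v h" and near: "dev u v h s < radius\<^sup>2"
  obtains a where "admissible (\<lambda>x. u (x - a)) (\<lambda>x. v (x - a)) (\<lambda>x. h (x - a))"
proof -
  note D = stateD[OF S]
  note R = radius
  have close: "\<bar>u x - \<phi> (x - s)\<bar> < radius" for x
  proof -
    have "(u x - \<phi> (x - s))\<^sup>2 \<le> dev u v h s"
      using stateD(11)[OF state_diff[OF S state_shift[OF state_\<phi>, of s]], of x] by (simp add: energy_def dev_def)
    then have "\<bar>u x - \<phi> (x - s)\<bar>\<^sup>2 < radius\<^sup>2" using near by simp
    then show ?thesis by (rule power2_less_imp_less) (use R in simp)
  qed
  have lim: "(u \<longlongrightarrow> 0) at_infinity"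
    unfolding at_infinity_eq_at_top_bot by (rule filterlim_sup[OF D(6) D(7)])
  have low: "c - r - radius < u (s + x0)" using close[of "s + x0"] top by (simp add: abs_less_iff)
  have "2 * radius \<le> c - r" using R(2) by simp
  then have "0 < u (s + x0)" using low R(1) by linarith
  then obtain z where z: "\<And>x. u x \<le> u z" using vanishing_attains_max[OF D(5) lim] by blast
  have R2: "2 * radius \<le> r" using R(3) by simp
  have Rs: "2 * (\<bar>\<sigma>\<bar> * radius) \<le> r" using R(4) by linarith
  have uz: "u z < c - r + radius" "c - r - radius < u z"
    using close[of z] le[of "z - s"] low z[of "s + x0"] by linarith+
  \<comment> \<open>For \<open>u \<ge> 0\<close> this is \<open>\<sigma> \<le> 1\<close>; a negative
    value of \<open>u\<close> is above \<open>- radius\<close> because the wave is positive.\<close>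
  have sp: "\<sigma> * u x \<le> max (u z) (r / 2)" for x
  proof (cases "0 \<le> u x")
    case True
    have "\<sigma> * u x \<le> 1 * u x" by (rule mult_right_mono[OF sg True])
    then show ?thesis using z[of x] by simp
  next
    case False
    have "- u x < radius" using close[of x] pos[of "x - s"] by linarith
    then have "\<bar>\<sigma>\<bar> * \<bar>u x\<bar> \<le> \<bar>\<sigma>\<bar> * radius" using False by (intro mult_left_mono) auto
    then have "\<sigma> * u x \<le> \<bar>\<sigma>\<bar> * radius" using abs_ge_self[of "\<sigma> * u x"] by (simp add: abs_mult)
    then show ?thesis using R(4) by simp
  qed
  have h1: "r \<le> 2 * (c - \<sigma> * u x)" for x
    using sp[of x] uz R2 cr r0 by (cases "u z \<le> r / 2") (auto simp: max_def)
  have h2: "0 \<le> u z + r - \<sigma> * u x" for x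
  proof -
    have "0 \<le> u z" using uz \<open>2 * radius \<le> c - r\<close> R(1) by linarith
    moreover have "max (u z) (r / 2) \<le> u z + r" using \<open>0 \<le> u z\<close> r0 by (simp add: max_def)
    ultimately show ?thesis using sp[of x] by linarith
  qed
  show ?thesis
  proof (rule that[of "x0 - z"])
    have "\<bar>u z - (c - r)\<bar> \<le> radius" using uz by (simp add: abs_le_iff)
    then have "\<bar>u z - (c - r)\<bar> \<le> (c - r) / 2" "\<bar>u z - (c - r)\<bar> \<le> r / 2" using R(2,3) by linarith+
    moreover have "r / 2 \<le> c - \<sigma> * u x" for x using h1[of x] by (simp add: field_simps)
    ultimately show "admissible (\<lambda>x. u (x - (x0 - z))) (\<lambda>x. v (x - (x0 - z))) (\<lambda>x. h (x - (x0 - z)))"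
      unfolding admissible_def using state_shift[OF S, of "x0 - z"] z h2 by (intro conjI allI) simp_all
  qed
qed

text \<open>A sequence of counterexamples would have energy and moment tending to those of the wave.
  The bound by \<open>radius\<close> makes each member admissible after a translation, and
  \<open>stability_sequence\<close> then gives convergence to the wave.\<close>

lemma static_stability:
  assumes e: "e > 0"
  obtains \<delta> where "\<delta> > 0" "\<And>u v h s. state u v h \<Longrightarrow> dev u v h s < radius\<^sup>2 \<Longrightarrow>
    \<bar>energy u v h - energy \<phi> \<phi>1 \<eta>\<phi>\<bar> < \<delta> \<Longrightarrow> \<bar>moment A \<sigma> u v h - moment A \<sigma> \<phi> \<phi>1 \<eta>\<phi>\<bar> < \<delta> \<Longrightarrow>
    \<exists>s. dev u v h s < e\<^sup>2"
proof (rule ccontr)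
  assume contra: "\<not> thesis"
  have "\<exists>u v h s. state u v h \<and> dev u v h s < radius\<^sup>2 \<and> \<bar>energy u v h - energy \<phi> \<phi>1 \<eta>\<phi>\<bar> < inverse (real (Suc n)) \<and>
    \<bar>moment A \<sigma> u v h - moment A \<sigma> \<phi> \<phi>1 \<eta>\<phi>\<bar> < inverse (real (Suc n)) \<and> \<not> (\<exists>s. dev u v h s < e\<^sup>2)" for n
    using contra that[of "inverse (real (Suc n))"] by (metis inverse_positive_iff_positive of_nat_0_less_iff zero_less_Suc)
  then obtain u v h s where U: "\<And>n. state (u n) (v n) (h n)" "\<And>n. dev (u n) (v n) (h n) (s n) < radius\<^sup>2"
    "\<And>n. \<bar>energy (u n) (v n) (h n) - energy \<phi> \<phi>1 \<eta>\<phi>\<bar> < inverse (real (Suc n))"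
    "\<And>n. \<bar>moment A \<sigma> (u n) (v n) (h n) - moment A \<sigma> \<phi> \<phi>1 \<eta>\<phi>\<bar> < inverse (real (Suc n))"
    "\<And>n. \<not> (\<exists>s. dev (u n) (v n) (h n) s < e\<^sup>2)" by metis
  have "\<exists>a. admissible (\<lambda>x. u n (x - a)) (\<lambda>x. v n (x - a)) (\<lambda>x. h n (x - a))" for n
    using near_admissible[OF U(1,2)] by blast
  then obtain a where a: "\<And>n. admissible (\<lambda>x. u n (x - a n)) (\<lambda>x. v n (x - a n)) (\<lambda>x. h n (x - a n))" by metis
  have "(\<lambda>n. energy (u n) (v n) (h n) - energy \<phi> \<phi>1 \<eta>\<phi>) \<longlonglongrightarrow> 0"
    by (rule Lim_null_comparison[OF _ LIMSEQ_inverse_real_of_nat]) (use U(3) less_imp_le in \<open>auto intro!: always_eventually\<close>)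
  then have E: "(\<lambda>n. energy (u n) (v n) (h n)) \<longlonglongrightarrow> energy \<phi> \<phi>1 \<eta>\<phi>" by (rule LIM_zero_cancel)
  have "(\<lambda>n. moment A \<sigma> (u n) (v n) (h n) - moment A \<sigma> \<phi> \<phi>1 \<eta>\<phi>) \<longlonglongrightarrow> 0"
    by (rule Lim_null_comparison[OF _ LIMSEQ_inverse_real_of_nat]) (use U(4) less_imp_le in \<open>auto intro!: always_eventually\<close>)
  then have F: "(\<lambda>n. moment A \<sigma> (u n) (v n) (h n)) \<longlonglongrightarrow> moment A \<sigma> \<phi> \<phi>1 \<eta>\<phi>" by (rule LIM_zero_cancel)
  have "(\<lambda>n. dev (\<lambda>x. u n (x - a n)) (\<lambda>x. v n (x - a n)) (\<lambda>x. h n (x - a n)) 0) \<longlonglongrightarrow> 0"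
    using stability_sequence[OF a, unfolded energy_shift moment_shift, OF E F] by (simp add: dev_def)
  then have "eventually (\<lambda>n. dev (\<lambda>x. u n (x - a n)) (\<lambda>x. v n (x - a n)) (\<lambda>x. h n (x - a n)) 0 < e\<^sup>2) sequentially"
    by (rule order_tendstoD(2)) (use e in simp)
  then obtain n where "dev (\<lambda>x. u n (x - a n)) (\<lambda>x. v n (x - a n)) (\<lambda>x. h n (x - a n)) 0 < e\<^sup>2"
    by (auto simp: eventually_sequentially)
  then show False using U(5)[of n] unfolding dev_shift by blast
qed

text \<open>The sign \<open>\<tau>\<close> covers waves of negative speed: flipping the sign of \<open>u\<close> turns \<open>A\<close> and \<open>c\<close> into
  \<open>- A\<close> and \<open>- c\<close>, and \<open>F\<close> into \<open>- F\<close>.\<close>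
lemma orbital_stability:
  fixes \<tau> :: real
  assumes \<tau>: "\<tau> = 1 \<or> \<tau> = -1"
  shows "orbitally_stable (\<tau> * A) \<sigma> (\<lambda>x. \<tau> * \<phi> x) \<eta>\<phi>"
proof -
  have tt: "\<tau> * \<tau> = 1" using \<tau> by auto
  have tsq: "(\<tau> * y)\<^sup>2 = y\<^sup>2" for y using \<tau> by auto
  define wave where "wave s = ((\<lambda>x. \<tau> * \<phi> (x - s)), (\<lambda>x. \<eta>\<phi> (x - s)))" for s
  note D\<phi> = stateD[OF state_\<phi>]
  have wave: "H1 (\<lambda>x. \<tau> * \<phi> (x - s))" "AE x in lborel. wd (\<lambda>x. \<tau> * \<phi> (x - s)) x = \<tau> * \<phi>1 (x - s)" "inX (wave s)" for s
  proof -
    have P: "is_primitive (\<lambda>x. \<tau> * \<phi> (x - s)) (\<lambda>x. \<tau> * \<phi>1 (x - s))" by (intro is_primitive_cmult is_primitive_shift prim)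
    have L: "L2 (\<lambda>x. \<tau> * \<phi> (x - s))" "L2 (\<lambda>x. \<tau> * \<phi>1 (x - s))" by (intro L2_cmult L2_shift L\<phi> L\<phi>1)+
    show H: "H1 (\<lambda>x. \<tau> * \<phi> (x - s))" and "AE x in lborel. wd (\<lambda>x. \<tau> * \<phi> (x - s)) x = \<tau> * \<phi>1 (x - s)"
      by (rule primitive_H1[OF P L(2,1)]; simp)+
    show "inX (wave s)" using H L2_shift[OF D\<phi>(4)] by (simp add: inX_def wave_def)
  qed
  \<comment> \<open>\<open>rep\<close> passes from a point of \<open>X\<close> to the continuous
    representative and its derivative, with the sign \<open>\<tau>\<close> removed, which is the
    form in which the static estimates are stated.\<close>
  define rep where "rep a h u v \<longleftrightarrow> inX (a, h) \<and> state u v h \<and> (AE x in lborel. a x = \<tau> * u x) \<and> (AE x in lborel. wd a x = \<tau> * v x)" for a h u v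
  have rep_ex: "\<exists>u v. rep a h u v" if X: "inX (a, h)" for a h
  proof -
    have H: "H1 a" "L2 h" using X by (auto simp: inX_def)
    obtain p where p: "is_primitive p (wd a)" "AE x in lborel. p x = a x" using H1_primitive[OF H(1)] by blast
    have Lp: "L2 p"
      by (rule L2_cong_AE[OF H1D(1)[OF H(1)]]) (use p(2) continuous_loc_integrable(2)[OF is_primitive_continuous[OF p(1)]] in auto)
    have "state (\<lambda>x. \<tau> * p x) (\<lambda>x. \<tau> * wd a x) h"
      unfolding state_def by (intro conjI is_primitive_cmult p L2_cmult Lp H1D H)
    moreover have "AE x in lborel. a x = \<tau> * (\<tau> * p x)" using p(2) tt by (auto simp: mult.assoc[symmetric])
    ultimately have "rep a h (\<lambda>x. \<tau> * p x) (\<lambda>x. \<tau> * wd a x)" unfolding rep_def using X tt by (auto simp: mult.assoc[symmetric])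
    then show ?thesis by blast
  qed
  have rep_meas: "a \<in> borel_measurable borel" "wd a \<in> borel_measurable borel" "h \<in> borel_measurable borel"
    "u \<in> borel_measurable borel" "v \<in> borel_measurable borel" if "rep a h u v" for a h u v
    using that H1D[of a] unfolding rep_def inX_def state_def by (auto simp: L2_def)
  have rep_E: "energy u v h = 2 * Efun a h" if "rep a h u v" for a h u v
  proof -
    note [measurable] = rep_meas[OF that]
    have "AE x in lborel. a x = \<tau> * u x" "AE x in lborel. wd a x = \<tau> * v x" using that by (auto simp: rep_def)
    then have ae: "AE x in lborel. (u x)\<^sup>2 + (v x)\<^sup>2 + (h x)\<^sup>2 = (a x)\<^sup>2 + (wd a x)\<^sup>2 + (h x)\<^sup>2"
      by eventually_elim (simp only: tsq)
    have "energy u v h = (LINT x|lborel. (a x)\<^sup>2 + (wd a x)\<^sup>2 + (h x)\<^sup>2)"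
      unfolding energy_def by (rule integral_cong_AE[OF _ _ ae]) auto
    then show ?thesis by (simp add: Efun_def)
  qed
  have rep_F: "moment A \<sigma> u v h = \<tau> * (2 * Ffun (\<tau> * A) \<sigma> a h)" if "rep a h u v" for a h u v
  proof -
    note [measurable] = rep_meas[OF that]
    have id: "(\<tau> * y)^3 + \<sigma> * (\<tau> * y) * (\<tau> * z)\<^sup>2 + 2 * (\<tau> * y) * k + (\<tau> * y) * k\<^sup>2 - \<tau> * A * (\<tau> * y)\<^sup>2
      = \<tau> * (y^3 + \<sigma> * y * z\<^sup>2 + 2 * y * k + y * k\<^sup>2 - A * y\<^sup>2)" for y z k
      using \<tau> by (auto simp: algebra_simps power2_eq_square power3_eq_cube)
    have "AE x in lborel. a x = \<tau> * u x" "AE x in lborel. wd a x = \<tau> * v x" using that by (auto simp: rep_def)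
    then have ae: "AE x in lborel. (a x)^3 + \<sigma> * a x * (wd a x)\<^sup>2 + 2 * a x * h x + a x * (h x)\<^sup>2 - \<tau> * A * (a x)\<^sup>2
       = \<tau> * ((u x)^3 + \<sigma> * u x * (v x)\<^sup>2 + 2 * u x * h x + u x * (h x)\<^sup>2 - A * (u x)\<^sup>2)"
      by eventually_elim (simp only: id)
    have "(LINT x|lborel. (a x)^3 + \<sigma> * a x * (wd a x)\<^sup>2 + 2 * a x * h x + a x * (h x)\<^sup>2 - \<tau> * A * (a x)\<^sup>2)
       = (LINT x|lborel. \<tau> * ((u x)^3 + \<sigma> * u x * (v x)\<^sup>2 + 2 * u x * h x + u x * (h x)\<^sup>2 - A * (u x)\<^sup>2))"
      by (rule integral_cong_AE[OF _ _ ae]) auto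
    also have "\<dots> = \<tau> * moment A \<sigma> u v h" by (simp add: moment_def)
    finally have "2 * Ffun (\<tau> * A) \<sigma> a h = \<tau> * moment A \<sigma> u v h" by (simp add: Ffun_def)
    then show ?thesis using tt by (simp add: mult.assoc[symmetric])
  qed
  have rep_d: "distX (a, h) (wave s) = sqrt (dev u v h s)" if "rep a h u v" for a h u v s
  proof -
    note [measurable] = rep_meas[OF that]
    have [measurable]: "\<phi> \<in> borel_measurable borel" "\<phi>1 \<in> borel_measurable borel" "\<eta>\<phi> \<in> borel_measurable borel"
      using D\<phi>(2-4) by (auto simp: L2_def)
    have [measurable]: "wd (\<lambda>x. \<tau> * \<phi> (x - s)) \<in> borel_measurable borel" using H1D(2)[OF wave(1)] by (simp add: L2_def)
    have X: "inX (a, h)" using that by (simp add: rep_def)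
    have ae: "AE x in lborel. a x = \<tau> * u x" "AE x in lborel. wd a x = \<tau> * v x" using that by (auto simp: rep_def)
    have df: "(\<tau> * y - \<tau> * z)\<^sup>2 = (y - z)\<^sup>2" for y z using tsq[of "y - z"] by (simp add: right_diff_distrib)
    have ae': "AE x in lborel. (a x - \<tau> * \<phi> (x - s))\<^sup>2 + (wd a x - wd (\<lambda>x. \<tau> * \<phi> (x - s)) x)\<^sup>2 + (h x - \<eta>\<phi> (x - s))\<^sup>2
       = (u x - \<phi> (x - s))\<^sup>2 + (v x - \<phi>1 (x - s))\<^sup>2 + (h x - \<eta>\<phi> (x - s))\<^sup>2"
      using ae wave(2)[of s] by eventually_elim (simp only: df)
    have "(LINT x|lborel. (a x - \<tau> * \<phi> (x - s))\<^sup>2 + (wd a x - wd (\<lambda>x. \<tau> * \<phi> (x - s)) x)\<^sup>2 + (h x - \<eta>\<phi> (x - s))\<^sup>2) = dev u v h s"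
      unfolding dev_def by (rule integral_cong_AE[OF _ _ ae']) auto
    then show ?thesis using distX_eq[OF X wave(3)[of s, unfolded wave_def]] by (simp add: wave_def)
  qed
  define N where "N w = (INF s. distX w (wave s))" for w
  have bdd: "bdd_below (range (\<lambda>s. distX w (wave s)))" for w
    by (rule bdd_belowI[of _ 0]) (auto simp: distX_nonneg)
  have N_less: "N w < e \<longleftrightarrow> (\<exists>s. distX w (wave s) < e)" for w e
    unfolding N_def using cInf_less_iff[OF _ bdd] by auto
  have N_dev: "N (a, h) < e \<longleftrightarrow> (\<exists>s. dev u v h s < e\<^sup>2)" if "rep a h u v" "e > 0" for a h u v e
  proof -
    have "sqrt (dev u v h s) < e \<longleftrightarrow> dev u v h s < e\<^sup>2" for s
      using real_sqrt_less_iff[of "dev u v h s" "e\<^sup>2"] that(2) by simp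
    then show ?thesis unfolding N_less rep_d[OF that(1)] by simp
  qed
  \<comment> \<open>The distance to the orbit is 1-Lipschitz, hence continuous in time along a
    solution.\<close>
  have N_lip: "N w \<le> N w' + distX w w'" if "inX w" "inX w'" for w w'
  proof -
    have "N w - distX w w' \<le> N w'"
      unfolding N_def[of w']
    proof (rule cINF_greatest)
      fix s
      have "N w \<le> distX w (wave s)" unfolding N_def by (rule cINF_lower[OF bdd]) simp
      also have "\<dots> \<le> distX w w' + distX w' (wave s)"
        using distX_triangle[of "fst w" "snd w" "fst w'" "snd w'" "fst (wave s)" "snd (wave s)"] that wave(3)[of s] by simp
      finally show "N w - distX w w' \<le> distX w' (wave s)" by simp
    qed simp
    then show ?thesis by simp
  qed
  have sym: "distX w w' = distX w' w" if "inX w" "inX w'" for w w'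
    using distX_eq[of "fst w" "snd w" "fst w'" "snd w'"] distX_eq[of "fst w'" "snd w'" "fst w" "snd w"] that
    by (simp add: power2_commute)
  have tube: "w \<in> tube (\<lambda>x. \<tau> * \<phi> x) \<eta>\<phi> e \<longleftrightarrow> inX w \<and> N w < e" for w e
    by (simp add: tube_def N_def wave_def)
  show ?thesis
    unfolding orbitally_stable_def
  proof (intro allI impI)
    fix \<epsilon> :: real assume \<epsilon>: "\<epsilon> > 0"
    define e where "e = min \<epsilon> radius"
    have e: "0 < e" "e \<le> \<epsilon>" "e \<le> radius" using \<epsilon> radius(1) by (auto simp: e_def)
    have "0 < e / 2" using e by simp
    then obtain \<delta>0 where \<delta>0: "\<delta>0 > 0" "\<And>u v h s. state u v h \<Longrightarrow> dev u v h s < radius\<^sup>2 \<Longrightarrow>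
      \<bar>energy u v h - energy \<phi> \<phi>1 \<eta>\<phi>\<bar> < \<delta>0 \<Longrightarrow> \<bar>moment A \<sigma> u v h - moment A \<sigma> \<phi> \<phi>1 \<eta>\<phi>\<bar> < \<delta>0 \<Longrightarrow> \<exists>s. dev u v h s < (e / 2)\<^sup>2"
      by (rule static_stability) blast
    obtain C where C: "C > 0" "\<And>u v \<eta> \<delta>. state u v \<eta> \<Longrightarrow> 0 < \<delta> \<Longrightarrow> \<delta> \<le> 1 \<Longrightarrow>
      (LINT x|lborel. (u x - \<phi> x)\<^sup>2 + (v x - \<phi>1 x)\<^sup>2 + (\<eta> x - \<eta>\<phi> x)\<^sup>2) \<le> \<delta>\<^sup>2 \<Longrightarrow>
      \<bar>energy u v \<eta> - energy \<phi> \<phi>1 \<eta>\<phi>\<bar> \<le> C * \<delta> \<and> \<bar>moment A \<sigma> u v \<eta> - moment A \<sigma> \<phi> \<phi>1 \<eta>\<phi>\<bar> \<le> C * \<delta>"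
      by (rule functionals_close[OF state_\<phi>, of A \<sigma>]) blast
    \<comment> \<open>\<open>e / 2\<close> puts the initial distance below the gap found below, and
      \<open>\<delta>0 / (C + 1)\<close> makes energy and moment \<open>\<delta>0\<close>-close to
      those of the wave.\<close>
    define \<delta> where "\<delta> = min (min 1 (e / 2)) (\<delta>0 / (C + 1))"
    have \<delta>: "0 < \<delta>" using e \<delta>0 C by (simp add: \<delta>_def)
    have \<delta>_le: "\<delta> \<le> 1" "\<delta> \<le> e / 2"
      unfolding \<delta>_def by (rule min.coboundedI1[OF min.cobounded1] min.coboundedI1[OF min.cobounded2])+
    have C\<delta>: "C * \<delta> < \<delta>0"
    proof -
      have "C * \<delta> < (C + 1) * \<delta>" using \<delta> by (simp add: distrib_right)
      also have "\<dots> \<le> (C + 1) * (\<delta>0 / (C + 1))" using C by (intro mult_left_mono) (auto simp: \<delta>_def)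
      also have "\<dots> = \<delta>0" using C by simp
      finally show ?thesis .
    qed
    show "\<exists>\<delta>>0. \<forall>u0 \<eta>0 T u \<eta>. (u0, \<eta>0) \<in> tube (\<lambda>x. \<tau> * \<phi> x) \<eta>\<phi> \<delta> \<longrightarrow> 0 < T \<longrightarrow> is_solution (\<tau> * A) \<sigma> T u \<eta> \<longrightarrow>
        u 0 = u0 \<longrightarrow> \<eta> 0 = \<eta>0 \<longrightarrow> (\<forall>t \<in> time_dom T. (u t, \<eta> t) \<in> tube (\<lambda>x. \<tau> * \<phi> x) \<eta>\<phi> \<epsilon>)"
    proof (intro exI[of _ \<delta>] conjI allI impI ballI)
      show "\<delta> > 0" by (rule \<delta>)
      fix u0 \<eta>0 T u \<eta> t1
      assume start: "(u0, \<eta>0) \<in> tube (\<lambda>x. \<tau> * \<phi> x) \<eta>\<phi> \<delta>" and T: "0 < T" and sol: "is_solution (\<tau> * A) \<sigma> T u \<eta>"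
        and u0: "u 0 = u0" and \<eta>0: "\<eta> 0 = \<eta>0" and t1: "t1 \<in> time_dom T"
      note sol' = sol[unfolded is_solution_def]
      have X: "inX (u t, \<eta> t)" if "t \<in> time_dom T" for t using sol' that by blast
      have cont: "((\<lambda>t. distX (u t, \<eta> t) (u t0, \<eta> t0)) \<longlongrightarrow> 0) (at t0 within time_dom T)" if "t0 \<in> time_dom T" for t0
        using sol' that by blast
      have cE: "Efun (u t) (\<eta> t) = Efun (u 0) (\<eta> 0)" and cF: "Ffun (\<tau> * A) \<sigma> (u t) (\<eta> t) = Ffun (\<tau> * A) \<sigma> (u 0) (\<eta> 0)" if "t \<in> time_dom T" for t
        using sol' that by blast+
      have t0: "0 \<in> time_dom T" using T by (simp add: time_dom_def zero_ereal_def[symmetric])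
      define d where "d t = N (u t, \<eta> t)" for t
      have d0: "d 0 < \<delta>" using start unfolding d_def u0 \<eta>0 tube by simp
      obtain v0 w0 where r0': "rep (u 0) (\<eta> 0) v0 w0" using rep_ex[OF X[OF t0]] by blast
      have EF0: "\<bar>energy v0 w0 (\<eta> 0) - energy \<phi> \<phi>1 \<eta>\<phi>\<bar> < \<delta>0 \<and> \<bar>moment A \<sigma> v0 w0 (\<eta> 0) - moment A \<sigma> \<phi> \<phi>1 \<eta>\<phi>\<bar> < \<delta>0"
      proof -
        obtain s where s: "dev v0 w0 (\<eta> 0) s < \<delta>\<^sup>2" using d0 unfolding d_def N_dev[OF r0' \<delta>] by blast
        have S: "state v0 w0 (\<eta> 0)" using r0' by (simp add: rep_def)
        have "dev (\<lambda>x. v0 (x - - s)) (\<lambda>x. w0 (x - - s)) (\<lambda>x. \<eta> 0 (x - - s)) 0 \<le> \<delta>\<^sup>2" unfolding dev_shift using s by simp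
        then have "(LINT x|lborel. (v0 (x - - s) - \<phi> x)\<^sup>2 + (w0 (x - - s) - \<phi>1 x)\<^sup>2 + (\<eta> 0 (x - - s) - \<eta>\<phi> x)\<^sup>2) \<le> \<delta>\<^sup>2"
          unfolding dev_def diff_zero .
        from C(2)[OF state_shift[OF S] \<delta> \<delta>_le(1) this] show ?thesis
          unfolding energy_shift moment_shift using C\<delta> by linarith
      qed
      \<comment> \<open>By conservation the closeness of energy and moment holds at all times, so
        the distance to the orbit never lies between \<open>e / 2\<close> and
        \<open>radius\<close>.\<close>
      have gap: "d t < e / 2" if t: "t \<in> time_dom T" and dt: "d t < radius" for t
      proof -
        obtain v w where r: "rep (u t) (\<eta> t) v w" using rep_ex[OF X[OF t]] by blast
        have S: "state v w (\<eta> t)" using r by (simp add: rep_def)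
        obtain s where s: "dev v w (\<eta> t) s < radius\<^sup>2" using dt unfolding d_def N_dev[OF r radius(1)] by blast
        have "energy v w (\<eta> t) = energy v0 w0 (\<eta> 0)" "moment A \<sigma> v w (\<eta> t) = moment A \<sigma> v0 w0 (\<eta> 0)"
          unfolding rep_E[OF r] rep_E[OF r0'] rep_F[OF r] rep_F[OF r0'] cE[OF t] cF[OF t] by simp_all
        then have "\<exists>s. dev v w (\<eta> t) s < (e / 2)\<^sup>2" using \<delta>0(2)[OF S s] EF0 by simp
        then show ?thesis unfolding d_def using N_dev[OF r \<open>0 < e / 2\<close>] by blast
      qed
      have sub: "{0..t1} \<subseteq> time_dom T"
      proof
        fix t assume "t \<in> {0..t1}"
        then have t: "0 \<le> t" "ereal t \<le> ereal t1" by auto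
        have "ereal t < T" using t1 order_le_less_trans[OF t(2)] by (simp add: time_dom_def)
        then show "t \<in> time_dom T" using t(1) by (simp add: time_dom_def)
      qed
      have "continuous_on {0..t1} d"
        unfolding continuous_on_def
      proof
        fix s assume s: "s \<in> {0..t1}"
        then have sT: "s \<in> time_dom T" using sub by blast
        have "((\<lambda>t. d t - d s) \<longlongrightarrow> 0) (at s within {0..t1})"
        proof (rule Lim_null_comparison)
          show "((\<lambda>t. distX (u t, \<eta> t) (u s, \<eta> s)) \<longlongrightarrow> 0) (at s within {0..t1})"
            by (rule tendsto_within_subset[OF cont[OF sT] sub])
          have "\<bar>d t - d s\<bar> \<le> distX (u t, \<eta> t) (u s, \<eta> s)" if "t \<in> {0..t1}" for t
          proof -
            have tT: "t \<in> time_dom T" using that sub by blast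
            show ?thesis using N_lip[OF X[OF tT] X[OF sT]] N_lip[OF X[OF sT] X[OF tT]] sym[OF X[OF tT] X[OF sT]]
              unfolding d_def by linarith
          qed
          then show "eventually (\<lambda>t. norm (d t - d s) \<le> distX (u t, \<eta> t) (u s, \<eta> s)) (at s within {0..t1})"
            by (auto simp: eventually_at_filter)
        qed
        then show "(d \<longlongrightarrow> d s) (at s within {0..t1})" by (rule LIM_zero_cancel)
      qed
      note cd = this
      have "d t1 < e"
      proof (rule ccontr)
        assume n: "\<not> d t1 < e"
        have "0 \<le> t1" using t1 by (simp add: time_dom_def)
        \<comment> \<open>The level \<open>3 / 4 * e\<close> lies inside the forbidden gap, since
          \<open>e \<le> radius\<close>; a continuous distance starting below the gap cannot cross
          it.\<close>
        moreover have "d 0 \<le> 3 / 4 * e" "3 / 4 * e \<le> d t1" using d0 \<delta>_le(2) e(1) n by linarith+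
        ultimately obtain t where t: "0 \<le> t" "t \<le> t1" "d t = 3 / 4 * e" using IVT'[of d 0 "3 / 4 * e" t1] cd by blast
        have "t \<in> time_dom T" using t sub by auto
        moreover have "d t < radius" using t(3) e(1,3) by linarith
        ultimately have "d t < e / 2" by (rule gap)
        then show False using t(3) e(1) by linarith
      qed
      then show "(u t1, \<eta> t1) \<in> tube (\<lambda>x. \<tau> * \<phi> x) \<eta>\<phi> \<epsilon>"
        unfolding tube using X[OF t1] e(2) by (simp add: d_def)
    qed
  qed
qed

end

theorem theorem3p2:
  fixes A \<sigma> c :: real and \<phi> \<eta>c :: "real \<Rightarrow> real"
  assumes "A > 0" and "\<sigma> \<le> 1"
    and "smooth_solitary_wave A \<sigma> c \<phi> \<eta>c"
  shows "orbitally_stable A \<sigma> \<phi> \<eta>c"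
proof -
  note w = assms(3)[unfolded smooth_solitary_wave_def]
  have s: "smooth1 \<phi>" "smooth1 \<eta>c" "H1 \<phi>" "(\<phi> \<longlongrightarrow> 0) at_infinity" "(\<eta>c \<longlongrightarrow> 0) at_infinity"
    and nontriv: "\<not> (\<phi> = (\<lambda>x. 0) \<and> \<eta>c = (\<lambda>x. 0))" using w by auto
  note H = H1_smooth[OF s(3,1)]
  note d = smooth1_deriv(1)[OF s(1)] and s1 = smooth1_deriv(2)[OF s(1)]
  note d1 = smooth1_deriv(1)[OF s1] and c2 = smooth1_deriv(3)[OF smooth1_deriv(2)[OF s1]]
  obtain K where ode: "\<And>x. c * \<phi> x - c * deriv (deriv \<phi>) x + \<sigma> * (\<phi> x * deriv (deriv \<phi>) x + (deriv \<phi> x)\<^sup>2 / 2)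
       - 3 / 2 * (\<phi> x)\<^sup>2 + A * \<phi> x - (1 + \<eta>c x)\<^sup>2 / 2 + K = 0"
    and mass: "\<And>x. (1 + \<eta>c x) * \<phi> x = c * \<eta>c x"
    using solitary_wave_equations[OF assms(3)] by metis
  \<comment> \<open>The definition of a solitary wave admits every real speed, so zero speed is
    ruled out before the sign of \<open>c\<close> is used.\<close>
  have c0: "c \<noteq> 0"
  proof
    assume c: "c = 0"
    have "\<phi> x = 0 \<and> \<eta>c x = 0" for x
      by (rule zero_speed_trivial[OF d smooth1_deriv(3)[OF s(2)] s(4,5)]) (use ode mass in \<open>simp_all add: c\<close>)
    then show False using nontriv by auto
  qed
  \<comment> \<open>Multiplying \<open>\<phi>\<close>, \<open>c\<close> and \<open>A\<close> by
    \<open>\<tau>\<close> leaves the profile equation unchanged, multiplies the mass relation by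
    \<open>\<tau>\<close>, and makes the speed positive.\<close>
  define \<tau> where "\<tau> = sgn c"
  have \<tau>: "\<tau> = 1 \<or> \<tau> = -1" using c0 by (auto simp: \<tau>_def sgn_if)
  have tt: "\<tau> * \<tau> = 1" using \<tau> by auto
  have ti: "\<tau> * (\<tau> * y) = y" for y using tt by (simp add: mult.assoc[symmetric])
  define A' where "A' = \<tau> * A"
  \<comment> \<open>This is \<open>A\<^sub>1\<close> for a wave of positive speed and
    \<open>- A\<^sub>2\<close> for one of negative speed.\<close>
  define r where "r = sqrt (A'\<^sup>2 + 4) / 2 - A' / 2"
  have r: "r > 0" "A' = 1 / r - r"
  proof -
    have "\<bar>A'\<bar> < sqrt (A'\<^sup>2 + 4)" using real_sqrt_less_mono[of "A'\<^sup>2" "A'\<^sup>2 + 4"] by simp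
    then show r0: "r > 0" unfolding r_def by linarith
    have "2 * r + A' = sqrt (A'\<^sup>2 + 4)" by (simp add: r_def field_simps)
    then have "(2 * r + A')\<^sup>2 = A'\<^sup>2 + 4" by simp
    then have "r * r + A' * r = 1" by (simp add: power2_eq_square algebra_simps)
    then show "A' = 1 / r - r" using r0 by (simp add: field_simps)
  qed
  define C where "C = \<tau> * c"
  have C: "C > 0" using c0 by (auto simp: C_def \<tau>_def sgn_if)
  define \<Phi> where "\<Phi> x = \<tau> * \<phi> x" for x
  define \<Phi>1 where "\<Phi>1 x = \<tau> * deriv \<phi> x" for x
  define \<Phi>2 where "\<Phi>2 x = \<tau> * deriv (deriv \<phi>) x" for x
  have D: "(\<Phi> has_real_derivative \<Phi>1 x) (at x)" "(\<Phi>1 has_real_derivative \<Phi>2 x) (at x)" for x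
    unfolding \<Phi>_def[abs_def] \<Phi>1_def[abs_def] \<Phi>2_def by (rule DERIV_cmult[OF d] DERIV_cmult[OF d1])+
  have lim: "(\<Phi> \<longlongrightarrow> 0) at_infinity"
    using tendsto_mult[OF tendsto_const[of \<tau>] s(4)] by (simp add: \<Phi>_def[abs_def])
  have ODE: "C * \<Phi> x - C * \<Phi>2 x + \<sigma> * (\<Phi> x * \<Phi>2 x + (\<Phi>1 x)\<^sup>2 / 2) - 3 / 2 * (\<Phi> x)\<^sup>2 + A' * \<Phi> x - (1 + \<eta>c x)\<^sup>2 / 2 + K = 0" for x
    using ode[of x] \<tau> by (auto simp: C_def \<Phi>_def \<Phi>1_def \<Phi>2_def A'_def)
  have MASS: "(1 + \<eta>c x) * \<Phi> x = C * \<eta>c x" for x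
    using mass[of x] \<tau> by (auto simp: C_def \<Phi>_def)
  note wave = profile_first_integral[OF C r D lim ODE MASS]
  have nz: "\<exists>y. \<Phi> y \<noteq> 0"
  proof (rule ccontr)
    assume "\<not> (\<exists>y. \<Phi> y \<noteq> 0)"
    then have z: "\<Phi> y = 0" for y by blast
    then have "\<eta>c y = 0" for y using wave(2)[of y] by simp
    moreover have "\<phi> y = 0" for y using z[of y] \<tau> by (auto simp: \<Phi>_def)
    ultimately show False using nontriv by auto
  qed
  then obtain y0 where y0: "\<Phi> y0 \<noteq> 0" by blast
  obtain x0 where x0: "C > r" "\<And>x. 0 < \<Phi> x" "\<And>x. \<Phi> x \<le> C - r" "\<Phi> x0 = C - r"
    "\<And>x. x < x0 \<Longrightarrow> \<Phi>1 x > 0" "\<And>x. x0 < x \<Longrightarrow> \<Phi>1 x < 0"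
    using profile_shape[OF C r assms(2) D lim wave(1,3,4) y0] by metis
  interpret wave_profile \<sigma> C r A' x0 \<Phi> \<Phi>1 \<Phi>2
  proof
    show "continuous_on UNIV \<Phi>2" unfolding \<Phi>2_def[abs_def] by (intro continuous_intros c2)
    show "L2 \<Phi>" "L2 \<Phi>1" unfolding \<Phi>_def[abs_def] \<Phi>1_def[abs_def] by (intro L2_cmult H1D(1)[OF s(3)] H(2))+
  qed (fact assms(2) r x0 D wave(3) wave(4))+
  have "(\<lambda>x. \<tau> * \<Phi> x) = \<phi>" "\<tau> * A' = A" by (auto simp: \<Phi>_def A'_def ti)
  moreover have "\<eta>\<phi> = \<eta>c" by (rule ext) (simp add: \<eta>\<phi>_def wave(2))
  ultimately show ?thesis using orbital_stability[OF \<tau>] by simp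
qed

end
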